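(* Let $n\ge 3$. The map $\beta\mapsto f(\beta)$, sending a good and stable pure braid $\beta$ to the product $f(\beta)$ of the generators $a'_{i_l j_l k_l}$ corresponding to its successive critical moments, is a (well-defined) homomorphism from the pure braid group $PB_n$ to ${}'G_n^3$.
   Context: Definition of ${}'G_n^3$ ($n\ge 3$): the group with generators $a'_{ijk}$, where $i,j,k\in\{1,\dots,n\}$ are pairwise distinct and ordered triples are taken up to order reversal only, i.e. $a'_{ijk}=a'_{kji}$ (so there are $3\binom{n}{3}$ generators), and relations: (1) $(a'_{ijk})^2=1$ for all pairwise distinct $i,j,k$; (2) $a'_{ijk}a'_{pqr}=a'_{pqr}a'_{ijk}$ whenever $|\{i,j,k\}|=|\{p,q,r\}|=3$ and $|\{i,j,k\}\cap\{p,q,r\}|\le 1$; (3) $a'_{ijk}a'_{ijl}a'_{ikl}a'_{jkl}=a'_{jkl}a'_{ikl}a'_{ijl}a'_{ijk}$ for all pairwise distinct $i,j,k,l$. Pure braids: an $n$-strand pure braid is represented by smooth functions $\beta(t)=(z_1(t),\dots,z_n(t))$, $t\in[0,1]$, $z_j(t)\in\mathbb{C}=\mathbb{R}^2$, pairwise distinct for every $t$, with $z_j(0)=z_j(1)=\exp(2\pi \sqrt{-1}\,j/n)$. $PB_n$ is the group of isotopy classes (homotopy classes with fixed endpoints, through such families) with product given by concatenation in time (first factor first). Critical moments: a value $t$ is critical if there are three distinct indices $i,j,k$ such that $z_i(t),z_j(t),z_k(t)$ are collinear. A braid $\beta$ is good and stable if: the number of its critical moments is finite; at each critical moment there is exactly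 one triple of indices whose points are collinear; and the number of critical moments does not change after any sufficiently small perturbation of the braid (small in the $C^1$ sense). Every braid can be made good and stable by an arbitrarily small perturbation. Definition of $f$: let $\beta$ be a good and stable pure braid with critical moments $t_1<t_2<\dots<t_m$. At $t_l$ let the three collinear points have indices $i_l,j_l,k_l$, with the point with index $j_l$ lying between the other two. Set $f(\beta)=a'_{i_1j_1k_1}a'_{i_2j_2k_2}\cdots a'_{i_mj_mk_m}\in {}'G_n^3$. The value of $f$ on an element of $PB_n$ is its value on any good and stable representative. *)

theory Defs
  imports "HOL-Analysis.Analysis" "HOL-Algebra.Coset"
begin

section \<open>Groups given by generators and relations\<close>

text \<open>The letter \<open>(x, True)\<close> stands for the generator \<open>x\<close>, and \<open>(x, False)\<close> for its
  formal inverse.  A pair \<open>(u, v)\<close> in \<open>R\<close> stands for the relation \<open>u = v\<close>.\<close>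

inductive_set pres_rel ::
    "'a set \<Rightarrow> (('a \<times> bool) list \<times> ('a \<times> bool) list) set \<Rightarrow>
      (('a \<times> bool) list \<times> ('a \<times> bool) list) set"
  for X R where
  relator: "(u, v) \<in> R \<Longrightarrow> (u, v) \<in> pres_rel X R"
| cancel: "x \<in> X \<Longrightarrow> ([(x, b), (x, \<not> b)], []) \<in> pres_rel X R"
| embed: "(u, v) \<in> pres_rel X R \<Longrightarrow> w \<in> lists (X \<times> UNIV) \<Longrightarrow> w' \<in> lists (X \<times> UNIV) \<Longrightarrow>
    (w @ u @ w', w @ v @ w') \<in> pres_rel X R"
| refl: "w \<in> lists (X \<times> UNIV) \<Longrightarrow> (w, w) \<in> pres_rel X R"
| sym: "(u, v) \<in> pres_rel X R \<Longrightarrow> (v, u) \<in> pres_rel X R"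
| trans: "(u, v) \<in> pres_rel X R \<Longrightarrow> (v, w) \<in> pres_rel X R \<Longrightarrow> (u, w) \<in> pres_rel X R"

definition presented_group ::
    "'a set \<Rightarrow> (('a \<times> bool) list \<times> ('a \<times> bool) list) set \<Rightarrow> ('a \<times> bool) list set monoid" where
  "presented_group X R =
    \<lparr>carrier = lists (X \<times> UNIV) // pres_rel X R,
     mult = (\<lambda>A B. \<Union>u\<in>A. \<Union>v\<in>B. pres_rel X R `` {u @ v}),
     one = pres_rel X R `` {[]}\<rparr>"

section \<open>The group \<open>'G\<^sub>n\<^sup>3\<close>\<close>

definition dist_idx :: "nat \<Rightarrow> nat list \<Rightarrow> bool" where
  "dist_idx n xs \<longleftrightarrow> distinct xs \<and> set xs \<subseteq> {1..n}"

text \<open>An ordered triple up to reversal.\<close>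

definition triple :: "nat \<Rightarrow> nat \<Rightarrow> nat \<Rightarrow> (nat \<times> nat \<times> nat) set" where
  "triple i j k = {(i, j, k), (k, j, i)}"

definition G3_gens :: "nat \<Rightarrow> (nat \<times> nat \<times> nat) set set" where
  "G3_gens n = {triple i j k | i j k. dist_idx n [i, j, k]}"

abbreviation letter :: "nat \<Rightarrow> nat \<Rightarrow> nat \<Rightarrow> (nat \<times> nat \<times> nat) set \<times> bool" where
  "letter i j k \<equiv> (triple i j k, True)"

definition G3_rels ::
    "nat \<Rightarrow> (((nat \<times> nat \<times> nat) set \<times> bool) list \<times> ((nat \<times> nat \<times> nat) set \<times> bool) list) set" where
  "G3_rels n =
     {([letter i j k, letter i j k], []) | i j k. dist_idx n [i, j, k]}
   \<union> {([letter i j k, letter p q r], [letter p q r, letter i j k]) | i j k p q r.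
        dist_idx n [i, j, k] \<and> dist_idx n [p, q, r] \<and> card ({i, j, k} \<inter> {p, q, r}) \<le> 1}
   \<union> {([letter i j k, letter i j l, letter i k l, letter j k l],
       [letter j k l, letter i k l, letter i j l, letter i j k]) | i j k l.
        dist_idx n [i, j, k, l]}"

definition G3 :: "nat \<Rightarrow> ((nat \<times> nat \<times> nat) set \<times> bool) list set monoid" where
  "G3 n = presented_group (G3_gens n) (G3_rels n)"

definition G3_gen ::
    "nat \<Rightarrow> (nat \<times> nat \<times> nat) set \<Rightarrow> ((nat \<times> nat \<times> nat) set \<times> bool) list set" where
  "G3_gen n x = pres_rel (G3_gens n) (G3_rels n) `` {[(x, True)]}"

section \<open>Pure braids\<close>

text \<open>\<open>C\<^sup>\<infinity>\<close> smoothness, with one-sided derivatives at the end points of an interval.\<close>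

definition smooth_on :: "real set \<Rightarrow> (real \<Rightarrow> 'a::real_normed_vector) \<Rightarrow> bool" where
  "smooth_on S f \<longleftrightarrow> (\<exists>D :: nat \<Rightarrow> real \<Rightarrow> 'a.
     (\<forall>t\<in>S. D 0 t = f t) \<and>
     (\<forall>m. \<forall>t\<in>S. (D m has_vector_derivative D (Suc m) t) (at t within S)))"

text \<open>A configuration \<open>z\<close> of \<open>n\<close> points is a function on \<open>{1..n}\<close>, extended by
  \<open>undefined\<close> to all of \<open>nat\<close>, as in the library's product topology.\<close>

definition config_space :: "nat \<Rightarrow> (nat \<Rightarrow> complex) topology" where
  "config_space n = subtopology (product_topology (\<lambda>_. euclidean) {1..n}) {z. inj_on z {1..n}}"

definition base_config :: "nat \<Rightarrow> nat \<Rightarrow> complex" where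
  "base_config n = (\<lambda>j\<in>{1..n}. exp (2 * of_real pi * \<i> * of_nat j / of_nat n))"

text \<open>Only the values of \<open>\<beta>\<close> on \<open>{0..1}\<close> matter; \<open>\<beta> t j\<close> is the position of
  strand \<open>j\<close> at time \<open>t\<close>.\<close>

definition pure_braid :: "nat \<Rightarrow> (real \<Rightarrow> nat \<Rightarrow> complex) \<Rightarrow> bool" where
  "pure_braid n \<beta> \<longleftrightarrow>
     (\<forall>t\<in>{0..1}. \<beta> t \<in> topspace (config_space n)) \<and>
     (\<forall>j\<in>{1..n}. smooth_on {0..1} (\<lambda>t. \<beta> t j)) \<and>
     \<beta> 0 = base_config n \<and> \<beta> 1 = base_config n"

definition braid_isotopic :: "nat \<Rightarrow> (real \<Rightarrow> nat \<Rightarrow> complex) \<Rightarrow> (real \<Rightarrow> nat \<Rightarrow> complex) \<Rightarrow> bool" where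
  "braid_isotopic n = homotopic_with (pure_braid n) (top_of_set {0..1}) (config_space n)"

definition braid_class :: "nat \<Rightarrow> (real \<Rightarrow> nat \<Rightarrow> complex) \<Rightarrow> (real \<Rightarrow> nat \<Rightarrow> complex) set" where
  "braid_class n \<beta> = {\<gamma>. braid_isotopic n \<beta> \<gamma>}"

text \<open>The concatenation of two smooth braids need not be smooth at the junction, so the product
  of two classes is formed from representatives whose concatenation is smooth.  Every class has
  representatives that are constant near both ends, so suitable representatives exist; all
  choices give isotopic concatenations, so the union below is a single class.\<close>

definition PB :: "nat \<Rightarrow> (real \<Rightarrow> nat \<Rightarrow> complex) set monoid" where
  "PB n =
    \<lparr>carrier = {braid_class n \<beta> | \<beta>. pure_braid n \<beta>},
     mult = (\<lambda>A B. \<Union>{braid_class n (\<beta> +++ \<gamma>) | \<beta> \<gamma>. \<beta> \<in> A \<and> \<gamma> \<in> B \<and> pure_braid n (\<beta> +++ \<gamma>)}),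
     one = braid_class n (\<lambda>_. base_config n)\<rparr>"

section \<open>Good and stable braids\<close>

definition collinear_triples :: "nat \<Rightarrow> (nat \<Rightarrow> complex) \<Rightarrow> nat set set" where
  "collinear_triples n z = {T. T \<subseteq> {1..n} \<and> card T = 3 \<and> collinear (z ` T)}"

definition critical_moments :: "nat \<Rightarrow> (real \<Rightarrow> nat \<Rightarrow> complex) \<Rightarrow> real set" where
  "critical_moments n \<beta> = {t \<in> {0..1}. collinear_triples n (\<beta> t) \<noteq> {}}"

definition C1_close ::
    "nat \<Rightarrow> real \<Rightarrow> (real \<Rightarrow> nat \<Rightarrow> complex) \<Rightarrow> (real \<Rightarrow> nat \<Rightarrow> complex) \<Rightarrow> bool" where
  "C1_close n \<epsilon> \<beta> \<gamma> \<longleftrightarrow> (\<forall>j\<in>{1..n}. \<forall>t\<in>{0..1}.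
     dist (\<beta> t j) (\<gamma> t j) < \<epsilon> \<and>
     dist (vector_derivative (\<lambda>s. \<beta> s j) (at t within {0..1}))
          (vector_derivative (\<lambda>s. \<gamma> s j) (at t within {0..1})) < \<epsilon>)"

text \<open>In the last clause finiteness has to be stated, since \<open>card\<close> of an infinite set is \<open>0\<close>.\<close>

definition good_stable :: "nat \<Rightarrow> (real \<Rightarrow> nat \<Rightarrow> complex) \<Rightarrow> bool" where
  "good_stable n \<beta> \<longleftrightarrow>
     pure_braid n \<beta> \<and>
     finite (critical_moments n \<beta>) \<and>
     (\<forall>t\<in>critical_moments n \<beta>. \<exists>!T. T \<in> collinear_triples n (\<beta> t)) \<and>
     (\<exists>\<epsilon>>0. \<forall>\<gamma>. pure_braid n \<gamma> \<and> C1_close n \<epsilon> \<beta> \<gamma> \<longrightarrow>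
        finite (critical_moments n \<gamma>) \<and>
        card (critical_moments n \<gamma>) = card (critical_moments n \<beta>))"

section \<open>The map \<open>f\<close>\<close>

text \<open>Meaningful when exactly one triple of points of \<open>z\<close> is collinear.\<close>

definition crit_triple :: "nat \<Rightarrow> (nat \<Rightarrow> complex) \<Rightarrow> (nat \<times> nat \<times> nat) set" where
  "crit_triple n z =
     (THE x. \<exists>i j k. dist_idx n [i, j, k] \<and> between (z i, z k) (z j) \<and> x = triple i j k)"

definition braid_word_value ::
    "nat \<Rightarrow> (real \<Rightarrow> nat \<Rightarrow> complex) \<Rightarrow> ((nat \<times> nat \<times> nat) set \<times> bool) list set" where
  "braid_word_value n \<beta> =
     foldr (mult (G3 n)) (map (\<lambda>t. G3_gen n (crit_triple n (\<beta> t)))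
       (sorted_list_of_set (critical_moments n \<beta>))) (one (G3 n))"

definition PB_map ::
    "nat \<Rightarrow> (real \<Rightarrow> nat \<Rightarrow> complex) set \<Rightarrow> ((nat \<times> nat \<times> nat) set \<times> bool) list set" where
  "PB_map n A = (THE g. \<exists>\<beta>\<in>A. good_stable n \<beta> \<and> g = braid_word_value n \<beta>)"

end

(* The word of a braid is the monodromy of a locally constant system on the space of configurations.
   Near any configuration choose a direction in which the projections of the points are distinct and
   define, for a configuration without collinear triples, an element of the group by letting the points,
   in the order of their projections, descend one after another from infinity to their places and
   recording the letters of the lines they meet.  This element depends only on the orientations of the
   triples, and by the relations of the group it is multiplied by the letter a_ijk when a single triple
   ijk changes its orientation: the commutation relations make the order of independent letters
   irrelevant, and the four-term relation accounts for the three lines ij, ik, jk meeting a later point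
   in the opposite order.  Two such local potentials differ by a left factor, because any two
   configurations of a convex box are joined by moves of single points that cross one wall at a time.
   Continuing potentials along a path gives a holonomy which is invariant under homotopy and
   multiplicative under concatenation.  Stability means that the orientation of the collinear triple
   really changes at each critical moment, so the holonomy of a good and stable braid is its word.
   Every loop of configurations is approximated by a smooth braid moving one point at a time along
   generic segments; such a braid is good and stable, and smooth isotopy of braids coincides with
   homotopy of loops. *)
theory Submission
  imports Defs
begin

text \<open>Two conventions carry the construction. Letters are appended on the right, so for two
  local potentials \<open>f\<close> and \<open>g\<close> the quotient \<open>f z * inv (g z)\<close>
  is unchanged when a wall is crossed; this is what allows a potential to be continued along a path.
  And every letter is an involution, so the direction of a crossing does not matter and walls need
  no coorientation. The main obstacle is that a box of configurations contains strata with several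
  collinear triples, about which potentials say nothing. No dimension count is made: each
  orientation determinant is affine in the position of a single point, so the end point of a
  one-point move only has to avoid finitely many lines to meet the walls one at a time. The same
  moves, slowed down by a smooth step function with positive derivative inside its interval, cross
  every wall transversely and supply the good and stable representatives. The second obstacle is
  that a product of two classes of braids uses smooth concatenations only; approximants of two loops
  with equally many moves always have one.\<close>

section \<open>Presented groups\<close>

context
  fixes X :: "'a set" and R :: "(('a \<times> bool) list \<times> ('a \<times> bool) list) set"
  assumes R: "R \<subseteq> lists (X \<times> UNIV) \<times> lists (X \<times> UNIV)"
begin

lemma pres_rel_lists: "(u, v) \<in> pres_rel X R \<Longrightarrow> u \<in> lists (X \<times> UNIV) \<and> v \<in> lists (X \<times> UNIV)"
  by (induction rule: pres_rel.induct) (use R in auto)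

lemma equiv_pres_rel: "equiv (lists (X \<times> UNIV)) (pres_rel X R)"
proof (rule equivI)
  show "pres_rel X R \<subseteq> lists (X \<times> UNIV) \<times> lists (X \<times> UNIV)"
    using pres_rel_lists by (meson SigmaI subrelI)
  show "refl_on (lists (X \<times> UNIV)) (pres_rel X R)"
    by (rule refl_onI) (blast intro: pres_rel.refl)
  show "sym (pres_rel X R)"
    by (rule symI) (rule pres_rel.sym)
  show "trans (pres_rel X R)"
    by (rule transI) (rule pres_rel.trans)
qed

lemma pres_rel_append:
  assumes "(u, u') \<in> pres_rel X R" "(v, v') \<in> pres_rel X R"
  shows "(u @ v, u' @ v') \<in> pres_rel X R"
proof -
  have "([] @ u @ v, [] @ u' @ v) \<in> pres_rel X R"
    using assms pres_rel_lists by (intro pres_rel.embed) auto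
  moreover have "(u' @ v @ [], u' @ v' @ []) \<in> pres_rel X R"
    using assms pres_rel_lists by (intro pres_rel.embed) auto
  ultimately show ?thesis
    using pres_rel.trans[of "u @ v" "u' @ v" X R "u' @ v'"] by simp
qed

lemma presented_group_carrierI:
  "u \<in> lists (X \<times> UNIV) \<Longrightarrow> pres_rel X R `` {u} \<in> carrier (presented_group X R)"
  by (auto simp: presented_group_def intro: quotientI)

lemma presented_group_carrierE:
  assumes "A \<in> carrier (presented_group X R)"
  obtains u where "u \<in> lists (X \<times> UNIV)" "A = pres_rel X R `` {u}"
  using assms that by (fastforce simp: presented_group_def elim: quotientE)

lemma presented_group_mult:
  assumes "u \<in> lists (X \<times> UNIV)" "v \<in> lists (X \<times> UNIV)"
  shows "pres_rel X R `` {u} \<otimes>\<^bsub>presented_group X R\<^esub> pres_rel X R `` {v} = pres_rel X R `` {u @ v}"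
proof -
  have "congruent2 (pres_rel X R) (pres_rel X R) (\<lambda>u v. pres_rel X R `` {u @ v})"
    by (intro congruent2I') (metis equiv_class_eq equiv_pres_rel pres_rel_append)
  from UN_equiv_class2[OF equiv_pres_rel equiv_pres_rel this assms] show ?thesis
    by (simp add: presented_group_def)
qed

lemma presented_group_eqI:
  "(u, v) \<in> pres_rel X R \<Longrightarrow> pres_rel X R `` {u} = pres_rel X R `` {v}"
  by (rule equiv_class_eq[OF equiv_pres_rel])

text \<open>The inverse word is the reversed word with all exponents flipped. Only the left-hand
  equation is proved, which is what \<open>groupI\<close> asks for.\<close>

lemma pres_rel_inverse:
  assumes "u \<in> lists (X \<times> UNIV)"
  shows "\<exists>v\<in>lists (X \<times> UNIV). (v @ u, []) \<in> pres_rel X R"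
  using assms
proof (induction u)
  case Nil
  then show ?case by (auto intro!: pres_rel.refl bexI[of _ "[]"])
next
  case (Cons a u)
  obtain x b where a: "a = (x, b)" "x \<in> X" "u \<in> lists (X \<times> UNIV)"
    using Cons.prems Cons.hyps by (cases a) auto
  obtain v where v: "v \<in> lists (X \<times> UNIV)" "(v @ u, []) \<in> pres_rel X R"
    using Cons.IH a by auto
  have "(v @ [(x, \<not> b), (x, \<not> \<not> b)] @ u, v @ [] @ u) \<in> pres_rel X R"
    using a v by (intro pres_rel.embed pres_rel.cancel) auto
  then have "((v @ [(x, \<not> b)]) @ (a # u), []) \<in> pres_rel X R"
    using v(2) pres_rel.trans a(1) by fastforce
  then show ?case
    using a v by (intro bexI[of _ "v @ [(x, \<not> b)]"]) auto
qed

lemma group_presented_group: "group (presented_group X R)"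
proof (rule groupI)
  have one: "\<one>\<^bsub>presented_group X R\<^esub> = pres_rel X R `` {[]}"
    by (simp add: presented_group_def)
  show "\<one>\<^bsub>presented_group X R\<^esub> \<in> carrier (presented_group X R)"
    unfolding one by (rule presented_group_carrierI) auto
  fix x y z
  assume x: "x \<in> carrier (presented_group X R)"
  then obtain u where u: "u \<in> lists (X \<times> UNIV)" "x = pres_rel X R `` {u}"
    by (rule presented_group_carrierE)
  show "\<one>\<^bsub>presented_group X R\<^esub> \<otimes>\<^bsub>presented_group X R\<^esub> x = x"
    unfolding one using u by (simp add: presented_group_mult)
  obtain v where v: "v \<in> lists (X \<times> UNIV)" "(v @ u, []) \<in> pres_rel X R"
    using pres_rel_inverse u by blast
  then show "\<exists>y\<in>carrier (presented_group X R). y \<otimes>\<^bsub>presented_group X R\<^esub> x = \<one>\<^bsub>presented_group X R\<^esub>"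
    using u by (intro bexI[of _ "pres_rel X R `` {v}"])
      (auto simp: one presented_group_mult intro!: presented_group_eqI presented_group_carrierI)
  assume y: "y \<in> carrier (presented_group X R)"
  then obtain v where v: "v \<in> lists (X \<times> UNIV)" "y = pres_rel X R `` {v}"
    by (rule presented_group_carrierE)
  have uv: "u @ v \<in> lists (X \<times> UNIV)" using u v by simp
  show "x \<otimes>\<^bsub>presented_group X R\<^esub> y \<in> carrier (presented_group X R)"
    unfolding u v using u v uv by (simp only: presented_group_mult presented_group_carrierI)
  assume z: "z \<in> carrier (presented_group X R)"
  then obtain w where w: "w \<in> lists (X \<times> UNIV)" "z = pres_rel X R `` {w}"
    by (rule presented_group_carrierE)
  have vw: "v @ w \<in> lists (X \<times> UNIV)" using w v by simp
  show "x \<otimes>\<^bsub>presented_group X R\<^esub> y \<otimes>\<^bsub>presented_group X R\<^esub> z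
      = x \<otimes>\<^bsub>presented_group X R\<^esub> (y \<otimes>\<^bsub>presented_group X R\<^esub> z)"
    unfolding u v w using u v w uv vw by (simp only: presented_group_mult append_assoc)
qed

end

section \<open>Products of lists in a group\<close>

text \<open>The fold has the same form as in \<open>braid_word_value\<close>, so that the value of a
  braid is an \<open>lprod\<close> by unfolding.\<close>

definition lprod :: "('a, 'b) monoid_scheme \<Rightarrow> 'a list \<Rightarrow> 'a" where
  "lprod G xs = foldr (mult G) xs (one G)"

lemma lprod_simps [simp]:
  "lprod G [] = \<one>\<^bsub>G\<^esub>" "lprod G (x # xs) = x \<otimes>\<^bsub>G\<^esub> lprod G xs"
  by (simp_all add: lprod_def)

context group
begin

lemma lprod_closed [simp]: "set xs \<subseteq> carrier G \<Longrightarrow> lprod G xs \<in> carrier G"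
  by (induction xs) auto

lemma lprod_append:
  "set xs \<subseteq> carrier G \<Longrightarrow> set ys \<subseteq> carrier G \<Longrightarrow> lprod G (xs @ ys) = lprod G xs \<otimes> lprod G ys"
  by (induction xs) (auto simp: m_assoc)

lemma lprod_commute:
  assumes "a \<in> carrier G" "set xs \<subseteq> carrier G" "\<And>x. x \<in> set xs \<Longrightarrow> a \<otimes> x = x \<otimes> a"
  shows "a \<otimes> lprod G xs = lprod G xs \<otimes> a"
  using assms(2,3)
proof (induction xs)
  case (Cons x xs)
  have cl: "x \<in> carrier G" "lprod G xs \<in> carrier G"
    using Cons.prems(1) by auto
  have "a \<otimes> (x \<otimes> lprod G xs) = x \<otimes> (a \<otimes> lprod G xs)"
    using Cons.prems(2)[of x] cl assms(1) by (simp flip: m_assoc)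
  also have "\<dots> = x \<otimes> lprod G xs \<otimes> a"
    using Cons cl assms(1) by (simp add: m_assoc)
  finally show ?case by simp
qed (use assms in auto)

text \<open>The Cartier--Foata principle: the product of a list depends only on the relative order of
  its non-commuting entries.\<close>

lemma lprod_trace:
  assumes "distinct xs" "distinct ys" "set xs = set ys"
    and "sorted_wrt R xs" "sorted_wrt S ys"
    and g: "\<And>e. e \<in> set xs \<Longrightarrow> g e \<in> carrier G"
    and com: "\<And>e f. e \<in> set xs \<Longrightarrow> f \<in> set xs \<Longrightarrow> e \<noteq> f \<Longrightarrow> R e f \<Longrightarrow> S f e \<Longrightarrow> g e \<otimes> g f = g f \<otimes> g e"
  shows "lprod G (map g xs) = lprod G (map g ys)"
  using assms
proof (induction xs arbitrary: ys)
  case Nil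
  then show ?case by simp
next
  case (Cons e xs)
  obtain A B where ys: "ys = A @ e # B"
    using Cons.prems(3) by (metis list.set_intros(1) split_list)
  have sub: "set A \<subseteq> set xs" "set B \<subseteq> set xs" "set xs = set (A @ B)"
    using Cons.prems(1,2,3) ys by auto
  have gA: "set (map g A) \<subseteq> carrier G" "set (map g B) \<subseteq> carrier G" "g e \<in> carrier G"
    using sub Cons.prems(6) by auto
  \<comment> \<open>The entries of \<open>A\<close> precede \<open>e\<close> in \<open>ys\<close>
    but follow it in \<open>e # xs\<close>; by hypothesis each of them commutes with
    \<open>e\<close>, which can therefore be moved to the front of \<open>ys\<close>.\<close>
  have "g e \<otimes> lprod G (map g A) = lprod G (map g A) \<otimes> g e"
  proof (rule lprod_commute)
    fix x assume "x \<in> set (map g A)"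
    then obtain f where f: "f \<in> set A" "x = g f" by auto
    have "R e f" "S f e" "f \<noteq> e"
      using f sub Cons.prems(1,4,5) ys by (auto simp: sorted_wrt_append)
    then show "g e \<otimes> x = x \<otimes> g e"
      using Cons.prems(7)[of e f] f sub by auto
  qed (use gA in auto)
  moreover have "lprod G (map g xs) = lprod G (map g (A @ B))"
    using Cons.prems ys sub
    by (intro Cons.IH) (auto simp: sorted_wrt_append)
  ultimately show ?case
    using gA by (simp add: ys lprod_append flip: m_assoc)
qed

end

section \<open>Relations in \<open>'G\<^sub>n\<^sup>3\<close>\<close>

lemma triple_in_gens: "dist_idx n [i, j, k] \<Longrightarrow> triple i j k \<in> G3_gens n"
  by (auto simp: G3_gens_def)

lemma G3_rels_lists: "G3_rels n \<subseteq> lists (G3_gens n \<times> UNIV) \<times> lists (G3_gens n \<times> UNIV)"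
  by (auto simp: G3_rels_def dist_idx_def intro!: triple_in_gens)

lemma group_G3: "group (G3 n)"
  unfolding G3_def by (rule group_presented_group[OF G3_rels_lists])

interpretation G3: group "G3 n" for n
  by (rule group_G3)

definition agen :: "nat \<Rightarrow> nat \<Rightarrow> nat \<Rightarrow> nat \<Rightarrow> ((nat \<times> nat \<times> nat) set \<times> bool) list set" where
  "agen n i j k = G3_gen n (triple i j k)"

lemma agen_closed [simp]: "dist_idx n [i, j, k] \<Longrightarrow> agen n i j k \<in> carrier (G3 n)"
  unfolding agen_def G3_gen_def G3_def
  by (rule presented_group_carrierI[OF G3_rels_lists]) (simp add: triple_in_gens)

lemma lprod_gens:
  assumes "set xs \<subseteq> G3_gens n"
  shows "lprod (G3 n) (map (G3_gen n) xs) = pres_rel (G3_gens n) (G3_rels n) `` {map (\<lambda>x. (x, True)) xs}"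
  using assms
proof (induction xs)
  case Nil
  then show ?case by (simp add: G3_def presented_group_def)
next
  case (Cons x xs)
  have "[(x, True)] \<in> lists (G3_gens n \<times> UNIV)" "map (\<lambda>x. (x, True)) xs \<in> lists (G3_gens n \<times> UNIV)"
    using Cons.prems by auto
  note mult = presented_group_mult[OF G3_rels_lists this]
  show ?case
    using Cons mult by (simp add: G3_def G3_gen_def)
qed

text \<open>Every relation of the presentation is between words of positive letters, so it becomes
  an equation between products of generators without formal inverses.\<close>

lemma lprod_rel:
  assumes "(map (\<lambda>x. (x, True)) xs, map (\<lambda>x. (x, True)) ys) \<in> G3_rels n"
  shows "lprod (G3 n) (map (G3_gen n) xs) = lprod (G3 n) (map (G3_gen n) ys)"
proof -
  have "set xs \<subseteq> G3_gens n" "set ys \<subseteq> G3_gens n"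
    using assms G3_rels_lists by fastforce+
  then show ?thesis
    using assms by (auto simp: lprod_gens intro!: presented_group_eqI[OF G3_rels_lists] pres_rel.relator)
qed

lemma agen_square:
  assumes "dist_idx n [i, j, k]"
  shows "agen n i j k \<otimes>\<^bsub>G3 n\<^esub> agen n i j k = \<one>\<^bsub>G3 n\<^esub>"
proof -
  have "lprod (G3 n) (map (G3_gen n) [triple i j k, triple i j k]) = lprod (G3 n) (map (G3_gen n) [])"
    by (rule lprod_rel) (use assms in \<open>auto simp: G3_rels_def\<close>)
  then show ?thesis
    using agen_closed[OF assms] by (simp add: agen_def)
qed

lemma agen_commute:
  assumes "dist_idx n [i, j, k]" "dist_idx n [p, q, r]" "card ({i, j, k} \<inter> {p, q, r}) \<le> 1"
  shows "agen n i j k \<otimes>\<^bsub>G3 n\<^esub> agen n p q r = agen n p q r \<otimes>\<^bsub>G3 n\<^esub> agen n i j k"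
proof -
  have "([letter i j k, letter p q r], [letter p q r, letter i j k]) \<in> G3_rels n"
    unfolding G3_rels_def using assms by blast
  then have "lprod (G3 n) (map (G3_gen n) [triple i j k, triple p q r])
      = lprod (G3 n) (map (G3_gen n) [triple p q r, triple i j k])"
    by (intro lprod_rel) simp
  then show ?thesis
    using agen_closed assms by (simp add: agen_def)
qed

lemma agen_tetrahedron:
  assumes "dist_idx n [i, j, k, l]"
  shows "lprod (G3 n) [agen n i j k, agen n i j l, agen n i k l, agen n j k l]
    = lprod (G3 n) [agen n j k l, agen n i k l, agen n i j l, agen n i j k]"
proof -
  have "([letter i j k, letter i j l, letter i k l, letter j k l],
      [letter j k l, letter i k l, letter i j l, letter i j k]) \<in> G3_rels n"
    unfolding G3_rels_def using assms by blast
  then have "lprod (G3 n) (map (G3_gen n) [triple i j k, triple i j l, triple i k l, triple j k l])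
      = lprod (G3 n) (map (G3_gen n) [triple j k l, triple i k l, triple i j l, triple i j k])"
    by (intro lprod_rel) simp
  then show ?thesis
    by (simp add: agen_def)
qed

section \<open>Signed areas and the order of lines seen over a point\<close>

section \<open>Orientations and shear charts\<close>

text \<open>Twice the signed area of the triangle \<open>z i\<close>, \<open>z j\<close>,
  \<open>z k\<close>; positive when the triangle is traversed counterclockwise.\<close>

definition cdet :: "(nat \<Rightarrow> complex) \<Rightarrow> nat \<Rightarrow> nat \<Rightarrow> nat \<Rightarrow> real" where
  "cdet z i j k = Im (cnj (z j - z i) * (z k - z i))"

definition generic :: "nat \<Rightarrow> (nat \<Rightarrow> complex) \<Rightarrow> bool" where
  "generic n z \<longleftrightarrow> (\<forall>i j k. dist_idx n [i, j, k] \<longrightarrow> cdet z i j k \<noteq> 0)"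

text \<open>For generic configurations positivity alone fixes the sign. A set \<open>T\<close> that
  is not an admissible triple satisfies the condition vacuously, so quantifiers over
  \<open>T\<close> may range over all sets.\<close>

definition same_sign :: "nat \<Rightarrow> (nat \<Rightarrow> complex) \<Rightarrow> (nat \<Rightarrow> complex) \<Rightarrow> nat set \<Rightarrow> bool" where
  "same_sign n z z' T \<longleftrightarrow> (\<forall>i j k. dist_idx n [i, j, k] \<longrightarrow> {i, j, k} = T \<longrightarrow>
     (0 < cdet z i j k \<longleftrightarrow> 0 < cdet z' i j k))"

text \<open>A shear serves as the change of direction because it keeps imaginary parts as heights
  and has determinant one, so that \<open>cdet\<close> is the same in the sheared
  coordinates.\<close>

definition shx :: "real \<Rightarrow> (nat \<Rightarrow> complex) \<Rightarrow> nat \<Rightarrow> real" where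
  "shx t z j = Re (z j) + t * Im (z j)"

text \<open>Height at abscissa \<open>shx t z m\<close> of the line through the points \<open>z i\<close> and \<open>z j\<close>.\<close>

definition height :: "real \<Rightarrow> (nat \<Rightarrow> complex) \<Rightarrow> nat \<Rightarrow> nat \<times> nat \<Rightarrow> real" where
  "height t z m = (\<lambda>(i, j). Im (z i) + (Im (z j) - Im (z i)) / (shx t z j - shx t z i) * (shx t z m - shx t z i))"

lemma cdet_shear:
  "cdet z i j k = (shx t z j - shx t z i) * (Im (z k) - Im (z i)) - (Im (z j) - Im (z i)) * (shx t z k - shx t z i)"
  by (simp add: cdet_def shx_def algebra_simps)

lemma cdet_eq:
  "cdet z i j k = Re (z j) * Im (z k) - Re (z j) * Im (z i) - Re (z i) * Im (z k)
     - Im (z j) * Re (z k) + Im (z j) * Re (z i) + Im (z i) * Re (z k)"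
  by (simp add: cdet_def algebra_simps)

text \<open>The determinant is the horizontal distance from \<open>i\<close> to \<open>j\<close>
  times the height of \<open>m\<close> above the line through them.\<close>

lemma below_line_iff:
  assumes "shx t z i < shx t z j"
  shows "cdet z i j m < 0 \<longleftrightarrow> Im (z m) < height t z m (i, j)"
proof -
  have "cdet z i j m = (shx t z j - shx t z i) * (Im (z m) - height t z m (i, j))"
    using assms by (simp add: cdet_shear[of _ _ _ _ t] height_def field_simps)
  then show ?thesis using assms by (simp add: mult_less_0_iff)
qed

text \<open>To the right of all three points, the height of \<open>ik\<close> minus that of
  \<open>ij\<close>, and the height of \<open>jk\<close> minus that of \<open>ik\<close>, are
  positive multiples of \<open>cdet z i j k\<close>. Hence the three lines stand in one of two
  opposite orders, and a change of orientation of \<open>ijk\<close> reverses the order.\<close>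

lemma height_less_iff:
  assumes "shx t z i < shx t z j" "shx t z j < shx t z k" "shx t z k < shx t z m"
  shows "height t z m (i, j) < height t z m (i, k) \<longleftrightarrow> 0 < cdet z i j k"
    and "height t z m (i, k) < height t z m (j, k) \<longleftrightarrow> 0 < cdet z i j k"
    and "height t z m (i, k) < height t z m (i, j) \<longleftrightarrow> cdet z i j k < 0"
    and "height t z m (j, k) < height t z m (i, k) \<longleftrightarrow> cdet z i j k < 0"
proof -
  have 1: "height t z m (i, k) - height t z m (i, j)
      = cdet z i j k * ((shx t z m - shx t z i) / ((shx t z j - shx t z i) * (shx t z k - shx t z i)))"
    using assms by (simp add: cdet_shear[of _ _ _ _ t] height_def divide_simps) (simp add: algebra_simps)
  have p1: "0 < (shx t z m - shx t z i) / ((shx t z j - shx t z i) * (shx t z k - shx t z i))"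
    using assms by (intro divide_pos_pos mult_pos_pos) auto
  show "height t z m (i, j) < height t z m (i, k) \<longleftrightarrow> 0 < cdet z i j k"
    "height t z m (i, k) < height t z m (i, j) \<longleftrightarrow> cdet z i j k < 0"
    using 1 p1 by (smt (verit) zero_less_mult_iff mult_less_0_iff)+
  have 2: "height t z m (j, k) - height t z m (i, k)
      = cdet z i j k * ((shx t z m - shx t z k) / ((shx t z k - shx t z j) * (shx t z k - shx t z i)))"
    using assms by (simp add: cdet_shear[of _ _ _ _ t] height_def divide_simps) (simp add: algebra_simps)
  have p2: "0 < (shx t z m - shx t z k) / ((shx t z k - shx t z j) * (shx t z k - shx t z i))"
    using assms by (intro divide_pos_pos mult_pos_pos) auto
  show "height t z m (i, k) < height t z m (j, k) \<longleftrightarrow> 0 < cdet z i j k"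
    "height t z m (j, k) < height t z m (i, k) \<longleftrightarrow> cdet z i j k < 0"
    using 2 p2 by (smt (verit) zero_less_mult_iff mult_less_0_iff)+
qed

section \<open>Group elements attached to configurations with a fixed left-to-right order\<close>

section \<open>The chart function\<close>

text \<open>\<open>block\<close> lists the lines met by the point \<open>m\<close> when it descends vertically (in the sheared
  coordinates) from \<open>+\<infinity>\<close> to its position, the points to its left being already in place.\<close>

definition block :: "nat \<Rightarrow> real \<Rightarrow> (nat \<Rightarrow> complex) \<Rightarrow> nat \<Rightarrow> (nat \<times> nat) list" where
  "block n t z m = sort_key (\<lambda>e. - height t z m e)
     (filter (\<lambda>(i, j). shx t z i < shx t z j \<and> shx t z j < shx t z m \<and> cdet z i j m < 0)
       (List.product [1..<Suc n] [1..<Suc n]))"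

definition pgen :: "nat \<Rightarrow> nat \<Rightarrow> nat \<times> nat \<Rightarrow> ((nat \<times> nat \<times> nat) set \<times> bool) list set" where
  "pgen n m = (\<lambda>(i, j). agen n i j m)"

definition block_val :: "nat \<Rightarrow> real \<Rightarrow> (nat \<Rightarrow> complex) \<Rightarrow> nat \<Rightarrow> ((nat \<times> nat \<times> nat) set \<times> bool) list set" where
  "block_val n t z m = lprod (G3 n) (map (pgen n m) (block n t z m))"

text \<open>The list \<open>\<sigma>\<close> is meant to contain the indices from left to right. It
  is a parameter, not computed from \<open>z\<close>, because one order has to serve a whole box of
  configurations.\<close>

definition chart_val ::
    "nat \<Rightarrow> real \<Rightarrow> nat list \<Rightarrow> (nat \<Rightarrow> complex) \<Rightarrow> ((nat \<times> nat \<times> nat) set \<times> bool) list set" where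
  "chart_val n t \<sigma> z = lprod (G3 n) (map (block_val n t z) \<sigma>)"

lemma set_block:
  "set (block n t z m) = {(i, j). i \<in> {1..n} \<and> j \<in> {1..n} \<and>
     shx t z i < shx t z j \<and> shx t z j < shx t z m \<and> cdet z i j m < 0}"
  unfolding block_def set_sort by (auto simp: set_product)

lemma distinct_block: "distinct (block n t z m)"
  unfolding block_def by (auto simp: distinct_product)

lemma sorted_block: "sorted_wrt (\<lambda>e f. height t z m e \<ge> height t z m f) (block n t z m)"
proof -
  have "sorted (map (\<lambda>e. - height t z m e) (block n t z m))"
    unfolding block_def by (rule sorted_sort_key)
  then show ?thesis by (simp add: sorted_map)
qed

lemma block_dist_idx: "(i, j) \<in> set (block n t z m) \<Longrightarrow> m \<in> {1..n} \<Longrightarrow> dist_idx n [i, j, m]"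
  by (auto simp: set_block dist_idx_def)

lemma pgen_block_closed: "m \<in> {1..n} \<Longrightarrow> e \<in> set (block n t z m) \<Longrightarrow> pgen n m e \<in> carrier (G3 n)"
  using block_dist_idx by (cases e) (auto simp: pgen_def)

lemma block_val_closed: "m \<in> {1..n} \<Longrightarrow> block_val n t z m \<in> carrier (G3 n)"
  unfolding block_val_def by (rule G3.lprod_closed) (auto simp: pgen_block_closed)

text \<open>Two lines without a common index give triples whose only common index is
  \<open>m\<close>, which is the case of the commutation relation.\<close>

lemma pgen_commute:
  assumes "dist_idx n [i, j, m]" "dist_idx n [k, l, m]" "{i, j} \<inter> {k, l} = {}"
  shows "pgen n m (i, j) \<otimes>\<^bsub>G3 n\<^esub> pgen n m (k, l) = pgen n m (k, l) \<otimes>\<^bsub>G3 n\<^esub> pgen n m (i, j)"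
proof -
  have "{i, j, m} \<inter> {k, l, m} = {m}"
    using assms by (auto simp: dist_idx_def)
  then show ?thesis
    using assms(1,2) unfolding pgen_def prod.case by (intro agen_commute) simp_all
qed

text \<open>Two different lines with a common index are two sides of one triangle. Naming its
  corners from left to right brings the lines into the form that \<open>height_less_iff\<close>
  compares.\<close>

lemma share_index_cases:
  fixes x :: "nat \<Rightarrow> real"
  assumes "x i < x j" "x k < x l" "(i, j) \<noteq> (k, l)" "{i, j} \<inter> {k, l} \<noteq> {}"
    and inj: "inj_on x {i, j, k, l}"
  obtains u v w where "x u < x v" "x v < x w" "(i, j) \<in> {(u, v), (u, w), (v, w)}"
    "(k, l) \<in> {(u, v), (u, w), (v, w)}" "{u, v, w} = {i, j} \<union> {k, l}"
proof -
  consider "i = k" "x j < x l" | "i = k" "x l < x j" | "j = l" "x i < x k" | "j = l" "x k < x i"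
    | "i = l" | "j = k"
    using assms by (auto simp: inj_on_def) (metis linorder_neqE_linordered_idom)+
  then show ?thesis
  proof cases
    case 1 show ?thesis by (rule that[of i j l]) (use 1 assms in auto)
  next
    case 2 show ?thesis by (rule that[of i l j]) (use 2 assms in auto)
  next
    case 3 show ?thesis by (rule that[of i k j]) (use 3 assms in auto)
  next
    case 4 show ?thesis by (rule that[of k i j]) (use 4 assms in auto)
  next
    case 5 show ?thesis by (rule that[of k i j]) (use 5 assms in auto)
  next
    case 6 show ?thesis by (rule that[of i j l]) (use 6 assms in auto)
  qed
qed

locale chart =
  fixes n :: nat and t :: real and \<sigma> :: "nat list"
  assumes \<sigma>: "distinct \<sigma>" "set \<sigma> = {1..n}"
begin

definition adm :: "(nat \<Rightarrow> complex) \<Rightarrow> bool" where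
  "adm z \<longleftrightarrow> generic n z \<and> sorted_wrt (\<lambda>i j. shx t z i < shx t z j) \<sigma>"

lemma adm_less:
  assumes "adm z" "adm z'" "i \<in> {1..n}" "j \<in> {1..n}"
  shows "shx t z i < shx t z j \<longleftrightarrow> shx t z' i < shx t z' j"
proof -
  obtain a b where ab: "a < length \<sigma>" "b < length \<sigma>" "i = \<sigma> ! a" "j = \<sigma> ! b"
    using assms(3,4) \<sigma>(2) by (metis in_set_conv_nth)
  have "shx t y i < shx t y j \<longleftrightarrow> a < b" if "adm y" for y
  proof -
    have "sorted_wrt (\<lambda>i j. shx t y i < shx t y j) \<sigma>" using that by (simp add: adm_def)
    then show ?thesis
      using ab by (cases a b rule: linorder_cases) (auto dest: sorted_wrt_nth_less less_asym)
  qed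
  then show ?thesis using assms(1,2) by simp
qed

lemma adm_inj: "adm z \<Longrightarrow> inj_on (shx t z) {1..n}"
proof (rule inj_onI)
  fix i j assume z: "adm z" and ij: "i \<in> {1..n}" "j \<in> {1..n}" "shx t z i = shx t z j"
  obtain a b where ab: "a < length \<sigma>" "b < length \<sigma>" "i = \<sigma> ! a" "j = \<sigma> ! b"
    using ij(1,2) \<sigma>(2) by (metis in_set_conv_nth)
  have "sorted_wrt (\<lambda>i j. shx t z i < shx t z j) \<sigma>" using z by (simp add: adm_def)
  then show "i = j"
    using ab ij(3) by (cases a b rule: linorder_cases) (auto dest: sorted_wrt_nth_less)
qed

lemma same_signD:
  assumes "adm z" "adm z'" "same_sign n z z' {i, j, k}" "dist_idx n [i, j, k]"
  shows "0 < cdet z i j k \<longleftrightarrow> 0 < cdet z' i j k" "cdet z i j k < 0 \<longleftrightarrow> cdet z' i j k < 0"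
proof -
  show "0 < cdet z i j k \<longleftrightarrow> 0 < cdet z' i j k"
    using assms by (simp add: same_sign_def)
  moreover have "cdet z i j k \<noteq> 0" "cdet z' i j k \<noteq> 0"
    using assms by (auto simp: adm_def generic_def)
  ultimately show "cdet z i j k < 0 \<longleftrightarrow> cdet z' i j k < 0" by linarith
qed

text \<open>Two lines with a common index are compared over \<open>m\<close> by the orientation of
  the triangle they span. Lines without a common index may change their order freely, but their
  letters commute.\<close>

lemma height_order:
  assumes z: "adm z" "adm z'" and m: "m \<in> {1..n}"
    and ij: "i \<in> {1..n}" "j \<in> {1..n}" "shx t z i < shx t z j" "shx t z j < shx t z m"
    and kl: "k \<in> {1..n}" "l \<in> {1..n}" "shx t z k < shx t z l" "shx t z l < shx t z m"
    and ne: "(i, j) \<noteq> (k, l)" and share: "{i, j} \<inter> {k, l} \<noteq> {}"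
    and ss: "same_sign n z z' ({i, j} \<union> {k, l})"
  shows "height t z m (i, j) < height t z m (k, l) \<longleftrightarrow> height t z' m (i, j) < height t z' m (k, l)"
    and "height t z m (i, j) \<noteq> height t z m (k, l)"
proof -
  have "inj_on (shx t z) {i, j, k, l}"
    using ij(1,2) kl(1,2) by (intro inj_on_subset[OF adm_inj[OF z(1)]]) auto
  then obtain u v w where uvw: "shx t z u < shx t z v" "shx t z v < shx t z w"
    "(i, j) \<in> {(u, v), (u, w), (v, w)}" "(k, l) \<in> {(u, v), (u, w), (v, w)}" "{u, v, w} = {i, j} \<union> {k, l}"
    using share_index_cases[OF ij(3) kl(3) ne share] by metis
  have in_n: "u \<in> {1..n}" "v \<in> {1..n}" "w \<in> {1..n}"
    using uvw(5) ij kl by (metis insert_iff singletonD UnE)+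
  have wm: "shx t z w < shx t z m"
    using uvw(5) ij kl by (metis insert_iff singletonD UnE order.strict_trans)
  have uvw': "shx t z' u < shx t z' v" "shx t z' v < shx t z' w" "shx t z' w < shx t z' m"
    using adm_less[OF z] in_n m uvw(1,2) wm by blast+
  have d: "dist_idx n [u, v, w]"
    using in_n uvw(1,2) by (auto simp: dist_idx_def)
  note sg = same_signD[OF z _ d]
  have "same_sign n z z' {u, v, w}" using ss uvw(5) by simp
  note sg = sg[OF this]
  have nz: "cdet z u v w \<noteq> 0" "cdet z' u v w \<noteq> 0"
    using z d by (auto simp: adm_def generic_def)
  note h = height_less_iff[OF uvw(1,2) wm] and h' = height_less_iff[OF uvw']
  show "height t z m (i, j) < height t z m (k, l) \<longleftrightarrow> height t z' m (i, j) < height t z' m (k, l)"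
    using uvw(3,4) ne h h' sg nz by (smt (verit) insert_iff prod.inject singletonD)
  show "height t z m (i, j) \<noteq> height t z m (k, l)"
    using uvw(3,4) ne h nz by (smt (verit) insert_iff prod.inject singletonD)
qed

lemma set_block_eq:
  assumes z: "adm z" "adm z'" and m: "m \<in> {1..n}"
    and ss: "\<And>i j. shx t z i < shx t z j \<Longrightarrow> shx t z j < shx t z m \<Longrightarrow> same_sign n z z' {i, j, m}"
  shows "set (block n t z m) = set (block n t z' m)"
proof -
  have "cdet z i j m < 0 \<longleftrightarrow> cdet z' i j m < 0"
    if "i \<in> {1..n}" "j \<in> {1..n}" "shx t z i < shx t z j" "shx t z j < shx t z m" for i j
  proof -
    have "dist_idx n [i, j, m]" using that m by (auto simp: dist_idx_def)
    then show ?thesis using same_signD[OF z ss] that by blast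
  qed
  then show ?thesis
    using adm_less[OF z] m by (auto simp: set_block)
qed

text \<open>Only lines without a common index can be met in a different order, so the two lists
  agree up to commuting letters and \<open>lprod_trace\<close> applies. Equality of the sets is a
  separate hypothesis since it concerns the triples containing \<open>m\<close>, whereas the order
  concerns triples of the points to its left.\<close>

lemma block_val_eq:
  assumes z: "adm z" "adm z'" and m: "m \<in> {1..n}"
    and eq: "set (block n t z m) = set (block n t z' m)"
    and ss: "\<And>e f. e \<in> set (block n t z m) \<Longrightarrow> f \<in> set (block n t z m) \<Longrightarrow> e \<noteq> f \<Longrightarrow>
      {fst e, snd e} \<inter> {fst f, snd f} \<noteq> {} \<Longrightarrow> same_sign n z z' ({fst e, snd e} \<union> {fst f, snd f})"
  shows "block_val n t z m = block_val n t z' m"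
  unfolding block_val_def
proof (rule G3.lprod_trace[OF distinct_block distinct_block eq sorted_block sorted_block])
  show "pgen n m e \<in> carrier (G3 n)" if "e \<in> set (block n t z m)" for e
    using that m by (rule pgen_block_closed[rotated])
  fix e f assume ef: "e \<in> set (block n t z m)" "f \<in> set (block n t z m)" "e \<noteq> f"
    and h: "height t z m f \<le> height t z m e" "height t z' m e \<le> height t z' m f"
  obtain i j k l where e: "e = (i, j)" "f = (k, l)" by (cases e, cases f)
  show "pgen n m e \<otimes>\<^bsub>G3 n\<^esub> pgen n m f = pgen n m f \<otimes>\<^bsub>G3 n\<^esub> pgen n m e"
  proof (cases "{i, j} \<inter> {k, l} = {}")
    case True
    then show ?thesis
      using ef m unfolding e by (intro pgen_commute block_dist_idx) auto
  next
    case False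
    have ij: "i \<in> {1..n}" "j \<in> {1..n}" "shx t z i < shx t z j" "shx t z j < shx t z m"
      and kl: "k \<in> {1..n}" "l \<in> {1..n}" "shx t z k < shx t z l" "shx t z l < shx t z m"
      using ef by (auto simp: e set_block)
    have "same_sign n z z' ({i, j} \<union> {k, l})"
      using ss[OF ef] False by (simp add: e)
    with height_order[OF z m kl ij] height_order[OF z m ij kl] ef(3) False h
    show ?thesis by (auto simp: e Un_commute Int_commute)
  qed
qed


lemma chart_val_same:
  assumes z: "adm z" "adm z'" and ss: "\<And>T. same_sign n z z' T"
  shows "chart_val n t \<sigma> z = chart_val n t \<sigma> z'"
proof -
  have "block_val n t z m = block_val n t z' m" if "m \<in> {1..n}" for m
    using ss by (intro block_val_eq[OF z that] set_block_eq[OF z that])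
  then have "map (block_val n t z) \<sigma> = map (block_val n t z') \<sigma>"
    using \<sigma> by simp
  then show ?thesis unfolding chart_val_def by (rule arg_cong)
qed

lemma chart_val_closed: "chart_val n t \<sigma> z \<in> carrier (G3 n)"
  unfolding chart_val_def using \<sigma> by (intro G3.lprod_closed) (auto intro!: block_val_closed)

section \<open>Crossing a single wall within a chart\<close>

context
  fixes z z' i j k
  assumes z: "adm z" "adm z'"
    and idx: "i \<in> {1..n}" "j \<in> {1..n}" "k \<in> {1..n}"
    and ijk: "shx t z i < shx t z j" "shx t z j < shx t z k"
    and cross: "0 < cdet z i j k" "cdet z' i j k < 0"
    and ss: "\<And>T. T \<noteq> {i, j, k} \<Longrightarrow> same_sign n z z' T"
begin

lemma cross_order: "shx t z' i < shx t z' j" "shx t z' j < shx t z' k"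
  using adm_less[OF z] idx ijk by blast+

lemma cross_dist_idx: "dist_idx n [i, j, k]"
  using idx ijk by (auto simp: dist_idx_def)

text \<open>All indices that influence the block of such an \<open>m\<close>, both in the triples
  with \<open>m\<close> and in the triangles spanned by two lines, lie strictly to the left of
  \<open>k\<close>; so none of these triples is \<open>{i, j, k}\<close>.\<close>

lemma cross_block_left:
  assumes m: "m \<in> {1..n}" "shx t z m < shx t z k"
  shows "block_val n t z m = block_val n t z' m"
proof (intro block_val_eq[OF z m(1)] set_block_eq[OF z m(1)] ss)
  fix p q assume pq: "shx t z p < shx t z q" "shx t z q < shx t z m"
  show "{p, q, m} \<noteq> {i, j, k}"
  proof
    assume "{p, q, m} = {i, j, k}"
    then have "k \<in> {p, q, m}" by simp
    then show False using m pq by auto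
  qed
next
  fix e f assume "e \<in> set (block n t z m)" "f \<in> set (block n t z m)"
  with m have "\<forall>p\<in>{fst e, snd e} \<union> {fst f, snd f}. shx t z p < shx t z k"
    by (auto simp: set_block)
  then show "{fst e, snd e} \<union> {fst f, snd f} \<noteq> {i, j, k}"
    by (metis insertI1 insert_commute order.irrefl)
qed

text \<open>The point \<open>k\<close> passes from above to below the line \<open>ij\<close>, so
  exactly this line is added to those it meets. At the moment of crossing the line runs through
  \<open>k\<close> itself, below all others that are met, whence its letter comes last.\<close>

lemma cross_block_top:
  "block_val n t z' k = block_val n t z k \<otimes>\<^bsub>G3 n\<^esub> agen n i j k"
proof -
  have set_eq: "set (block n t z k @ [(i, j)]) = set (block n t z' k)"
  proof -
    have "e \<in> set (block n t z k @ [(i, j)]) \<longleftrightarrow> e \<in> set (block n t z' k)" for e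
    proof (cases "e = (i, j)")
      case True
      then show ?thesis using cross_order idx cross by (simp add: set_block)
    next
      case False
      obtain p q where e: "e = (p, q)" by (cases e)
      have "cdet z p q k < 0 \<longleftrightarrow> cdet z' p q k < 0"
        if pq: "p \<in> {1..n}" "q \<in> {1..n}" "shx t z p < shx t z q" "shx t z q < shx t z k"
      proof (rule same_signD[OF z])
        have "p \<noteq> q" "p \<noteq> k" "q \<noteq> k" using pq by auto
        then have "{p, q, k} = {i, j, k} \<Longrightarrow> (p, q) = (i, j) \<or> (p, q) = (j, i)"
          using ijk by auto
        then show "same_sign n z z' {p, q, k}"
          using False ijk(1) pq(3) unfolding e by (intro ss) force
        show "dist_idx n [p, q, k]" using pq idx by (auto simp: dist_idx_def)
      qed
      then show ?thesis
        using False adm_less[OF z] idx by (auto simp: e set_block)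
    qed
    then show ?thesis by blast
  qed
  have nij: "(i, j) \<notin> set (block n t z k)"
    using cross by (auto simp: set_block)
  \<comment> \<open>The relation sorting the extended list: \<open>(i, j)\<close> last, all other
    lines by decreasing height over \<open>z\<close>.\<close>
  let ?R = "\<lambda>e f. e \<noteq> (i, j) \<and> (f \<noteq> (i, j) \<longrightarrow> height t z k e \<ge> height t z k f)"
  have "lprod (G3 n) (map (pgen n k) (block n t z k @ [(i, j)])) = block_val n t z' k"
    unfolding block_val_def
  proof (rule G3.lprod_trace[OF _ distinct_block set_eq _ sorted_block])
    show "distinct (block n t z k @ [(i, j)])"
      using nij distinct_block by auto
    show "sorted_wrt ?R (block n t z k @ [(i, j)])"
      using sorted_block[of t z k n] nij
      by (auto simp: sorted_wrt_append intro: sorted_wrt_mono_rel[rotated])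
    show "pgen n k e \<in> carrier (G3 n)" if "e \<in> set (block n t z k @ [(i, j)])" for e
      using that idx unfolding set_eq by (intro pgen_block_closed)
    fix e f assume ef: "e \<in> set (block n t z k @ [(i, j)])" "f \<in> set (block n t z k @ [(i, j)])" "e \<noteq> f"
      and h: "?R e f" "height t z' k e \<le> height t z' k f"
    obtain p q r s where e: "e = (p, q)" "f = (r, s)" by (cases e, cases f)
    show "pgen n k e \<otimes>\<^bsub>G3 n\<^esub> pgen n k f = pgen n k f \<otimes>\<^bsub>G3 n\<^esub> pgen n k e"
    proof (cases "{p, q} \<inter> {r, s} = {}")
      case True
      then show ?thesis
        using ef idx unfolding e set_eq by (intro pgen_commute block_dist_idx) auto
    next
      case False
      have pq: "p \<in> {1..n}" "q \<in> {1..n}" "shx t z p < shx t z q" "shx t z q < shx t z k"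
        and rs: "r \<in> {1..n}" "s \<in> {1..n}" "shx t z r < shx t z s" "shx t z s < shx t z k"
        using ef idx ijk by (auto simp: e set_block)
      have "same_sign n z z' ({p, q} \<union> {r, s})"
      proof (rule ss, rule notI)
        assume "{p, q} \<union> {r, s} = {i, j, k}"
        then have "k \<in> {p, q} \<union> {r, s}" by simp
        then show False using pq rs by auto
      qed
      note ho = height_order[OF z idx(3) pq rs _ False this]
      \<comment> \<open>For \<open>f = (i, j)\<close> the point \<open>z k\<close> separates the
        lines: \<open>e\<close> runs above it, and \<open>ij\<close> does not.\<close>
      have "height t z k f \<le> height t z k e"
      proof (cases "f = (i, j)")
        case True
        then have "cdet z p q k < 0" using h(1) ef(1) by (auto simp: e set_block)
        then have "Im (z k) < height t z k (p, q)"
          using below_line_iff pq by blast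
        moreover have "height t z k (i, j) \<le> Im (z k)"
          using below_line_iff[OF ijk(1), of k] cross(1) by linarith
        ultimately show ?thesis using True by (simp add: e)
      qed (use h in auto)
      then show ?thesis
        using ho h(2) ef(3) height_order[OF z idx(3) rs pq] False \<open>same_sign n z z' ({p, q} \<union> {r, s})\<close>
        by (auto simp: e Un_commute Int_commute)
    qed
  qed
  moreover have "set (map (pgen n k) (block n t z k)) \<subseteq> carrier (G3 n)"
    using idx by (auto simp: pgen_block_closed)
  ultimately show ?thesis
    using agen_closed[OF cross_dist_idx] by (simp add: block_val_def G3.lprod_append pgen_def)
qed

text \<open>Either all or none of the lines \<open>ij\<close>, \<open>ik\<close>, \<open>jk\<close> are met by \<open>m\<close>; in the first case they can be
  made adjacent, and the crossing reverses them: this is the four-term relation.\<close>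

lemma cross_block_right:
  assumes m: "m \<in> {1..n}" "shx t z k < shx t z m"
  shows "agen n i j k \<otimes>\<^bsub>G3 n\<^esub> block_val n t z' m = block_val n t z m \<otimes>\<^bsub>G3 n\<^esub> agen n i j k"
proof -
  have km': "shx t z' k < shx t z' m"
    using adm_less[OF z] idx m by blast
  define P where "P = {(i, j), (i, k), (j, k)}"
  define h where "h = height t z m"
  define h' where "h' = height t z' m"
  have B: "set (block n t z m) = set (block n t z' m)"
  proof (intro set_block_eq[OF z m(1)] ss)
    show "{p, q, m} \<noteq> {i, j, k}" for p q
    proof
      assume "{p, q, m} = {i, j, k}"
      then have "m \<in> {i, j, k}" by blast
      then show False using m(2) ijk by auto
    qed
  qed
  have hP: "h (i, j) < h (i, k)" "h (i, k) < h (j, k)" "h' (j, k) < h' (i, k)" "h' (i, k) < h' (i, j)"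
    using height_less_iff[OF ijk m(2)] height_less_iff[OF cross_order km'] cross by (auto simp: h_def h'_def)
  have block_iff: "(p, q) \<in> set (block n t z m) \<longleftrightarrow> Im (z m) < h (p, q)"
    "(p, q) \<in> set (block n t z m) \<longleftrightarrow> Im (z' m) < h' (p, q)" if "(p, q) \<in> P" for p q
  proof -
    have pq: "p \<in> {1..n}" "q \<in> {1..n}" "shx t z p < shx t z q" "shx t z q < shx t z m"
      "shx t z' p < shx t z' q" "shx t z' q < shx t z' m"
      using that idx ijk m cross_order km' by (auto simp: P_def)
    show "(p, q) \<in> set (block n t z m) \<longleftrightarrow> Im (z m) < h (p, q)"
      using pq by (simp add: set_block below_line_iff h_def)
    show "(p, q) \<in> set (block n t z m) \<longleftrightarrow> Im (z' m) < h' (p, q)"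
      unfolding B using pq by (simp add: set_block below_line_iff h'_def)
  qed
  have inP: "e \<in> P" if "e \<in> set (block n t z m)" "{fst e, snd e} \<subseteq> {i, j, k}" for e
  proof -
    obtain p q where e: "e = (p, q)" by (cases e)
    then have "shx t z p < shx t z q" "p \<in> {i, j, k}" "q \<in> {i, j, k}"
      using that by (auto simp: set_block)
    then show ?thesis using ijk by (auto simp: e P_def)
  qed
  \<comment> \<open>A line outside \<open>P\<close> has at most one index among \<open>i\<close>,
    \<open>j\<close>, \<open>k\<close>, and \<open>m\<close> lies to the right of all three; so the
    two triples share at most one index.\<close>
  have com_a: "agen n i j k \<otimes>\<^bsub>G3 n\<^esub> pgen n m e = pgen n m e \<otimes>\<^bsub>G3 n\<^esub> agen n i j k"
    if e: "e \<in> set (block n t z m)" "e \<notin> P" for e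
  proof -
    obtain p q where pq: "e = (p, q)" by (cases e)
    have "{i, j, k} \<inter> {p, q, m} \<subseteq> {p} \<or> {i, j, k} \<inter> {p, q, m} \<subseteq> {q}"
      using inP e ijk m by (force simp: pq)
    then have "card ({i, j, k} \<inter> {p, q, m}) \<le> 1"
      by (metis card_mono card.empty card.insert One_nat_def empty_iff finite.intros)
    then show ?thesis
      unfolding pq pgen_def prod.case using cross_dist_idx block_dist_idx e m by (intro agen_commute) (auto simp: pq)
  qed
  have cl: "pgen n m e \<in> carrier (G3 n)" if "e \<in> set (block n t z m)" for e
    using that m by (intro pgen_block_closed)
  have com_list: "agen n i j k \<otimes>\<^bsub>G3 n\<^esub> lprod (G3 n) (map (pgen n m) es)
      = lprod (G3 n) (map (pgen n m) es) \<otimes>\<^bsub>G3 n\<^esub> agen n i j k"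
    if es: "set es \<subseteq> set (block n t z m) - P" for es
  proof (rule G3.lprod_commute)
    show "agen n i j k \<in> carrier (G3 n)" using cross_dist_idx by simp
    show "set (map (pgen n m) es) \<subseteq> carrier (G3 n)" using es cl by auto
    fix x assume "x \<in> set (map (pgen n m) es)"
    then obtain e where e: "e \<in> set es" "x = pgen n m e" by auto
    show "agen n i j k \<otimes>\<^bsub>G3 n\<^esub> x = x \<otimes>\<^bsub>G3 n\<^esub> agen n i j k"
      unfolding e(2) using e(1) es by (intro com_a) auto
  qed
  \<comment> \<open>If any of the three lines is met at \<open>z\<close>, then so is
    \<open>jk\<close>, the highest there. At \<open>z'\<close> the order is reversed and
    \<open>jk\<close> is the lowest, so all three are met; and both configurations meet the same
    lines.\<close>
  consider "P \<inter> set (block n t z m) = {}" | "P \<subseteq> set (block n t z m)"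
  proof -
    have "P \<subseteq> set (block n t z m)" if "e \<in> P" "e \<in> set (block n t z m)" for e
    proof -
      have "(j, k) \<in> set (block n t z m)"
        using that hP block_iff(1) by (auto simp: P_def)
      then have "Im (z' m) < h' (j, k)" using block_iff(2) by (auto simp: P_def)
      then show ?thesis
        using hP block_iff(2) by (auto simp: P_def)
    qed
    then show ?thesis using that by blast
  qed
  then show ?thesis
  proof cases
    case 1
    have "block_val n t z m = block_val n t z' m"
    proof (intro block_val_eq[OF z m(1) B] ss)
      fix e f assume e: "e \<in> set (block n t z m)" "f \<in> set (block n t z m)"
      then have "\<not> {fst e, snd e} \<subseteq> {i, j, k}" using 1 inP by blast
      then show "{fst e, snd e} \<union> {fst f, snd f} \<noteq> {i, j, k}" by auto
    qed
    moreover have "agen n i j k \<otimes>\<^bsub>G3 n\<^esub> block_val n t z m = block_val n t z m \<otimes>\<^bsub>G3 n\<^esub> agen n i j k"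
      unfolding block_val_def using 1 by (intro com_list) auto
    ultimately show ?thesis by simp
  next
    case 2
    \<comment> \<open>The remaining lines are split at the height of \<open>ik\<close>: those of
      \<open>A\<close> are placed before the three lines of \<open>P\<close>, those of
      \<open>C\<close> after them.\<close>
    define E where "E = filter (\<lambda>e. e \<notin> P) (block n t z m)"
    define A where "A = filter (\<lambda>e. h e > h (i, k)) E"
    define C where "C = filter (\<lambda>e. \<not> h e > h (i, k)) E"
    have E: "set E = set (block n t z m) - P" by (auto simp: E_def)
    have AC: "set A = {e \<in> set E. h e > h (i, k)}" "set C = {e \<in> set E. \<not> h e > h (i, k)}"
      by (auto simp: A_def C_def)
    have "distinct E" by (simp add: E_def distinct_block)
    then have dist: "distinct A" "distinct C" by (auto simp: A_def C_def)
    have "sorted_wrt (\<lambda>e f. h f \<le> h e) E"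
      unfolding E_def h_def by (intro sorted_wrt_filter sorted_block)
    then have sorted: "sorted_wrt (\<lambda>e f. h f \<le> h e) A" "sorted_wrt (\<lambda>e f. h f \<le> h e) C"
      unfolding A_def C_def by (auto intro: sorted_wrt_filter)
    have tr: "(h e < h f \<longleftrightarrow> h' e < h' f) \<and> (h f < h e \<longleftrightarrow> h' f < h' e) \<and> h e \<noteq> h f \<and> h' e \<noteq> h' f"
      if ef: "e \<in> set E" "f \<in> set (block n t z m)" "e \<noteq> f" "{fst e, snd e} \<inter> {fst f, snd f} \<noteq> {}" for e f
    proof -
      obtain p q r s where e: "e = (p, q)" "f = (r, s)" by (cases e, cases f)
      have pq: "p \<in> {1..n}" "q \<in> {1..n}" "shx t z p < shx t z q" "shx t z q < shx t z m"
        and rs: "r \<in> {1..n}" "s \<in> {1..n}" "shx t z r < shx t z s" "shx t z s < shx t z m"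
        using ef(1,2) unfolding E by (auto simp: e set_block)
      have "\<not> {p, q} \<subseteq> {i, j, k}" using ef(1) inP[of e] by (auto simp: E e)
      then have s: "same_sign n z z' ({p, q} \<union> {r, s})" by (intro ss) auto
      then have s': "same_sign n z z' ({r, s} \<union> {p, q})" by (simp add: Un_commute)
      have ne: "(p, q) \<noteq> (r, s)" "{p, q} \<inter> {r, s} \<noteq> {}" "(r, s) \<noteq> (p, q)" "{r, s} \<inter> {p, q} \<noteq> {}"
        using ef(3,4) by (auto simp: e)
      show ?thesis
        using height_order[OF z m(1) pq rs ne(1,2) s] height_order[OF z m(1) rs pq ne(3,4) s']
        unfolding e h_def h'_def by linarith
    qed
    have PB: "P \<subseteq> set (block n t z m)" by (rule 2)
    \<comment> \<open>A line through one of the points \<open>i\<close>, \<open>j\<close>,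
      \<open>k\<close> shares an index with two of the three lines. Its order relative to each of
      these two is the same at \<open>z\<close> and \<open>z'\<close>, while the two change places;
      so it cannot run between them and lies on one side of both.\<close>
    have mixed: "(h e > h (i, k) \<longrightarrow> h f < h e \<and> h' f < h' e) \<and> (\<not> h e > h (i, k) \<longrightarrow> h e < h f \<and> h' e < h' f)"
      if ef: "e \<in> set E" "f \<in> P" "{fst e, snd e} \<inter> {fst f, snd f} \<noteq> {}" for e f
    proof -
      have "e \<noteq> f" using ef by (auto simp: E)
      have fP: "f = (i, j) \<or> f = (i, k) \<or> f = (j, k)" using ef by (auto simp: P_def)
      have t1: "{fst e, snd e} \<inter> {i, j} \<noteq> {} \<Longrightarrow> (h e < h (i, j) \<longleftrightarrow> h' e < h' (i, j)) \<and>
          (h (i, j) < h e \<longleftrightarrow> h' (i, j) < h' e) \<and> h e \<noteq> h (i, j) \<and> h' e \<noteq> h' (i, j)"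
        using tr[of e "(i, j)"] PB ef(1) by (auto simp: P_def E)
      have t2: "{fst e, snd e} \<inter> {i, k} \<noteq> {} \<Longrightarrow> (h e < h (i, k) \<longleftrightarrow> h' e < h' (i, k)) \<and>
          (h (i, k) < h e \<longleftrightarrow> h' (i, k) < h' e) \<and> h e \<noteq> h (i, k) \<and> h' e \<noteq> h' (i, k)"
        using tr[of e "(i, k)"] PB ef(1) by (auto simp: P_def E)
      have t3: "{fst e, snd e} \<inter> {j, k} \<noteq> {} \<Longrightarrow> (h e < h (j, k) \<longleftrightarrow> h' e < h' (j, k)) \<and>
          (h (j, k) < h e \<longleftrightarrow> h' (j, k) < h' e) \<and> h e \<noteq> h (j, k) \<and> h' e \<noteq> h' (j, k)"
        using tr[of e "(j, k)"] PB ef(1) by (auto simp: P_def E)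
      define I J K where "I \<longleftrightarrow> i \<in> {fst e, snd e}" and "J \<longleftrightarrow> j \<in> {fst e, snd e}"
        and "K \<longleftrightarrow> k \<in> {fst e, snd e}"
      have t1: "I \<or> J \<Longrightarrow> (h e < h (i, j) \<longleftrightarrow> h' e < h' (i, j)) \<and>
          (h (i, j) < h e \<longleftrightarrow> h' (i, j) < h' e) \<and> h e \<noteq> h (i, j) \<and> h' e \<noteq> h' (i, j)"
        using t1 by (auto simp: I_def J_def)
      have t2: "I \<or> K \<Longrightarrow> (h e < h (i, k) \<longleftrightarrow> h' e < h' (i, k)) \<and>
          (h (i, k) < h e \<longleftrightarrow> h' (i, k) < h' e) \<and> h e \<noteq> h (i, k) \<and> h' e \<noteq> h' (i, k)"
        using t2 by (auto simp: I_def K_def)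
      have t3: "J \<or> K \<Longrightarrow> (h e < h (j, k) \<longleftrightarrow> h' e < h' (j, k)) \<and>
          (h (j, k) < h e \<longleftrightarrow> h' (j, k) < h' e) \<and> h e \<noteq> h (j, k) \<and> h' e \<noteq> h' (j, k)"
        using t3 by (auto simp: J_def K_def)
      have "f = (i, j) \<Longrightarrow> I \<or> J" "f = (i, k) \<Longrightarrow> I \<or> K" "f = (j, k) \<Longrightarrow> J \<or> K"
        using ef(3) by (auto simp: I_def J_def K_def)
      with fP t1 t2 t3 hP show ?thesis by smt
    qed
    \<comment> \<open>The claim is made for \<open>z\<close> and \<open>z'\<close> at once,
      \<open>ps\<close> being the three lines by decreasing height in the respective configuration.
      Since \<open>A\<close> and \<open>C\<close> are the same in both cases, the two block values
      then differ only by the reversal of the middle part.\<close>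
    have key: "lprod (G3 n) (map (pgen n m) (A @ ps @ C)) = block_val n t w m"
      if w: "w = z \<and> ho = h \<or> w = z' \<and> ho = h'" and ps: "distinct ps" "set ps = P" "sorted_wrt (\<lambda>e f. ho f < ho e) ps"
      for w ho ps
      unfolding block_val_def
    proof (rule G3.lprod_trace)
      let ?R = "\<lambda>e f. (e \<in> set C \<longrightarrow> f \<in> set C) \<and> (f \<in> set A \<longrightarrow> e \<in> set A) \<and>
        (e \<in> set E \<and> f \<in> set E \<longrightarrow> h f \<le> h e) \<and> (e \<in> P \<and> f \<in> P \<longrightarrow> ho f < ho e)"
      have ho: "ho = height t w m" using w by (auto simp: h_def h'_def)
      have Bw: "set (block n t z m) = set (block n t w m)" using w B by auto
      show "distinct (A @ ps @ C)" using dist ps AC E by auto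
      show "distinct (block n t w m)" by (rule distinct_block)
      show set_eq: "set (A @ ps @ C) = set (block n t w m)"
        using ps AC E PB Bw by auto
      show "sorted_wrt ?R (A @ ps @ C)"
        unfolding sorted_wrt_append
      proof (intro conjI ballI)
        show "sorted_wrt ?R A"
          by (rule sorted_wrt_mono_rel[OF _ sorted(1)]) (auto simp: AC E)
        show "sorted_wrt ?R ps"
          by (rule sorted_wrt_mono_rel[OF _ ps(3)]) (auto simp: AC E ps)
        show "sorted_wrt ?R C"
          by (rule sorted_wrt_mono_rel[OF _ sorted(2)]) (auto simp: AC E)
      qed (auto simp: AC E ps)
      show "sorted_wrt (\<lambda>e f. ho f \<le> ho e) (block n t w m)"
        unfolding ho by (rule sorted_block)
      show "pgen n m e \<in> carrier (G3 n)" if "e \<in> set (A @ ps @ C)" for e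
        using that cl unfolding set_eq Bw by blast
      fix e f assume ef: "e \<in> set (A @ ps @ C)" "f \<in> set (A @ ps @ C)" "e \<noteq> f"
        and R: "?R e f" and le: "ho e \<le> ho f"
      have ef': "e \<in> set (block n t z m)" "f \<in> set (block n t z m)"
        using ef unfolding set_eq Bw by auto
      have False if share: "{fst e, snd e} \<inter> {fst f, snd f} \<noteq> {}"
      proof -
        have share': "{fst f, snd f} \<inter> {fst e, snd e} \<noteq> {}" using share by auto
        consider "e \<in> set E" "f \<in> set E" | "e \<in> P" "f \<in> P" | "e \<in> set E" "f \<in> P" | "e \<in> P" "f \<in> set E"
          using ef' by (auto simp: E)
        then show False
        proof cases
          case 1
          then show False using tr[OF 1(1) ef'(2) ef(3) share] R le w by auto
        next
          case 2
          then show False using R le by auto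
        next
          case 3
          then have "e \<notin> set C" using R by (auto simp: AC E)
          then have "h e > h (i, k)" using 3 by (auto simp: AC)
          then show False using mixed[OF 3 share] le w by auto
        next
          case 4
          then have "f \<notin> set A" using R by (auto simp: AC E)
          then have "\<not> h f > h (i, k)" using 4 by (auto simp: AC)
          then show False using mixed[OF 4(2,1) share'] le w by auto
        qed
      qed
      moreover obtain p q r s where e: "e = (p, q)" "f = (r, s)" by (cases e, cases f)
      ultimately show "pgen n m e \<otimes>\<^bsub>G3 n\<^esub> pgen n m f = pgen n m f \<otimes>\<^bsub>G3 n\<^esub> pgen n m e"
        using ef' m unfolding e by (intro pgen_commute) (auto intro: block_dist_idx)
    qed
    have ne: "i \<noteq> j" "j \<noteq> k" "i \<noteq> k" using ijk by auto
    have z_val: "block_val n t z m = lprod (G3 n) (map (pgen n m) (A @ [(j, k), (i, k), (i, j)] @ C))"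
      by (rule key[of z h, symmetric]) (use hP ne in \<open>auto simp: P_def\<close>)
    have z'_val: "block_val n t z' m = lprod (G3 n) (map (pgen n m) (A @ [(i, j), (i, k), (j, k)] @ C))"
      by (rule key[of z' h', symmetric]) (use hP ne in \<open>auto simp: P_def\<close>)
    define a where "a = agen n i j k"
    define LA LC where "LA = lprod (G3 n) (map (pgen n m) A)" and "LC = lprod (G3 n) (map (pgen n m) C)"
    define u v w where "u = agen n i j m" and "v = agen n i k m" and "w = agen n j k m"
    have clAC: "set (map (pgen n m) A) \<subseteq> carrier (G3 n)" "set (map (pgen n m) C) \<subseteq> carrier (G3 n)"
      using cl by (auto simp: AC E)
    have uvw: "u \<in> carrier (G3 n)" "v \<in> carrier (G3 n)" "w \<in> carrier (G3 n)"
      using PB cl[of "(i, j)"] cl[of "(i, k)"] cl[of "(j, k)"] by (auto simp: P_def u_def v_def w_def pgen_def)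
    have a: "a \<in> carrier (G3 n)" using cross_dist_idx by (simp add: a_def)
    have L: "LA \<in> carrier (G3 n)" "LC \<in> carrier (G3 n)"
      unfolding LA_def LC_def using clAC by (auto intro: G3.lprod_closed)
    have aL: "a \<otimes>\<^bsub>G3 n\<^esub> LA = LA \<otimes>\<^bsub>G3 n\<^esub> a" "a \<otimes>\<^bsub>G3 n\<^esub> LC = LC \<otimes>\<^bsub>G3 n\<^esub> a"
      unfolding LA_def LC_def a_def by (intro com_list; force simp: AC E)+
    have aLA: "a \<otimes>\<^bsub>G3 n\<^esub> (LA \<otimes>\<^bsub>G3 n\<^esub> x) = LA \<otimes>\<^bsub>G3 n\<^esub> (a \<otimes>\<^bsub>G3 n\<^esub> x)" if "x \<in> carrier (G3 n)" for x
      using a L that aL(1) by (metis G3.m_assoc)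
    have "dist_idx n [i, j, k, m]"
      using idx m ijk by (auto simp: dist_idx_def)
    from agen_tetrahedron[OF this]
    have tet: "a \<otimes>\<^bsub>G3 n\<^esub> (u \<otimes>\<^bsub>G3 n\<^esub> (v \<otimes>\<^bsub>G3 n\<^esub> w)) = w \<otimes>\<^bsub>G3 n\<^esub> (v \<otimes>\<^bsub>G3 n\<^esub> (u \<otimes>\<^bsub>G3 n\<^esub> a))"
      using a uvw by (simp add: a_def u_def v_def w_def)
    have z_val: "block_val n t z m = LA \<otimes>\<^bsub>G3 n\<^esub> (w \<otimes>\<^bsub>G3 n\<^esub> (v \<otimes>\<^bsub>G3 n\<^esub> (u \<otimes>\<^bsub>G3 n\<^esub> LC)))"
      unfolding z_val map_append using clAC uvw
      by (subst G3.lprod_append) (auto simp: LA_def LC_def u_def v_def w_def pgen_def)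
    have z'_val: "block_val n t z' m = LA \<otimes>\<^bsub>G3 n\<^esub> (u \<otimes>\<^bsub>G3 n\<^esub> (v \<otimes>\<^bsub>G3 n\<^esub> (w \<otimes>\<^bsub>G3 n\<^esub> LC)))"
      unfolding z'_val map_append using clAC uvw
      by (subst G3.lprod_append) (auto simp: LA_def LC_def u_def v_def w_def pgen_def)
    have "a \<otimes>\<^bsub>G3 n\<^esub> block_val n t z' m
        = LA \<otimes>\<^bsub>G3 n\<^esub> (a \<otimes>\<^bsub>G3 n\<^esub> (u \<otimes>\<^bsub>G3 n\<^esub> (v \<otimes>\<^bsub>G3 n\<^esub> w)) \<otimes>\<^bsub>G3 n\<^esub> LC)"
      unfolding z'_val using a L uvw by (simp add: aLA G3.m_assoc)
    also have "\<dots> = LA \<otimes>\<^bsub>G3 n\<^esub> (w \<otimes>\<^bsub>G3 n\<^esub> (v \<otimes>\<^bsub>G3 n\<^esub> (u \<otimes>\<^bsub>G3 n\<^esub> (a \<otimes>\<^bsub>G3 n\<^esub> LC))))"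
      unfolding tet using a L uvw by (simp add: G3.m_assoc)
    also have "\<dots> = block_val n t z m \<otimes>\<^bsub>G3 n\<^esub> a"
      unfolding z_val using a L uvw aL(2) by (simp add: G3.m_assoc)
    finally show ?thesis by (simp add: a_def)
  qed
qed

text \<open>The new letter appears at the end of the block of \<open>k\<close> and is then carried
  through the blocks of the points to the right of \<open>k\<close> one by one, turning each block
  over \<open>z'\<close> into the block over \<open>z\<close>, until it stands at the end of the
  whole product.\<close>

lemma chart_val_cross: "chart_val n t \<sigma> z' = chart_val n t \<sigma> z \<otimes>\<^bsub>G3 n\<^esub> agen n i j k"
proof -
  obtain \<sigma>1 \<sigma>2 where split: "\<sigma> = \<sigma>1 @ k # \<sigma>2"
    using idx \<sigma> by (metis split_list)
  have "sorted_wrt (\<lambda>i j. shx t z i < shx t z j) \<sigma>" using z by (simp add: adm_def)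
  then have left: "\<And>m. m \<in> set \<sigma>1 \<Longrightarrow> shx t z m < shx t z k"
    and right: "\<And>m. m \<in> set \<sigma>2 \<Longrightarrow> shx t z k < shx t z m"
    by (auto simp: split sorted_wrt_append)
  have sub: "set \<sigma>1 \<subseteq> {1..n}" "set \<sigma>2 \<subseteq> {1..n}" using \<sigma> split by auto
  have a: "agen n i j k \<in> carrier (G3 n)" using cross_dist_idx by simp
  have 1: "map (block_val n t z) \<sigma>1 = map (block_val n t z') \<sigma>1"
    using cross_block_left left sub by auto
  have cl: "lprod (G3 n) (map (block_val n t y) \<sigma>2) \<in> carrier (G3 n)" for y
    using sub by (intro G3.lprod_closed) (auto intro!: block_val_closed)
  have "agen n i j k \<otimes>\<^bsub>G3 n\<^esub> lprod (G3 n) (map (block_val n t z') \<sigma>2)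
      = lprod (G3 n) (map (block_val n t z) \<sigma>2) \<otimes>\<^bsub>G3 n\<^esub> agen n i j k"
    using right sub
  proof (induction \<sigma>2)
    case Nil
    then show ?case using a by simp
  next
    case (Cons m ms)
    have m: "m \<in> {1..n}" "shx t z k < shx t z m" using Cons.prems by auto
    have c: "lprod (G3 n) (map (block_val n t y) ms) \<in> carrier (G3 n)" for y
      using Cons.prems by (intro G3.lprod_closed) (auto intro!: block_val_closed)
    have bc: "block_val n t y m \<in> carrier (G3 n)" for y
      using m by (intro block_val_closed)
    have IH: "agen n i j k \<otimes>\<^bsub>G3 n\<^esub> lprod (G3 n) (map (block_val n t z') ms)
      = lprod (G3 n) (map (block_val n t z) ms) \<otimes>\<^bsub>G3 n\<^esub> agen n i j k"
      using Cons by auto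
    show ?case
      using cross_block_right[OF m] c bc a IH
      by simp (metis G3.m_assoc)
  qed
  moreover have "block_val n t z k \<in> carrier (G3 n)" "block_val n t z' k \<in> carrier (G3 n)"
    using idx by (auto intro: block_val_closed)
  moreover have "set (map (block_val n t z') \<sigma>1) \<subseteq> carrier (G3 n)"
    "set (map (block_val n t z) \<sigma>2) \<subseteq> carrier (G3 n)" "set (map (block_val n t z') \<sigma>2) \<subseteq> carrier (G3 n)"
    using sub by (auto intro!: block_val_closed)
  moreover have "lprod (G3 n) (map (block_val n t z') \<sigma>1) \<in> carrier (G3 n)"
    using calculation by (intro G3.lprod_closed)
  ultimately show ?thesis
    unfolding chart_val_def split map_append list.map 1 cross_block_top
    using a cl by (simp add: G3.lprod_append G3.m_assoc)
qed

end

end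

section \<open>Neighbourhoods of configurations and common radii\<close>

section \<open>Boxes around configurations\<close>

text \<open>Boxes are products over the points, so a configuration whose coordinates are picked from
  two members of a box is again a member. Values outside \<open>{1..n}\<close> are left
  free.\<close>

definition nbox :: "nat \<Rightarrow> (nat \<Rightarrow> complex) \<Rightarrow> real \<Rightarrow> (nat \<Rightarrow> complex) set" where
  "nbox n p e = {z. \<forall>j\<in>{1..n}. dist (p j) (z j) < e}"

text \<open>The name abbreviates "at most one": generic configurations are included together with
  the generic points of the walls.\<close>

definition amo :: "nat \<Rightarrow> (nat \<Rightarrow> complex) \<Rightarrow> bool" where
  "amo n z \<longleftrightarrow> (\<forall>S\<in>collinear_triples n z. \<forall>T\<in>collinear_triples n z. S = T)"

lemma nbox_mono: "d \<le> e \<Longrightarrow> nbox n p d \<subseteq> nbox n p e"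
  by (force simp: nbox_def)

lemma nbox_center [simp]: "0 < e \<Longrightarrow> p \<in> nbox n p e"
  by (simp add: nbox_def)

lemma nbox_add: "q \<in> nbox n p d \<Longrightarrow> nbox n q e \<subseteq> nbox n p (d + e)"
proof
  fix z assume "q \<in> nbox n p d" "z \<in> nbox n q e"
  then show "z \<in> nbox n p (d + e)"
    unfolding nbox_def by (auto intro: order.strict_trans1[OF dist_triangle add_strict_mono])
qed

text \<open>Takes the place of a minimum of radii over a finite set that may be empty; every
  condition has to survive a decrease of the radius.\<close>

lemma finite_uniform_radius:
  fixes P :: "real \<Rightarrow> 'a \<Rightarrow> bool"
  assumes "finite A" "\<And>x. x \<in> A \<Longrightarrow> \<exists>e>0. P e x" "\<And>d e x. x \<in> A \<Longrightarrow> 0 < d \<Longrightarrow> d \<le> e \<Longrightarrow> P e x \<Longrightarrow> P d x"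
  obtains e where "0 < e" "\<And>x. x \<in> A \<Longrightarrow> P e x"
proof -
  have "\<forall>\<^sub>F e in at_right 0. P e x" if x: "x \<in> A" for x
  proof -
    obtain e where "0 < e" "P e x" using assms(2)[OF x] by auto
    then show ?thesis
      unfolding eventually_at_right_field using assms(3)[OF x _ less_imp_le] by blast
  qed
  then have "\<forall>\<^sub>F e in at_right 0. \<forall>x\<in>A. P e x"
    using assms(1) by (simp add: eventually_ball_finite)
  then obtain b where "0 < b" "\<forall>e. 0 < e \<longrightarrow> e < b \<longrightarrow> (\<forall>x\<in>A. P e x)"
    unfolding eventually_at_right_field by auto
  then show ?thesis using that[of "b / 2"] by simp
qed

lemma nbox_open:
  assumes "q \<in> nbox n p e"
  obtains d where "0 < d" "nbox n q d \<subseteq> nbox n p e"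
proof -
  obtain d where d: "0 < d" "\<And>j. j \<in> {1..n} \<Longrightarrow> d \<le> e - dist (p j) (q j)"
    by (rule finite_uniform_radius[of "{1..n}" "\<lambda>d j. d \<le> e - dist (p j) (q j)"])
      (use assms in \<open>auto simp: nbox_def intro!: exI[of _ "e - dist (p _) (q _)"]\<close>)
  have "dist (p j) (z j) < e" if "z \<in> nbox n q d" "j \<in> {1..n}" for z j
    using d(2)[OF that(2)] that dist_triangle[of "p j" "z j" "q j"] by (force simp: nbox_def)
  then have "nbox n q d \<subseteq> nbox n p e" unfolding nbox_def[of n p] by blast
  then show ?thesis using that d(1) by blast
qed

lemma finite_dist_idx: "finite {(i, j, k). dist_idx n [i, j, k]}"
  by (rule finite_subset[of _ "{1..n} \<times> {1..n} \<times> {1..n}"]) (auto simp: dist_idx_def)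

section \<open>Collinearity\<close>

lemma collinear_iff_cdet: "collinear {z i, z j, z k} \<longleftrightarrow> cdet z i j k = 0"
proof -
  have "cdet z i j k = 0" if col: "collinear {z i, z j, z k}"
  proof -
    obtain u c d where "z j - z i = c *\<^sub>R u" "z k - z i = d *\<^sub>R u"
      using col unfolding collinear_def by (metis insertCI)
    then show ?thesis unfolding cdet_def by simp
  qed
  moreover have "collinear {z i, z j, z k}" if 0: "cdet z i j k = 0"
  proof (cases "z j = z i")
    case True
    then show ?thesis by simp
  next
    case False
    define a b where "a = z j - z i" and "b = z k - z i"
    have "a \<noteq> 0" using False by (simp add: a_def)
    have "Im (cnj a * b) = 0" using 0 by (simp add: cdet_def a_def b_def)
    then have "cnj a * b = of_real (Re (cnj a * b))" by (simp add: complex_eq_iff)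
    then have "b = (Re (cnj a * b) / (cmod a)\<^sup>2) *\<^sub>R a"
      using \<open>a \<noteq> 0\<close>
      by (simp add: scaleR_conv_of_real field_simps complex_norm_square del: of_real_power)
    then have "collinear {0, a, b}" unfolding collinear_lemma by blast
    then have "collinear {z j, z i, z k}"
      using collinear_3[of "z j" "z i" "z k"] by (simp add: NO_MATCH_def a_def b_def)
    then show ?thesis by (simp add: insert_commute)
  qed
  ultimately show ?thesis by blast
qed

lemma collinear_triples_iff:
  assumes "dist_idx n [i, j, k]"
  shows "{i, j, k} \<in> collinear_triples n z \<longleftrightarrow> cdet z i j k = 0"
  using assms collinear_iff_cdet[of z i j k]
  by (auto simp: collinear_triples_def dist_idx_def)

lemma collinear_triplesE:
  assumes "T \<in> collinear_triples n z"
  obtains i j k where "dist_idx n [i, j, k]" "T = {i, j, k}" "cdet z i j k = 0"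
proof -
  obtain i j k where T: "T = {i, j, k}" "i \<noteq> j" "j \<noteq> k" "i \<noteq> k"
    using assms by (auto simp: collinear_triples_def card_3_iff)
  then have d: "dist_idx n [i, j, k]"
    using assms by (auto simp: collinear_triples_def dist_idx_def)
  show ?thesis
    using that[OF d T(1)] assms collinear_triples_iff[OF d] T(1) by simp
qed

lemma generic_iff: "generic n z \<longleftrightarrow> collinear_triples n z = {}"
  using collinear_triples_iff by (fastforce simp: generic_def elim: collinear_triplesE)

lemma generic_amo: "generic n z \<Longrightarrow> amo n z"
  by (simp add: generic_iff amo_def)

lemma sgn_stable:
  obtains e where "0 < e" "\<And>z i j k. z \<in> nbox n p e \<Longrightarrow> dist_idx n [i, j, k] \<Longrightarrow> cdet p i j k \<noteq> 0 \<Longrightarrow>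
    cdet z i j k \<noteq> 0 \<and> (0 < cdet z i j k \<longleftrightarrow> 0 < cdet p i j k)"
proof -
  define Q where "Q = (\<lambda>e (i, j, k). \<forall>z\<in>nbox n p e. cdet p i j k \<noteq> 0 \<longrightarrow>
    cdet z i j k \<noteq> 0 \<and> (0 < cdet z i j k \<longleftrightarrow> 0 < cdet p i j k))"
  obtain e where e: "0 < e" "\<And>x. x \<in> {(i, j, k). dist_idx n [i, j, k]} \<Longrightarrow> Q e x"
  proof (rule finite_uniform_radius[OF finite_dist_idx, of n Q])
    fix x assume "x \<in> {(i, j, k). dist_idx n [i, j, k]}"
    then obtain i j k where x: "x = (i, j, k)" "i \<in> {1..n}" "j \<in> {1..n}" "k \<in> {1..n}"
      by (auto simp: dist_idx_def)
    define F where "F = (\<lambda>(a, b, c). Im (cnj (b - a) * (c - a)) :: real)"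
    define s where "s = sgn (cdet p i j k)"
    have F: "F (z i, z j, z k) = cdet z i j k" for z by (simp add: F_def cdet_def)
    show "\<exists>e>0. Q e x"
    proof (cases "cdet p i j k = 0")
      case True
      then show ?thesis by (auto simp: Q_def x intro!: exI[of _ 1])
    next
      case False
      have "open {y. 0 < s * F y}"
        unfolding F_def case_prod_beta by (intro open_Collect_less continuous_intros)
      moreover have "(p i, p j, p k) \<in> {y. 0 < s * F y}"
        using False by (simp add: F s_def sgn_if)
      ultimately obtain e where e: "0 < e" "ball (p i, p j, p k) e \<subseteq> {y. 0 < s * F y}"
        using open_contains_ball by blast
      \<comment> \<open>The distance between triples of points is at most the sum of the three
        distances, hence the third of the radius.\<close>
      have "0 < s * cdet z i j k" if z: "z \<in> nbox n p (e / 3)" for z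
      proof -
        have d: "dist (p i) (z i) < e / 3" "dist (p j) (z j) < e / 3" "dist (p k) (z k) < e / 3"
          using z x by (auto simp: nbox_def)
        have "dist (p j, p k) (z j, z k) \<le> dist (p j) (z j) + dist (p k) (z k)"
          unfolding dist_Pair_Pair by (rule sqrt_sum_squares_le_sum) auto
        moreover have "dist (p i, p j, p k) (z i, z j, z k) \<le> dist (p i) (z i) + dist (p j, p k) (z j, z k)"
          unfolding dist_Pair_Pair[of "p i"] by (rule sqrt_sum_squares_le_sum) auto
        ultimately have "(z i, z j, z k) \<in> ball (p i, p j, p k) e"
          using d by simp
        then show ?thesis using e(2) F by auto
      qed
      note pos = this
      have "cdet z i j k \<noteq> 0 \<and> (0 < cdet z i j k \<longleftrightarrow> 0 < cdet p i j k)" if "z \<in> nbox n p (e / 3)" for z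
      proof (cases "0 < cdet p i j k")
        case True
        then have "s = 1" by (simp add: s_def)
        then show ?thesis using pos[OF that] True by simp
      next
        case neg: False
        then have "s = - 1" using False by (simp add: s_def)
        then show ?thesis using pos[OF that] neg by simp
      qed
      then have "Q (e / 3) x" unfolding Q_def x by blast
      then show ?thesis using e(1) by (intro exI[of _ "e / 3"]) simp
    qed
  next
    fix d e x assume "x \<in> {(i, j, k). dist_idx n [i, j, k]}" "0 < d" "d \<le> e" "Q e x"
    then show "Q d x" using nbox_mono[of d e n p] unfolding Q_def by fast
  qed blast
  show ?thesis
  proof (rule that[OF e(1)])
    fix z i j k assume "z \<in> nbox n p e" "dist_idx n [i, j, k]" "cdet p i j k \<noteq> 0"
    moreover from this have "Q e (i, j, k)" using e(2) by simp
    ultimately show "cdet z i j k \<noteq> 0 \<and> (0 < cdet z i j k \<longleftrightarrow> 0 < cdet p i j k)"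
      unfolding Q_def by blast
  qed
qed

text \<open>The determinant is alternating, so one ordering of a triple decides all six.\<close>

lemma same_signI:
  assumes g: "generic n z" "generic n z'" and d: "dist_idx n [i, j, k]"
    and s: "0 < cdet z i j k \<longleftrightarrow> 0 < cdet z' i j k"
  shows "same_sign n z z' {i, j, k}"
  unfolding same_sign_def
proof (intro allI impI)
  fix a b c assume abc: "dist_idx n [a, b, c]" "{a, b, c} = {i, j, k}"
  have nz: "cdet z i j k \<noteq> 0" "cdet z' i j k \<noteq> 0"
    using g d by (auto simp: generic_def)
  have "(a, b, c) \<in> {(i, j, k), (j, k, i), (k, i, j), (j, i, k), (i, k, j), (k, j, i)}"
  proof -
    have "a \<in> {i, j, k}" "b \<in> {i, j, k}" "c \<in> {i, j, k}" using abc(2) by blast+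
    then show ?thesis using abc(1) by (auto simp: dist_idx_def)
  qed
  moreover have "cdet y j k i = cdet y i j k" "cdet y k i j = cdet y i j k" "cdet y j i k = - cdet y i j k"
    "cdet y i k j = - cdet y i j k" "cdet y k j i = - cdet y i j k" for y
    by (simp_all add: cdet_eq)
  ultimately show "0 < cdet z a b c \<longleftrightarrow> 0 < cdet z' a b c"
    using s nz by auto
qed

text \<open>Betweenness forces collinearity and hence the only collinear triple; a projection
  injective on this triple preserves betweenness, so \<open>j\<close> is the middle index. The outer
  two may be exchanged, which \<open>triple\<close> does not see.\<close>

lemma crit_triple_eq:
  assumes amo: "amo n p" and d: "dist_idx n [i, j, k]" and 0: "cdet p i j k = 0"
    and x: "shx t p i < shx t p j" "shx t p j < shx t p k"
  shows "crit_triple n p = triple i j k"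
  unfolding crit_triple_def
proof (rule the_equality)
  \<comment> \<open>The ratio in which \<open>p j\<close> divides the segment from
    \<open>p i\<close> to \<open>p k\<close>, read off from the projections.\<close>
  define c where "c = (shx t p j - shx t p i) / (shx t p k - shx t p i)"
  have c: "0 \<le> c" "c \<le> 1" using x by (auto simp: c_def field_simps)
  have im: "Im (p j) - Im (p i) = c * (Im (p k) - Im (p i))"
    using 0 x by (simp add: c_def cdet_shear[of _ _ _ _ t] field_simps)
  have "shx t p j - shx t p i = c * (shx t p k - shx t p i)"
    using x by (simp add: c_def)
  then have "Re (p j) - Re (p i) = c * (Re (p k) - Re (p i))"
  proof -
    assume *: "shx t p j - shx t p i = c * (shx t p k - shx t p i)"
    have "t * (Im (p j) - Im (p i)) = t * (c * (Im (p k) - Im (p i)))" by (simp only: im)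
    with * show ?thesis by (simp add: shx_def algebra_simps)
  qed
  with im have "p j = (1 - c) *\<^sub>R p i + c *\<^sub>R p k"
    by (simp add: complex_eq_iff algebra_simps)
  then have "between (p i, p k) (p j)"
    unfolding between_def using c by (auto simp: in_segment)
  then show "\<exists>a b c. dist_idx n [a, b, c] \<and> between (p a, p c) (p b) \<and> triple i j k = triple a b c"
    using d by blast
  fix T assume "\<exists>a b c. dist_idx n [a, b, c] \<and> between (p a, p c) (p b) \<and> T = triple a b c"
  then obtain a b c where abc: "dist_idx n [a, b, c]" "between (p a, p c) (p b)" "T = triple a b c"
    by blast
  obtain u where u: "0 \<le> u" "u \<le> 1" "p b = (1 - u) *\<^sub>R p a + u *\<^sub>R p c"
    using abc(2) by (auto simp: between_def in_segment)
  have "cdet p a b c = 0"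
    unfolding cdet_def u(3) by (simp add: algebra_simps)
  then have eq: "{a, b, c} = {i, j, k}"
    using collinear_triples_iff[OF abc(1)] collinear_triples_iff[OF d] 0 amo by (simp add: amo_def)
  have xb: "shx t p b = (1 - u) * shx t p a + u * shx t p c"
    unfolding shx_def u(3) by (simp add: algebra_simps)
  have "shx t p b = shx t p a + u * (shx t p c - shx t p a)"
    using xb by (simp add: algebra_simps)
  then have lo: "min (shx t p a) (shx t p c) \<le> shx t p b" "shx t p b \<le> max (shx t p a) (shx t p c)"
    using u mult_left_le_one_le[of "shx t p c - shx t p a" u] mult_nonneg_nonneg[of u "shx t p c - shx t p a"]
      mult_left_le_one_le[of "shx t p a - shx t p c" u] mult_nonneg_nonneg[of u "shx t p a - shx t p c"]
    by (cases "shx t p a \<le> shx t p c"; simp add: algebra_simps)+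
  have mem: "a \<in> {i, j, k}" "b \<in> {i, j, k}" "c \<in> {i, j, k}" using eq by blast+
  have dd: "distinct [a, b, c]" "distinct [i, j, k]" using abc(1) d by (auto simp: dist_idx_def)
  have "b = j"
    using mem dd x lo by auto
  then have "(a = i \<and> c = k) \<or> (a = k \<and> c = i)"
    using mem dd by auto
  with \<open>b = j\<close> show "T = triple i j k"
    unfolding abc(3) triple_def by auto
qed

lemma sort_triple:
  fixes x :: "nat \<Rightarrow> real"
  assumes inj: "inj_on x {1..n}" and d: "dist_idx n [i0, j0, k0]"
  obtains i j k where "{i, j, k} = {i0, j0, k0}" "x i < x j" "x j < x k" "dist_idx n [i, j, k]"
proof -
  have "x i0 \<noteq> x j0" "x j0 \<noteq> x k0" "x i0 \<noteq> x k0"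
    using d by (auto simp: dist_idx_def inj_on_eq_iff[OF inj])
  then consider "x i0 < x j0" "x j0 < x k0" | "x i0 < x k0" "x k0 < x j0" | "x j0 < x i0" "x i0 < x k0"
    | "x j0 < x k0" "x k0 < x i0" | "x k0 < x i0" "x i0 < x j0" | "x k0 < x j0" "x j0 < x i0"
    by linarith
  then show ?thesis
  proof cases
    case 1 show ?thesis by (rule that[of i0 j0 k0]) (use 1 d in \<open>auto simp: dist_idx_def\<close>)
  next
    case 2 show ?thesis by (rule that[of i0 k0 j0]) (use 2 d in \<open>auto simp: dist_idx_def\<close>)
  next
    case 3 show ?thesis by (rule that[of j0 i0 k0]) (use 3 d in \<open>auto simp: dist_idx_def\<close>)
  next
    case 4 show ?thesis by (rule that[of j0 k0 i0]) (use 4 d in \<open>auto simp: dist_idx_def\<close>)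
  next
    case 5 show ?thesis by (rule that[of k0 i0 j0]) (use 5 d in \<open>auto simp: dist_idx_def\<close>)
  next
    case 6 show ?thesis by (rule that[of k0 j0 i0]) (use 6 d in \<open>auto simp: dist_idx_def\<close>)
  qed
qed

section \<open>Local potentials and their existence\<close>

section \<open>Potentials\<close>

text \<open>The factor gained between two generic configurations near \<open>p\<close>. It takes no
  account of the direction of the crossing, since each letter is its own inverse.\<close>

definition jump ::
    "nat \<Rightarrow> (nat \<Rightarrow> complex) \<Rightarrow> (nat \<Rightarrow> complex) \<Rightarrow> (nat \<Rightarrow> complex) \<Rightarrow> ((nat \<times> nat \<times> nat) set \<times> bool) list set" where
  "jump n p z z' = (if \<forall>T. same_sign n z z' T then \<one>\<^bsub>G3 n\<^esub> else G3_gen n (crit_triple n p))"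

text \<open>A potential changes by the letter of the wall when a single wall is crossed; nothing is required
  near configurations with several collinear triples.\<close>

definition potential ::
    "nat \<Rightarrow> (nat \<Rightarrow> complex) set \<Rightarrow> ((nat \<Rightarrow> complex) \<Rightarrow> ((nat \<times> nat \<times> nat) set \<times> bool) list set) \<Rightarrow> bool" where
  "potential n W f \<longleftrightarrow> (\<forall>z. f z \<in> carrier (G3 n)) \<and>
     (\<forall>p\<in>W. amo n p \<longrightarrow> (\<exists>e>0. \<forall>z\<in>nbox n p e. \<forall>z'\<in>nbox n p e. generic n z \<longrightarrow> generic n z' \<longrightarrow>
        f z' = f z \<otimes>\<^bsub>G3 n\<^esub> jump n p z z'))"

text \<open>Each pair of distinct points excludes at most one parameter, and there are only finitely
  many pairs.\<close>

lemma exists_shear: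
  assumes "inj_on p {1..n}"
  shows "\<exists>t. inj_on (shx t p) {1..n}"
proof -
  define bad where "bad = (\<lambda>(i, j). {t. shx t p i = shx t p j})"
  have "finite (bad (i, j))" if ij: "i \<in> {1..n}" "j \<in> {1..n}" "i \<noteq> j" for i j
  proof -
    have ne: "p i \<noteq> p j" using assms ij by (meson inj_onD)
    have "bad (i, j) \<subseteq> {(Re (p j) - Re (p i)) / (Im (p i) - Im (p j))}"
    proof
      fix t assume "t \<in> bad (i, j)"
      then have "shx t p i = shx t p j" by (simp add: bad_def)
      then have *: "t * (Im (p i) - Im (p j)) = Re (p j) - Re (p i)"
        unfolding shx_def right_diff_distrib by linarith
      then have "Im (p i) \<noteq> Im (p j)" using ne by (auto simp: complex_eq_iff)
      then show "t \<in> {(Re (p j) - Re (p i)) / (Im (p i) - Im (p j))}"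
        using * by (simp add: eq_divide_eq)
    qed
    then show ?thesis by (rule finite_subset) simp
  qed
  then have fin: "finite (\<Union>x\<in>{(i, j). i \<in> {1..n} \<and> j \<in> {1..n} \<and> i \<noteq> j}. bad x)"
    by (intro finite_UN_I finite_subset[OF _ finite_cartesian_product[of "{1..n}" "{1..n}"]]) auto
  then obtain t where "t \<notin> (\<Union>x\<in>{(i, j). i \<in> {1..n} \<and> j \<in> {1..n} \<and> i \<noteq> j}. bad x)"
    using ex_new_if_finite[OF infinite_UNIV_char_0 fin] by blast
  then show ?thesis by (intro exI[of _ t] inj_onI) (auto simp: bad_def)
qed

text \<open>Close to \<open>p\<close> the projections keep their order, so one chart covers the box.
  Around a point \<open>q\<close> of the box with at most one collinear triple only that triple can
  change its orientation, so \<open>chart_val_same\<close> and \<open>chart_val_cross\<close>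
  exhaust the cases.\<close>

lemma exists_potential:
  assumes "inj_on p {1..n}"
  obtains e f where "0 < e" "potential n (nbox n p e) f"
proof -
  obtain t where t: "inj_on (shx t p) {1..n}" using exists_shear[OF assms] by blast
  define \<sigma> where "\<sigma> = sort_key (shx t p) [1..<Suc n]"
  have \<sigma>: "distinct \<sigma>" "set \<sigma> = {1..n}" by (auto simp: \<sigma>_def)
  interpret chart n t \<sigma> by unfold_locales (use \<sigma> in auto)
  have "sorted (map (shx t p) \<sigma>)" by (simp add: \<sigma>_def)
  moreover have "distinct (map (shx t p) \<sigma>)" using \<sigma> t by (simp add: distinct_map)
  ultimately have "sorted_wrt (<) (map (shx t p) \<sigma>)" by (simp add: strict_sorted_iff)
  then have sorted_p: "sorted_wrt (\<lambda>i j. shx t p i < shx t p j) \<sigma>" by (simp add: sorted_wrt_map)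
  define A where "A = {(i, j). i \<in> {1..n} \<and> j \<in> {1..n} \<and> shx t p i < shx t p j}"
  have "finite A" by (rule finite_subset[of _ "{1..n} \<times> {1..n}"]) (auto simp: A_def)
  \<comment> \<open>A point that moves by less than \<open>e\<close> moves its projection by less
    than \<open>(1 + \<bar>t\<bar>) * e\<close>; two projections keep their order if their distance
    is at least twice this amount.\<close>
  then obtain e where e: "0 < e" "\<And>x. x \<in> A \<Longrightarrow> 2 * (1 + \<bar>t\<bar>) * e \<le> shx t p (snd x) - shx t p (fst x)"
  proof (rule finite_uniform_radius)
    fix x assume x: "x \<in> A"
    show "\<exists>e>0. 2 * (1 + \<bar>t\<bar>) * e \<le> shx t p (snd x) - shx t p (fst x)"
      using x by (intro exI[of _ "(shx t p (snd x) - shx t p (fst x)) / (2 * (1 + \<bar>t\<bar>))"])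
        (auto simp: A_def intro!: divide_pos_pos)
  next
    fix d e x assume "d \<le> e" "2 * (1 + \<bar>t\<bar>) * e \<le> shx t p (snd x) - shx t p (fst x)"
    then show "2 * (1 + \<bar>t\<bar>) * d \<le> shx t p (snd x) - shx t p (fst x)"
      using mult_left_mono[of d e "2 * (1 + \<bar>t\<bar>)"] by simp
  qed blast
  have close: "\<bar>shx t z j - shx t p j\<bar> < (1 + \<bar>t\<bar>) * e" if "z \<in> nbox n p e" "j \<in> {1..n}" for z j
  proof -
    have "\<bar>shx t z j - shx t p j\<bar> = \<bar>Re (z j - p j) + t * Im (z j - p j)\<bar>"
      by (simp add: shx_def algebra_simps)
    also have "\<dots> \<le> \<bar>Re (z j - p j)\<bar> + \<bar>t\<bar> * \<bar>Im (z j - p j)\<bar>"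
      by (metis abs_mult abs_triangle_ineq)
    also have "\<dots> \<le> cmod (z j - p j) + \<bar>t\<bar> * cmod (z j - p j)"
      by (intro add_mono mult_left_mono abs_Re_le_cmod abs_Im_le_cmod) auto
    also have "\<dots> = (1 + \<bar>t\<bar>) * cmod (z j - p j)" by (simp add: algebra_simps)
    also have "\<dots> < (1 + \<bar>t\<bar>) * e"
      using that by (intro mult_strict_left_mono) (auto simp: nbox_def dist_norm norm_minus_commute)
    finally show ?thesis .
  qed
  have less: "shx t z i < shx t z j" if z: "z \<in> nbox n p e" and ij: "(i, j) \<in> A" for z i j
    using close[OF z, of i] close[OF z, of j] e(2)[OF ij] ij by (auto simp: A_def algebra_simps)
  have sorted_z: "sorted_wrt (\<lambda>i j. shx t z i < shx t z j) \<sigma>" if z: "z \<in> nbox n p e" for z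
    using sorted_p less[OF z] \<sigma>(2) by (auto simp: A_def intro: sorted_wrt_mono_rel[rotated])
  have "potential n (nbox n p e) (chart_val n t \<sigma>)"
    unfolding potential_def
  proof (intro conjI allI ballI impI)
    show "chart_val n t \<sigma> z \<in> carrier (G3 n)" for z by (rule chart_val_closed)
    fix q assume q: "q \<in> nbox n p e" and amo: "amo n q"
    obtain d1 where d1: "0 < d1" "nbox n q d1 \<subseteq> nbox n p e" using nbox_open[OF q] by blast
    obtain d2 where d2: "0 < d2" "\<And>z i j k. z \<in> nbox n q d2 \<Longrightarrow> dist_idx n [i, j, k] \<Longrightarrow> cdet q i j k \<noteq> 0 \<Longrightarrow>
        cdet z i j k \<noteq> 0 \<and> (0 < cdet z i j k \<longleftrightarrow> 0 < cdet q i j k)"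
      using sgn_stable[of n q] by blast
    show "\<exists>e>0. \<forall>z\<in>nbox n q e. \<forall>z'\<in>nbox n q e. generic n z \<longrightarrow> generic n z' \<longrightarrow>
        chart_val n t \<sigma> z' = chart_val n t \<sigma> z \<otimes>\<^bsub>G3 n\<^esub> jump n q z z'"
    proof (rule exI[of _ "min d1 d2"], intro conjI ballI impI)
      show "0 < min d1 d2" using d1 d2 by simp
      fix z z' assume zz: "z \<in> nbox n q (min d1 d2)" "z' \<in> nbox n q (min d1 d2)"
        and gen: "generic n z" "generic n z'"
      have z2: "z \<in> nbox n q d2" "z' \<in> nbox n q d2"
        using zz nbox_mono[of "min d1 d2" d2] by auto
      have adm: "adm z" "adm z'" "z \<in> nbox n p e"
        using zz nbox_mono[of "min d1 d2" d1] d1(2) gen sorted_z unfolding adm_def by force+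
      show "chart_val n t \<sigma> z' = chart_val n t \<sigma> z \<otimes>\<^bsub>G3 n\<^esub> jump n q z z'"
      proof (cases "\<forall>T. same_sign n z z' T")
        case True
        then show ?thesis
          using chart_val_same[OF adm(1,2)] chart_val_closed by (simp add: jump_def)
      next
        case False
        then obtain i0 j0 k0 where ijk0: "dist_idx n [i0, j0, k0]" "\<not> same_sign n z z' {i0, j0, k0}"
          unfolding same_sign_def by metis
        have 0: "cdet q a b c = 0" if "dist_idx n [a, b, c]" "\<not> same_sign n z z' {a, b, c}" for a b c
        proof (rule ccontr)
          assume "cdet q a b c \<noteq> 0"
          then have "0 < cdet z a b c \<longleftrightarrow> 0 < cdet z' a b c"
            using d2(2)[OF z2(1) that(1)] d2(2)[OF z2(2) that(1)] by simp
          then show False using same_signI[OF gen that(1)] that(2) by blast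
        qed
        have inj: "inj_on (shx t q) {1..n}"
        proof (rule inj_onI)
          fix a b assume ab: "a \<in> {1..n}" "b \<in> {1..n}" "shx t q a = shx t q b"
          then have "(a, b) \<notin> A" "(b, a) \<notin> A" using less[OF q, of a b] less[OF q, of b a] by auto
          then have "shx t p a = shx t p b" using ab by (auto simp: A_def)
          then show "a = b" using t ab by (meson inj_onD)
        qed
        obtain i j k where ijk: "{i, j, k} = {i0, j0, k0}" "shx t q i < shx t q j" "shx t q j < shx t q k"
          and d: "dist_idx n [i, j, k]"
          using sort_triple[OF inj ijk0(1)] by metis
        have idx: "i \<in> {1..n}" "j \<in> {1..n}" "k \<in> {1..n}" using d by (auto simp: dist_idx_def)
        have ns: "\<not> same_sign n z z' {i, j, k}" using ijk0(2) ijk(1) by simp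
        have q0: "cdet q i j k = 0" by (rule 0[OF d ns])
        have others: "same_sign n z z' T" if "T \<noteq> {i, j, k}" for T
        proof (rule ccontr)
          assume nT: "\<not> same_sign n z z' T"
          then obtain a b c where abc: "dist_idx n [a, b, c]" "T = {a, b, c}"
            unfolding same_sign_def by metis
          then have "T \<in> collinear_triples n q"
            using 0[OF abc(1)] nT by (simp add: collinear_triples_iff)
          moreover have "{i, j, k} \<in> collinear_triples n q"
            using q0 d by (simp add: collinear_triples_iff)
          ultimately show False using that amo by (auto simp: amo_def)
        qed
        have nz: "cdet z i j k \<noteq> 0" "cdet z' i j k \<noteq> 0" using gen d by (auto simp: generic_def)
        have opp: "(0 < cdet z i j k) \<noteq> (0 < cdet z' i j k)"
          using same_signI[OF gen d] ns by blast
        have xz: "shx t y i < shx t y j" "shx t y j < shx t y k" if "adm y" "y \<in> nbox n p e" for y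
        proof -
          have A: "(i, j) \<in> A" "(j, k) \<in> A"
            using idx ijk less[OF q, of j i] less[OF q, of k j] t
            by (auto simp: A_def) (metis inj_onD linorder_neqE_linordered_idom less_asym atLeastAtMost_iff One_nat_def order_less_irrefl)+
          then show "shx t y i < shx t y j" "shx t y j < shx t y k" using less[OF that(2)] by auto
        qed
        have a: "agen n i j k \<in> carrier (G3 n)" using d by simp
        have jump: "jump n q z z' = agen n i j k"
          using False crit_triple_eq[OF amo d q0 ijk(2,3)] unfolding jump_def agen_def by argo
        have z'p: "z' \<in> nbox n p e"
          using zz nbox_mono[of "min d1 d2" d1] d1(2) by force
        show ?thesis
        proof (cases "0 < cdet z i j k")
          case True
          then have neg: "cdet z' i j k < 0" using opp nz by auto
          show ?thesis
            unfolding jump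
            by (rule chart_val_cross[OF adm(1,2) idx xz[OF adm(1,3)] True neg others])
        next
          \<comment> \<open>A crossing from negative to positive is read backwards; the letter
            changes sides because its square is one.\<close>
          case F: False
          then have "cdet z i j k < 0" "0 < cdet z' i j k" using opp nz by auto
          moreover have "same_sign n z' z T" if "T \<noteq> {i, j, k}" for T
            using others[OF that] by (simp add: same_sign_def)
          ultimately have "chart_val n t \<sigma> z = chart_val n t \<sigma> z' \<otimes>\<^bsub>G3 n\<^esub> agen n i j k"
            by (intro chart_val_cross[OF adm(2,1) idx xz[OF adm(2) z'p]]) auto
          then show ?thesis
            unfolding jump using a chart_val_closed agen_square[OF d] by (simp add: G3.m_assoc)
        qed
      qed
    qed
  qed
  then show ?thesis using that e(1) by blast
qed

section \<open>Moves of one point in general position\<close>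

section \<open>General position\<close>

lemma base_config_inj: "inj_on (base_config n) {1..n}"
proof (rule inj_onI)
  fix j k assume jk: "j \<in> {1..n}" "k \<in> {1..n}" "base_config n j = base_config n k"
  then have "j mod n = k mod n"
    using complex_root_unity_eq[of n j k] by (simp add: base_config_def)
  then show "j = k" using jk by (cases "j = n"; cases "k = n") auto
qed

text \<open>On the unit circle conjugation is inversion. Reality of
  \<open>cnj (b - a) * (c - a)\<close> becomes an identity between rational expressions, which after
  multiplication by \<open>a * b * c\<close> says that \<open>(b - a) * (a - c) * (b - c)\<close>
  vanishes.\<close>

lemma base_config_generic: "generic n (base_config n)"
  unfolding generic_def
proof (intro allI impI notI)
  fix i j k assume d: "dist_idx n [i, j, k]" and 0: "cdet (base_config n) i j k = 0"
  define a b c where "a = base_config n i" and "b = base_config n j" and "c = base_config n k"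
  have in_n: "i \<in> {1..n}" "j \<in> {1..n}" "k \<in> {1..n}" and ne: "i \<noteq> j" "j \<noteq> k" "i \<noteq> k"
    using d by (auto simp: dist_idx_def)
  have norm1: "cmod (base_config n l) = 1" if "l \<in> {1..n}" for l
    using that by (simp add: base_config_def norm_exp_eq_Re)
  have dist: "a \<noteq> b" "b \<noteq> c" "a \<noteq> c"
    unfolding a_def b_def c_def using inj_onD[OF base_config_inj[of n]] in_n ne by blast+
  have n1: "cmod a = 1" "cmod b = 1" "cmod c = 1"
    unfolding a_def b_def c_def using norm1 in_n by auto
  have nz: "a \<noteq> 0" "b \<noteq> 0" "c \<noteq> 0" using n1 by auto
  have cnj: "cnj a = 1 / a" "cnj b = 1 / b" "cnj c = 1 / c"
    using n1 nz by (auto simp: divide_conv_cnj)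
  have "Im (cnj (b - a) * (c - a)) = 0" using 0 by (simp add: cdet_def a_def b_def c_def)
  moreover have "cnj w = w" if "Im w = 0" for w using that by (simp add: complex_eq_iff)
  ultimately have "cnj (cnj (b - a) * (c - a)) = cnj (b - a) * (c - a)" by blast
  then have "(b - a) * (1 / c - 1 / a) = (1 / b - 1 / a) * (c - a)"
    by (simp add: cnj)
  moreover have "(1 / c - 1 / a) * (a * b * c) = (a - c) * b" "(1 / b - 1 / a) * (a * b * c) = (a - b) * c"
    using nz by (simp_all add: left_diff_distrib)
  ultimately have "(b - a) * ((a - c) * b) = ((a - b) * c) * (c - a)"
    by (metis mult.assoc mult.commute)
  then have "(b - a) * (a - c) * (b - c) = 0" by (simp add: algebra_simps)
  then show False using dist by simp
qed

text \<open>Constant functions are included, because \<open>cdet\<close> does not depend on a point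
  outside its triple; that a function is not identically zero is therefore a separate condition in
  \<open>avoid_affine\<close>.\<close>

definition aff :: "(complex \<Rightarrow> real) \<Rightarrow> bool" where
  "aff F \<longleftrightarrow> (\<exists>u b. \<forall>v. F v = inner u v - b)"

lemma aff_diff_mult:
  assumes "aff F" "aff G"
  shows "aff (\<lambda>v. \<alpha> * F v - \<beta> * G v)"
proof -
  obtain u b u' b' where FG: "\<And>v. F v = inner u v - b" "\<And>v. G v = inner u' v - b'"
    using assms by (auto simp: aff_def)
  have "\<forall>v. \<alpha> * F v - \<beta> * G v = inner (\<alpha> *\<^sub>R u - \<beta> *\<^sub>R u') v - (\<alpha> * b - \<beta> * b')"
    unfolding FG by (simp add: inner_diff_left algebra_simps)
  then show ?thesis unfolding aff_def by blast
qed

lemma aff_cdet: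
  assumes "distinct [i, j, k]"
  shows "aff (\<lambda>v. cdet (c(a := v)) i j k)"
proof -
  consider "a = i" | "a = j" | "a = k" | "a \<notin> {i, j, k}" by blast
  then show ?thesis
  proof cases
    case 1
    then show ?thesis
      using assms unfolding aff_def
      by (intro exI[of _ "Complex (Im (c j) - Im (c k)) (Re (c k) - Re (c j))"]
          exI[of _ "Im (c j) * Re (c k) - Re (c j) * Im (c k)"])
        (simp add: cdet_eq inner_complex_def algebra_simps)
  next
    case 2
    then show ?thesis
      using assms unfolding aff_def
      by (intro exI[of _ "Complex (Im (c k) - Im (c i)) (Re (c i) - Re (c k))"]
          exI[of _ "Re (c i) * Im (c k) - Im (c i) * Re (c k)"])
        (simp add: cdet_eq inner_complex_def algebra_simps)
  next
    case 3
    then show ?thesis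
      using assms unfolding aff_def
      by (intro exI[of _ "Complex (Im (c i) - Im (c j)) (Re (c j) - Re (c i))"]
          exI[of _ "Re (c j) * Im (c i) - Im (c j) * Re (c i)"])
        (simp add: cdet_eq inner_complex_def algebra_simps)
  next
    case 4
    then show ?thesis
      unfolding aff_def by (intro exI[of _ 0] exI[of _ "- cdet c i j k"]) (simp add: cdet_eq)
  qed
qed

text \<open>The zero set of each function is a line or empty, hence negligible; a ball is not
  covered by finitely many such sets.\<close>

lemma avoid_affine:
  assumes "finite I" "\<And>i. i \<in> I \<Longrightarrow> aff (F i)" "\<And>i. i \<in> I \<Longrightarrow> \<exists>v. F i v \<noteq> 0" "0 < e"
  shows "\<exists>v. dist w v < e \<and> (\<forall>i\<in>I. F i v \<noteq> 0)"
proof -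
  have "negligible {v. F i v = 0}" if i: "i \<in> I" for i
  proof -
    obtain u b where F: "\<And>v. F i v = inner u v - b" using assms(2)[OF i] by (auto simp: aff_def)
    moreover obtain v where "F i v \<noteq> 0" using assms(3)[OF i] by blast
    ultimately have "u \<noteq> 0 \<or> b \<noteq> 0" by auto
    then show ?thesis using negligible_hyperplane[of u b] by (simp add: F)
  qed
  then have "negligible (\<Union>i\<in>I. {v. F i v = 0})"
    using assms(1) by (intro negligible_Union finite_imageI) auto
  moreover have "\<not> negligible (ball w e)"
    using assms(4) by (intro open_not_negligible) auto
  ultimately have "\<not> ball w e \<subseteq> (\<Union>i\<in>I. {v. F i v = 0})"
    using negligible_subset by blast
  then show ?thesis by auto
qed

definition seg :: "(nat \<Rightarrow> complex) \<Rightarrow> (nat \<Rightarrow> complex) \<Rightarrow> real \<Rightarrow> nat \<Rightarrow> complex" where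
  "seg c c' s = (\<lambda>j. c j + of_real s * (c' j - c j))"

text \<open>Moving a single point makes all determinants affine along the segment. The condition
  \<open>amo\<close> at all times is what lets a potential be followed along it.\<close>

definition gstep :: "nat \<Rightarrow> (nat \<Rightarrow> complex) \<Rightarrow> (nat \<Rightarrow> complex) \<Rightarrow> bool" where
  "gstep n c c' \<longleftrightarrow> generic n c \<and> generic n c' \<and> (\<exists>a\<in>{1..n}. \<forall>j. j \<noteq> a \<longrightarrow> c' j = c j) \<and>
     (\<forall>s\<in>{0..1}. amo n (seg c c' s))"

lemma seg_0 [simp]: "seg c c' 0 = c" and seg_1 [simp]: "seg c c' 1 = c'"
  by (auto simp: seg_def)

lemma cdet_seg:
  assumes "\<And>j. j \<noteq> a \<Longrightarrow> c' j = c j" "distinct [i, j, k]"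
  shows "cdet (seg c c' s) i j k = (1 - s) * cdet c i j k + s * cdet c' i j k"
proof -
  have c': "c' = c(a := c' a)" using assms(1) by auto
  have s: "seg c c' s = c(a := (1 - s) *\<^sub>R c a + s *\<^sub>R c' a)"
    using assms(1) by (auto simp: seg_def fun_eq_iff scaleR_conv_of_real algebra_simps)
  obtain u b where F: "\<And>v. cdet (c(a := v)) i j k = inner u v - b"
    using aff_cdet[OF assms(2)] unfolding aff_def by blast
  have 1: "cdet c' i j k = inner u (c' a) - b" using F[of "c' a"] c' by simp
  have 2: "cdet c i j k = inner u (c a) - b" using F[of "c a"] by simp
  have 3: "cdet (seg c c' s) i j k = inner u ((1 - s) *\<^sub>R c a + s *\<^sub>R c' a) - b"
    unfolding s by (rule F)
  show ?thesis unfolding 1 2 3 by (simp add: inner_add_right algebra_simps)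
qed

text \<open>A triple without \<open>a\<close> keeps its nonzero determinant. If two triples
  containing \<open>a\<close> become collinear at the same time, the pairs of values of their
  determinants at the two ends are proportional, and this is an affine condition on the end point
  \<open>v\<close> alone, without the time.\<close>

lemma good_step:
  assumes c: "generic n c" and a: "a \<in> {1..n}" and e: "0 < e"
  shows "\<exists>v. dist w v < e \<and> gstep n c (c(a := v))"
proof -
  define I1 where "I1 = {(i, j, k). dist_idx n [i, j, k]}"
  define I2 where "I2 = {((b, b'), (d, d')). dist_idx n [a, b, b'] \<and> dist_idx n [a, d, d'] \<and> {b, b'} \<noteq> {d, d'}}"
  define A where "A = (\<lambda>b b' v. cdet (c(a := v)) a b b')"
  define F1 where "F1 = (\<lambda>(i, j, k) v. cdet (c(a := v)) i j k)"
  \<comment> \<open>If the two lines through \<open>b b'\<close> and \<open>d d'\<close> are hit at the same time on the segment from \<open>c a\<close>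
    to \<open>v\<close>, then \<open>F2\<close> vanishes at \<open>v\<close>; it does not vanish at an endpoint of one line off the other.\<close>
  define F2 where "F2 = (\<lambda>((b, b'), (d, d')) v. A b b' (c a) * A d d' v - A d d' (c a) * A b b' v)"
  have affA: "aff (A b b')" if "dist_idx n [a, b, b']" for b b'
    unfolding A_def by (rule aff_cdet) (use that in \<open>simp add: dist_idx_def\<close>)
  have fin: "finite I1" "finite I2"
  proof -
    show "finite I1" unfolding I1_def by (rule finite_dist_idx)
    have "I2 \<subseteq> ({1..n} \<times> {1..n}) \<times> ({1..n} \<times> {1..n})" by (clarsimp simp: I2_def dist_idx_def)
    then show "finite I2" by (rule finite_subset) simp
  qed
  have "\<exists>v. dist w v < e \<and> (\<forall>i\<in>I1 <+> I2. case_sum F1 F2 i v \<noteq> 0)"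
  proof (rule avoid_affine[OF _ _ _ e])
    show "finite (I1 <+> I2)" using fin by simp
    fix x assume x: "x \<in> I1 <+> I2"
    show "aff (case_sum F1 F2 x)"
      using x affA by (auto simp: I1_def I2_def F1_def F2_def dist_idx_def intro!: aff_cdet aff_diff_mult)
    show "\<exists>v. case_sum F1 F2 x v \<noteq> 0"
    proof (cases x)
      case (Inl y)
      then show ?thesis
        using x c by (intro exI[of _ "c a"]) (auto simp: I1_def F1_def generic_def)
    next
      case (Inr y)
      then have "y \<in> I2" using x by auto
      then obtain b b' d d' where y: "y = ((b, b'), (d, d'))" "dist_idx n [a, b, b']"
          "dist_idx n [a, d, d']" "{b, b'} \<noteq> {d, d'}"
        unfolding I2_def by blast
      then obtain x' where x': "x' \<in> {b, b'}" "x' \<notin> {d, d'}"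
        by (auto simp: dist_idx_def doubleton_eq_iff)
      have "A b b' (c x') = 0" using x'(1) y(2) by (auto simp: A_def cdet_eq dist_idx_def)
      moreover have "A d d' (c x') \<noteq> 0"
      proof -
        have "A d d' (c x') = cdet c x' d d'"
          using y(3) by (auto simp: A_def cdet_eq dist_idx_def)
        moreover have "dist_idx n [x', d, d']" using x' y(2,3) by (auto simp: dist_idx_def)
        ultimately show ?thesis using c by (simp add: generic_def)
      qed
      moreover have "A b b' (c a) \<noteq> 0"
        using c y(2) by (simp add: A_def generic_def)
      ultimately show ?thesis
        unfolding Inr y(1) by (intro exI[of _ "c x'"]) (simp add: F2_def)
    qed
  qed
  then obtain v where v: "dist w v < e" "\<And>i. i \<in> I1 <+> I2 \<Longrightarrow> case_sum F1 F2 i v \<noteq> 0" by blast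
  let ?c' = "c(a := v)"
  have ca: "?c' j = c j" if "j \<noteq> a" for j using that by simp
  have gen: "generic n ?c'"
    using v(2)[OF InlI] by (force simp: generic_def I1_def F1_def)
  have "amo n (seg c ?c' s)" for s
    unfolding amo_def
  proof (intro ballI)
    have form: "\<exists>b b'. S = {a, b, b'} \<and> dist_idx n [a, b, b'] \<and> (1 - s) * A b b' (c a) + s * A b b' v = 0"
      if S: "S \<in> collinear_triples n (seg c ?c' s)" for S
    proof -
      obtain i j k where ijk: "dist_idx n [i, j, k]" "S = {i, j, k}" "cdet (seg c ?c' s) i j k = 0"
        using S by (rule collinear_triplesE)
      have "a \<in> S"
      proof (rule ccontr)
        assume "a \<notin> S"
        then have "cdet (seg c ?c' s) i j k = cdet c i j k"
          unfolding ijk(2) by (auto simp: cdet_eq seg_def)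
        then show False using c ijk by (simp add: generic_def)
      qed
      then obtain b b' where b: "S = {a, b, b'}" "dist_idx n [a, b, b']"
      proof -
        assume r: "\<And>b b'. S = {a, b, b'} \<Longrightarrow> dist_idx n [a, b, b'] \<Longrightarrow> thesis"
        consider "a = i" | "a = j" | "a = k" using \<open>a \<in> S\<close> ijk(2) by blast
        then show thesis
        proof cases
          case 1 then show thesis using r[of j k] ijk by (auto simp: dist_idx_def)
        next
          case 2 then show thesis using r[of i k] ijk by (auto simp: dist_idx_def)
        next
          case 3 then show thesis using r[of i j] ijk by (auto simp: dist_idx_def)
        qed
      qed
      then have "cdet (seg c ?c' s) a b b' = 0"
        using S collinear_triples_iff by blast
      then show ?thesis
        using b cdet_seg[of a ?c' c a b b' s] by (auto simp: A_def dist_idx_def)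
    qed
    fix S T assume S: "S \<in> collinear_triples n (seg c ?c' s)" and T: "T \<in> collinear_triples n (seg c ?c' s)"
    obtain b b' where b: "S = {a, b, b'}" "dist_idx n [a, b, b']" "(1 - s) * A b b' (c a) + s * A b b' v = 0"
      using form[OF S] by blast
    obtain d d' where d: "T = {a, d, d'}" "dist_idx n [a, d, d']" "(1 - s) * A d d' (c a) + s * A d d' v = 0"
      using form[OF T] by blast
    show "S = T"
    proof (rule ccontr)
      assume "S \<noteq> T"
      then have "((b, b'), (d, d')) \<in> I2" using b d by (auto simp: I2_def)
      then have "F2 ((b, b'), (d, d')) v \<noteq> 0" using v(2)[OF InrI] by force
      then have ne: "A b b' (c a) * A d d' v - A d d' (c a) * A b b' v \<noteq> 0" by (simp add: F2_def)
      \<comment> \<open>Eliminating the time from the two linear equations leaves \<open>s\<close>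
        times the value of \<open>F2\<close>; so \<open>s\<close> is zero, where both determinants
        are known not to vanish.\<close>
      have "s * (A b b' (c a) * A d d' v - A d d' (c a) * A b b' v) = 
          A b b' (c a) * (s * A d d' v) - A d d' (c a) * (s * A b b' v)"
        by (simp add: algebra_simps)
      also have "\<dots> = A b b' (c a) * (- ((1 - s) * A d d' (c a))) - A d d' (c a) * (- ((1 - s) * A b b' (c a)))"
        using b(3) d(3) by (smt (verit))
      also have "\<dots> = 0" by (simp add: algebra_simps)
      finally have "s = 0" using ne by simp
      then have "A b b' (c a) = 0" using b(3) by simp
      then show False using c b(2) by (simp add: A_def generic_def)
    qed
  qed
  then have "gstep n c ?c'"
    unfolding gstep_def using c gen a by auto
  then show ?thesis using v(1) by blast
qed

text \<open>One round moves the points \<open>1\<close> to \<open>n\<close> in turn. Every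
  coordinate on the way is an old or a final one, so a box containing both ends contains all
  intermediate configurations.\<close>

lemma round_approx:
  assumes P: "generic n P" and e: "0 < e"
  obtains C where "C 0 = P" "generic n (C n)" "\<And>i. i < n \<Longrightarrow> gstep n (C i) (C (Suc i))"
    "\<And>j. j \<in> {1..n} \<Longrightarrow> dist (Q j) (C n j) < e" "\<And>i j. i \<le> n \<Longrightarrow> C i j \<in> {P j, C n j}"
    "\<And>j. j \<notin> {1..n} \<Longrightarrow> C n j = P j"
proof -
  have "\<exists>C. C 0 = P \<and> generic n (C k) \<and> (\<forall>i<k. gstep n (C i) (C (Suc i))) \<and>
    (\<forall>j\<in>{1..k}. dist (Q j) (C k j) < e) \<and> (\<forall>i\<le>k. \<forall>j. C i j \<in> {P j, C k j}) \<and>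
    (\<forall>j. j \<notin> {1..k} \<longrightarrow> C k j = P j)" if "k \<le> n" for k
    using that
  proof (induction k)
    case 0
    then show ?case using P by (intro exI[of _ "\<lambda>_. P"]) auto
  next
    case (Suc k)
    then obtain C where C: "C 0 = P" "generic n (C k)" "\<forall>i<k. gstep n (C i) (C (Suc i))"
      "\<forall>j\<in>{1..k}. dist (Q j) (C k j) < e" "\<forall>i\<le>k. \<forall>j. C i j \<in> {P j, C k j}"
      "\<forall>j. j \<notin> {1..k} \<longrightarrow> C k j = P j" by auto
    have "Suc k \<in> {1..n}" using Suc.prems by simp
    from good_step[OF C(2) this e, of "Q (Suc k)"]
    obtain v where v: "dist (Q (Suc k)) v < e" "gstep n (C k) ((C k)(Suc k := v))" by blast
    define C' where "C' = C(Suc k := (C k)(Suc k := v))"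
    have "C' i j \<in> {P j, C' (Suc k) j}" if "i \<le> Suc k" for i j
    proof (cases "i = Suc k")
      case False
      then have ik: "i \<le> k" using that by simp
      have "C k (Suc k) = P (Suc k)" using C(6) by simp
      then show ?thesis
        using C(5)[rule_format, OF ik, of j] False by (cases "j = Suc k") (auto simp: C'_def)
    qed simp
    moreover have "gstep n (C' i) (C' (Suc i))" if "i < Suc k" for i
      using C(3) v(2) that by (cases "i = k") (auto simp: C'_def)
    moreover have "generic n (C' (Suc k))" using v(2) by (simp add: C'_def gstep_def)
    moreover have "dist (Q j) (C' (Suc k) j) < e" if "j \<in> {1..Suc k}" for j
      using C(4) v(1) that by (cases "j = Suc k") (auto simp: C'_def)
    moreover have "C' (Suc k) j = P j" if "j \<notin> {1..Suc k}" for j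
      using C(6) that by (auto simp: C'_def)
    moreover have "C' 0 = P" using C(1) by (simp add: C'_def)
    ultimately show ?case by blast
  qed
  from this[of n] show ?thesis using that by auto
qed

lemma seg_dist:
  assumes "dist w (c j) < e" "dist w (c' j) < e" "s \<in> {0..1}"
  shows "dist w (seg c c' s j) < e"
proof -
  have "(1 - s) *\<^sub>R c j + s *\<^sub>R c' j \<in> ball w e"
    using assms by (intro convexD_alt[OF convex_ball]) auto
  then show ?thesis by (simp add: seg_def scaleR_conv_of_real algebra_simps)
qed

lemma nbox_seg: "c \<in> nbox n p e \<Longrightarrow> c' \<in> nbox n p e \<Longrightarrow> s \<in> {0..1} \<Longrightarrow> seg c c' s \<in> nbox n p e"
  using seg_dist by (auto simp: nbox_def)

text \<open>In a box without walls every one-point move is admissible, so here the points can be put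
  exactly on their targets. This is needed to end at a prescribed configuration, in particular at
  the base configuration.\<close>

lemma round_exact:
  assumes gen: "\<And>z. z \<in> nbox n Q e \<Longrightarrow> generic n z" and P: "P \<in> nbox n Q e"
  obtains C where "C 0 = P" "\<And>i. i < n \<Longrightarrow> gstep n (C i) (C (Suc i))"
    "\<And>j. j \<in> {1..n} \<Longrightarrow> C n j = Q j" "\<And>i j. C i j \<in> {P j, Q j}" "\<And>j. j \<notin> {1..n} \<Longrightarrow> C n j = P j"
proof -
  define C where "C = (\<lambda>i j. if j \<in> {1..i} then Q j else P j)"
  \<comment> \<open>For \<open>n = 0\<close> every configuration lies in the box, whatever the sign
    of \<open>e\<close>.\<close>
  have e: "0 < e" if "n \<noteq> 0" using P that by (force simp: nbox_def dest: bspec[of _ _ n] intro: le_less_trans[OF zero_le_dist])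
  have box: "C i \<in> nbox n Q e" for i using P e by (auto simp: C_def nbox_def)
  have "gstep n (C i) (C (Suc i))" if "i < n" for i
    unfolding gstep_def using that box gen generic_amo nbox_seg[OF box box]
    by (auto simp: C_def intro!: bexI[of _ "Suc i"])
  then show ?thesis by (intro that[of C]) (auto simp: C_def)
qed

text \<open>The base configuration serves as a generic starting point, from which one round of moves
  leads close to \<open>p\<close>.\<close>

lemma generic_dense:
  assumes "0 < e"
  shows "\<exists>z\<in>nbox n p e. generic n z"
proof -
  obtain C where "generic n (C n)" "\<And>j. j \<in> {1..n} \<Longrightarrow> dist (p j) (C n j) < e"
    using round_approx[OF base_config_generic assms, of n p] by metis
  then show ?thesis by (intro bexI[of _ "C n"]) (auto simp: nbox_def)
qed

lemma generic_box:
  assumes "generic n p"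
  obtains e where "0 < e" "\<And>z. z \<in> nbox n p e \<Longrightarrow> generic n z"
    "\<And>z T. z \<in> nbox n p e \<Longrightarrow> same_sign n p z T"
proof -
  obtain e where e: "0 < e" "\<And>z i j k. z \<in> nbox n p e \<Longrightarrow> dist_idx n [i, j, k] \<Longrightarrow> cdet p i j k \<noteq> 0 \<Longrightarrow>
    cdet z i j k \<noteq> 0 \<and> (0 < cdet z i j k \<longleftrightarrow> 0 < cdet p i j k)"
    using sgn_stable[of n p] by blast
  show ?thesis
  proof (rule that[OF e(1)])
    have nz: "cdet p i j k \<noteq> 0" if "dist_idx n [i, j, k]" for i j k
      using assms that by (simp add: generic_def)
    show "generic n z" "same_sign n p z T" if z: "z \<in> nbox n p e" for z T
      using e(2)[OF z] nz unfolding generic_def same_sign_def by blast+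
  qed
qed

section \<open>Uniqueness of local potentials up to a left factor\<close>

section \<open>Comparing potentials\<close>

definition cpath :: "nat \<Rightarrow> (real \<Rightarrow> nat \<Rightarrow> complex) \<Rightarrow> bool" where
  "cpath n p \<longleftrightarrow> (\<forall>j\<in>{1..n}. continuous_on {0..1} (\<lambda>t. p t j))"

lemma cpath_uniform:
  assumes "cpath n p" "0 < e"
  shows "\<exists>d>0. \<forall>s\<in>{0..1}. \<forall>t\<in>{0..1}. \<bar>s - t\<bar> < d \<longrightarrow> p s \<in> nbox n (p t) e"
proof -
  obtain d where d: "0 < d" "\<And>j. j \<in> {1..n} \<Longrightarrow> \<forall>s\<in>{0..1}. \<forall>t\<in>{0..1}. \<bar>s - t\<bar> < d \<longrightarrow> dist (p t j) (p s j) < e"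
  proof (rule finite_uniform_radius[of "{1..n}" "\<lambda>d j. \<forall>s\<in>{0..1}. \<forall>t\<in>{0..1}. \<bar>s - t\<bar> < d \<longrightarrow> dist (p t j) (p s j) < e"])
    fix j assume "j \<in> {1..n}"
    then have "uniformly_continuous_on {0..1} (\<lambda>t. p t j)"
      using assms(1) by (intro compact_uniformly_continuous) (auto simp: cpath_def)
    then show "\<exists>d>0. \<forall>s\<in>{0..1}. \<forall>t\<in>{0..1}. \<bar>s - t\<bar> < d \<longrightarrow> dist (p t j) (p s j) < e"
      unfolding uniformly_continuous_on_def using assms(2) by (metis dist_real_def dist_commute)
  qed auto
  then show ?thesis by (intro exI[of _ d]) (auto simp: nbox_def)
qed

text \<open>The quantity \<open>K\<close> is meaningful at generic configurations only, while the
  path meets walls. Each time is therefore given the common value of \<open>K\<close> at all generic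
  configurations near \<open>p t\<close>; these exist by density, and the value is locally constant
  on a connected interval.\<close>

lemma path_const:
  assumes p: "cpath n p"
    and loc: "\<And>t. t \<in> {0..1} \<Longrightarrow> \<exists>e>0. \<forall>t'\<in>{0..1}. \<forall>z\<in>nbox n (p t) e. \<forall>z'\<in>nbox n (p t) e.
      \<bar>t' - t\<bar> < e \<longrightarrow> generic n z \<longrightarrow> generic n z' \<longrightarrow> K t' z' = K t z"
    and gen: "generic n (p 0)" "generic n (p 1)"
  shows "K 0 (p 0) = K 1 (p 1)"
proof -
  obtain e where e: "\<And>t. t \<in> {0..1} \<Longrightarrow> 0 < e t"
    and K: "\<And>t t' z z'. t \<in> {0..1} \<Longrightarrow> t' \<in> {0..1} \<Longrightarrow> z \<in> nbox n (p t) (e t) \<Longrightarrow> z' \<in> nbox n (p t) (e t) \<Longrightarrow>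
      \<bar>t' - t\<bar> < e t \<Longrightarrow> generic n z \<Longrightarrow> generic n z' \<Longrightarrow> K t' z' = K t z"
    using loc by metis
  define k where "k = (\<lambda>t. K t (SOME z. z \<in> nbox n (p t) (e t) \<and> generic n z))"
  have k: "K t z = k t" if t: "t \<in> {0..1}" and z: "z \<in> nbox n (p t) (e t)" "generic n z" for t z
  proof -
    have "\<exists>z. z \<in> nbox n (p t) (e t) \<and> generic n z" using z by blast
    from someI_ex[OF this] show ?thesis
      unfolding k_def using e[OF t] by (intro K[OF t t _ z(1) _ _ z(2)]) auto
  qed
  have "k 0 = k 1"
  proof (rule connected_local_const[of "{0..1::real}"])
    show "\<forall>t\<in>{0..1}. \<forall>\<^sub>F t' in at t within {0..1}. k t = k t'"
    proof
      fix t :: real assume t: "t \<in> {0..1}"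
      have pos: "0 < e t / 2" using e[OF t] by simp
      obtain d where d: "0 < d" "\<forall>s\<in>{0..1}. \<forall>t'\<in>{0..1}. \<bar>s - t'\<bar> < d \<longrightarrow> p s \<in> nbox n (p t') (e t / 2)"
        using cpath_uniform[OF p pos] by blast
      have "k t = k t'" if t': "t' \<in> {0..1}" "dist t' t < min d (e t)" for t'
      proof -
        \<comment> \<open>A generic configuration this close to \<open>p t'\<close> belongs to the
          boxes of both times, because \<open>p t'\<close> is within \<open>e t / 2\<close> of
          \<open>p t\<close>.\<close>
        define r where "r = min (e t') (e t / 2)"
        have r: "0 < r" using e t t' by (simp add: r_def)
        obtain w where w: "w \<in> nbox n (p t') r" "generic n w" using generic_dense[OF r] by blast
        have wt': "w \<in> nbox n (p t') (e t')" using w nbox_mono[of r "e t'"] by (auto simp: r_def)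
        have "p t' \<in> nbox n (p t) (e t / 2)"
          using d(2)[rule_format, OF t'(1) t] t' by (simp add: dist_real_def)
        moreover have "nbox n (p t') r \<subseteq> nbox n (p t') (e t / 2)"
          by (rule nbox_mono) (simp add: r_def)
        ultimately have wt: "w \<in> nbox n (p t) (e t)"
          using nbox_add[of "p t'" n "p t" "e t / 2" "e t / 2"] w by auto
        have "k t' = K t' w" using k[OF t'(1) wt' w(2)] by simp
        also have "\<dots> = K t w" using K[OF t t'(1) wt wt _ w(2) w(2)] t'(2) by (simp add: dist_real_def)
        also have "\<dots> = k t" by (rule k[OF t wt w(2)])
        finally show ?thesis by simp
      qed
      then show "\<forall>\<^sub>F t' in at t within {0..1}. k t = k t'"
        unfolding eventually_at using d(1) e[OF t] by (intro exI[of _ "min d (e t)"]) auto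
    qed
  qed auto
  then show ?thesis using k[of 0 "p 0"] k[of 1 "p 1"] gen e[of 0] e[of 1] by simp
qed

lemma crit_triple_in_gens:
  assumes inj: "inj_on p {1..n}" and amo: "amo n p" and T: "T \<in> collinear_triples n p"
  shows "crit_triple n p \<in> G3_gens n"
proof -
  obtain t where t: "inj_on (shx t p) {1..n}" using exists_shear[OF inj] by blast
  obtain i0 j0 k0 where 0: "dist_idx n [i0, j0, k0]" "T = {i0, j0, k0}"
    using T by (rule collinear_triplesE)
  obtain i j k where ijk: "{i, j, k} = {i0, j0, k0}" "shx t p i < shx t p j" "shx t p j < shx t p k"
    "dist_idx n [i, j, k]"
    using sort_triple[OF t 0(1)] by metis
  have "cdet p i j k = 0" using T 0(2) ijk(1) collinear_triples_iff[OF ijk(4)] by simp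
  then show ?thesis
    using crit_triple_eq[OF amo ijk(4) _ ijk(2,3)] triple_in_gens[OF ijk(4)] by simp
qed

text \<open>The letter \<open>crit_triple n p\<close> is given by a definite description that is
  justified only on a wall. Away from walls all nearby configurations have the same orientations and
  the factor is one.\<close>

lemma jump_closed:
  assumes inj: "inj_on p {1..n}" and amo: "amo n p"
  obtains e where "0 < e" "\<And>z z'. z \<in> nbox n p e \<Longrightarrow> z' \<in> nbox n p e \<Longrightarrow> jump n p z z' \<in> carrier (G3 n)"
proof (cases "collinear_triples n p = {}")
  case True
  then have "generic n p" by (simp add: generic_iff)
  then obtain e where e: "0 < e" "\<And>z T. z \<in> nbox n p e \<Longrightarrow> same_sign n p z T"
    using generic_box by metis
  have "same_sign n z z' T" if z: "z \<in> nbox n p e" "z' \<in> nbox n p e" for z z' T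
    using e(2)[OF z(1), of T] e(2)[OF z(2), of T] unfolding same_sign_def by blast
  then show ?thesis using that[OF e(1)] by (simp add: jump_def)
next
  case False
  then obtain T where "T \<in> collinear_triples n p" by blast
  then have "crit_triple n p \<in> G3_gens n" using crit_triple_in_gens[OF inj amo] by blast
  then have "G3_gen n (crit_triple n p) \<in> carrier (G3 n)"
    by (auto simp: G3_gens_def agen_def[symmetric])
  then show ?thesis using that[of 1] by (simp add: jump_def)
qed

lemma potentialD:
  assumes "potential n W f" "p \<in> W" "amo n p"
  obtains e where "0 < e" "\<And>z z'. z \<in> nbox n p e \<Longrightarrow> z' \<in> nbox n p e \<Longrightarrow> generic n z \<Longrightarrow> generic n z' \<Longrightarrow>
    f z' = f z \<otimes>\<^bsub>G3 n\<^esub> jump n p z z'"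
  using assms unfolding potential_def by metis

lemma potential_closed: "potential n W f \<Longrightarrow> f z \<in> carrier (G3 n)"
  by (simp add: potential_def)

text \<open>The moves of a round leave the values outside \<open>{1..n}\<close> alone, so the last
  configuration equals the target on \<open>{1..n}\<close> only; potentials have the same value at
  both.\<close>

lemma potential_cong:
  assumes f: "potential n W f" and q: "q \<in> W" "generic n q" and eq: "\<And>j. j \<in> {1..n} \<Longrightarrow> q' j = q j"
  shows "f q' = f q"
proof -
  obtain e where e: "0 < e" "\<And>z z'. z \<in> nbox n q e \<Longrightarrow> z' \<in> nbox n q e \<Longrightarrow> generic n z \<Longrightarrow> generic n z' \<Longrightarrow>
    f z' = f z \<otimes>\<^bsub>G3 n\<^esub> jump n q z z'"
    using potentialD[OF f q(1) generic_amo[OF q(2)]] by blast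
  have cd: "cdet q' i j k = cdet q i j k" if "dist_idx n [i, j, k]" for i j k
    using that eq by (simp add: cdet_def dist_idx_def)
  have "generic n q'" using q(2) cd by (simp add: generic_def)
  moreover have "q' \<in> nbox n q e" using e(1) eq by (simp add: nbox_def)
  ultimately have "f q' = f q \<otimes>\<^bsub>G3 n\<^esub> jump n q q q'"
    using e(1) q(2) by (intro e(2)) auto
  moreover have "jump n q q q' = \<one>\<^bsub>G3 n\<^esub>" using cd by (simp add: jump_def same_sign_def)
  ultimately show ?thesis using potential_closed[OF f] by simp
qed

lemma quotient_local_const:
  assumes f: "potential n W f" and g: "potential n W g" and inj: "inj_on p {1..n}" and p: "p \<in> W" "amo n p"
  obtains e where "0 < e" "\<And>z z'. z \<in> nbox n p e \<Longrightarrow> z' \<in> nbox n p e \<Longrightarrow> generic n z \<Longrightarrow> generic n z' \<Longrightarrow>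
    f z' \<otimes>\<^bsub>G3 n\<^esub> inv\<^bsub>G3 n\<^esub> g z' = f z \<otimes>\<^bsub>G3 n\<^esub> inv\<^bsub>G3 n\<^esub> g z"
proof -
  obtain e1 where e1: "0 < e1" "\<And>z z'. z \<in> nbox n p e1 \<Longrightarrow> z' \<in> nbox n p e1 \<Longrightarrow> generic n z \<Longrightarrow> generic n z' \<Longrightarrow>
    f z' = f z \<otimes>\<^bsub>G3 n\<^esub> jump n p z z'"
    using potentialD[OF f p] by blast
  obtain e2 where e2: "0 < e2" "\<And>z z'. z \<in> nbox n p e2 \<Longrightarrow> z' \<in> nbox n p e2 \<Longrightarrow> generic n z \<Longrightarrow> generic n z' \<Longrightarrow>
    g z' = g z \<otimes>\<^bsub>G3 n\<^esub> jump n p z z'"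
    using potentialD[OF g p] by blast
  obtain e3 where e3: "0 < e3" "\<And>z z'. z \<in> nbox n p e3 \<Longrightarrow> z' \<in> nbox n p e3 \<Longrightarrow> jump n p z z' \<in> carrier (G3 n)"
    using jump_closed[OF inj p(2)] by blast
  define e where "e = min e1 (min e2 e3)"
  have sub: "nbox n p e \<subseteq> nbox n p e1" "nbox n p e \<subseteq> nbox n p e2" "nbox n p e \<subseteq> nbox n p e3"
    by (auto simp: e_def intro!: nbox_mono)
  show ?thesis
  proof (rule that[of e])
    show "0 < e" using e1 e2 e3 by (simp add: e_def)
    fix z z' assume z: "z \<in> nbox n p e" "z' \<in> nbox n p e" and gen: "generic n z" "generic n z'"
    have j: "jump n p z z' \<in> carrier (G3 n)" using e3(2) z sub by blast
    have cl: "f z \<in> carrier (G3 n)" "g z \<in> carrier (G3 n)"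
      using potential_closed f g by blast+
    have "f z' \<otimes>\<^bsub>G3 n\<^esub> inv\<^bsub>G3 n\<^esub> g z' = (f z \<otimes>\<^bsub>G3 n\<^esub> jump n p z z') \<otimes>\<^bsub>G3 n\<^esub> inv\<^bsub>G3 n\<^esub> (g z \<otimes>\<^bsub>G3 n\<^esub> jump n p z z')"
      using e1(2) e2(2) z sub gen by (metis subsetD)
    also have "\<dots> = f z \<otimes>\<^bsub>G3 n\<^esub> (jump n p z z' \<otimes>\<^bsub>G3 n\<^esub> inv\<^bsub>G3 n\<^esub> jump n p z z') \<otimes>\<^bsub>G3 n\<^esub> inv\<^bsub>G3 n\<^esub> g z"
      using cl j by (simp only: G3.inv_mult_group G3.m_assoc G3.m_closed G3.inv_closed)
    finally show "f z' \<otimes>\<^bsub>G3 n\<^esub> inv\<^bsub>G3 n\<^esub> g z' = f z \<otimes>\<^bsub>G3 n\<^esub> inv\<^bsub>G3 n\<^esub> g z"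
      using cl j by simp
  qed
qed

lemma cpath_seg: "cpath n (seg c c')"
  unfolding cpath_def seg_def by (intro ballI continuous_intros)

lemma quotient_gstep:
  assumes f: "potential n W f" and g: "potential n W g"
    and W: "\<And>s. s \<in> {0..1} \<Longrightarrow> seg c c' s \<in> W" "\<And>z. z \<in> W \<Longrightarrow> inj_on z {1..n}"
    and step: "gstep n c c'"
  shows "f c \<otimes>\<^bsub>G3 n\<^esub> inv\<^bsub>G3 n\<^esub> g c = f c' \<otimes>\<^bsub>G3 n\<^esub> inv\<^bsub>G3 n\<^esub> g c'"
proof -
  have "(\<lambda>t z. f z \<otimes>\<^bsub>G3 n\<^esub> inv\<^bsub>G3 n\<^esub> g z) 0 (seg c c' 0) = (\<lambda>t z. f z \<otimes>\<^bsub>G3 n\<^esub> inv\<^bsub>G3 n\<^esub> g z) 1 (seg c c' 1)"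
  proof (rule path_const[OF cpath_seg])
    show "generic n (seg c c' 0)" "generic n (seg c c' 1)" using step by (auto simp: gstep_def)
    fix t :: real assume t: "t \<in> {0..1}"
    then have amo: "amo n (seg c c' t)" using step by (simp add: gstep_def)
    show "\<exists>e>0. \<forall>t'\<in>{0..1}. \<forall>z\<in>nbox n (seg c c' t) e. \<forall>z'\<in>nbox n (seg c c' t) e. \<bar>t' - t\<bar> < e \<longrightarrow>
        generic n z \<longrightarrow> generic n z' \<longrightarrow> f z' \<otimes>\<^bsub>G3 n\<^esub> inv\<^bsub>G3 n\<^esub> g z' = f z \<otimes>\<^bsub>G3 n\<^esub> inv\<^bsub>G3 n\<^esub> g z"
      using quotient_local_const[OF f g W(2)[OF W(1)[OF t]] W(1)[OF t] amo] by metis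
  qed
  then show ?thesis by simp
qed

text \<open>Two points of a box are joined by moves of single points that meet one wall at a time.\<close>

lemma potential_quotient:
  assumes f: "potential n (nbox n w r) f" and g: "potential n (nbox n w r) g"
    and W: "\<And>z. z \<in> nbox n w r \<Longrightarrow> inj_on z {1..n}"
    and p: "p \<in> nbox n w r" "generic n p" and q: "q \<in> nbox n w r" "generic n q"
  shows "f p \<otimes>\<^bsub>G3 n\<^esub> inv\<^bsub>G3 n\<^esub> g p = f q \<otimes>\<^bsub>G3 n\<^esub> inv\<^bsub>G3 n\<^esub> g q"
proof -
  let ?K = "\<lambda>z. f z \<otimes>\<^bsub>G3 n\<^esub> inv\<^bsub>G3 n\<^esub> g z"
  have chain: "?K (C 0) = ?K (C m)"
    if C: "\<And>i. i < m \<Longrightarrow> gstep n (C i) (C (Suc i))" "\<And>i. i \<le> m \<Longrightarrow> C i \<in> nbox n w r" for C and m :: nat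
    using C
  proof (induction m)
    case (Suc m)
    have "?K (C m) = ?K (C (Suc m))"
      using Suc.prems W by (intro quotient_gstep[OF f g]) (auto intro: nbox_seg)
    then show ?case using Suc by simp
  qed simp
  obtain d1 where d1: "0 < d1" "nbox n q d1 \<subseteq> nbox n w r" using nbox_open[OF q(1)] by blast
  obtain d2 where d2: "0 < d2" "\<And>z. z \<in> nbox n q d2 \<Longrightarrow> generic n z" using generic_box[OF q(2)] by metis
  define d where "d = min d1 d2"
  have "nbox n q d \<subseteq> nbox n q d1" "nbox n q d \<subseteq> nbox n q d2"
    by (auto simp: d_def intro!: nbox_mono)
  then have d: "0 < d" "nbox n q d \<subseteq> nbox n w r" "\<And>z. z \<in> nbox n q d \<Longrightarrow> generic n z"
    using d1 d2 unfolding d_def by (simp, blast+)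
  \<comment> \<open>General position allows the first round to come close to \<open>q\<close> but
    not to hit it. Around \<open>q\<close> there are no walls, so a second round completes the
    way.\<close>
  obtain C where C: "C 0 = p" "\<And>i. i < n \<Longrightarrow> gstep n (C i) (C (Suc i))"
    "\<And>j. j \<in> {1..n} \<Longrightarrow> dist (q j) (C n j) < d" "\<And>i j. i \<le> n \<Longrightarrow> C i j \<in> {p j, C n j}"
    using round_approx[OF p(2) d(1), of q] by metis
  have Cn: "C n \<in> nbox n q d" using C(3) by (simp add: nbox_def)
  have Cw: "C n \<in> nbox n w r" using Cn d(2) by blast
  have "C i \<in> nbox n w r" if "i \<le> n" for i
    unfolding nbox_def
  proof (intro CollectI ballI)
    fix j assume j: "j \<in> {1..n}"
    have "C i j = p j \<or> C i j = C n j" using C(4)[OF that, of j] by simp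
    then show "dist (w j) (C i j) < r" using p(1) Cw j by (auto simp: nbox_def)
  qed
  then have 1: "?K p = ?K (C n)" using chain[of n C] C by simp
  obtain D where D: "D 0 = C n" "\<And>i. i < n \<Longrightarrow> gstep n (D i) (D (Suc i))"
    "\<And>j. j \<in> {1..n} \<Longrightarrow> D n j = q j" "\<And>i j. D i j \<in> {C n j, q j}"
    using round_exact[OF d(3) Cn] by metis
  have "D i \<in> nbox n w r" for i
    unfolding nbox_def
  proof (intro CollectI ballI)
    fix j assume j: "j \<in> {1..n}"
    have "D i j = C n j \<or> D i j = q j" using D(4)[of i j] by simp
    then show "dist (w j) (D i j) < r" using q(1) Cw j by (auto simp: nbox_def)
  qed
  then have 2: "?K (C n) = ?K (D n)" using chain[of n D] D by simp
  have "f (D n) = f q" "g (D n) = g q"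
    using potential_cong[OF f q] potential_cong[OF g q] D(3) by blast+
  then show ?thesis using 1 2 by simp
qed

section \<open>Continuation of potentials along paths\<close>

section \<open>Lifts of paths and holonomy\<close>

definition bpath :: "nat \<Rightarrow> (real \<Rightarrow> nat \<Rightarrow> complex) \<Rightarrow> bool" where
  "bpath n p \<longleftrightarrow> cpath n p \<and> (\<forall>t\<in>{0..1}. inj_on (p t) {1..n})"

text \<open>A lift along \<open>p\<close> attaches to every time a potential near the current configuration, in a
  locally constant way; this is a path in the covering space of germs of potentials.\<close>

definition lift ::
    "nat \<Rightarrow> real \<Rightarrow> (real \<Rightarrow> nat \<Rightarrow> complex) \<Rightarrow>
      (real \<Rightarrow> (nat \<Rightarrow> complex) \<Rightarrow> ((nat \<times> nat \<times> nat) set \<times> bool) list set) \<Rightarrow> bool" where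
  "lift n e p L \<longleftrightarrow> 0 < e \<and> (\<forall>t\<in>{0..1}. (\<forall>z\<in>nbox n (p t) e. inj_on z {1..n}) \<and>
     potential n (nbox n (p t) e) (L t) \<and>
     (\<forall>t'\<in>{0..1}. \<bar>t' - t\<bar> < e \<longrightarrow> (\<forall>z\<in>nbox n (p t) e. generic n z \<longrightarrow> L t' z = L t z)))"

text \<open>Lifts are unique only up to a constant left factor; this factor cancels in the quotient
  of the two end values.\<close>

definition holonomy :: "nat \<Rightarrow> (real \<Rightarrow> nat \<Rightarrow> complex) \<Rightarrow> ((nat \<times> nat \<times> nat) set \<times> bool) list set" where
  "holonomy n p = (THE v. \<exists>e L. lift n e p L \<and> v = inv\<^bsub>G3 n\<^esub> L 0 (p 0) \<otimes>\<^bsub>G3 n\<^esub> L 1 (p 1))"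

lemma liftD:
  assumes "lift n e p L"
  shows "0 < e" "t \<in> {0..1} \<Longrightarrow> z \<in> nbox n (p t) e \<Longrightarrow> inj_on z {1..n}"
    "t \<in> {0..1} \<Longrightarrow> potential n (nbox n (p t) e) (L t)"
    "t \<in> {0..1} \<Longrightarrow> t' \<in> {0..1} \<Longrightarrow> \<bar>t' - t\<bar> < e \<Longrightarrow> z \<in> nbox n (p t) e \<Longrightarrow> generic n z \<Longrightarrow> L t' z = L t z"
  using assms unfolding lift_def by blast+

lemma potential_mono: "potential n W f \<Longrightarrow> V \<subseteq> W \<Longrightarrow> potential n V f"
  unfolding potential_def by blast

lemma lift_closed: "lift n e p L \<Longrightarrow> t \<in> {0..1} \<Longrightarrow> L t z \<in> carrier (G3 n)"
  using liftD(3) potential_closed by blast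

lemma inj_box:
  assumes "inj_on p {1..n}"
  shows "\<exists>e>0. \<forall>z\<in>nbox n p e. inj_on z {1..n}"
proof -
  define A where "A = {(i, j). i \<in> {1..n} \<and> j \<in> {1..n} \<and> i \<noteq> j}"
  have "finite A" by (rule finite_subset[of _ "{1..n} \<times> {1..n}"]) (auto simp: A_def)
  then obtain e where e: "0 < e" "\<And>x. x \<in> A \<Longrightarrow> 2 * e \<le> dist (p (fst x)) (p (snd x))"
  proof (rule finite_uniform_radius[of A "\<lambda>e x. 2 * e \<le> dist (p (fst x)) (p (snd x))"])
    fix x assume "x \<in> A"
    then have "p (fst x) \<noteq> p (snd x)" using assms by (auto simp: A_def dest: inj_onD)
    then show "\<exists>e>0. 2 * e \<le> dist (p (fst x)) (p (snd x))"
      by (intro exI[of _ "dist (p (fst x)) (p (snd x)) / 2"]) simp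
  qed auto
  have "inj_on z {1..n}" if z: "z \<in> nbox n p e" for z
  proof (rule inj_onI, rule ccontr)
    fix i j assume ij: "i \<in> {1..n}" "j \<in> {1..n}" "z i = z j" "i \<noteq> j"
    then have "2 * e \<le> dist (p i) (p j)" using e(2)[of "(i, j)"] by (simp add: A_def)
    moreover have "dist (p i) (z i) < e" "dist (p j) (z j) < e" using z ij(1,2) by (auto simp: nbox_def)
    ultimately show False using ij(3) dist_triangle2[of "p i" "p j" "z i"] by (simp add: dist_commute)
  qed
  then show ?thesis using e(1) by blast
qed

text \<open>A Lebesgue number argument: the local radius has to serve for all times in a
  neighbourhood of the same size, finitely many such neighbourhoods cover the interval, and the
  smallest radius is taken.\<close>

lemma interval_uniform:
  fixes P :: "real \<Rightarrow> real \<Rightarrow> bool"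
  assumes "\<And>t. t \<in> {0..1} \<Longrightarrow> \<exists>d>0. \<forall>t'\<in>{0..1}. \<bar>t' - t\<bar> < d \<longrightarrow> P d t'"
    and mono: "\<And>d e t. 0 < d \<Longrightarrow> d \<le> e \<Longrightarrow> P e t \<Longrightarrow> P d t"
  shows "\<exists>e>0. \<forall>t\<in>{0..1}. P e t"
proof -
  obtain d where d: "\<And>t. t \<in> {0..1} \<Longrightarrow> 0 < d t"
    "\<And>t t'. t \<in> {0..1} \<Longrightarrow> t' \<in> {0..1} \<Longrightarrow> \<bar>t' - t\<bar> < d t \<Longrightarrow> P (d t) t'"
    using assms(1) by metis
  have "{0..1} \<subseteq> (\<Union>t\<in>{0..1}. ball t (d t))" using d(1) by force
  then obtain D where D: "D \<subseteq> {0..1}" "finite D" "{0..1} \<subseteq> (\<Union>t\<in>D. ball t (d t))"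
    using compactE_image[of "{0..1::real}" "{0..1}" "\<lambda>t. ball t (d t)"] by auto
  obtain e where e: "0 < e" "\<And>t. t \<in> D \<Longrightarrow> e \<le> d t"
  proof (rule finite_uniform_radius[OF D(2), of "\<lambda>e t. e \<le> d t"])
    show "\<exists>e>0. e \<le> d t" if "t \<in> D" for t
      using d(1)[of t] D(1) that by (intro exI[of _ "d t"]) auto
  qed auto
  have "P e t" if t: "t \<in> {0..1}" for t
  proof -
    obtain s where s: "s \<in> D" "t \<in> ball s (d s)" using D(3) t by blast
    then have "P (d s) t" using d(2)[of s t] D(1) t by (auto simp: dist_real_def)
    then show ?thesis using mono e s(1) by blast
  qed
  then show ?thesis using e(1) by blast
qed

lemma uniform_potential:
  assumes p: "bpath n p"
  shows "\<exists>e>0. \<forall>t\<in>{0..1}. (\<forall>z\<in>nbox n (p t) e. inj_on z {1..n}) \<and> (\<exists>f. potential n (nbox n (p t) e) f)"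
proof (rule interval_uniform)
  fix t :: real assume t: "t \<in> {0..1}"
  then have inj: "inj_on (p t) {1..n}" using p by (simp add: bpath_def)
  obtain e1 where e1: "0 < e1" "\<forall>z\<in>nbox n (p t) e1. inj_on z {1..n}" using inj_box[OF inj] by blast
  obtain e2 f where e2: "0 < e2" "potential n (nbox n (p t) e2) f" using exists_potential[OF inj] by blast
  define e where "e = min e1 e2"
  have e: "0 < e" "\<forall>z\<in>nbox n (p t) e. inj_on z {1..n}" "potential n (nbox n (p t) e) f"
    using e1 e2 nbox_mono[of e e1 n "p t"] nbox_mono[of e e2 n "p t"]
    by (auto simp: e_def intro: potential_mono)
  have c: "cpath n p" "0 < e / 2" using p e(1) by (simp_all add: bpath_def)
  obtain d where d: "0 < d" "\<forall>s\<in>{0..1}. \<forall>t\<in>{0..1}. \<bar>s - t\<bar> < d \<longrightarrow> p s \<in> nbox n (p t) (e / 2)"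
    using cpath_uniform[OF c] by blast
  show "\<exists>d>0. \<forall>t'\<in>{0..1}. \<bar>t' - t\<bar> < d \<longrightarrow>
      (\<forall>z\<in>nbox n (p t') d. inj_on z {1..n}) \<and> (\<exists>f. potential n (nbox n (p t') d) f)"
  proof (intro exI[of _ "min d (e / 2)"] conjI ballI impI)
    show "0 < min d (e / 2)" using d(1) e(1) by simp
    fix t' assume t': "t' \<in> {0..1}" "\<bar>t' - t\<bar> < min d (e / 2)"
    then have "p t' \<in> nbox n (p t) (e / 2)" using d(2) t by auto
    then have "nbox n (p t') (e / 2) \<subseteq> nbox n (p t) e" using nbox_add[of "p t'" n "p t" "e / 2" "e / 2"] by simp
    moreover have "nbox n (p t') (min d (e / 2)) \<subseteq> nbox n (p t') (e / 2)" by (rule nbox_mono) simp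
    ultimately have sub: "nbox n (p t') (min d (e / 2)) \<subseteq> nbox n (p t) e" by blast
    then show "inj_on z {1..n}" if "z \<in> nbox n (p t') (min d (e / 2))" for z
      using that e(2) by blast
    show "\<exists>f. potential n (nbox n (p t') (min d (e / 2))) f"
      using potential_mono[OF e(3) sub] by blast
  qed
next
  fix d e t assume "0 < (d::real)" "d \<le> e"
    "(\<forall>z\<in>nbox n (p t) e. inj_on z {1..n}) \<and> (\<exists>f. potential n (nbox n (p t) e) f)"
  then show "(\<forall>z\<in>nbox n (p t) d. inj_on z {1..n}) \<and> (\<exists>f. potential n (nbox n (p t) d) f)"
    using nbox_mono[of d e n "p t"] by (blast intro: potential_mono)
qed

lemma potential_left_mult:
  assumes "potential n W f" "k \<in> carrier (G3 n)" "\<And>z. z \<in> W \<Longrightarrow> inj_on z {1..n}"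
  shows "potential n W (\<lambda>z. k \<otimes>\<^bsub>G3 n\<^esub> f z)"
  unfolding potential_def
proof (intro conjI allI ballI impI)
  show "k \<otimes>\<^bsub>G3 n\<^esub> f z \<in> carrier (G3 n)" for z
    using potential_closed[OF assms(1)] assms(2) by simp
  fix p assume p: "p \<in> W" "amo n p"
  obtain e1 where e1: "0 < e1" "\<And>z z'. z \<in> nbox n p e1 \<Longrightarrow> z' \<in> nbox n p e1 \<Longrightarrow> generic n z \<Longrightarrow> generic n z' \<Longrightarrow>
    f z' = f z \<otimes>\<^bsub>G3 n\<^esub> jump n p z z'"
    using potentialD[OF assms(1) p] by blast
  obtain e2 where e2: "0 < e2" "\<And>z z'. z \<in> nbox n p e2 \<Longrightarrow> z' \<in> nbox n p e2 \<Longrightarrow> jump n p z z' \<in> carrier (G3 n)"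
    using jump_closed[OF assms(3)[OF p(1)] p(2)] by blast
  have sub: "nbox n p (min e1 e2) \<subseteq> nbox n p e1" "nbox n p (min e1 e2) \<subseteq> nbox n p e2"
    by (auto intro!: nbox_mono)
  show "\<exists>e>0. \<forall>z\<in>nbox n p e. \<forall>z'\<in>nbox n p e. generic n z \<longrightarrow> generic n z' \<longrightarrow>
      k \<otimes>\<^bsub>G3 n\<^esub> f z' = k \<otimes>\<^bsub>G3 n\<^esub> f z \<otimes>\<^bsub>G3 n\<^esub> jump n p z z'"
  proof (intro exI[of _ "min e1 e2"] conjI ballI impI)
    show "0 < min e1 e2" using e1 e2 by simp
    fix z z' assume z: "z \<in> nbox n p (min e1 e2)" "z' \<in> nbox n p (min e1 e2)" "generic n z" "generic n z'"
    have z1: "z \<in> nbox n p e1" "z' \<in> nbox n p e1" "z \<in> nbox n p e2" "z' \<in> nbox n p e2" using z sub by blast+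
    show "k \<otimes>\<^bsub>G3 n\<^esub> f z' = k \<otimes>\<^bsub>G3 n\<^esub> f z \<otimes>\<^bsub>G3 n\<^esub> jump n p z z'"
      unfolding e1(2)[OF z1(1,2) z(3,4)]
      using e2(2)[OF z1(3,4)] assms(2) potential_closed[OF assms(1)] by (simp add: G3.m_assoc)
  qed
qed

text \<open>The interval is divided finely enough for consecutive boxes to overlap, and the
  potential at each division point is corrected by a left factor to agree with the previous one. The
  lift at time \<open>t\<close> is the potential of the last division point up to
  \<open>t\<close>.\<close>

lemma lift_exists:
  assumes p: "bpath n p"
  obtains e L where "lift n e p L"
proof -
  obtain e where e: "0 < e"
    and inj: "\<And>t z. t \<in> {0..1} \<Longrightarrow> z \<in> nbox n (p t) e \<Longrightarrow> inj_on z {1..n}"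
    and pot: "\<And>t. t \<in> {0..1} \<Longrightarrow> \<exists>f. potential n (nbox n (p t) e) f"
    using uniform_potential[OF p] by blast
  have c: "cpath n p" "0 < e / 4" using p e by (simp_all add: bpath_def)
  obtain d where d: "0 < d" "\<forall>s\<in>{0..1}. \<forall>t\<in>{0..1}. \<bar>s - t\<bar> < d \<longrightarrow> p s \<in> nbox n (p t) (e / 4)"
    using cpath_uniform[OF c] by blast
  \<comment> \<open>Two times closer than \<open>1 / N\<close> may belong to neighbouring pieces, so
    each can be up to \<open>2 / N\<close> away from the division point of the other.\<close>
  obtain N :: nat where N: "0 < N" "2 / real N < d"
  proof -
    obtain N where "2 / d < real N" using reals_Archimedean2 by blast
    moreover from this have "0 < real N" using d(1) by (smt (verit) divide_pos_pos)
    ultimately show ?thesis using that[of N] d(1) by (simp add: field_simps)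
  qed
  define \<tau> where "\<tau> = (\<lambda>i. real i / real N)"
  have \<tau>: "\<tau> i \<in> {0..1}" if "i \<le> N" for i using that N(1) by (auto simp: \<tau>_def)
  have near: "nbox n (p t) (e / 4) \<subseteq> nbox n (p s) (e / 2)" "nbox n (p t) (e / 2) \<subseteq> nbox n (p s) e"
    if "s \<in> {0..1}" "t \<in> {0..1}" "\<bar>t - s\<bar> \<le> 2 / real N" for s t
  proof -
    have pt: "p t \<in> nbox n (p s) (e / 4)" using d(2) that N(2) by auto
    show "nbox n (p t) (e / 4) \<subseteq> nbox n (p s) (e / 2)" using nbox_add[OF pt, of "e / 4"] by simp
    have "nbox n (p s) (e / 4 + e / 2) \<subseteq> nbox n (p s) e" using e by (intro nbox_mono) simp
    then show "nbox n (p t) (e / 2) \<subseteq> nbox n (p s) e" using nbox_add[OF pt, of "e / 2"] by blast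
  qed
  have "\<exists>f. \<forall>i. (i \<le> N \<longrightarrow> potential n (nbox n (p (\<tau> i)) e) (f i)) \<and>
     (Suc i \<le> N \<longrightarrow> (\<forall>z\<in>nbox n (p (\<tau> i)) (e / 2). generic n z \<longrightarrow> f (Suc i) z = f i z))"
  proof (rule dependent_nat_choice)
    show "\<exists>f. 0 \<le> N \<longrightarrow> potential n (nbox n (p (\<tau> 0)) e) f" using pot[OF \<tau>] by blast
    fix f i assume f: "i \<le> N \<longrightarrow> potential n (nbox n (p (\<tau> i)) e) f"
    show "\<exists>g. (Suc i \<le> N \<longrightarrow> potential n (nbox n (p (\<tau> (Suc i))) e) g) \<and>
      (Suc i \<le> N \<longrightarrow> (\<forall>z\<in>nbox n (p (\<tau> i)) (e / 2). generic n z \<longrightarrow> g z = f z))"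
    proof (cases "Suc i \<le> N")
      case True
      then have f: "potential n (nbox n (p (\<tau> i)) e) f" using f by simp
      obtain g where g: "potential n (nbox n (p (\<tau> (Suc i))) e) g" using pot[OF \<tau>[OF True]] by blast
      have half: "0 < e / 2" using e by simp
      obtain w where w: "w \<in> nbox n (p (\<tau> i)) (e / 2)" "generic n w" using generic_dense[OF half] by blast
      \<comment> \<open>By \<open>potential_quotient\<close> this quotient is the same at all
        generic configurations of the overlap, so the correction by \<open>k\<close> is correct
        everywhere in it.\<close>
      define k where "k = f w \<otimes>\<^bsub>G3 n\<^esub> inv\<^bsub>G3 n\<^esub> g w"
      have cl: "f z \<in> carrier (G3 n)" "g z \<in> carrier (G3 n)" for z
        using potential_closed f g by blast+
      have k: "k \<in> carrier (G3 n)" using cl by (simp add: k_def)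
      have "\<bar>\<tau> i - \<tau> (Suc i)\<bar> \<le> 2 / real N" using N(1) by (simp add: \<tau>_def field_simps)
      then have sub: "nbox n (p (\<tau> i)) (e / 2) \<subseteq> nbox n (p (\<tau> (Suc i))) e"
        using near(2) \<tau> True by simp
      have sub': "nbox n (p (\<tau> i)) (e / 2) \<subseteq> nbox n (p (\<tau> i)) e" using e by (intro nbox_mono) simp
      have inji: "inj_on z {1..n}" if "z \<in> nbox n (p (\<tau> i)) (e / 2)" for z
        using inj[OF \<tau>, of i z] True sub' that by auto
      have "k \<otimes>\<^bsub>G3 n\<^esub> g z = f z" if z: "z \<in> nbox n (p (\<tau> i)) (e / 2)" "generic n z" for z
      proof -
        have "f z \<otimes>\<^bsub>G3 n\<^esub> inv\<^bsub>G3 n\<^esub> g z = k"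
          unfolding k_def
          by (rule potential_quotient[OF potential_mono[OF f sub'] potential_mono[OF g sub] inji z w])
        then show ?thesis using cl by (metis G3.inv_closed G3.l_inv G3.m_assoc G3.r_one)
      qed
      moreover have "potential n (nbox n (p (\<tau> (Suc i))) e) (\<lambda>z. k \<otimes>\<^bsub>G3 n\<^esub> g z)"
        using inj[OF \<tau>[OF True]] by (intro potential_left_mult[OF g k])
      ultimately show ?thesis by (intro exI[of _ "\<lambda>z. k \<otimes>\<^bsub>G3 n\<^esub> g z"]) simp
    qed auto
  qed
  then obtain f where f: "\<And>i. i \<le> N \<Longrightarrow> potential n (nbox n (p (\<tau> i)) e) (f i)"
    and agree: "\<And>i z. Suc i \<le> N \<Longrightarrow> z \<in> nbox n (p (\<tau> i)) (e / 2) \<Longrightarrow> generic n z \<Longrightarrow> f (Suc i) z = f i z"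
    by blast
  define ix where "ix = (\<lambda>t. nat \<lfloor>t * real N\<rfloor>)"
  have ix: "ix t \<le> N" "\<tau> (ix t) \<le> t" "t < \<tau> (ix t) + 1 / real N" if "t \<in> {0..1}" for t
  proof -
    have 0: "0 \<le> t * real N" "t * real N \<le> real N" using that N(1) by (auto simp: mult_left_le_one_le)
    then have r: "real (ix t) = of_int \<lfloor>t * real N\<rfloor>" by (simp add: ix_def)
    then have "real (ix t) \<le> t * real N" "t * real N < real (ix t) + 1" by linarith+
    moreover from this have "real (ix t) \<le> real N" using 0 by linarith
    then show "ix t \<le> N" by simp
    ultimately show "\<tau> (ix t) \<le> t" "t < \<tau> (ix t) + 1 / real N"
      using 0 N(1) by (auto simp: \<tau>_def field_simps)
  qed
  \<comment> \<open>The bound \<open>1 / N\<close> ensures that the pieces of two close times differ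
    by at most one, so that \<open>agree\<close> applies once.\<close>
  define \<epsilon> where "\<epsilon> = min (e / 4) (1 / real N)"
  have "lift n \<epsilon> p (\<lambda>t. f (ix t))"
    unfolding lift_def
  proof (intro conjI ballI impI)
    show "0 < \<epsilon>" using e N(1) by (simp add: \<epsilon>_def)
    fix t :: real assume t: "t \<in> {0..1}"
    have sub4: "nbox n (p t) \<epsilon> \<subseteq> nbox n (p t) (e / 4)" by (rule nbox_mono) (simp add: \<epsilon>_def)
    have sub1: "nbox n (p t) \<epsilon> \<subseteq> nbox n (p t) e" using e by (intro nbox_mono) (simp add: \<epsilon>_def)
    show "inj_on z {1..n}" if "z \<in> nbox n (p t) \<epsilon>" for z using that sub1 inj[OF t] by blast
    have "1 / real N \<le> 2 / real N" using N(1) by (simp add: field_simps)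
    then have "\<bar>t - \<tau> (ix t)\<bar> \<le> 2 / real N" using ix[OF t] by linarith
    then have sub2: "nbox n (p t) \<epsilon> \<subseteq> nbox n (p (\<tau> (ix t))) (e / 2)"
      using near(1)[OF \<tau> t] ix(1)[OF t] sub4 by blast
    moreover have "nbox n (p (\<tau> (ix t))) (e / 2) \<subseteq> nbox n (p (\<tau> (ix t))) e"
      using e by (intro nbox_mono) simp
    ultimately show "potential n (nbox n (p t) \<epsilon>) (f (ix t))"
      using potential_mono[OF f[OF ix(1)[OF t]]] by blast
    fix t' z assume t': "t' \<in> {0..1}" "\<bar>t' - t\<bar> < \<epsilon>" and z: "z \<in> nbox n (p t) \<epsilon>" "generic n z"
    have tt: "\<bar>t' - t\<bar> < 1 / real N" using t'(2) by (simp add: \<epsilon>_def)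
    have "\<tau> (ix t') < \<tau> (ix t) + 2 / real N" "\<tau> (ix t) < \<tau> (ix t') + 2 / real N"
      using ix[OF t] ix[OF t'(1)] tt by linarith+
    then have "real (ix t') < real (ix t) + 2" "real (ix t) < real (ix t') + 2"
      using N(1) by (simp_all add: \<tau>_def field_simps)
    then consider "ix t' = ix t" | "ix t' = Suc (ix t)" | "ix t = Suc (ix t')" by linarith
    then show "f (ix t') z = f (ix t) z"
    proof cases
      case 2
      then show ?thesis using agree[of "ix t" z] ix(1)[OF t'(1)] z sub2 by auto
    next
      case 3
      have "\<bar>t - \<tau> (ix t')\<bar> \<le> 2 / real N" using ix[OF t] ix[OF t'(1)] tt by linarith
      then have "nbox n (p t) \<epsilon> \<subseteq> nbox n (p (\<tau> (ix t'))) (e / 2)"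
        using near(1)[OF \<tau> t] ix(1)[OF t'(1)] sub4 by blast
      then show ?thesis using 3 agree[of "ix t'" z] ix(1)[OF t] z by auto
    qed simp
  qed
  then show ?thesis by (rule that)
qed

text \<open>The quotient of two lifts is constant along the path by \<open>path_const\<close>, and a
  constant left factor disappears from the quotient of end values.\<close>

lemma lift_unique:
  assumes p: "cpath n p" and gen: "generic n (p 0)" "generic n (p 1)"
    and L: "lift n e p L" and M: "lift n e' p M"
  shows "inv\<^bsub>G3 n\<^esub> L 0 (p 0) \<otimes>\<^bsub>G3 n\<^esub> L 1 (p 1) = inv\<^bsub>G3 n\<^esub> M 0 (p 0) \<otimes>\<^bsub>G3 n\<^esub> M 1 (p 1)"
proof -
  define K where "K = (\<lambda>t z. L t z \<otimes>\<^bsub>G3 n\<^esub> inv\<^bsub>G3 n\<^esub> M t z)"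
  have "K 0 (p 0) = K 1 (p 1)"
  proof (rule path_const[OF p _ gen])
    fix t :: real assume t: "t \<in> {0..1}"
    define d where "d = min e e'"
    have sub: "nbox n (p t) d \<subseteq> nbox n (p t) e" "nbox n (p t) d \<subseteq> nbox n (p t) e'"
      by (auto simp: d_def intro!: nbox_mono)
    note pot = potential_mono[OF liftD(3)[OF L t] sub(1)] potential_mono[OF liftD(3)[OF M t] sub(2)]
    have "K t' z' = K t z" if t': "t' \<in> {0..1}" "\<bar>t' - t\<bar> < d"
      and z: "z \<in> nbox n (p t) d" "z' \<in> nbox n (p t) d" "generic n z" "generic n z'" for t' z z'
    proof -
      have "L t' z' = L t z'" "M t' z' = M t z'"
        using liftD(4)[OF L t t'(1) _ _ z(4)] liftD(4)[OF M t t'(1) _ _ z(4)] t'(2) z(2) sub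
        by (auto simp only: d_def min_less_iff_conj subset_iff)
      then have "K t' z' = K t z'" by (simp only: K_def)
      also have "\<dots> = K t z"
        unfolding K_def using liftD(2)[OF L t] sub
        by (intro potential_quotient[OF pot _ z(2,4) z(1,3)]) auto
      finally show ?thesis .
    qed
    moreover have "0 < d" using liftD(1) L M by (simp add: d_def)
    ultimately show "\<exists>e>0. \<forall>t'\<in>{0..1}. \<forall>z\<in>nbox n (p t) e. \<forall>z'\<in>nbox n (p t) e. \<bar>t' - t\<bar> < e \<longrightarrow>
      generic n z \<longrightarrow> generic n z' \<longrightarrow> K t' z' = K t z" by blast
  qed
  moreover have "L 0 (p 0) \<in> carrier (G3 n)" "L 1 (p 1) \<in> carrier (G3 n)"
    "M 0 (p 0) \<in> carrier (G3 n)" "M 1 (p 1) \<in> carrier (G3 n)"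
    using lift_closed[OF L] lift_closed[OF M] by auto
  ultimately show ?thesis
    unfolding K_def
    by (smt (verit) G3.inv_closed G3.inv_equality G3.l_inv G3.m_assoc G3.m_closed G3.r_inv G3.r_one G3.l_one)
qed

lemma holonomy_eq:
  assumes "cpath n p" "generic n (p 0)" "generic n (p 1)" "lift n e p L"
  shows "holonomy n p = inv\<^bsub>G3 n\<^esub> L 0 (p 0) \<otimes>\<^bsub>G3 n\<^esub> L 1 (p 1)"
  unfolding holonomy_def by (rule the_equality) (use assms lift_unique in blast)+

lemma holonomy_closed:
  assumes "bpath n p" "generic n (p 0)" "generic n (p 1)"
  shows "holonomy n p \<in> carrier (G3 n)"
proof -
  obtain e L where L: "lift n e p L" using lift_exists[OF assms(1)] by blast
  have "cpath n p" using assms(1) by (simp add: bpath_def)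
  then show ?thesis using holonomy_eq[OF _ assms(2,3) L] lift_closed[OF L] by simp
qed

text \<open>The boxes of half the size around \<open>q\<close> lie in those around \<open>p\<close>,
  so the very same potentials form a lift along \<open>q\<close>.\<close>

lemma lift_perturb:
  assumes L: "lift n e p L" and near: "\<And>t. t \<in> {0..1} \<Longrightarrow> q t \<in> nbox n (p t) (e / 2)"
  shows "lift n (e / 2) q L"
  unfolding lift_def
proof (intro conjI ballI impI)
  show "0 < e / 2" using liftD(1)[OF L] by simp
  fix t :: real assume t: "t \<in> {0..1}"
  have sub: "nbox n (q t) (e / 2) \<subseteq> nbox n (p t) e"
    using nbox_add[OF near[OF t], of "e / 2"] by simp
  then show "inj_on z {1..n}" if "z \<in> nbox n (q t) (e / 2)" for z using liftD(2)[OF L t] that by blast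
  show "potential n (nbox n (q t) (e / 2)) (L t)" using potential_mono[OF liftD(3)[OF L t] sub] .
  show "L t' z = L t z" if "t' \<in> {0..1}" "\<bar>t' - t\<bar> < e / 2" "z \<in> nbox n (q t) (e / 2)" "generic n z" for t' z
    using liftD(1)[OF L] liftD(4)[OF L t that(1) _ _ that(4)] that(2,3) sub by auto
qed

lemma square_near:
  fixes h :: "real \<times> real \<Rightarrow> nat \<Rightarrow> complex"
  assumes cont: "\<And>j. j \<in> {1..n} \<Longrightarrow> continuous_on ({0..1} \<times> {0..1}) (\<lambda>x. h x j)" and e: "0 < e"
  shows "\<exists>d>0. \<forall>s\<in>{0..1}. \<forall>s'\<in>{0..1}. dist s' s < d \<longrightarrow> (\<forall>t\<in>{0..1}. h (s', t) \<in> nbox n (h (s, t)) e)"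
proof -
  obtain d where d: "0 < d" "\<And>j. j \<in> {1..n} \<Longrightarrow> \<forall>x\<in>{0..1} \<times> {0..1}. \<forall>y\<in>{0..1} \<times> {0..1}. dist x y < d \<longrightarrow> dist (h x j) (h y j) < e"
  proof (rule finite_uniform_radius[of "{1..n}" "\<lambda>d j. \<forall>x\<in>{0..1} \<times> {0..1}. \<forall>y\<in>{0..1} \<times> {0..1}. dist x y < d \<longrightarrow> dist (h x j) (h y j) < e"])
    fix j assume "j \<in> {1..n}"
    then have "uniformly_continuous_on ({0..1} \<times> {0..1}) (\<lambda>x. h x j)"
      using cont by (intro compact_uniformly_continuous compact_Times) auto
    then show "\<exists>d>0. \<forall>x\<in>{0..1} \<times> {0..1}. \<forall>y\<in>{0..1} \<times> {0..1}. dist x y < d \<longrightarrow> dist (h x j) (h y j) < e"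
      unfolding uniformly_continuous_on_def using e by (metis dist_commute)
  next
    fix d e' j assume "d \<le> e'" "\<forall>x\<in>{0..1} \<times> {0..1}. \<forall>y\<in>{0..1} \<times> {0..1}. dist x y < e' \<longrightarrow> dist (h x j) (h y j) < e"
    then show "\<forall>x\<in>{0..1} \<times> {0..1}. \<forall>y\<in>{0..1} \<times> {0..1}. dist x y < d \<longrightarrow> dist (h x j) (h y j) < e"
      by force
  qed auto
  have "h (s', t) \<in> nbox n (h (s, t)) e"
    if "s \<in> {0..1}" "s' \<in> {0..1}" "dist s' s < d" "t \<in> {0..1}" for s s' t
  proof -
    have "dist (s, t) (s', t) < d" using that(3) by (simp add: dist_Pair_Pair dist_commute)
    then show ?thesis unfolding nbox_def using d(2) that by auto
  qed
  then show ?thesis using d(1) by blast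
qed

text \<open>Nearby slices of the homotopy share a lift and have the same ends, so the holonomy is
  locally constant in \<open>s\<close>.\<close>

lemma holonomy_homotopy:
  fixes h :: "real \<times> real \<Rightarrow> nat \<Rightarrow> complex"
  assumes cont: "\<And>j. j \<in> {1..n} \<Longrightarrow> continuous_on ({0..1} \<times> {0..1}) (\<lambda>x. h x j)"
    and path: "\<And>s. s \<in> {0..1} \<Longrightarrow> bpath n (\<lambda>t. h (s, t))"
    and ends: "\<And>s. s \<in> {0..1} \<Longrightarrow> h (s, 0) = a \<and> h (s, 1) = b" and gen: "generic n a" "generic n b"
  shows "holonomy n (\<lambda>t. h (0, t)) = holonomy n (\<lambda>t. h (1, t))"
proof (rule connected_local_const[of "{0..1::real}" 0 1 "\<lambda>s. holonomy n (\<lambda>t. h (s, t))"])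
  show "\<forall>s\<in>{0..1}. \<forall>\<^sub>F s' in at s within {0..1}. holonomy n (\<lambda>t. h (s, t)) = holonomy n (\<lambda>t. h (s', t))"
  proof
    fix s :: real assume s: "s \<in> {0..1}"
    obtain e L where L: "lift n e (\<lambda>t. h (s, t)) L" using lift_exists[OF path[OF s]] by blast
    have e: "0 < e / 2" using liftD(1)[OF L] by simp
    obtain d where d: "0 < d" "\<forall>s\<in>{0..1}. \<forall>s'\<in>{0..1}. dist s' s < d \<longrightarrow> (\<forall>t\<in>{0..1}. h (s', t) \<in> nbox n (h (s, t)) (e / 2))"
      using square_near[of n h "e / 2", OF cont e] by blast
    have "holonomy n (\<lambda>t. h (s, t)) = holonomy n (\<lambda>t. h (s', t))" if s': "s' \<in> {0..1}" "dist s' s < d" for s'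
    proof -
      have L': "lift n (e / 2) (\<lambda>t. h (s', t)) L"
        using d(2)[rule_format, OF s s'] by (intro lift_perturb[OF L])
      have c: "cpath n (\<lambda>t. h (s, t))" "cpath n (\<lambda>t. h (s', t))"
        using path[OF s] path[OF s'(1)] by (auto simp: bpath_def)
      show ?thesis
        using holonomy_eq[OF c(1) _ _ L] holonomy_eq[OF c(2) _ _ L'] ends[OF s] ends[OF s'(1)] gen by simp
    qed
    then show "\<forall>\<^sub>F s' in at s within {0..1}. holonomy n (\<lambda>t. h (s, t)) = holonomy n (\<lambda>t. h (s', t))"
      unfolding eventually_at using d(1) by auto
  qed
qed auto

text \<open>A lift along the concatenation restricts to lifts along both factors, and the values at
  the common configuration cancel. Each factor is run at half speed on its half of the lift, so the
  radius \<open>e\<close> remains valid.\<close>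

lemma holonomy_join:
  assumes p: "bpath n p" "bpath n q" "bpath n (p +++ q)" and pq: "p 1 = q 0"
    and gen: "generic n (p 0)" "generic n (p 1)" "generic n (q 1)"
  shows "holonomy n (p +++ q) = holonomy n p \<otimes>\<^bsub>G3 n\<^esub> holonomy n q"
proof -
  obtain e L where L: "lift n e (p +++ q) L" using lift_exists[OF p(3)] by blast
  have j1: "(p +++ q) (t / 2) = p t" if "t \<in> {0..1}" for t using that by (simp add: joinpaths_def)
  have j2: "(p +++ q) ((t + 1) / 2) = q t" if "t \<in> {0..1}" for t
  proof (cases "t = 0")
    case False
    then have "\<not> (t + 1) / 2 \<le> 1 / 2" using that by simp
    moreover have "2 * ((t + 1) / 2) - 1 = t" by (simp add: field_simps)
    ultimately show ?thesis unfolding joinpaths_def by presburger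
  qed (use pq in \<open>simp add: joinpaths_def\<close>)
  have L1: "lift n e p (\<lambda>t. L (t / 2))"
    unfolding lift_def
  proof (intro conjI ballI impI)
    show "0 < e" using liftD(1)[OF L] .
    fix t :: real assume t: "t \<in> {0..1}"
    then have t2: "t / 2 \<in> {0..1}" by simp
    show "inj_on z {1..n}" if "z \<in> nbox n (p t) e" for z using liftD(2)[OF L t2] that j1[OF t] by simp
    show "potential n (nbox n (p t) e) (L (t / 2))" using liftD(3)[OF L t2] j1[OF t] by simp
    show "L (t' / 2) z = L (t / 2) z" if "t' \<in> {0..1}" "\<bar>t' - t\<bar> < e" "z \<in> nbox n (p t) e" "generic n z" for t' z
      using that j1[OF t] by (intro liftD(4)[OF L t2]) auto
  qed
  have L2: "lift n e q (\<lambda>t. L ((t + 1) / 2))"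
    unfolding lift_def
  proof (intro conjI ballI impI)
    show "0 < e" using liftD(1)[OF L] .
    fix t :: real assume t: "t \<in> {0..1}"
    then have t2: "(t + 1) / 2 \<in> {0..1}" by simp
    show "inj_on z {1..n}" if "z \<in> nbox n (q t) e" for z using liftD(2)[OF L t2] that j2[OF t] by simp
    show "potential n (nbox n (q t) e) (L ((t + 1) / 2))" using liftD(3)[OF L t2] j2[OF t] by simp
    show "L ((t' + 1) / 2) z = L ((t + 1) / 2) z"
      if "t' \<in> {0..1}" "\<bar>t' - t\<bar> < e" "z \<in> nbox n (q t) e" "generic n z" for t' z
    proof (rule liftD(4)[OF L t2])
      have eq: "(t' + 1) / 2 - (t + 1) / 2 = (t' - t) / 2"
        by (simp add: diff_divide_distrib add_divide_distrib)
      show "\<bar>(t' + 1) / 2 - (t + 1) / 2\<bar> < e" unfolding eq using that(2) by simp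
    qed (use that j2[OF t] in auto)
  qed
  have c: "cpath n p" "cpath n q" "cpath n (p +++ q)" using p by (auto simp: bpath_def)
  have cl: "L 0 (p 0) \<in> carrier (G3 n)" "L (1 / 2) (p 1) \<in> carrier (G3 n)" "L 1 (q 1) \<in> carrier (G3 n)"
    using lift_closed[OF L] by auto
  have "(p +++ q) 0 = p 0" "(p +++ q) 1 = q 1" by (auto simp: joinpaths_def)
  then have "holonomy n (p +++ q) = inv\<^bsub>G3 n\<^esub> L 0 (p 0) \<otimes>\<^bsub>G3 n\<^esub> L 1 (q 1)"
    using holonomy_eq[OF c(3) _ _ L] gen by simp
  moreover have "holonomy n p = inv\<^bsub>G3 n\<^esub> L 0 (p 0) \<otimes>\<^bsub>G3 n\<^esub> L (1 / 2) (p 1)"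
    using holonomy_eq[OF c(1) _ _ L1] gen by simp
  moreover have "holonomy n q = inv\<^bsub>G3 n\<^esub> L (1 / 2) (p 1) \<otimes>\<^bsub>G3 n\<^esub> L 1 (q 1)"
    using holonomy_eq[OF c(2) _ _ L2] gen pq by simp
  moreover have "L (1 / 2) (p 1) \<otimes>\<^bsub>G3 n\<^esub> (inv\<^bsub>G3 n\<^esub> L (1 / 2) (p 1) \<otimes>\<^bsub>G3 n\<^esub> L 1 (q 1)) = L 1 (q 1)"
    using cl by (simp flip: G3.m_assoc)
  ultimately show ?thesis using cl by (simp add: G3.m_assoc)
qed

section \<open>Evaluation of the holonomy from its jumps\<close>

section \<open>Holonomy as a product over critical moments\<close>

lemma local_const_interval:
  fixes F :: "real \<Rightarrow> 'a"
  assumes "a \<le> b" "\<And>t. t \<in> {a..b} \<Longrightarrow> \<exists>d>0. \<forall>t'\<in>{a..b}. \<bar>t' - t\<bar> < d \<longrightarrow> F t' = F t"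
  shows "F a = F b"
proof (rule connected_local_const[of "{a..b}"])
  show "\<forall>t\<in>{a..b}. \<forall>\<^sub>F t' in at t within {a..b}. F t = F t'"
    unfolding eventually_at dist_real_def using assms(2) by metis
qed (use assms in auto)

text \<open>The values of \<open>F\<close> at the jump times do not enter; only the values on either
  side are compared. The induction removes the earliest jump and restarts just after it.\<close>

lemma (in group) product_of_jumps:
  fixes F :: "real \<Rightarrow> 'a" and Z :: "real set"
  assumes "finite Z" "Z \<subseteq> {a<..<b}" "a \<le> b"
    and const: "\<And>t. t \<in> {a..b} - Z \<Longrightarrow> \<exists>d>0. \<forall>t'\<in>{a..b} - Z. \<bar>t' - t\<bar> < d \<longrightarrow> F t' = F t"
    and jump: "\<And>c. c \<in> Z \<Longrightarrow> \<exists>d>0. \<forall>s\<in>{c-d<..<c}. \<forall>u\<in>{c<..<c+d}. s \<in> {a..b} \<longrightarrow> u \<in> {a..b} \<longrightarrow> F u = F s \<otimes> g c"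
    and cl: "\<And>t. t \<in> {a..b} \<Longrightarrow> F t \<in> carrier G" "\<And>c. c \<in> Z \<Longrightarrow> g c \<in> carrier G"
  shows "F b = F a \<otimes> lprod G (map g (sorted_list_of_set Z))"
  using assms
proof (induction "card Z" arbitrary: Z a)
  case 0
  then have "Z = {}" by simp
  then have "F a = F b"
    using 0 by (intro local_const_interval) auto
  then show ?case using 0 \<open>Z = {}\<close> by simp
next
  case (Suc m)
  then have ne: "Z \<noteq> {}" by auto
  define c where "c = Min Z"
  define Z' where "Z' = Z - {c}"
  have c: "c \<in> Z" "\<And>x. x \<in> Z \<Longrightarrow> c \<le> x" using ne Suc.prems(1) by (auto simp: c_def)
  have Z': "finite Z'" "card Z' = m" "Z = insert c Z'" "c \<notin> Z'"
    using Suc c by (auto simp: Z'_def)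
  have cab: "a < c" "c < b" using c(1) Suc.prems(2) by auto
  obtain d where d: "0 < d" "\<forall>s\<in>{c-d<..<c}. \<forall>u\<in>{c<..<c+d}. s \<in> {a..b} \<longrightarrow> u \<in> {a..b} \<longrightarrow> F u = F s \<otimes> g c"
    using Suc.prems(5)[OF c(1)] by blast
  obtain r where r: "0 < r" "\<And>x. x \<in> Z' \<Longrightarrow> r \<le> x - c"
  proof (rule finite_uniform_radius[OF Z'(1), of "\<lambda>r x. r \<le> x - c"])
    fix x assume "x \<in> Z'"
    then have "c < x" using c(2)[of x] by (auto simp: Z'_def)
    then show "\<exists>e>0. e \<le> x - c" by (intro exI[of _ "x - c"]) auto
  qed auto
  \<comment> \<open>Half of the least of four bounds: validity of the jump formula, distance to the
    next jump, and distance to both ends.\<close>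
  define \<delta> where "\<delta> = min (min d r) (min (c - a) (b - c)) / 2"
  have \<delta>: "0 < \<delta>" "\<delta> < d" "\<delta> < r" "\<delta> < c - a" "\<delta> < b - c"
    using d(1) r(1) cab by (auto simp: \<delta>_def min_def field_simps)
  define s u where "s = c - \<delta>" and "u = c + \<delta>"
  have su: "a \<le> s" "s < c" "c < u" "u \<le> b" "c - d < s" "u < c + d" using \<delta> by (auto simp: s_def u_def)
  have noZ: "t \<notin> Z" if "t \<in> {a..s}" for t using that su c(2)[of t] by auto
  have "F a = F s"
  proof (rule local_const_interval[OF su(1)])
    fix t assume t: "t \<in> {a..s}"
    then have "t \<in> {a..b} - Z" using noZ su by auto
    then obtain d where "0 < d" "\<forall>t'\<in>{a..b} - Z. \<bar>t' - t\<bar> < d \<longrightarrow> F t' = F t"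
      using Suc.prems(4) by blast
    then show "\<exists>d>0. \<forall>t'\<in>{a..s}. \<bar>t' - t\<bar> < d \<longrightarrow> F t' = F t"
      using noZ su by (intro exI[of _ d]) auto
  qed
  moreover have "F u = F s \<otimes> g c"
    using d(2)[rule_format, of s u] su by auto
  moreover have "F b = F u \<otimes> lprod G (map g (sorted_list_of_set Z'))"
  proof (rule Suc.hyps(1))
    show "m = card Z'" "finite Z'" using Z' by auto
    show "Z' \<subseteq> {u<..<b}"
    proof
      fix x assume x: "x \<in> Z'"
      then show "x \<in> {u<..<b}" using r(2)[OF x] \<delta> Z'(3) Suc.prems(2) by (auto simp: u_def)
    qed
    have cu: "c \<notin> {u..b}" using su by auto
    show "\<exists>d>0. \<forall>t'\<in>{u..b} - Z'. \<bar>t' - t\<bar> < d \<longrightarrow> F t' = F t" if t: "t \<in> {u..b} - Z'" for t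
    proof -
      have "t \<in> {a..b} - Z" using t cu su cab by (auto simp: Z'(3))
      then obtain d where "0 < d" "\<forall>t'\<in>{a..b} - Z. \<bar>t' - t\<bar> < d \<longrightarrow> F t' = F t"
        using Suc.prems(4) by blast
      then show ?thesis using cu su cab by (intro exI[of _ d]) (auto simp: Z'(3))
    qed
    show "\<exists>d>0. \<forall>s\<in>{x-d<..<x}. \<forall>v\<in>{x<..<x+d}. s \<in> {u..b} \<longrightarrow> v \<in> {u..b} \<longrightarrow> F v = F s \<otimes> g x"
      if x: "x \<in> Z'" for x
    proof -
      have "x \<in> Z" using x Z'(3) by simp
      then obtain d where "0 < d" "\<forall>s\<in>{x-d<..<x}. \<forall>v\<in>{x<..<x+d}. s \<in> {a..b} \<longrightarrow> v \<in> {a..b} \<longrightarrow> F v = F s \<otimes> g x"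
        using Suc.prems(5) by blast
      then show ?thesis using su cab by (intro exI[of _ d]) auto
    qed
    show "u \<le> b" using su by simp
    show "F t \<in> carrier G" if "t \<in> {u..b}" for t using that su cab by (intro Suc.prems(6)) auto
    show "g x \<in> carrier G" if "x \<in> Z'" for x using that Z'(3) by (intro Suc.prems(7)) auto
  qed
  moreover have "sorted_list_of_set Z = c # sorted_list_of_set Z'"
    using sorted_list_of_set_nonempty[OF Suc.prems(1) ne] by (simp add: c_def Z'_def)
  moreover have "F a \<in> carrier G" "g c \<in> carrier G" "lprod G (map g (sorted_list_of_set Z')) \<in> carrier G"
    using Suc.prems(3,6,7) c(1) Z' by (auto intro!: lprod_closed)
  ultimately show ?case by (simp add: m_assoc)
qed

text \<open>The value \<open>L t (p t)\<close> is locally constant away from the critical moments.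
  The hypothesis on signs guarantees that a wall is really crossed at each of them; otherwise the
  jump would be one although the word contains a letter.\<close>

lemma holonomy_word:
  assumes p: "bpath n p" and fin: "finite (critical_moments n p)"
    and gen: "generic n (p 0)" "generic n (p 1)"
    and amo: "\<And>t. t \<in> {0..1} \<Longrightarrow> amo n (p t)"
    and sgn: "\<And>c. c \<in> critical_moments n p \<Longrightarrow>
      \<exists>d>0. \<forall>s\<in>{c-d<..<c}. \<forall>u\<in>{c<..<c+d}. s \<in> {0..1} \<longrightarrow> u \<in> {0..1} \<longrightarrow> \<not> (\<forall>T. same_sign n (p s) (p u) T)"
  shows "holonomy n p = braid_word_value n p"
proof -
  obtain e L where L: "lift n e p L" using lift_exists[OF p] by blast
  have c: "cpath n p" using p by (simp add: bpath_def)
  define Z where "Z = critical_moments n p"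
  define F where "F = (\<lambda>t. L t (p t))"
  define g where "g = (\<lambda>t. G3_gen n (crit_triple n (p t)))"
  have e: "0 < e" using liftD(1)[OF L] .
  have gen_iff: "generic n (p t) \<longleftrightarrow> t \<notin> Z" if "t \<in> {0..1}" for t
    using that by (simp add: Z_def critical_moments_def generic_iff)
  have F_near: "\<exists>d>0. \<forall>s\<in>{0..1}. \<forall>u\<in>{0..1}. \<bar>s - t\<bar> < d \<longrightarrow> \<bar>u - t\<bar> < d \<longrightarrow> s \<notin> Z \<longrightarrow> u \<notin> Z \<longrightarrow>
      F u = F s \<otimes>\<^bsub>G3 n\<^esub> jump n (p t) (p s) (p u)" if t: "t \<in> {0..1}" for t
  proof -
    have pt: "p t \<in> nbox n (p t) e" using e by simp
    obtain e1 where e1: "0 < e1" "\<And>z z'. z \<in> nbox n (p t) e1 \<Longrightarrow> z' \<in> nbox n (p t) e1 \<Longrightarrow> generic n z \<Longrightarrow> generic n z' \<Longrightarrow>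
      L t z' = L t z \<otimes>\<^bsub>G3 n\<^esub> jump n (p t) z z'"
      using potentialD[OF liftD(3)[OF L t] pt amo[OF t]] by blast
    define e2 where "e2 = min e e1"
    have e2: "0 < e2" "nbox n (p t) e2 \<subseteq> nbox n (p t) e" "nbox n (p t) e2 \<subseteq> nbox n (p t) e1"
      using e e1(1) by (auto simp: e2_def intro!: nbox_mono)
    obtain d where d: "0 < d" "\<forall>s\<in>{0..1}. \<forall>t\<in>{0..1}. \<bar>s - t\<bar> < d \<longrightarrow> p s \<in> nbox n (p t) e2"
      using cpath_uniform[OF c e2(1)] by blast
    show ?thesis
    proof (intro exI[of _ "min d e"] conjI ballI impI)
      show "0 < min d e" using d e by simp
      fix s u :: real assume s: "s \<in> {0..1}" "\<bar>s - t\<bar> < min d e" "s \<notin> Z"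
        and u: "u \<in> {0..1}" "\<bar>u - t\<bar> < min d e" "u \<notin> Z"
      have ps: "p s \<in> nbox n (p t) e2" "p u \<in> nbox n (p t) e2" using d(2) s u t by auto
      have g: "generic n (p s)" "generic n (p u)" using gen_iff s u by auto
      have "F s = L t (p s)"
        unfolding F_def using liftD(4)[OF L t s(1) _ _ g(1)] s(2) ps e2 by auto
      moreover have "F u = L t (p u)"
        unfolding F_def using liftD(4)[OF L t u(1) _ _ g(2)] u(2) ps e2 by auto
      ultimately show "F u = F s \<otimes>\<^bsub>G3 n\<^esub> jump n (p t) (p s) (p u)"
        using e1(2)[of "p s" "p u"] ps g e2 by auto
    qed
  qed
  have Fcl: "F t \<in> carrier (G3 n)" if "t \<in> {0..1}" for t
    unfolding F_def using lift_closed[OF L that] .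
  have gcl: "g t \<in> carrier (G3 n)" if "t \<in> Z" for t
  proof -
    have t: "t \<in> {0..1}" "collinear_triples n (p t) \<noteq> {}" using that by (auto simp: Z_def critical_moments_def)
    then have "crit_triple n (p t) \<in> G3_gens n"
      using crit_triple_in_gens[OF _ amo] p by (auto simp: bpath_def)
    then show ?thesis unfolding g_def G3_gens_def by (auto simp flip: agen_def)
  qed
  have "F 1 = F 0 \<otimes>\<^bsub>G3 n\<^esub> lprod (G3 n) (map g (sorted_list_of_set Z))"
  proof (rule G3.product_of_jumps)
    show "finite Z" using fin by (simp add: Z_def)
    have "0 \<notin> Z" "1 \<notin> Z" using gen gen_iff[of 0] gen_iff[of 1] by auto
    then show "Z \<subseteq> {0<..<1}"
      by (auto simp: Z_def critical_moments_def order.order_iff_strict)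
    show "(0::real) \<le> 1" by simp
    show "F t \<in> carrier (G3 n)" if "t \<in> {0..1}" for t by (rule Fcl[OF that])
    show "g t \<in> carrier (G3 n)" if "t \<in> Z" for t by (rule gcl[OF that])
    show "\<exists>d>0. \<forall>t'\<in>{0..1} - Z. \<bar>t' - t\<bar> < d \<longrightarrow> F t' = F t" if t: "t \<in> {0..1} - Z" for t
    proof -
      have t1: "t \<in> {0..1}" "generic n (p t)" using t gen_iff by auto
      obtain d1 where d1: "0 < d1" "\<forall>s\<in>{0..1}. \<forall>u\<in>{0..1}. \<bar>s - t\<bar> < d1 \<longrightarrow> \<bar>u - t\<bar> < d1 \<longrightarrow> s \<notin> Z \<longrightarrow> u \<notin> Z \<longrightarrow>
        F u = F s \<otimes>\<^bsub>G3 n\<^esub> jump n (p t) (p s) (p u)" using F_near[OF t1(1)] by blast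
      obtain r where r: "0 < r" "\<And>z T. z \<in> nbox n (p t) r \<Longrightarrow> same_sign n (p t) z T"
        using generic_box[OF t1(2)] by metis
      obtain d2 where d2: "0 < d2" "\<forall>s\<in>{0..1}. \<forall>t\<in>{0..1}. \<bar>s - t\<bar> < d2 \<longrightarrow> p s \<in> nbox n (p t) r"
        using cpath_uniform[OF c r(1)] by blast
      have "F t' = F t" if t': "t' \<in> {0..1} - Z" "\<bar>t' - t\<bar> < min d1 d2" for t'
      proof -
        have "F t' = F t \<otimes>\<^bsub>G3 n\<^esub> jump n (p t) (p t) (p t')"
          using d1 t t' by auto
        moreover have "p t' \<in> nbox n (p t) r" using d2(2) t t' by auto
        then have "jump n (p t) (p t) (p t') = \<one>\<^bsub>G3 n\<^esub>" using r(2) by (simp add: jump_def)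
        ultimately show ?thesis using Fcl[OF t1(1)] by simp
      qed
      then show ?thesis using d1(1) d2(1) by (intro exI[of _ "min d1 d2"]) auto
    qed
    show "\<exists>d>0. \<forall>s\<in>{x-d<..<x}. \<forall>u\<in>{x<..<x+d}. s \<in> {0..1} \<longrightarrow> u \<in> {0..1} \<longrightarrow> F u = F s \<otimes>\<^bsub>G3 n\<^esub> g x"
      if x: "x \<in> Z" for x
    proof -
      have x1: "x \<in> {0..1}" using x by (simp add: Z_def critical_moments_def)
      obtain d1 where d1: "0 < d1" "\<forall>s\<in>{0..1}. \<forall>u\<in>{0..1}. \<bar>s - x\<bar> < d1 \<longrightarrow> \<bar>u - x\<bar> < d1 \<longrightarrow> s \<notin> Z \<longrightarrow> u \<notin> Z \<longrightarrow>
        F u = F s \<otimes>\<^bsub>G3 n\<^esub> jump n (p x) (p s) (p u)" using F_near[OF x1] by blast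
      obtain d2 where d2: "0 < d2" "\<forall>s\<in>{x-d2<..<x}. \<forall>u\<in>{x<..<x+d2}. s \<in> {0..1} \<longrightarrow> u \<in> {0..1} \<longrightarrow> \<not> (\<forall>T. same_sign n (p s) (p u) T)"
        using sgn x unfolding Z_def by blast
      obtain d3 where d3: "0 < d3" "\<And>y. y \<in> Z - {x} \<Longrightarrow> d3 \<le> \<bar>y - x\<bar>"
      proof (rule finite_uniform_radius[of "Z - {x}" "\<lambda>d y. d \<le> \<bar>y - x\<bar>"])
        show "finite (Z - {x})" using fin by (simp add: Z_def)
        show "\<exists>e>0. e \<le> \<bar>y - x\<bar>" if "y \<in> Z - {x}" for y using that by (intro exI[of _ "\<bar>y - x\<bar>"]) auto
      qed auto
      define d where "d = min d1 (min d2 d3)"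
      have "F u = F s \<otimes>\<^bsub>G3 n\<^esub> g x"
        if s: "s \<in> {x-d<..<x}" "s \<in> {0..1}" and u: "u \<in> {x<..<x+d}" "u \<in> {0..1}" for s u
      proof -
        have "s \<notin> Z" using d3(2)[of s] s by (auto simp: d_def)
        moreover have "u \<notin> Z" using d3(2)[of u] u by (auto simp: d_def)
        moreover have "\<bar>s - x\<bar> < d1" "\<bar>u - x\<bar> < d1" using s u by (auto simp: d_def)
        ultimately have "F u = F s \<otimes>\<^bsub>G3 n\<^esub> jump n (p x) (p s) (p u)"
          using d1(2) s(2) u(2) by blast
        moreover have "\<not> (\<forall>T. same_sign n (p s) (p u) T)"
          using d2(2)[rule_format, of s u] s u by (auto simp: d_def)
        then have "jump n (p x) (p s) (p u) = g x" unfolding jump_def g_def by argo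
        ultimately show ?thesis by simp
      qed
      moreover have "0 < d" using d1 d2 d3 by (simp add: d_def)
      ultimately show ?thesis by blast
    qed
  qed
  moreover have "holonomy n p = inv\<^bsub>G3 n\<^esub> F 0 \<otimes>\<^bsub>G3 n\<^esub> F 1"
    unfolding F_def by (rule holonomy_eq[OF c gen L])
  moreover have "lprod (G3 n) (map g (sorted_list_of_set Z)) \<in> carrier (G3 n)"
    using gcl fin by (intro G3.lprod_closed) (auto simp: Z_def)
  ultimately have "holonomy n p = lprod (G3 n) (map g (sorted_list_of_set Z))"
    using Fcl[of 0] by (simp flip: G3.m_assoc)
  then show ?thesis by (simp add: braid_word_value_def lprod_def g_def Z_def)
qed

section \<open>Smoothness from families closed under differentiation, and a smooth step\<close>

section \<open>Smooth functions\<close>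

text \<open>Choosing a derivative inside \<open>F\<close> again and again yields the whole sequence
  of derivatives; so smoothness reduces to finding a family closed under differentiation.\<close>

lemma smooth_on_coinduct:
  assumes f: "f \<in> F"
    and step: "\<And>g. g \<in> F \<Longrightarrow> \<exists>g'\<in>F. \<forall>t\<in>S. (g has_vector_derivative g' t) (at t within S)"
  shows "smooth_on S f"
proof -
  have "\<exists>D. \<forall>m. D m \<in> F \<and> (m = 0 \<longrightarrow> D m = f) \<and>
      (\<forall>t\<in>S. (D m has_vector_derivative D (Suc m) t) (at t within S))"
  proof -
    have "\<exists>D. \<forall>m. (D m \<in> F \<and> (m = 0 \<longrightarrow> D m = f)) \<and>
        (\<forall>t\<in>S. (D m has_vector_derivative D (Suc m) t) (at t within S))"
      by (rule dependent_nat_choice) (use f step in blast)+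
    then show ?thesis by simp
  qed
  then show ?thesis unfolding smooth_on_def by metis
qed

lemma smooth_on_derivE:
  assumes "smooth_on S f"
  obtains f' where "smooth_on S f'" "\<And>t. t \<in> S \<Longrightarrow> (f has_vector_derivative f' t) (at t within S)"
proof -
  obtain D where D: "\<forall>t\<in>S. D 0 t = f t"
    "\<forall>m. \<forall>t\<in>S. (D m has_vector_derivative D (Suc m) t) (at t within S)"
    using assms unfolding smooth_on_def by blast
  have "smooth_on S (D 1)"
    unfolding smooth_on_def by (rule exI[of _ "\<lambda>m. D (Suc m)"]) (use D(2) in simp)
  moreover have "(f has_vector_derivative D 1 t) (at t within S)" if t: "t \<in> S" for t
  proof (rule has_vector_derivative_transform[OF t])
    show "(D 0 has_vector_derivative D 1 t) (at t within S)" using D(2) t by simp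
  qed (use D(1) in auto)
  ultimately show ?thesis by (rule that)
qed

lemma smooth_on_cong: "(\<And>t. t \<in> S \<Longrightarrow> f t = g t) \<Longrightarrow> smooth_on S f \<longleftrightarrow> smooth_on S g"
  unfolding smooth_on_def by auto

lemma smooth_on_const: "smooth_on S (\<lambda>_. c)"
proof (rule smooth_on_coinduct[where F = "range (\<lambda>c _. c)"])
  fix g :: "real \<Rightarrow> 'a" assume "g \<in> range (\<lambda>c _. c)"
  then show "\<exists>g'\<in>range (\<lambda>c _. c). \<forall>t\<in>S. (g has_vector_derivative g' t) (at t within S)"
    by (intro bexI[of _ "\<lambda>_. 0"]) auto
qed auto

lemma smooth_on_add:
  assumes "smooth_on S f" "smooth_on S g"
  shows "smooth_on S (\<lambda>t. f t + g t)"
proof (rule smooth_on_coinduct[where F = "{\<lambda>t. f t + g t | f g. smooth_on S f \<and> smooth_on S g}"])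
  fix h :: "real \<Rightarrow> 'a" assume "h \<in> {\<lambda>t. f t + g t | f g. smooth_on S f \<and> smooth_on S g}"
  then obtain f g where h: "h = (\<lambda>t. f t + g t)" "smooth_on S f" "smooth_on S g" by blast
  obtain f' where f': "smooth_on S f'" "\<And>t. t \<in> S \<Longrightarrow> (f has_vector_derivative f' t) (at t within S)"
    using smooth_on_derivE[OF h(2)] by metis
  obtain g' where g': "smooth_on S g'" "\<And>t. t \<in> S \<Longrightarrow> (g has_vector_derivative g' t) (at t within S)"
    using smooth_on_derivE[OF h(3)] by metis
  show "\<exists>h'\<in>{\<lambda>t. f t + g t | f g. smooth_on S f \<and> smooth_on S g}.
      \<forall>t\<in>S. (h has_vector_derivative h' t) (at t within S)"
    using f' g' by (intro bexI[of _ "\<lambda>t. f' t + g' t"]) (auto simp: h intro: has_vector_derivative_add)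
qed (use assms in blast)

lemma smooth_on_bounded_linear:
  assumes L: "bounded_linear L" and f: "smooth_on S f"
  shows "smooth_on S (\<lambda>t. L (f t))"
proof (rule smooth_on_coinduct[where F = "{\<lambda>t. L (f t) | f. smooth_on S f}"])
  fix h assume "h \<in> {\<lambda>t. L (f t) | f. smooth_on S f}"
  then obtain f where h: "h = (\<lambda>t. L (f t))" "smooth_on S f" by blast
  obtain f' where f': "smooth_on S f'" "\<And>t. t \<in> S \<Longrightarrow> (f has_vector_derivative f' t) (at t within S)"
    using smooth_on_derivE[OF h(2)] by metis
  show "\<exists>h'\<in>{\<lambda>t. L (f t) | f. smooth_on S f}. \<forall>t\<in>S. (h has_vector_derivative h' t) (at t within S)"
    using f' by (intro bexI[of _ "\<lambda>t. L (f' t)"]) (auto simp: h intro: bounded_linear.has_vector_derivative[OF L])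
qed (use f in blast)

lemma smooth_on_sum:
  "(\<And>i. i \<in> I \<Longrightarrow> smooth_on S (f i)) \<Longrightarrow> smooth_on S (\<lambda>t. \<Sum>i\<in>I. f i t)"
  by (induction I rule: infinite_finite_induct) (auto intro: smooth_on_const smooth_on_add)

lemma smooth_on_affine:
  assumes f: "smooth_on UNIV f"
  shows "smooth_on S (\<lambda>t. f (a * t + b))"
proof (rule smooth_on_coinduct[where F = "{\<lambda>t. f (a * t + b) | f. smooth_on UNIV f}"])
  fix h :: "real \<Rightarrow> 'a" assume "h \<in> {\<lambda>t. f (a * t + b) | f. smooth_on UNIV f}"
  then obtain f where h: "h = (\<lambda>t. f (a * t + b))" "smooth_on UNIV f" by blast
  obtain f' where f': "smooth_on UNIV f'" "\<And>t. (f has_vector_derivative f' t) (at t)"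
    using smooth_on_derivE[OF h(2)] by (metis UNIV_I)
  have "smooth_on UNIV (\<lambda>t. a *\<^sub>R f' t)"
    by (rule smooth_on_bounded_linear[OF bounded_linear_scaleR_right f'(1)])
  moreover have "((\<lambda>t. f (a * t + b)) has_vector_derivative a *\<^sub>R f' (a * t + b)) (at t within S)" for t
  proof -
    have "((\<lambda>t. a * t + b) has_vector_derivative a) (at t within S)"
      by (auto intro!: derivative_eq_intros)
    from vector_diff_chain_within[OF this has_vector_derivative_at_within[OF f'(2)]]
    show ?thesis by (simp add: o_def)
  qed
  ultimately show "\<exists>h'\<in>{\<lambda>t. f (a * t + b) | f. smooth_on UNIV f}. \<forall>t\<in>S. (h has_vector_derivative h' t) (at t within S)"
    unfolding h(1) by (intro bexI[of _ "\<lambda>t. a *\<^sub>R f' (a * t + b)"]) auto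
qed (use f in blast)

lemma smooth_on_continuous: "smooth_on S f \<Longrightarrow> continuous_on S f"
proof -
  assume "smooth_on S f"
  then obtain f' where "\<And>t. t \<in> S \<Longrightarrow> (f has_vector_derivative f' t) (at t within S)"
    using smooth_on_derivE by blast
  then show "continuous_on S f"
    unfolding continuous_on_eq_continuous_within by (blast intro: has_vector_derivative_continuous)
qed

text \<open>Closing a family of functions under sums and products turns an algebraic differential
  equation into smoothness.\<close>

inductive_set falg :: "(real \<Rightarrow> real) set \<Rightarrow> (real \<Rightarrow> real) set" for B where
  base: "b \<in> B \<Longrightarrow> b \<in> falg B"
| add: "f \<in> falg B \<Longrightarrow> g \<in> falg B \<Longrightarrow> (\<lambda>t. f t + g t) \<in> falg B"
| mult: "f \<in> falg B \<Longrightarrow> g \<in> falg B \<Longrightarrow> (\<lambda>t. f t * g t) \<in> falg B"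

lemma smooth_on_falg:
  assumes B: "\<And>b. b \<in> B \<Longrightarrow> \<exists>b'\<in>falg B. \<forall>t\<in>S. (b has_vector_derivative b' t) (at t within S)"
    and f: "f \<in> falg B"
  shows "smooth_on S f"
proof (rule smooth_on_coinduct[OF f])
  fix g assume "g \<in> falg B"
  then show "\<exists>g'\<in>falg B. \<forall>t\<in>S. (g has_vector_derivative g' t) (at t within S)"
  proof induction
    case (base b)
    then show ?case by (rule B)
  next
    case (add f g)
    then obtain f' g' where "f' \<in> falg B" "g' \<in> falg B"
      "\<forall>t\<in>S. (f has_vector_derivative f' t) (at t within S)"
      "\<forall>t\<in>S. (g has_vector_derivative g' t) (at t within S)" by blast
    then show ?case
      by (intro bexI[of _ "\<lambda>t. f' t + g' t"]) (auto intro: falg.add has_vector_derivative_add)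
  next
    case (mult f g)
    then obtain f' g' where "f' \<in> falg B" "g' \<in> falg B"
      "\<forall>t\<in>S. (f has_vector_derivative f' t) (at t within S)"
      "\<forall>t\<in>S. (g has_vector_derivative g' t) (at t within S)" by blast
    then show ?case
      using mult.hyps
      by (intro bexI[of _ "\<lambda>t. f t * g' t + f' t * g t"]) (auto intro: falg.add falg.mult has_vector_derivative_mult)
  qed
qed

lemma smooth_on_mult:
  fixes f g :: "real \<Rightarrow> real"
  assumes "smooth_on S f" "smooth_on S g"
  shows "smooth_on S (\<lambda>t. f t * g t)"
proof (rule smooth_on_falg[where B = "{f. smooth_on S f}"])
  fix b :: "real \<Rightarrow> real" assume "b \<in> {f. smooth_on S f}"
  then show "\<exists>b'\<in>falg {f. smooth_on S f}. \<forall>t\<in>S. (b has_vector_derivative b' t) (at t within S)"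
    using smooth_on_derivE[of S b] by (metis falg.base mem_Collect_eq)
qed (use assms in \<open>auto intro: falg.mult falg.base\<close>)

text \<open>The derivative of \<open>inverse (h t)\<close> is a polynomial in itself and a smooth
  function, so the algebra generated by it and all smooth functions is closed under
  differentiation.\<close>

lemma smooth_on_inverse:
  fixes h :: "real \<Rightarrow> real"
  assumes h: "smooth_on S h" and nz: "\<And>t. t \<in> S \<Longrightarrow> h t \<noteq> 0"
  shows "smooth_on S (\<lambda>t. inverse (h t))"
proof (rule smooth_on_falg[where B = "insert (\<lambda>t. inverse (h t)) {f. smooth_on S f}"])
  let ?B = "insert (\<lambda>t. inverse (h t)) {f. smooth_on S f}"
  fix b :: "real \<Rightarrow> real" assume b: "b \<in> ?B"
  show "\<exists>b'\<in>falg ?B. \<forall>t\<in>S. (b has_vector_derivative b' t) (at t within S)"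
  proof (cases "smooth_on S b")
    case True
    then show ?thesis
      using smooth_on_derivE[of S b] by (metis falg.base mem_Collect_eq insertCI)
  next
    case False
    then have b: "b = (\<lambda>t. inverse (h t))" using b by auto
    obtain h' where h': "smooth_on S h'" "\<And>t. t \<in> S \<Longrightarrow> (h has_vector_derivative h' t) (at t within S)"
      using smooth_on_derivE[OF h] by metis
    have "smooth_on S (\<lambda>t. - h' t)"
      using smooth_on_bounded_linear[OF bounded_linear_minus[OF bounded_linear_ident] h'(1)] .
    then have "(\<lambda>t. (- h' t * inverse (h t)) * inverse (h t)) \<in> falg ?B"
      by (intro falg.mult falg.base) auto
    moreover have "((\<lambda>t. inverse (h t)) has_vector_derivative (- h' t * inverse (h t)) * inverse (h t)) (at t within S)"
      if "t \<in> S" for t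
      using h'(2)[OF that] nz[OF that]
      unfolding has_real_derivative_iff_has_vector_derivative[symmetric]
      by (auto intro!: derivative_eq_intros simp: power2_eq_square)
    ultimately show ?thesis unfolding b by (intro bexI) auto
  qed
qed (auto intro: falg.base)

text \<open>The case \<open>k = 0\<close> is the classical function \<open>exp (- 1 / x)\<close>,
  extended by zero. The powers of \<open>inverse x\<close> make the linear span of the family closed
  under differentiation.\<close>

definition flat :: "nat \<Rightarrow> real \<Rightarrow> real" where
  "flat k x = (if 0 < x then inverse x ^ k * exp (- inverse x) else 0)"

lemma flat_deriv:
  "(flat k has_real_derivative - real k * flat (Suc k) x + flat (Suc (Suc k)) x) (at x)"
proof -
  consider "0 < x" | "x < 0" | "x = 0" by linarith
  then show ?thesis
  proof cases
    case 1
    have "((\<lambda>x. inverse x ^ k * exp (- inverse x)) has_real_derivative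
        (real k * (inverse x ^ (k - 1) * - (inverse x * inverse x)) * exp (- inverse x)
          + exp (- inverse x) * (inverse x * inverse x) * inverse x ^ k)) (at x)"
      using 1 by (auto intro!: derivative_eq_intros)
    moreover have "real k * (inverse x ^ (k - 1) * - (inverse x * inverse x)) * exp (- inverse x)
          + exp (- inverse x) * (inverse x * inverse x) * inverse x ^ k
        = - real k * flat (Suc k) x + flat (Suc (Suc k)) x"
      using 1 by (cases k) (simp_all add: flat_def algebra_simps)
    ultimately have "((\<lambda>x. inverse x ^ k * exp (- inverse x)) has_real_derivative
        - real k * flat (Suc k) x + flat (Suc (Suc k)) x) (at x)"
      by simp
    then show ?thesis
      by (rule has_field_derivative_transform_within_open[of _ _ _ "{0<..}"]) (use 1 in \<open>auto simp: flat_def\<close>)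
  next
    case 2
    have "((\<lambda>x. 0) has_real_derivative - real k * flat (Suc k) x + flat (Suc (Suc k)) x) (at x)"
      using 2 by (simp add: flat_def)
    then show ?thesis
      by (rule has_field_derivative_transform_within_open[of _ _ _ "{..<0}"]) (use 2 in \<open>auto simp: flat_def\<close>)
  next
    case 3
    \<comment> \<open>With \<open>y\<close> as the inverse of the argument this is the difference
      quotient at zero from the right; the exponential outgrows every power.\<close>
    have "((\<lambda>y. y ^ Suc k / exp y) \<longlongrightarrow> 0) (at_top :: real filter)" by (rule tendsto_power_div_exp_0)
    then have "((\<lambda>y. inverse y ^ Suc k / exp (inverse y)) \<longlongrightarrow> 0) (at_right (0 :: real))"
      by (rule filterlim_compose) (rule filterlim_inverse_at_top_right)
    then have right: "((\<lambda>y. (flat k y - flat k 0) / (y - 0)) \<longlongrightarrow> 0) (at_right 0)"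
    proof (rule Lim_transform_eventually)
      show "\<forall>\<^sub>F y in at_right 0. inverse y ^ Suc k / exp (inverse y) = (flat k y - flat k 0) / (y - 0)"
        using eventually_at_right_less[of 0]
        by eventually_elim (simp add: flat_def exp_minus field_simps)
    qed
    have left: "((\<lambda>y. (flat k y - flat k 0) / (y - 0)) \<longlongrightarrow> 0) (at_left 0)"
    proof (rule Lim_transform_eventually[OF tendsto_const])
      show "\<forall>\<^sub>F y in at_left 0. (0::real) = (flat k y - flat k 0) / (y - 0)"
        unfolding eventually_at_left_field by (intro exI[of _ "-1"]) (auto simp: flat_def)
    qed
    have "((\<lambda>y. (flat k y - flat k 0) / (y - 0)) \<longlongrightarrow> 0) (at 0)"
      using left right by (simp add: filterlim_split_at)
    then show ?thesis
      unfolding has_field_derivative_iff 3 by (simp add: flat_def)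
  qed
qed

lemma smooth_flat: "smooth_on UNIV (flat k)"
proof (rule smooth_on_falg[where B = "range flat \<union> range (\<lambda>c _. c)"])
  let ?B = "range flat \<union> range (\<lambda>c _. c) :: (real \<Rightarrow> real) set"
  fix b assume "b \<in> ?B"
  then consider k where "b = flat k" | c where "b = (\<lambda>_. c)" by blast
  then show "\<exists>b'\<in>falg ?B. \<forall>t\<in>UNIV. (b has_vector_derivative b' t) (at t)"
  proof cases
    case 1
    have "(\<lambda>x. - real k * flat (Suc k) x + flat (Suc (Suc k)) x) \<in> falg ?B"
      by (intro falg.add falg.mult falg.base) auto
    then show ?thesis
      unfolding 1 using flat_deriv[of k]
      by (intro bexI) (auto simp: has_real_derivative_iff_has_vector_derivative)
  next
    case 2
    have "(\<lambda>_. 0) \<in> falg ?B" by (intro falg.base) auto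
    then show ?thesis unfolding 2 by (intro bexI) auto
  qed
qed (auto intro: falg.base)

text \<open>The usual smooth transition from zero to one on the unit interval. The denominator is
  positive everywhere, since \<open>t\<close> or \<open>1 - t\<close> is.\<close>

definition step :: "real \<Rightarrow> real" where
  "step t = flat 0 t / (flat 0 t + flat 0 (1 - t))"

lemma flat_pos: "0 < x \<Longrightarrow> 0 < flat k x" and flat_nonneg: "0 \<le> flat k x"
  and flat_zero: "x \<le> 0 \<Longrightarrow> flat k x = 0"
  by (auto simp: flat_def)

lemma flat_sum_pos: "0 < flat 0 t + flat 0 (1 - t)"
  using flat_pos[of t 0] flat_pos[of "1 - t" 0] flat_nonneg[of 0 t] flat_nonneg[of 0 "1 - t"]
  by (cases "0 < t") (auto intro: add_pos_nonneg add_nonneg_pos)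

lemma smooth_step: "smooth_on UNIV step"
proof -
  have "smooth_on UNIV (\<lambda>t. flat 0 (- 1 * t + 1))" by (rule smooth_on_affine[OF smooth_flat])
  then have "smooth_on UNIV (\<lambda>t. flat 0 t + flat 0 (1 - t))"
    using smooth_on_add[OF smooth_flat] by simp
  then have "smooth_on UNIV (\<lambda>t. flat 0 t * inverse (flat 0 t + flat 0 (1 - t)))"
    using flat_sum_pos by (intro smooth_on_mult smooth_flat smooth_on_inverse) (auto simp: less_le)
  then show ?thesis by (simp add: step_def[abs_def] divide_inverse)
qed

lemma step_le_0: "t \<le> 0 \<Longrightarrow> step t = 0"
  by (simp add: step_def flat_zero)

lemma step_ge_1: "1 \<le> t \<Longrightarrow> step t = 1"
  using flat_sum_pos[of t] by (simp add: step_def flat_zero)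

lemma step_bounds: "0 \<le> step t" "step t \<le> 1"
  using flat_sum_pos[of t] flat_nonneg[of 0 t] flat_nonneg[of 0 "1 - t"] by (auto simp: step_def)

text \<open>Positivity of the derivative inside the interval is what makes the walls on a chain
  braid be crossed transversely.\<close>

lemma step_deriv:
  assumes "0 < t" "t < 1"
  obtains d where "0 < d" "(step has_real_derivative d) (at t)"
proof -
  define D where "D = flat 0 t + flat 0 (1 - t)"
  have D: "0 < D" unfolding D_def by (rule flat_sum_pos)
  have e: "(flat 0 has_real_derivative flat 2 t) (at t)"
    using flat_deriv[of 0 t] by (simp add: numeral_2_eq_2)
  have "(flat 0 has_real_derivative flat 2 (1 - t)) (at (1 - t))"
    using flat_deriv[of 0 "1 - t"] by (simp add: numeral_2_eq_2)
  then have f: "((\<lambda>t. flat 0 (1 - t)) has_real_derivative - flat 2 (1 - t)) (at t)"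
    by (rule DERIV_chain2[THEN DERIV_cong]) (auto intro!: derivative_eq_intros)
  have "(step has_real_derivative (flat 2 t * D - flat 0 t * (flat 2 t + - flat 2 (1 - t))) / (D * D)) (at t)"
    unfolding step_def[abs_def] D_def using flat_sum_pos[of t]
    by (intro DERIV_cong[OF DERIV_divide[OF e DERIV_add[OF e f]]]) auto
  moreover have "flat 2 t * D - flat 0 t * (flat 2 t + - flat 2 (1 - t)) = flat 2 t * flat 0 (1 - t) + flat 0 t * flat 2 (1 - t)"
    by (simp add: D_def algebra_simps)
  moreover have "0 < flat 2 t * flat 0 (1 - t) + flat 0 t * flat 2 (1 - t)"
    using assms by (intro add_pos_pos mult_pos_pos flat_pos) auto
  ultimately show ?thesis using D by (intro that) auto
qed

section \<open>The configuration space as a subspace of the function space\<close>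

section \<open>Configuration spaces\<close>

abbreviation Conf :: "nat \<Rightarrow> (nat \<Rightarrow> complex) set" where
  "Conf n \<equiv> topspace (config_space n)"

lemma Conf_iff: "z \<in> Conf n \<longleftrightarrow> z \<in> extensional {1..n} \<and> inj_on z {1..n}"
  by (auto simp: config_space_def PiE_def)

lemma base_config_Conf: "base_config n \<in> Conf n"
  using base_config_inj by (simp add: Conf_iff base_config_def)

lemma continuous_map_config_space:
  "continuous_map X (config_space n) f \<longleftrightarrow>
    (\<forall>x\<in>topspace X. f x \<in> Conf n) \<and> (\<forall>j\<in>{1..n}. continuous_map X euclidean (\<lambda>x. f x j))"
  unfolding config_space_def continuous_map_in_subtopology continuous_map_componentwise
  by (auto simp: PiE_def)

text \<open>Extensional functions are constant outside \<open>{1..n}\<close>, so the product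
  topology over \<open>{1..n}\<close> and that over all indices agree on configurations. Thus
  \<open>path\<close> and \<open>homotopic_paths\<close> become available.\<close>

lemma continuous_map_Conf:
  "continuous_map X (config_space n) f \<longleftrightarrow> continuous_map X (top_of_set (Conf n)) f"
proof -
  have "continuous_map X euclidean f \<longleftrightarrow> (\<forall>j\<in>{1..n}. continuous_map X euclidean (\<lambda>x. f x j))"
    if f: "\<forall>x\<in>topspace X. f x \<in> Conf n"
  proof -
    have "continuous_map X euclidean (\<lambda>x. f x j)" if "j \<notin> {1..n}" for j
    proof (rule continuous_map_eq[of _ _ "\<lambda>_. undefined"])
      show "undefined = f x j" if "x \<in> topspace X" for x
        using f that \<open>j \<notin> {1..n}\<close> by (auto simp: Conf_iff extensional_def)
    qed simp
    then show ?thesis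
      using continuous_map_componentwise_UNIV[of X "\<lambda>_. euclidean" f]
      unfolding euclidean_product_topology[symmetric] by blast
  qed
  then show ?thesis
    unfolding continuous_map_config_space continuous_map_in_subtopology by auto
qed

text \<open>Continuous loops mediate between smooth isotopy of braids and homotopy of paths.\<close>

definition bloop :: "nat \<Rightarrow> (real \<Rightarrow> nat \<Rightarrow> complex) \<Rightarrow> bool" where
  "bloop n p \<longleftrightarrow> path p \<and> path_image p \<subseteq> Conf n \<and> pathstart p = base_config n \<and> pathfinish p = base_config n"

lemma path_Conf_iff:
  "path p \<and> path_image p \<subseteq> Conf n \<longleftrightarrow> cpath n p \<and> (\<forall>t\<in>{0..1}. p t \<in> Conf n)"
  using continuous_map_Conf[of "top_of_set {0..1}" n p]
  by (auto simp: path_def path_image_def cpath_def continuous_map_config_space continuous_map_in_subtopology)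

lemma bloop_bpath: "bloop n p \<Longrightarrow> bpath n p"
  using path_Conf_iff[of p n] by (auto simp: bloop_def bpath_def Conf_iff)

lemma bloop_ends: "bloop n p \<Longrightarrow> p 0 = base_config n \<and> p 1 = base_config n"
  by (simp add: bloop_def pathstart_def pathfinish_def)

lemma pure_braid_bloop:
  assumes "pure_braid n \<beta>"
  shows "bloop n \<beta>"
proof -
  have "path \<beta> \<and> path_image \<beta> \<subseteq> Conf n"
    unfolding path_Conf_iff using assms smooth_on_continuous by (auto simp: pure_braid_def cpath_def)
  then show ?thesis using assms by (auto simp: bloop_def pure_braid_def pathstart_def pathfinish_def)
qed

lemma collinear_triples_cong:
  assumes "\<And>j. j \<in> {1..n} \<Longrightarrow> z j = z' j"
  shows "collinear_triples n z = collinear_triples n z'"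
proof -
  have "z ` T = z' ` T" if "T \<subseteq> {1..n}" for T using assms that by (intro image_cong) auto
  then show ?thesis unfolding collinear_triples_def by (metis (no_types, lifting))
qed

section \<open>Smooth approximation of loops by moves of one point\<close>

section \<open>Chain braids\<close>

text \<open>A chain braid moves one point at a time along a segment, stopping smoothly at its ends.\<close>

definition chain :: "nat \<Rightarrow> nat \<Rightarrow> (nat \<Rightarrow> nat \<Rightarrow> complex) \<Rightarrow> bool" where
  "chain n M c \<longleftrightarrow> c 0 = base_config n \<and> c M = base_config n \<and> (\<forall>w<M. gstep n (c w) (c (Suc w)))"

text \<open>Summand \<open>w\<close> grows from zero to the full displacement while
  \<open>M * t\<close> runs from \<open>w\<close> to \<open>w + 1\<close> and is constant elsewhere.
  A single sum over all moves makes smoothness immediate, without gluing at the division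
  points.\<close>

definition chain_braid :: "nat \<Rightarrow> nat \<Rightarrow> (nat \<Rightarrow> nat \<Rightarrow> complex) \<Rightarrow> real \<Rightarrow> nat \<Rightarrow> complex" where
  "chain_braid n M c t = (\<lambda>j\<in>{1..n}. c 0 j + (\<Sum>w<M. of_real (step (real M * t - real w)) * (c (Suc w) j - c w j)))"

text \<open>Each of \<open>N\<close> time intervals is served by one round of \<open>n\<close>
  moves; the last round ends exactly at the base configuration by \<open>round_exact\<close>. The
  statement covers all large \<open>N\<close>, so that two loops can be approximated with equally
  many moves.\<close>

lemma chain_approx:
  assumes n: "0 < n" and p: "bloop n p" and e: "0 < e"
  obtains N0 where "\<And>N. N0 \<le> N \<Longrightarrow> 0 < N \<and> (\<exists>c. chain n (n * N) c \<and> (\<forall>w<n * N. \<forall>t\<in>{0..1}.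
     real w \<le> real (n * N) * t \<longrightarrow> real (n * N) * t \<le> real (Suc w) \<longrightarrow> c w \<in> nbox n (p t) e \<and> c (Suc w) \<in> nbox n (p t) e))"
proof -
  have cp: "cpath n p" using bloop_bpath[OF p] by (simp add: bpath_def)
  have p01: "p 0 = base_config n" "p 1 = base_config n" using bloop_ends[OF p] by auto
  obtain e0 where e0: "0 < e0" "\<And>z. z \<in> nbox n (base_config n) e0 \<Longrightarrow> generic n z"
    using generic_box[OF base_config_generic] by metis
  \<comment> \<open>Halved because two distances add up: from a chosen configuration to the loop at
    its division point, and from there to the loop at time \<open>t\<close> or at its end.\<close>
  define \<eta> where "\<eta> = min e e0 / 2"
  have \<eta>: "0 < \<eta>" "\<eta> + \<eta> \<le> e" "\<eta> + \<eta> \<le> e0" using e e0(1) by (auto simp: \<eta>_def)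
  obtain d where d: "0 < d" "\<forall>s\<in>{0..1}. \<forall>t\<in>{0..1}. \<bar>s - t\<bar> < d \<longrightarrow> p s \<in> nbox n (p t) \<eta>"
    using cpath_uniform[OF cp \<eta>(1)] by blast
  obtain N0 :: nat where N0: "1 / d < real N0" using reals_Archimedean2 by blast
  show ?thesis
  proof (rule that[of "max N0 1"])
    fix N assume N: "max N0 1 \<le> N"
    then have N1: "0 < N" "1 / real N < d"
    proof -
      show "0 < N" using N by simp
      have "1 / d < real N" using N N0 by linarith
      then show "1 / real N < d" using \<open>0 < N\<close> d(1) by (simp add: field_simps)
    qed
    define \<tau> where "\<tau> = (\<lambda>r. real r / real N)"
    have \<tau>: "\<tau> r \<in> {0..1}" if "r \<le> N" for r using that N1 by (auto simp: \<tau>_def)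
    \<comment> \<open>After round \<open>N\<close> only the end conditions are required, so the
      dependent choice can continue forever with constant rounds.\<close>
    define R where "R = (\<lambda>r P (P' :: nat \<Rightarrow> complex) C. C 0 = P \<and> C n = P' \<and>
      (Suc r \<le> N \<longrightarrow> (\<forall>i<n. gstep n (C i) (C (Suc i))) \<and> (\<forall>i\<le>n. \<forall>j. C i j \<in> {P j, P' j})))"
    have "\<exists>P. \<forall>r. ((r \<le> N \<longrightarrow> generic n (P r) \<and> P r \<in> nbox n (p (\<tau> r)) \<eta>) \<and>
       (r = 0 \<or> r = N \<longrightarrow> P r = base_config n) \<and> (\<forall>j. j \<notin> {1..n} \<longrightarrow> P r j = base_config n j)) \<and> (\<exists>C. R r (P r) (P (Suc r)) C)"
    proof (rule dependent_nat_choice)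
      show "\<exists>P. (0 \<le> N \<longrightarrow> generic n P \<and> P \<in> nbox n (p (\<tau> 0)) \<eta>) \<and>
        (0 = 0 \<or> 0 = N \<longrightarrow> P = base_config n) \<and> (\<forall>j. j \<notin> {1..n} \<longrightarrow> P j = base_config n j)"
        using base_config_generic \<eta>(1) p01 by (intro exI[of _ "base_config n"]) (simp add: \<tau>_def)
      fix P r
      assume P: "(r \<le> N \<longrightarrow> generic n P \<and> P \<in> nbox n (p (\<tau> r)) \<eta>) \<and> (r = 0 \<or> r = N \<longrightarrow> P = base_config n) \<and>
        (\<forall>j. j \<notin> {1..n} \<longrightarrow> P j = base_config n j)"
      consider "Suc r < N" | "Suc r = N" | "N < Suc r" by linarith
      then show "\<exists>P'. ((Suc r \<le> N \<longrightarrow> generic n P' \<and> P' \<in> nbox n (p (\<tau> (Suc r))) \<eta>) \<and>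
        (Suc r = 0 \<or> Suc r = N \<longrightarrow> P' = base_config n) \<and> (\<forall>j. j \<notin> {1..n} \<longrightarrow> P' j = base_config n j)) \<and> (\<exists>C. R r P P' C)"
      proof cases
        case 1
        then have gP: "generic n P" using P by simp
        obtain C where C: "C 0 = P" "generic n (C n)" "\<And>i. i < n \<Longrightarrow> gstep n (C i) (C (Suc i))"
          "\<And>j. j \<in> {1..n} \<Longrightarrow> dist (p (\<tau> (Suc r)) j) (C n j) < \<eta>" "\<And>i j. i \<le> n \<Longrightarrow> C i j \<in> {P j, C n j}"
          "\<And>j. j \<notin> {1..n} \<Longrightarrow> C n j = P j"
          using round_approx[OF gP \<eta>(1), of "p (\<tau> (Suc r))"] by blast
        have "R r P (C n) C" using C by (simp add: R_def)
        then show ?thesis using 1 C P by (intro exI[of _ "C n"]) (auto simp: nbox_def)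
      next
        case 2
        have "\<bar>\<tau> r - 1\<bar> < d" using 2 N1 by (auto simp: \<tau>_def field_simps)
        then have "p (\<tau> r) \<in> nbox n (p 1) \<eta>" using d(2) \<tau>[of r] 2 by auto
        then have "nbox n (p (\<tau> r)) \<eta> \<subseteq> nbox n (base_config n) e0"
          using nbox_add[of "p (\<tau> r)" n "p 1" \<eta> \<eta>] nbox_mono[OF \<eta>(3), of n "p 1"] p01 by auto
        then have Pb: "P \<in> nbox n (base_config n) e0" using P 2 by auto
        obtain C where C: "C 0 = P" "\<And>i. i < n \<Longrightarrow> gstep n (C i) (C (Suc i))"
          "\<And>j. j \<in> {1..n} \<Longrightarrow> C n j = base_config n j" "\<And>i j. C i j \<in> {P j, base_config n j}"
          "\<And>j. j \<notin> {1..n} \<Longrightarrow> C n j = P j"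
          using round_exact[OF e0(2) Pb] by blast
        have Cn: "C n = base_config n" using C(3,5) P by (metis ext)
        have "R r P (base_config n) C" using C Cn by (simp add: R_def)
        moreover have "\<tau> (Suc r) = 1" using 2 N1 by (simp add: \<tau>_def)
        ultimately show ?thesis
          using 2 p01 \<eta>(1) base_config_generic by (intro exI[of _ "base_config n"]) auto
      next
        case 3
        have "R r P P (\<lambda>_. P)" using 3 by (simp add: R_def)
        then show ?thesis using 3 P by (intro exI[of _ P]) auto
      qed
    qed
    then obtain P where P: "\<And>r. r \<le> N \<Longrightarrow> P r \<in> nbox n (p (\<tau> r)) \<eta>" "P 0 = base_config n" "P N = base_config n"
      and "\<forall>r. \<exists>C. R r (P r) (P (Suc r)) C" by blast
    then obtain C where C: "\<And>r. R r (P r) (P (Suc r)) (C r)" by metis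
    \<comment> \<open>Move \<open>w\<close> is number \<open>w mod n\<close> of round
      \<open>w div n\<close>. The end of a round is the start of the next, so \<open>c_Suc\<close>
      holds across rounds too.\<close>
    define c where "c = (\<lambda>w. C (w div n) (w mod n))"
    have c_Suc: "c (Suc w) = C (w div n) (Suc (w mod n))" for w
    proof (cases "Suc (w mod n) = n")
      case True
      then have "Suc w mod n = 0" "Suc w div n = Suc (w div n)" using n by (simp_all add: mod_Suc div_Suc)
      then show ?thesis using C[of "w div n"] C[of "Suc (w div n)"] True by (simp add: c_def R_def)
    next
      case False
      then have "Suc w mod n = Suc (w mod n)" "Suc w div n = w div n" by (simp_all add: mod_Suc div_Suc)
      then show ?thesis by (simp add: c_def)
    qed
    have div: "w div n < N" "w mod n < n" if "w < n * N" for w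
      using that n by (auto simp: less_mult_imp_div_less mult.commute)
    have "chain n (n * N) c"
      unfolding chain_def
    proof (intro conjI allI impI)
      show "c 0 = base_config n" using C[of 0] P(2) by (simp add: c_def R_def)
      show "c (n * N) = base_config n" using C[of N] P(3) n by (simp add: c_def R_def)
      show "gstep n (c w) (c (Suc w))" if "w < n * N" for w
        unfolding c_Suc using C[of "w div n"] div[OF that] by (simp add: c_def R_def)
    qed
    moreover have "c w \<in> nbox n (p t) e \<and> c (Suc w) \<in> nbox n (p t) e"
      if w: "w < n * N" and t: "t \<in> {0..1}" "real w \<le> real (n * N) * t" "real (n * N) * t \<le> real (Suc w)" for w t
    proof -
      define r where "r = w div n"
      have r: "r < N" using div[OF w] by (simp add: r_def)
      have "n * r \<le> w" "Suc w \<le> n * Suc r"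
        using n div(2)[OF w] mult_div_mod_eq[of n w] by (simp_all add: r_def) (metis mult_div_mod_eq Suc_leI add_Suc_right add_le_cancel_left add.commute)
      then have "real (n * r) \<le> real (n * N) * t" "real (n * N) * t \<le> real (n * Suc r)"
        using t by (meson of_nat_le_iff order_trans)+
      then have "real n * real r \<le> real n * (real N * t)" "real n * (real N * t) \<le> real n * real (Suc r)"
        by (simp_all only: of_nat_mult mult.assoc)
      then have "real r \<le> real N * t" "real N * t \<le> real (Suc r)" using n by simp_all
      then have "\<bar>\<tau> r - t\<bar> \<le> 1 / real N" "\<bar>\<tau> (Suc r) - t\<bar> \<le> 1 / real N"
      proof -
        assume le: "real r \<le> real N * t" "real N * t \<le> real (Suc r)"
        have "\<tau> r \<le> t" "t \<le> \<tau> (Suc r)"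
          using le N1(1) by (simp_all add: \<tau>_def divide_le_eq pos_le_divide_eq mult.commute)
        moreover have "\<tau> (Suc r) = \<tau> r + 1 / real N" by (simp add: \<tau>_def add_divide_distrib)
        ultimately show "\<bar>\<tau> r - t\<bar> \<le> 1 / real N" "\<bar>\<tau> (Suc r) - t\<bar> \<le> 1 / real N" by linarith+
      qed
      then have "p (\<tau> r) \<in> nbox n (p t) \<eta>" "p (\<tau> (Suc r)) \<in> nbox n (p t) \<eta>"
        using d(2) \<tau>[of r] \<tau>[of "Suc r"] t(1) r N1(2) by auto
      then have PP: "P r \<in> nbox n (p t) e" "P (Suc r) \<in> nbox n (p t) e"
        using P(1)[of r] P(1)[of "Suc r"] r nbox_add[of _ n "p t" \<eta> \<eta>] nbox_mono[OF \<eta>(2), of n "p t"]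
        by (meson Suc_leI less_imp_le_nat subsetD)+
      have "C r i \<in> nbox n (p t) e" if i: "i \<le> n" for i
        unfolding nbox_def
      proof (intro CollectI ballI)
        fix j assume j: "j \<in> {1..n}"
        have "C r i j = P r j \<or> C r i j = P (Suc r) j" using C[of r] i r by (simp add: R_def)
        then show "dist (p t j) (C r i j) < e" using PP j by (auto simp: nbox_def)
      qed
      then show ?thesis
        unfolding c_Suc unfolding c_def r_def[symmetric] using div(2)[OF w] by simp
    qed
    ultimately show "0 < N \<and> (\<exists>c. chain n (n * N) c \<and> (\<forall>w<n * N. \<forall>t\<in>{0..1}.
      real w \<le> real (n * N) * t \<longrightarrow> real (n * N) * t \<le> real (Suc w) \<longrightarrow> c w \<in> nbox n (p t) e \<and> c (Suc w) \<in> nbox n (p t) e))"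
      using N1(1) by blast
  qed
qed

text \<open>In window \<open>w\<close> the earlier summands are complete and telescope to
  \<open>c w - c 0\<close>, and the later ones are still zero.\<close>

lemma chain_braid_seg:
  assumes w: "w < M" "real w \<le> real M * t" "real M * t \<le> real (Suc w)" and j: "j \<in> {1..n}"
  shows "chain_braid n M c t j = seg (c w) (c (Suc w)) (step (real M * t - real w)) j"
proof -
  let ?f = "\<lambda>v. of_real (step (real M * t - real v)) * (c (Suc v) j - c v j)"
  have "(\<Sum>v<M. ?f v) = (\<Sum>v<Suc w. ?f v) + (\<Sum>v=Suc w..<M. ?f v)"
    unfolding lessThan_atLeast0 using w(1) by (intro sum.atLeastLessThan_concat[symmetric]) auto
  also have "(\<Sum>v<Suc w. ?f v) = (\<Sum>v<w. ?f v) + ?f w" by (rule sum.lessThan_Suc)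
  also have "(\<Sum>v=Suc w..<M. ?f v) = 0"
    using w(3) by (intro sum.neutral) (auto simp: step_le_0)
  also have "(\<Sum>v<w. ?f v) = (\<Sum>v<w. c (Suc v) j - c v j)"
  proof (rule sum.cong)
    fix v assume "v \<in> {..<w}"
    then have "1 \<le> real M * t - real v" using w(2) by auto
    then show "?f v = c (Suc v) j - c v j" by (simp add: step_ge_1)
  qed simp
  also have "\<dots> = c w j - c 0 j" by (rule sum_lessThan_telescope)
  finally show ?thesis using j by (simp add: chain_braid_def seg_def)
qed

lemma window_exists:
  assumes "0 < M" "t \<in> {0..1}"
  obtains w where "w < M" "real w \<le> real M * t" "real M * t \<le> real (Suc w)"
proof (cases "t = 1")
  case True
  then show ?thesis using assms(1) that[of "M - 1"] by simp
next
  case False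
  have 0: "0 \<le> real M * t" "real M * t < real M" using assms False by auto
  show ?thesis
    by (rule that[of "nat \<lfloor>real M * t\<rfloor>"]) (use 0 in linarith)+
qed

lemma chain_braid_near:
  assumes M: "0 < M" and near: "\<forall>w<M. \<forall>t\<in>{0..1}. real w \<le> real M * t \<longrightarrow> real M * t \<le> real (Suc w) \<longrightarrow>
      c w \<in> nbox n (p t) e \<and> c (Suc w) \<in> nbox n (p t) e"
    and t: "t \<in> {0..1}"
  shows "chain_braid n M c t \<in> nbox n (p t) e"
proof -
  obtain w where w: "w < M" "real w \<le> real M * t" "real M * t \<le> real (Suc w)"
    using window_exists[OF M t] by blast
  have "seg (c w) (c (Suc w)) (step (real M * t - real w)) \<in> nbox n (p t) e"
    using near w t step_bounds by (intro nbox_seg) auto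
  then show ?thesis
    using chain_braid_seg[OF w] by (auto simp: nbox_def)
qed

lemma chain_braid_smooth: "j \<in> {1..n} \<Longrightarrow> smooth_on {0..1} (\<lambda>t. chain_braid n M c t j)"
proof -
  assume j: "j \<in> {1..n}"
  have "smooth_on {0..1} (\<lambda>t. of_real (step (real M * t - real w)) * (c (Suc w) j - c w j))" for w
  proof -
    have "smooth_on {0..1} (\<lambda>t. step (real M * t + - real w))" by (rule smooth_on_affine[OF smooth_step])
    then have "smooth_on {0..1} (\<lambda>t. step (real M * t + - real w) *\<^sub>R (c (Suc w) j - c w j))"
      by (rule smooth_on_bounded_linear[OF bounded_linear_scaleR_left])
    then show ?thesis by (simp add: scaleR_conv_of_real)
  qed
  then show ?thesis
    using j by (simp add: chain_braid_def smooth_on_add smooth_on_const smooth_on_sum)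
qed

lemma chain_braid_pure:
  assumes M: "0 < M" and c: "chain n M c"
    and near: "\<forall>w<M. \<forall>t\<in>{0..1}. real w \<le> real M * t \<longrightarrow> real M * t \<le> real (Suc w) \<longrightarrow>
      c w \<in> nbox n (p t) e \<and> c (Suc w) \<in> nbox n (p t) e"
    and inj: "\<And>t z. t \<in> {0..1} \<Longrightarrow> z \<in> nbox n (p t) e \<Longrightarrow> inj_on z {1..n}"
  shows "pure_braid n (chain_braid n M c)"
proof -
  have ext: "chain_braid n M c t \<in> extensional {1..n}" for t by (simp add: chain_braid_def)
  have "base_config n \<in> extensional {1..n}" using base_config_Conf Conf_iff by blast
  moreover have "chain_braid n M c 0 j = base_config n j" "chain_braid n M c 1 j = base_config n j"
    if j: "j \<in> {1..n}" for j
    using chain_braid_seg[of 0 M 0 j n c] chain_braid_seg[of "M - 1" M 1 j n c] M j c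
    by (auto simp: step_le_0 step_ge_1 chain_def)
  ultimately have "chain_braid n M c 0 = base_config n" "chain_braid n M c 1 = base_config n"
    using ext by (metis extensionalityI)+
  then show ?thesis
    unfolding pure_braid_def Conf_iff
    using ext inj chain_braid_near[OF M near] chain_braid_smooth by auto
qed

section \<open>Zeros of a family of functions under small changes of values and derivatives\<close>

section \<open>Stability of transverse zeros\<close>

lemma mvt01:
  fixes f :: "real \<Rightarrow> real"
  assumes d: "\<And>t. t \<in> {0..1} \<Longrightarrow> (f has_real_derivative f' t) (at t within {0..1})"
    and ab: "0 \<le> a" "a < b" "b \<le> 1"
  obtains z where "a < z" "z < b" "f b - f a = (b - a) * f' z"
proof -
  have D: "(f has_real_derivative f' t) (at t)" if "0 < t" "t < 1" for t
    using d[of t] that at_within_Icc_at[of 0 t 1] by simp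
  have "continuous_on {0..1} f"
    unfolding continuous_on_eq_continuous_within using d DERIV_continuous by blast
  then have c: "continuous_on {a..b} f" by (rule continuous_on_subset) (use ab in auto)
  have "f differentiable (at x)" if "a < x" "x < b" for x
    using D[of x] that ab real_differentiable_def by fastforce
  then obtain l z where z: "a < z" "z < b" "DERIV f z :> l" "f b - f a = (b - a) * l"
    using MVT[OF ab(2) c] by blast
  then have "l = f' z" using D[of z] ab DERIV_unique by fastforce
  then show ?thesis using that z by blast
qed

definition zero_times :: "'i set \<Rightarrow> ('i \<Rightarrow> real \<Rightarrow> real) \<Rightarrow> real set" where
  "zero_times I F = {t \<in> {0..1}. \<exists>i\<in>I. F i t = 0}"

text \<open>\<open>\<rho>\<close>-transversality at \<open>t\<close>: on the \<open>\<rho>\<close>-neighbourhood at most one member of the family can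
  vanish, and if it can, it is strictly monotone.\<close>

definition transv :: "'i set \<Rightarrow> ('i \<Rightarrow> real \<Rightarrow> real) \<Rightarrow> ('i \<Rightarrow> real \<Rightarrow> real) \<Rightarrow> real \<Rightarrow> real \<Rightarrow> bool" where
  "transv I F F' \<rho> t \<longleftrightarrow> (\<exists>i0. (\<forall>i\<in>I. i \<noteq> i0 \<longrightarrow> (\<forall>s\<in>{0..1}. \<bar>s - t\<bar> < \<rho> \<longrightarrow> \<rho> \<le> \<bar>F i s\<bar>)) \<and>
     (i0 \<in> I \<longrightarrow> (\<forall>s\<in>{0..1}. \<bar>s - t\<bar> < \<rho> \<longrightarrow> \<rho> \<le> F' i0 s) \<or> (\<forall>s\<in>{0..1}. \<bar>s - t\<bar> < \<rho> \<longrightarrow> F' i0 s \<le> - \<rho>)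
        \<or> (\<forall>s\<in>{0..1}. \<bar>s - t\<bar> < \<rho> \<longrightarrow> \<rho> \<le> \<bar>F i0 s\<bar>)))"

lemma transv_mono: "transv I F F' e t \<Longrightarrow> d \<le> e \<Longrightarrow> transv I F F' d t"
  unfolding transv_def by (elim exE) (intro exI, fastforce)

lemma transv_perturb:
  assumes "transv I F F' \<rho> t"
    and "\<And>i s. i \<in> I \<Longrightarrow> s \<in> {0..1} \<Longrightarrow> \<bar>G i s - F i s\<bar> < \<rho> / 2 \<and> \<bar>G' i s - F' i s\<bar> < \<rho> / 2"
  shows "transv I G G' (\<rho> / 2) t"
proof -
  obtain i0 where i0: "\<forall>i\<in>I. i \<noteq> i0 \<longrightarrow> (\<forall>s\<in>{0..1}. \<bar>s - t\<bar> < \<rho> \<longrightarrow> \<rho> \<le> \<bar>F i s\<bar>)"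
    "i0 \<in> I \<longrightarrow> (\<forall>s\<in>{0..1}. \<bar>s - t\<bar> < \<rho> \<longrightarrow> \<rho> \<le> F' i0 s) \<or> (\<forall>s\<in>{0..1}. \<bar>s - t\<bar> < \<rho> \<longrightarrow> F' i0 s \<le> - \<rho>)
        \<or> (\<forall>s\<in>{0..1}. \<bar>s - t\<bar> < \<rho> \<longrightarrow> \<rho> \<le> \<bar>F i0 s\<bar>)"
    using assms(1) unfolding transv_def by blast
  have r: "\<bar>s - t\<bar> < \<rho>" if "\<bar>s - t\<bar> < \<rho> / 2" for s using that by linarith
  have a: "\<rho> / 2 \<le> \<bar>G i s\<bar>" if "i \<in> I" "s \<in> {0..1}" "\<rho> \<le> \<bar>F i s\<bar>" for i s
    using assms(2)[OF that(1,2)] that(3) by linarith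
  have b: "\<rho> / 2 \<le> G' i s" if "i \<in> I" "s \<in> {0..1}" "\<rho> \<le> F' i s" for i s
    using assms(2)[OF that(1,2)] that(3) by linarith
  have c: "G' i s \<le> - (\<rho> / 2)" if "i \<in> I" "s \<in> {0..1}" "F' i s \<le> - \<rho>" for i s
    using assms(2)[OF that(1,2)] that(3) by linarith
  show ?thesis
    unfolding transv_def
  proof (rule exI[of _ i0], intro conjI impI ballI)
    show "\<rho> / 2 \<le> \<bar>G i s\<bar>" if "i \<in> I" "i \<noteq> i0" "s \<in> {0..1}" "\<bar>s - t\<bar> < \<rho> / 2" for i s
      using i0(1) r[OF that(4)] a[OF that(1,3)] that by blast
    assume I: "i0 \<in> I"
    consider "\<forall>s\<in>{0..1}. \<bar>s - t\<bar> < \<rho> \<longrightarrow> \<rho> \<le> F' i0 s" | "\<forall>s\<in>{0..1}. \<bar>s - t\<bar> < \<rho> \<longrightarrow> F' i0 s \<le> - \<rho>"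
      | "\<forall>s\<in>{0..1}. \<bar>s - t\<bar> < \<rho> \<longrightarrow> \<rho> \<le> \<bar>F i0 s\<bar>"
      using i0(2) I by blast
    then show "(\<forall>s\<in>{0..1}. \<bar>s - t\<bar> < \<rho> / 2 \<longrightarrow> \<rho> / 2 \<le> G' i0 s) \<or>
        (\<forall>s\<in>{0..1}. \<bar>s - t\<bar> < \<rho> / 2 \<longrightarrow> G' i0 s \<le> - (\<rho> / 2)) \<or>
        (\<forall>s\<in>{0..1}. \<bar>s - t\<bar> < \<rho> / 2 \<longrightarrow> \<rho> / 2 \<le> \<bar>G i0 s\<bar>)"
    proof cases
      case 1 then show ?thesis using b[OF I] r by blast
    next
      case 2 then show ?thesis using c[OF I] r by blast
    next
      case 3 then show ?thesis using a[OF I] r by blast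
    qed
  qed
qed

text \<open>Near \<open>t\<close> only one member of the family can vanish, and two zeros of it
  would give a zero of its derivative by the mean value theorem.\<close>

lemma transv_unique_zero:
  assumes tr: "transv I F F' \<rho> t" and \<rho>: "0 < \<rho>"
    and d: "\<And>i t. i \<in> I \<Longrightarrow> t \<in> {0..1} \<Longrightarrow> (F i has_real_derivative F' i t) (at t within {0..1})"
    and a: "a \<in> zero_times I F" "\<bar>a - t\<bar> < \<rho>" and b: "b \<in> zero_times I F" "\<bar>b - t\<bar> < \<rho>"
  shows "a = b"
proof (rule ccontr)
  assume "a \<noteq> b"
  obtain i0 where i0: "\<forall>i\<in>I. i \<noteq> i0 \<longrightarrow> (\<forall>s\<in>{0..1}. \<bar>s - t\<bar> < \<rho> \<longrightarrow> \<rho> \<le> \<bar>F i s\<bar>)"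
    "i0 \<in> I \<longrightarrow> (\<forall>s\<in>{0..1}. \<bar>s - t\<bar> < \<rho> \<longrightarrow> \<rho> \<le> F' i0 s) \<or> (\<forall>s\<in>{0..1}. \<bar>s - t\<bar> < \<rho> \<longrightarrow> F' i0 s \<le> - \<rho>)
        \<or> (\<forall>s\<in>{0..1}. \<bar>s - t\<bar> < \<rho> \<longrightarrow> \<rho> \<le> \<bar>F i0 s\<bar>)"
    using tr unfolding transv_def by blast
  have z: "i0 \<in> I \<and> F i0 x = 0 \<and> x \<in> {0..1}" if x: "x \<in> zero_times I F" "\<bar>x - t\<bar> < \<rho>" for x
  proof -
    obtain i where i: "i \<in> I" "F i x = 0" "x \<in> {0..1}" using x(1) by (auto simp: zero_times_def)
    have "i = i0"
    proof (rule ccontr)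
      assume "i \<noteq> i0"
      then have "\<rho> \<le> \<bar>F i x\<bar>" using i0(1) i x(2) by blast
      then show False using i(2) \<rho> by simp
    qed
    then show ?thesis using i by simp
  qed
  define l u where "l = min a b" and "u = max a b"
  have lu: "0 \<le> l" "l < u" "u \<le> 1" "F i0 l = 0" "F i0 u = 0" "\<bar>l - t\<bar> < \<rho>" "\<bar>u - t\<bar> < \<rho>" "l \<in> {0..1}"
    using z[OF a] z[OF b] a b \<open>a \<noteq> b\<close> by (auto simp: l_def u_def min_def max_def)
  have I: "i0 \<in> I" using z[OF a] by simp
  obtain y where y: "l < y" "y < u" "F i0 u - F i0 l = (u - l) * F' i0 y"
    using mvt01[of "F i0" "F' i0" l u] d[OF I] lu by blast
  then have "F' i0 y = 0" using lu by simp
  moreover have "y \<in> {0..1}" "\<bar>y - t\<bar> < \<rho>" using y lu by auto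
  ultimately show False using i0(2) I \<rho> lu by fastforce
qed

text \<open>Compactness makes transversality uniform. A close family has a zero near each old zero
  by the intermediate value theorem, only one there because it is transverse as well, and none
  elsewhere because the old values are bounded away from zero there.\<close>

lemma transverse_zeros_stable:
  fixes F F' :: "'i \<Rightarrow> real \<Rightarrow> real"
  assumes I: "finite I"
    and d: "\<And>i t. i \<in> I \<Longrightarrow> t \<in> {0..1} \<Longrightarrow> (F i has_real_derivative F' i t) (at t within {0..1})"
    and c: "\<And>i. i \<in> I \<Longrightarrow> continuous_on {0..1} (F' i)"
    and one: "\<And>i i' t. i \<in> I \<Longrightarrow> i' \<in> I \<Longrightarrow> t \<in> {0..1} \<Longrightarrow> F i t = 0 \<Longrightarrow> F i' t = 0 \<Longrightarrow> i = i'"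
    and tr: "\<And>i t. i \<in> I \<Longrightarrow> t \<in> {0..1} \<Longrightarrow> F i t = 0 \<Longrightarrow> F' i t \<noteq> 0"
    and ends: "\<And>i. i \<in> I \<Longrightarrow> F i 0 \<noteq> 0 \<and> F i 1 \<noteq> 0"
  shows "finite (zero_times I F) \<and> (\<exists>\<epsilon>>0. \<forall>G G'.
    (\<forall>i\<in>I. \<forall>t\<in>{0..1}. (G i has_real_derivative G' i t) (at t within {0..1}) \<and>
       \<bar>G i t - F i t\<bar> < \<epsilon> \<and> \<bar>G' i t - F' i t\<bar> < \<epsilon>) \<longrightarrow>
    finite (zero_times I G) \<and> card (zero_times I G) = card (zero_times I F))"
proof -
  have cF: "continuous_on {0..1} (F i)" if "i \<in> I" for i
    unfolding continuous_on_eq_continuous_within using d[OF that] DERIV_continuous by blast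
  have cont: "\<exists>e>0. \<forall>s\<in>{0..1}. \<bar>s - t\<bar> < e \<longrightarrow> e < u s"
    if u: "continuous_on {0..1} u" "t \<in> {0..1}" "0 < u t" for u :: "real \<Rightarrow> real" and t
  proof -
    obtain e where e: "0 < e" "\<forall>s\<in>{0..1}. dist s t < e \<longrightarrow> dist (u s) (u t) < u t / 2"
      using u unfolding continuous_on_iff by (metis half_gt_zero)
    show ?thesis
    proof (intro exI[of _ "min e (u t / 2)"] conjI ballI impI)
      fix s assume "s \<in> {0..1}" "\<bar>s - t\<bar> < min e (u t / 2)"
      then have "\<bar>u s - u t\<bar> < u t / 2" using e(2) by (simp add: dist_real_def)
      then show "min e (u t / 2) < u s" by linarith
    qed (use e u in auto)
  qed
  have "\<exists>\<rho>>0. \<forall>t\<in>{0..1}. transv I F F' \<rho> t"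
  proof (rule interval_uniform)
    fix t :: real assume t: "t \<in> {0..1}"
    define Q where "Q = (\<lambda>e i. (F i t \<noteq> 0 \<longrightarrow> (\<forall>s\<in>{0..1}. \<bar>s - t\<bar> < e \<longrightarrow> e < \<bar>F i s\<bar>)) \<and>
      (0 < F' i t \<longrightarrow> (\<forall>s\<in>{0..1}. \<bar>s - t\<bar> < e \<longrightarrow> e < F' i s)) \<and>
      (F' i t < 0 \<longrightarrow> (\<forall>s\<in>{0..1}. \<bar>s - t\<bar> < e \<longrightarrow> e < - F' i s)))"
    have Qmono: "Q e' i" if "e' \<le> e" "Q e i" for e e' i
      using that unfolding Q_def by (meson order.strict_trans1 order.strict_trans2)
    obtain e where e: "0 < e" "\<And>i. i \<in> I \<Longrightarrow> Q e i"
    proof (rule finite_uniform_radius[OF I, of Q])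
      fix i assume i: "i \<in> I"
      have 1: "\<exists>e>0. F i t \<noteq> 0 \<longrightarrow> (\<forall>s\<in>{0..1}. \<bar>s - t\<bar> < e \<longrightarrow> e < \<bar>F i s\<bar>)"
        using cont[of "\<lambda>s. \<bar>F i s\<bar>" t] cF[OF i] t by (cases "F i t = 0") (auto intro: continuous_on_rabs zero_less_one)
      have 2: "\<exists>e>0. 0 < F' i t \<longrightarrow> (\<forall>s\<in>{0..1}. \<bar>s - t\<bar> < e \<longrightarrow> e < F' i s)"
        using cont[OF c[OF i] t] by (cases "0 < F' i t") (auto intro: zero_less_one)
      have 3: "\<exists>e>0. F' i t < 0 \<longrightarrow> (\<forall>s\<in>{0..1}. \<bar>s - t\<bar> < e \<longrightarrow> e < - F' i s)"
        using cont[of "\<lambda>s. - F' i s" t] c[OF i] t by (cases "F' i t < 0") (auto intro: continuous_on_minus zero_less_one)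
      obtain e1 e2 e3 where "0 < e1" "0 < e2" "0 < e3"
        "F i t \<noteq> 0 \<longrightarrow> (\<forall>s\<in>{0..1}. \<bar>s - t\<bar> < e1 \<longrightarrow> e1 < \<bar>F i s\<bar>)"
        "0 < F' i t \<longrightarrow> (\<forall>s\<in>{0..1}. \<bar>s - t\<bar> < e2 \<longrightarrow> e2 < F' i s)"
        "F' i t < 0 \<longrightarrow> (\<forall>s\<in>{0..1}. \<bar>s - t\<bar> < e3 \<longrightarrow> e3 < - F' i s)"
        using 1 2 3 by blast
      then show "\<exists>e>0. Q e i"
        unfolding Q_def by (intro exI[of _ "min e1 (min e2 e3)"]) (simp add: min_less_iff_disj)
    qed (use Qmono in blast)+
    have "transv I F F' (e / 2) t'" if t': "t' \<in> {0..1}" "\<bar>t' - t\<bar> < e / 2" for t'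
    proof -
      have near: "\<bar>s - t\<bar> < e" if "\<bar>s - t'\<bar> < e / 2" for s using that t'(2) by linarith
      \<comment> \<open>The one member that vanishes at \<open>t\<close>, if any. If none does,
        \<open>i0\<close> is \<open>undefined\<close>; should it lie in \<open>I\<close>, the third
        alternative of \<open>transv\<close> applies to it.\<close>
      define i0 where "i0 = (if \<exists>i\<in>I. F i t = 0 then SOME i. i \<in> I \<and> F i t = 0 else undefined)"
      have i0: "F i t \<noteq> 0" if "i \<in> I" "i \<noteq> i0" for i
      proof
        assume z: "F i t = 0"
        then have ex: "\<exists>i. i \<in> I \<and> F i t = 0" using that by blast
        then have "i0 = (SOME i. i \<in> I \<and> F i t = 0)" by (auto simp: i0_def)
        then have "i0 \<in> I \<and> F i0 t = 0" using someI_ex[OF ex] by simp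
        then show False using one that z t by blast
      qed
      have sm: "e / 2 < e" using e by simp
      have A: "\<forall>i\<in>I. i \<noteq> i0 \<longrightarrow> (\<forall>s\<in>{0..1}. \<bar>s - t'\<bar> < e / 2 \<longrightarrow> e / 2 \<le> \<bar>F i s\<bar>)"
        using e(2) i0 near sm unfolding Q_def by (meson less_imp_le order.strict_trans)
      have B: "(\<forall>s\<in>{0..1}. \<bar>s - t'\<bar> < e / 2 \<longrightarrow> e / 2 \<le> F' i0 s) \<or> (\<forall>s\<in>{0..1}. \<bar>s - t'\<bar> < e / 2 \<longrightarrow> F' i0 s \<le> - (e / 2))
        \<or> (\<forall>s\<in>{0..1}. \<bar>s - t'\<bar> < e / 2 \<longrightarrow> e / 2 \<le> \<bar>F i0 s\<bar>)" if i: "i0 \<in> I"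
      proof (cases "F i0 t = 0")
        case True
        then consider "0 < F' i0 t" | "F' i0 t < 0" using tr[OF i t] by linarith
        then show ?thesis
        proof cases
          case 1
          then have "e < F' i0 s" if "s \<in> {0..1}" "\<bar>s - t'\<bar> < e / 2" for s
            using e(2)[OF i] near that unfolding Q_def by blast
          then show ?thesis using sm by (meson less_imp_le order.strict_trans)
        next
          case 2
          then have "e < - F' i0 s" if "s \<in> {0..1}" "\<bar>s - t'\<bar> < e / 2" for s
            using e(2)[OF i] near that unfolding Q_def by blast
          then have "F' i0 s \<le> - (e / 2)" if "s \<in> {0..1}" "\<bar>s - t'\<bar> < e / 2" for s
            using that sm by fastforce
          then show ?thesis by blast
        qed
      next
        case False
        then have "e < \<bar>F i0 s\<bar>" if "s \<in> {0..1}" "\<bar>s - t'\<bar> < e / 2" for s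
          using e(2)[OF i] near that unfolding Q_def by blast
        then show ?thesis using sm by (meson less_imp_le order.strict_trans)
      qed
      show ?thesis unfolding transv_def using A B by blast
    qed
    then show "\<exists>d>0. \<forall>t'\<in>{0..1}. \<bar>t' - t\<bar> < d \<longrightarrow> transv I F F' d t'"
      using e(1) by (intro exI[of _ "e / 2"]) auto
  qed (rule transv_mono)
  then obtain \<rho> where \<rho>: "0 < \<rho>" "\<And>t. t \<in> {0..1} \<Longrightarrow> transv I F F' \<rho> t" by blast
  define Z where "Z = zero_times I F"
  have Z01: "t \<in> {0..1}" if "t \<in> Z" for t using that by (simp add: Z_def zero_times_def)
  have sep: "a = b" if "a \<in> Z" "b \<in> Z" "\<bar>b - a\<bar> < \<rho>" for a b
    using transv_unique_zero[OF \<rho>(2)[OF Z01[OF that(1)]] \<rho>(1) d, of a b] that \<rho>(1) by (simp add: Z_def)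
  have fin: "finite Z"
  proof -
    \<comment> \<open>Different zeros are at least \<open>\<rho>\<close> apart, so they fall into
      different cells of length \<open>\<rho>\<close>, of which the unit interval meets finitely
      many.\<close>
    have "inj_on (\<lambda>t. \<lfloor>t / \<rho>\<rfloor>) Z"
    proof (rule inj_onI)
      fix a b assume ab: "a \<in> Z" "b \<in> Z" "\<lfloor>a / \<rho>\<rfloor> = \<lfloor>b / \<rho>\<rfloor>"
      then have "\<bar>b / \<rho> - a / \<rho>\<bar> < 1" by linarith
      then have "\<bar>b - a\<bar> < \<rho>" using \<rho>(1) by (simp add: diff_divide_distrib[symmetric] abs_divide)
      then show "a = b" using sep ab by blast
    qed
    moreover have "(\<lambda>t. \<lfloor>t / \<rho>\<rfloor>) ` Z \<subseteq> {0..\<lfloor>1 / \<rho>\<rfloor>}"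
    proof
      fix m assume "m \<in> (\<lambda>t. \<lfloor>t / \<rho>\<rfloor>) ` Z"
      then obtain t where t: "t \<in> Z" "m = \<lfloor>t / \<rho>\<rfloor>" by blast
      then have "0 \<le> t / \<rho>" "t / \<rho> \<le> 1 / \<rho>" using Z01[OF t(1)] \<rho>(1) by (auto simp: divide_right_mono)
      then show "m \<in> {0..\<lfloor>1 / \<rho>\<rfloor>}" unfolding t(2) by (simp add: floor_mono)
    qed
    ultimately show ?thesis using finite_imageD finite_subset finite_atLeastAtMost_int by metis
  qed
  obtain r0 where r0: "0 < r0" "\<And>t. t \<in> Z \<Longrightarrow> r0 \<le> t \<and> r0 \<le> 1 - t"
  proof (rule finite_uniform_radius[OF fin, of "\<lambda>r t. r \<le> t \<and> r \<le> 1 - t"])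
    fix t assume "t \<in> Z"
    then have "0 < t" "t < 1" using ends by (auto simp: Z_def zero_times_def order.order_iff_strict)
    then show "\<exists>r>0. r \<le> t \<and> r \<le> 1 - t" by (intro exI[of _ "min t (1 - t)"]) auto
  qed auto
  \<comment> \<open>The bound \<open>r0\<close> keeps the neighbourhoods of the zeros inside the
    unit interval; \<open>\<rho> / 4\<close> keeps them disjoint and within the range where zeros of
    the new family are unique.\<close>
  define r where "r = min r0 (\<rho> / 4)"
  have r: "0 < r" "r \<le> \<rho> / 4" "\<And>t. t \<in> Z \<Longrightarrow> r \<le> t \<and> r \<le> 1 - t"
    using r0 \<rho>(1) by (force simp: r_def)+
  have "\<exists>m>0. \<forall>t\<in>{0..1}. (\<forall>z\<in>Z. r \<le> \<bar>t - z\<bar>) \<longrightarrow> (\<forall>i\<in>I. m \<le> \<bar>F i t\<bar>)"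
  proof (rule interval_uniform)
    fix t :: real assume t: "t \<in> {0..1}"
    show "\<exists>d>0. \<forall>t'\<in>{0..1}. \<bar>t' - t\<bar> < d \<longrightarrow> (\<forall>z\<in>Z. r \<le> \<bar>t' - z\<bar>) \<longrightarrow> (\<forall>i\<in>I. d \<le> \<bar>F i t'\<bar>)"
    proof (cases "t \<in> Z")
      case True
      then show ?thesis using r(1) by (intro exI[of _ r]) fastforce
    next
      case False
      obtain e where e: "0 < e" "\<And>i. i \<in> I \<Longrightarrow> \<forall>s\<in>{0..1}. \<bar>s - t\<bar> < e \<longrightarrow> e < \<bar>F i s\<bar>"
      proof (rule finite_uniform_radius[OF I, of "\<lambda>e i. \<forall>s\<in>{0..1}. \<bar>s - t\<bar> < e \<longrightarrow> e < \<bar>F i s\<bar>"])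
        fix i assume i: "i \<in> I"
        then have "F i t \<noteq> 0" using False t by (auto simp: Z_def zero_times_def)
        then show "\<exists>e>0. \<forall>s\<in>{0..1}. \<bar>s - t\<bar> < e \<longrightarrow> e < \<bar>F i s\<bar>"
          using t cF[OF i] by (intro cont) (auto intro: continuous_on_rabs)
      qed force+
      then show ?thesis by (intro exI[of _ e]) (auto intro: less_imp_le)
    qed
  qed fastforce
  then obtain m where m: "0 < m" "\<And>t i. t \<in> {0..1} \<Longrightarrow> \<forall>z\<in>Z. r \<le> \<bar>t - z\<bar> \<Longrightarrow> i \<in> I \<Longrightarrow> m \<le> \<bar>F i t\<bar>" by blast
  \<comment> \<open>The three bounds keep the new family transverse, prevent zeros away from the old
    ones, and preserve the signs at distance \<open>r\<close> from an old zero, where the vanishing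
    member has absolute value at least \<open>\<rho> * r\<close>.\<close>
  define \<epsilon> where "\<epsilon> = min (\<rho> / 2) (min m (\<rho> * r))"
  have \<epsilon>: "0 < \<epsilon>" "\<epsilon> \<le> \<rho> / 2" "\<epsilon> \<le> m" "\<epsilon> \<le> \<rho> * r" using \<rho>(1) m(1) r(1) by (auto simp: \<epsilon>_def)
  have main: "finite (zero_times I G) \<and> card (zero_times I G) = card (zero_times I F)"
    if G: "\<And>i t. i \<in> I \<Longrightarrow> t \<in> {0..1} \<Longrightarrow> (G i has_real_derivative G' i t) (at t within {0..1})"
      and close: "\<And>i t. i \<in> I \<Longrightarrow> t \<in> {0..1} \<Longrightarrow> \<bar>G i t - F i t\<bar> < \<epsilon> \<and> \<bar>G' i t - F' i t\<bar> < \<epsilon>" for G G'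
  proof -
    have "transv I G G' (\<rho> / 2) t" if "t \<in> {0..1}" for t
    proof (rule transv_perturb[OF \<rho>(2)[OF that]])
      show "\<bar>G i s - F i s\<bar> < \<rho> / 2 \<and> \<bar>G' i s - F' i s\<bar> < \<rho> / 2" if "i \<in> I" "s \<in> {0..1}" for i s
        using close[OF that] \<epsilon>(2) by linarith
    qed
    then have uniq: "a = b" if "t \<in> {0..1}" "a \<in> zero_times I G" "\<bar>a - t\<bar> < \<rho> / 2"
      "b \<in> zero_times I G" "\<bar>b - t\<bar> < \<rho> / 2" for a b t
      using transv_unique_zero[of I G G' "\<rho> / 2" t a b] G \<rho>(1) that by simp
    have ex: "\<exists>s. s \<in> zero_times I G \<and> \<bar>s - t\<bar> \<le> r" if t: "t \<in> Z" for t
    proof -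
      obtain i where i: "i \<in> I" "F i t = 0" using t by (auto simp: Z_def zero_times_def)
      have t01: "t \<in> {0..1}" "0 \<le> t - r" "t + r \<le> 1" using r(3)[OF t] Z01[OF t] by auto
      obtain i0 where i0: "\<forall>i\<in>I. i \<noteq> i0 \<longrightarrow> (\<forall>s\<in>{0..1}. \<bar>s - t\<bar> < \<rho> \<longrightarrow> \<rho> \<le> \<bar>F i s\<bar>)"
        "i0 \<in> I \<longrightarrow> (\<forall>s\<in>{0..1}. \<bar>s - t\<bar> < \<rho> \<longrightarrow> \<rho> \<le> F' i0 s) \<or> (\<forall>s\<in>{0..1}. \<bar>s - t\<bar> < \<rho> \<longrightarrow> F' i0 s \<le> - \<rho>)
          \<or> (\<forall>s\<in>{0..1}. \<bar>s - t\<bar> < \<rho> \<longrightarrow> \<rho> \<le> \<bar>F i0 s\<bar>)"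
        using \<rho>(2)[OF t01(1)] unfolding transv_def by blast
      have "i0 = i" using i0(1) i t01 \<rho>(1) by fastforce
      then have alt: "(\<forall>s\<in>{0..1}. \<bar>s - t\<bar> < \<rho> \<longrightarrow> \<rho> \<le> F' i s) \<or> (\<forall>s\<in>{0..1}. \<bar>s - t\<bar> < \<rho> \<longrightarrow> F' i s \<le> - \<rho>)"
        using i0(2) i t01 \<rho>(1) by fastforce
      have tr1: "t - r < t" "t < t + r" using r(1) by auto
      obtain y1 where y1: "t - r < y1" "y1 < t" "F i t - F i (t - r) = (t - (t - r)) * F' i y1"
        using mvt01[of "F i" "F' i" "t - r" t] d[OF i(1)] t01 tr1 by (metis atLeastAtMost_iff)
      obtain y2 where y2: "t < y2" "y2 < t + r" "F i (t + r) - F i t = (t + r - t) * F' i y2"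
        using mvt01[of "F i" "F' i" t "t + r"] d[OF i(1)] t01 tr1 by (metis atLeastAtMost_iff)
      have y: "y1 \<in> {0..1}" "\<bar>y1 - t\<bar> < \<rho>" "y2 \<in> {0..1}" "\<bar>y2 - t\<bar> < \<rho>"
        using y1 y2 t01 r \<rho>(1) by auto
      have val: "F i (t - r) = - (r * F' i y1)" "F i (t + r) = r * F' i y2" using y1 y2 i(2) by auto
      have cl: "\<bar>G i (t - r) - F i (t - r)\<bar> < \<rho> * r" "\<bar>G i (t + r) - F i (t + r)\<bar> < \<rho> * r"
        using close[OF i(1), of "t - r"] close[OF i(1), of "t + r"] t01 \<epsilon>(4) r(1) by auto
      have "continuous_on {0..1} (G i)"
        unfolding continuous_on_eq_continuous_within using G[OF i(1)] DERIV_continuous by blast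
      then have cG: "continuous_on {t - r..t + r} (G i)" by (rule continuous_on_subset) (use t01 in auto)
      have "\<exists>s. t - r \<le> s \<and> s \<le> t + r \<and> G i s = 0"
        using alt
      proof
        assume "\<forall>s\<in>{0..1}. \<bar>s - t\<bar> < \<rho> \<longrightarrow> \<rho> \<le> F' i s"
        then have "\<rho> * r \<le> r * F' i y1" "\<rho> * r \<le> r * F' i y2"
          using y r(1) by (auto simp: mult.commute)
        then have "G i (t - r) \<le> 0" "0 \<le> G i (t + r)" using val cl by linarith+
        then show ?thesis using IVT'[of "G i" "t - r" 0 "t + r"] cG r(1) by auto
      next
        assume "\<forall>s\<in>{0..1}. \<bar>s - t\<bar> < \<rho> \<longrightarrow> F' i s \<le> - \<rho>"
        then have "F' i y1 \<le> - \<rho>" "F' i y2 \<le> - \<rho>" using y by auto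
        then have "r * F' i y1 \<le> r * (- \<rho>)" "r * F' i y2 \<le> r * (- \<rho>)"
          using r(1) by (intro mult_left_mono; simp)+
        then have "G i (t + r) \<le> 0" "0 \<le> G i (t - r)" using val cl by (auto simp: mult.commute)
        then show ?thesis using IVT2'[of "G i" "t + r" 0 "t - r"] cG r(1) by auto
      qed
      then obtain s where "t - r \<le> s" "s \<le> t + r" "G i s = 0" by blast
      then show ?thesis using i(1) t01 by (intro exI[of _ s]) (auto simp: zero_times_def)
    qed
    have cover: "\<exists>t\<in>Z. \<bar>s - t\<bar> < r" if s: "s \<in> zero_times I G" for s
    proof (rule ccontr)
      assume "\<not> (\<exists>t\<in>Z. \<bar>s - t\<bar> < r)"
      then have far: "\<forall>z\<in>Z. r \<le> \<bar>s - z\<bar>" by auto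
      obtain i where i: "i \<in> I" "G i s = 0" "s \<in> {0..1}" using s by (auto simp: zero_times_def)
      have "m \<le> \<bar>F i s\<bar>" by (rule m(2)[OF i(3) far i(1)])
      then show False using close[OF i(1,3)] i(2) \<epsilon>(3) by auto
    qed
    define h where "h = (\<lambda>t. SOME s. s \<in> zero_times I G \<and> \<bar>s - t\<bar> \<le> r)"
    have h: "h t \<in> zero_times I G" "\<bar>h t - t\<bar> \<le> r" if "t \<in> Z" for t
      using someI_ex[OF ex[OF that]] by (simp_all add: h_def)
    have "bij_betw h Z (zero_times I G)"
      unfolding bij_betw_def
    proof
      show "inj_on h Z"
      proof (rule inj_onI)
        fix a b assume ab: "a \<in> Z" "b \<in> Z" "h a = h b"
        then have "\<bar>b - a\<bar> < \<rho>" using h(2)[of a] h(2)[of b] r(2) \<rho>(1) by linarith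
        then show "a = b" using sep ab by blast
      qed
      show "h ` Z = zero_times I G"
      proof
        show "h ` Z \<subseteq> zero_times I G" using h by blast
        show "zero_times I G \<subseteq> h ` Z"
        proof
          fix s assume s: "s \<in> zero_times I G"
          obtain t where t: "t \<in> Z" "\<bar>s - t\<bar> < r" using cover[OF s] by blast
          have "s = h t"
            using uniq[OF Z01[OF t(1)] s _ h(1)[OF t(1)]] t(2) h(2)[OF t(1)] r(1,2) by linarith
          then show "s \<in> h ` Z" using t(1) by blast
        qed
      qed
    qed
    then show ?thesis using fin bij_betw_finite bij_betw_same_card unfolding Z_def by metis
  qed
  show ?thesis
    using fin \<epsilon>(1) main unfolding Z_def by (intro conjI exI[of _ \<epsilon>]) blast+
qed

section \<open>From transverse determinants to stability of braids\<close>

section \<open>Transverse braids are good and stable\<close>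

definition cross2 :: "complex \<Rightarrow> complex \<Rightarrow> real" where
  "cross2 u v = Im (cnj u * v)"

lemma cdet_cross2: "cdet z i j k = cross2 (z j - z i) (z k - z i)"
  by (simp add: cdet_def cross2_def)

lemma cross2_bound: "\<bar>cross2 u v\<bar> \<le> cmod u * cmod v"
  unfolding cross2_def by (metis abs_Im_le_cmod complex_mod_cnj norm_mult)

lemma cross2_diff: "\<bar>cross2 a b - cross2 c d\<bar> \<le> cmod (a - c) * cmod b + cmod c * cmod (b - d)"
proof -
  have "cross2 a b - cross2 c d = cross2 (a - c) b + cross2 c (b - d)"
    by (simp add: cross2_def algebra_simps)
  then show ?thesis using cross2_bound[of "a - c" b] cross2_bound[of c "b - d"] by linarith
qed

text \<open>The derivative of \<open>cdet\<close> at \<open>z\<close> when the points move with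
  velocities \<open>v\<close>, by the product rule.\<close>

definition dcdet :: "(nat \<Rightarrow> complex) \<Rightarrow> (nat \<Rightarrow> complex) \<Rightarrow> nat \<Rightarrow> nat \<Rightarrow> nat \<Rightarrow> real" where
  "dcdet z v i j k = cross2 (v j - v i) (z k - z i) + cross2 (z j - z i) (v k - v i)"

lemma cdet_has_derivative:
  assumes "\<And>l. l \<in> {i, j, k} \<Longrightarrow> ((\<lambda>t. \<beta> t l) has_vector_derivative v l) (at t within S)"
  shows "((\<lambda>t. cdet (\<beta> t) i j k) has_real_derivative dcdet (\<beta> t) v i j k) (at t within S)"
proof -
  have re: "((\<lambda>t. Re (\<beta> t l)) has_real_derivative Re (v l)) (at t within S)"
    and im: "((\<lambda>t. Im (\<beta> t l)) has_real_derivative Im (v l)) (at t within S)" if "l \<in> {i, j, k}" for l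
    using bounded_linear.has_vector_derivative[OF bounded_linear_Re assms[OF that]]
      bounded_linear.has_vector_derivative[OF bounded_linear_Im assms[OF that]]
    by (simp_all add: has_real_derivative_iff_has_vector_derivative)
  have "((\<lambda>t. (Re (\<beta> t j) - Re (\<beta> t i)) * (Im (\<beta> t k) - Im (\<beta> t i))
        - (Im (\<beta> t j) - Im (\<beta> t i)) * (Re (\<beta> t k) - Re (\<beta> t i))) has_real_derivative dcdet (\<beta> t) v i j k) (at t within S)"
    by (rule DERIV_cong[OF DERIV_diff[OF
          DERIV_mult[OF DERIV_diff[OF re[of j] re[of i]] DERIV_diff[OF im[of k] im[of i]]]
          DERIV_mult[OF DERIV_diff[OF im[of j] im[of i]] DERIV_diff[OF re[of k] re[of i]]]]])
      (simp_all add: dcdet_def cross2_def algebra_simps)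
  moreover have "(\<lambda>t. cdet (\<beta> t) i j k) = (\<lambda>t. (Re (\<beta> t j) - Re (\<beta> t i)) * (Im (\<beta> t k) - Im (\<beta> t i))
        - (Im (\<beta> t j) - Im (\<beta> t i)) * (Re (\<beta> t k) - Re (\<beta> t i)))"
    by (simp add: cdet_def algebra_simps)
  ultimately show ?thesis by simp
qed

definition vel :: "(real \<Rightarrow> nat \<Rightarrow> complex) \<Rightarrow> real \<Rightarrow> nat \<Rightarrow> complex" where
  "vel \<beta> t j = vector_derivative (\<lambda>s. \<beta> s j) (at t within {0..1})"

lemma vel_eqI:
  assumes "t \<in> {0..1}" "((\<lambda>s. \<beta> s j) has_vector_derivative v) (at t within {0..1})"
  shows "vel \<beta> t j = v"
  unfolding vel_def using vector_derivative_within_closed_interval[of 0 1 t "\<lambda>s. \<beta> s j" v] assms by simp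

lemma pure_braid_vel:
  assumes "pure_braid n \<beta>" "j \<in> {1..n}"
  shows "t \<in> {0..1} \<Longrightarrow> ((\<lambda>s. \<beta> s j) has_vector_derivative vel \<beta> t j) (at t within {0..1})"
    and "continuous_on {0..1} (\<lambda>t. vel \<beta> t j)" and "continuous_on {0..1} (\<lambda>t. \<beta> t j)"
proof -
  have sm: "smooth_on {0..1} (\<lambda>t. \<beta> t j)" using assms by (simp add: pure_braid_def)
  obtain D where D: "smooth_on {0..1} D" "\<And>t. t \<in> {0..1} \<Longrightarrow> ((\<lambda>t. \<beta> t j) has_vector_derivative D t) (at t within {0..1})"
    using smooth_on_derivE[OF sm] by metis
  have v: "vel \<beta> t j = D t" if "t \<in> {0..1}" for t
    using vel_eqI[of t \<beta> j "D t"] that D(2)[OF that] by simp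
  show "t \<in> {0..1} \<Longrightarrow> ((\<lambda>s. \<beta> s j) has_vector_derivative vel \<beta> t j) (at t within {0..1})"
    using D(2) v by simp
  have "continuous_on {0..1} (\<lambda>t. vel \<beta> t j) \<longleftrightarrow> continuous_on {0..1} D"
    by (rule continuous_on_cong) (use v in auto)
  then show "continuous_on {0..1} (\<lambda>t. vel \<beta> t j)" using smooth_on_continuous[OF D(1)] by simp
  show "continuous_on {0..1} (\<lambda>t. \<beta> t j)" by (rule smooth_on_continuous[OF sm])
qed

lemma pure_braid_bound:
  assumes "pure_braid n \<beta>"
  obtains K where "0 < K" "\<And>t j. t \<in> {0..1} \<Longrightarrow> j \<in> {1..n} \<Longrightarrow> cmod (\<beta> t j) \<le> K \<and> cmod (vel \<beta> t j) \<le> K"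
proof -
  have "\<exists>K. \<forall>t\<in>{0..1}. cmod (\<beta> t j) \<le> K \<and> cmod (vel \<beta> t j) \<le> K" if j: "j \<in> {1..n}" for j
  proof -
    have "bounded ((\<lambda>t. \<beta> t j) ` {0..1})" "bounded ((\<lambda>t. vel \<beta> t j) ` {0..1})"
      using pure_braid_vel(2,3)[OF assms j] by (auto intro!: compact_imp_bounded compact_continuous_image)
    then obtain a b where "\<forall>x\<in>(\<lambda>t. \<beta> t j) ` {0..1}. cmod x \<le> a" "\<forall>x\<in>(\<lambda>t. vel \<beta> t j) ` {0..1}. cmod x \<le> b"
      unfolding bounded_iff by blast
    then show ?thesis by (intro exI[of _ "max a b"]) (auto simp: le_max_iff_disj)
  qed
  then obtain K where K: "\<And>j t. j \<in> {1..n} \<Longrightarrow> t \<in> {0..1} \<Longrightarrow> cmod (\<beta> t j) \<le> K j \<and> cmod (vel \<beta> t j) \<le> K j"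
    by metis
  define L where "L = 1 + (\<Sum>j=1..n. \<bar>K j\<bar>)"
  have "K j \<le> L" if "j \<in> {1..n}" for j
    using member_le_sum[of j "{1..n}" "\<lambda>j. \<bar>K j\<bar>"] that by (simp add: L_def)
  then have "\<And>t j. t \<in> {0..1} \<Longrightarrow> j \<in> {1..n} \<Longrightarrow> cmod (\<beta> t j) \<le> L \<and> cmod (vel \<beta> t j) \<le> L"
    using K by (meson order_trans)
  moreover have "0 < L" unfolding L_def by (intro add_pos_nonneg sum_nonneg) auto
  ultimately show ?thesis using that by blast
qed

lemma C1_close_cdet:
  assumes \<beta>: "pure_braid n \<beta>" and e': "0 < e'"
  obtains e where "0 < e" "\<And>\<gamma> t i j k. C1_close n e \<beta> \<gamma> \<Longrightarrow> t \<in> {0..1} \<Longrightarrow> dist_idx n [i, j, k] \<Longrightarrow>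
    \<bar>cdet (\<gamma> t) i j k - cdet (\<beta> t) i j k\<bar> < e' \<and> \<bar>dcdet (\<gamma> t) (vel \<gamma> t) i j k - dcdet (\<beta> t) (vel \<beta> t) i j k\<bar> < e'"
proof -
  obtain K where K: "0 < K" "\<And>t j. t \<in> {0..1} \<Longrightarrow> j \<in> {1..n} \<Longrightarrow> cmod (\<beta> t j) \<le> K \<and> cmod (vel \<beta> t j) \<le> K"
    using pure_braid_bound[OF \<beta>] by blast
  \<comment> \<open>Each bilinear term changes by at most \<open>e * (8 * K + 4)\<close>;
    \<open>dcdet\<close> has two of them, and one more \<open>e\<close> makes the estimate strict,
    which gives the factor \<open>16 * K + 9\<close>.\<close>
  define e where "e = min 1 (e' / (16 * K + 9))"
  have e: "0 < e" "e \<le> 1" "e * (16 * K + 9) \<le> e'"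
  proof -
    have "e \<le> e' / (16 * K + 9)" by (simp add: e_def)
    then show "e * (16 * K + 9) \<le> e'" using K(1) by (simp add: pos_le_divide_eq)
  qed (use K(1) e' in \<open>auto simp: e_def\<close>)
  show ?thesis
  proof (rule that[OF e(1)])
    fix \<gamma> i j k and t :: real
    assume cl: "C1_close n e \<beta> \<gamma>" and t: "t \<in> {0..1}" and d: "dist_idx n [i, j, k]"
    have pt: "cmod (\<gamma> t l - \<beta> t l) \<le> e" "cmod (vel \<gamma> t l - vel \<beta> t l) \<le> e"
      "cmod (\<beta> t l) \<le> K" "cmod (vel \<beta> t l) \<le> K" if "l \<in> {i, j, k}" for l
    proof -
      have l: "l \<in> {1..n}" using d that by (auto simp: dist_idx_def)
      show "cmod (\<gamma> t l - \<beta> t l) \<le> e" "cmod (vel \<gamma> t l - vel \<beta> t l) \<le> e"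
        using cl t l unfolding C1_close_def vel_def by (auto simp: dist_norm norm_minus_commute less_imp_le)
      show "cmod (\<beta> t l) \<le> K" "cmod (vel \<beta> t l) \<le> K" using K(2)[OF t l] by auto
    qed
    have df: "cmod ((x' - y') - (x - y)) \<le> 2 * e \<and> cmod (x' - y') \<le> 2 * K + 2 * e \<and> cmod (x - y) \<le> 2 * K"
      if "cmod (x' - x) \<le> e" "cmod (y' - y) \<le> e" "cmod x \<le> K" "cmod y \<le> K" for x y x' y' :: complex
    proof -
      have "cmod ((x' - x) - (y' - y)) \<le> 2 * e" using that norm_triangle_ineq4[of "x' - x" "y' - y"] by simp
      moreover have "cmod (x - y) \<le> 2 * K" using that norm_triangle_ineq4[of x y] by simp
      moreover have "cmod (x' - y') \<le> cmod ((x' - x) - (y' - y)) + cmod (x - y)"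
        using norm_triangle_ineq[of "(x' - x) - (y' - y)" "x - y"] by simp
      ultimately show ?thesis by (simp add: algebra_simps)
    qed
    have bil: "\<bar>cross2 a' b' - cross2 a b\<bar> \<le> e * (8 * K + 4)"
      if "cmod (a' - a) \<le> 2 * e" "cmod b' \<le> 2 * K + 2 * e" "cmod a \<le> 2 * K" "cmod (b' - b) \<le> 2 * e" for a a' b b'
    proof -
      have "\<bar>cross2 a' b' - cross2 a b\<bar> \<le> cmod (a' - a) * cmod b' + cmod a * cmod (b' - b)"
        by (rule cross2_diff)
      also have "\<dots> \<le> (2 * e) * (2 * K + 2 * e) + (2 * K) * (2 * e)"
        using that e K(1) by (intro add_mono mult_mono) auto
      also have "\<dots> \<le> e * (8 * K + 4)"
        using mult_left_mono[of e 1 e] e by (simp add: algebra_simps)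
      finally show ?thesis .
    qed
    have ij: "cmod ((\<gamma> t j - \<gamma> t i) - (\<beta> t j - \<beta> t i)) \<le> 2 * e \<and> cmod (\<gamma> t j - \<gamma> t i) \<le> 2 * K + 2 * e \<and> cmod (\<beta> t j - \<beta> t i) \<le> 2 * K"
      and ik: "cmod ((\<gamma> t k - \<gamma> t i) - (\<beta> t k - \<beta> t i)) \<le> 2 * e \<and> cmod (\<gamma> t k - \<gamma> t i) \<le> 2 * K + 2 * e \<and> cmod (\<beta> t k - \<beta> t i) \<le> 2 * K"
      and vij: "cmod ((vel \<gamma> t j - vel \<gamma> t i) - (vel \<beta> t j - vel \<beta> t i)) \<le> 2 * e \<and> cmod (vel \<gamma> t j - vel \<gamma> t i) \<le> 2 * K + 2 * e \<and> cmod (vel \<beta> t j - vel \<beta> t i) \<le> 2 * K"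
      and vik: "cmod ((vel \<gamma> t k - vel \<gamma> t i) - (vel \<beta> t k - vel \<beta> t i)) \<le> 2 * e \<and> cmod (vel \<gamma> t k - vel \<gamma> t i) \<le> 2 * K + 2 * e \<and> cmod (vel \<beta> t k - vel \<beta> t i) \<le> 2 * K"
      by (rule df; simp add: pt)+
    have s: "e * (8 * K + 4) + e * (8 * K + 4) < e'" "e * (8 * K + 4) < e'"
    proof -
      have "e * (8 * K + 4) + e * (8 * K + 4) + e = e * (16 * K + 9)" by (simp add: algebra_simps)
      then show "e * (8 * K + 4) + e * (8 * K + 4) < e'" using e by linarith
      moreover have "0 < e * (8 * K + 4)" using e K by simp
      ultimately show "e * (8 * K + 4) < e'" by linarith
    qed
    have "\<bar>cdet (\<gamma> t) i j k - cdet (\<beta> t) i j k\<bar> \<le> e * (8 * K + 4)"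
      unfolding cdet_cross2 using ij ik by (intro bil) auto
    moreover have "\<bar>cross2 (vel \<gamma> t j - vel \<gamma> t i) (\<gamma> t k - \<gamma> t i) - cross2 (vel \<beta> t j - vel \<beta> t i) (\<beta> t k - \<beta> t i)\<bar> \<le> e * (8 * K + 4)"
      using vij ik by (intro bil) auto
    moreover have "\<bar>cross2 (\<gamma> t j - \<gamma> t i) (vel \<gamma> t k - vel \<gamma> t i) - cross2 (\<beta> t j - \<beta> t i) (vel \<beta> t k - vel \<beta> t i)\<bar> \<le> e * (8 * K + 4)"
      using ij vik by (intro bil) auto
    ultimately show "\<bar>cdet (\<gamma> t) i j k - cdet (\<beta> t) i j k\<bar> < e' \<and>
        \<bar>dcdet (\<gamma> t) (vel \<gamma> t) i j k - dcdet (\<beta> t) (vel \<beta> t) i j k\<bar> < e'"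
      unfolding dcdet_def using s by linarith
  qed
qed

text \<open>One ordering per set of three indices, so that a single collinear triple means a single
  vanishing member of the family.\<close>

definition triples3 :: "nat \<Rightarrow> (nat \<times> nat \<times> nat) set" where
  "triples3 n = {(i, j, k). 1 \<le> i \<and> i < j \<and> j < k \<and> k \<le> n}"

definition cdets :: "(real \<Rightarrow> nat \<Rightarrow> complex) \<Rightarrow> nat \<times> nat \<times> nat \<Rightarrow> real \<Rightarrow> real" where
  "cdets \<beta> = (\<lambda>(i, j, k) t. cdet (\<beta> t) i j k)"

lemma triples3_dist_idx: "(i, j, k) \<in> triples3 n \<Longrightarrow> dist_idx n [i, j, k]"
  by (auto simp: triples3_def dist_idx_def)

lemma finite_triples3: "finite (triples3 n)"
  by (rule finite_subset[OF _ finite_dist_idx[of n]]) (auto intro: triples3_dist_idx)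

lemma critical_moments_eq: "critical_moments n \<beta> = zero_times (triples3 n) (cdets \<beta>)"
proof -
  have "collinear_triples n z \<noteq> {} \<longleftrightarrow> (\<exists>(i, j, k)\<in>triples3 n. cdet z i j k = 0)" for z
  proof
    assume "collinear_triples n z \<noteq> {}"
    then obtain T where T: "T \<in> collinear_triples n z" by blast
    then obtain i0 j0 k0 where 0: "dist_idx n [i0, j0, k0]" "T = {i0, j0, k0}" by (rule collinear_triplesE)
    have "inj_on real {1..n}" by simp
    then obtain i j k where ijk: "{i, j, k} = {i0, j0, k0}" "real i < real j" "real j < real k" "dist_idx n [i, j, k]"
      using sort_triple[OF _ 0(1)] by metis
    have "cdet z i j k = 0" using T 0(2) ijk(1) collinear_triples_iff[OF ijk(4)] by simp
    moreover have "(i, j, k) \<in> triples3 n" using ijk by (auto simp: triples3_def dist_idx_def)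
    ultimately show "\<exists>(i, j, k)\<in>triples3 n. cdet z i j k = 0" by blast
  next
    assume "\<exists>(i, j, k)\<in>triples3 n. cdet z i j k = 0"
    then obtain i j k where "(i, j, k) \<in> triples3 n" "cdet z i j k = 0" by blast
    then show "collinear_triples n z \<noteq> {}"
      using collinear_triples_iff[OF triples3_dist_idx] by blast
  qed
  then show ?thesis by (simp add: critical_moments_def zero_times_def cdets_def case_prod_beta)
qed

lemma transverse_good_stable:
  assumes \<beta>: "pure_braid n \<beta>" and amo: "\<And>t. t \<in> {0..1} \<Longrightarrow> amo n (\<beta> t)"
    and tr: "\<And>t i j k. t \<in> {0..1} \<Longrightarrow> dist_idx n [i, j, k] \<Longrightarrow> cdet (\<beta> t) i j k = 0 \<Longrightarrow>
      dcdet (\<beta> t) (vel \<beta> t) i j k \<noteq> 0"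
  shows "good_stable n \<beta>"
proof -
  define F' where "F' = (\<lambda>\<beta> (i, j, k) t. dcdet (\<beta> t) (vel \<beta> t) i j k)"
  have der: "(cdets \<gamma> x has_real_derivative F' \<gamma> x t) (at t within {0..1})"
    if "pure_braid n \<gamma>" "x \<in> triples3 n" "t \<in> {0..1}" for \<gamma> x t
  proof -
    obtain i j k where x: "x = (i, j, k)" by (cases x)
    have "l \<in> {1..n}" if "l \<in> {i, j, k}" for l
      using \<open>x \<in> triples3 n\<close> that x by (auto simp: triples3_def)
    then show ?thesis
      using cdet_has_derivative[of i j k \<gamma> "vel \<gamma> t" t "{0..1}"] pure_braid_vel(1)[OF that(1) _ that(3)]
      by (simp add: x cdets_def F'_def)
  qed
  have Z: "finite (zero_times (triples3 n) (cdets \<beta>)) \<and> (\<exists>\<epsilon>>0. \<forall>G G'.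
    (\<forall>i\<in>triples3 n. \<forall>t\<in>{0..1}. (G i has_real_derivative G' i t) (at t within {0..1}) \<and>
       \<bar>G i t - cdets \<beta> i t\<bar> < \<epsilon> \<and> \<bar>G' i t - F' \<beta> i t\<bar> < \<epsilon>) \<longrightarrow>
    finite (zero_times (triples3 n) G) \<and> card (zero_times (triples3 n) G) = card (zero_times (triples3 n) (cdets \<beta>)))"
  proof (rule transverse_zeros_stable[OF finite_triples3])
    show "(cdets \<beta> i has_real_derivative F' \<beta> i t) (at t within {0..1})" if "i \<in> triples3 n" "t \<in> {0..1}" for i t
      by (rule der[OF \<beta> that])
    show "continuous_on {0..1} (F' \<beta> x)" if x: "x \<in> triples3 n" for x
    proof -
      obtain i j k where xx: "x = (i, j, k)" by (cases x)
      have "l \<in> {1..n}" if "l \<in> {i, j, k}" for l using x that xx by (auto simp: triples3_def)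
      then have c: "continuous_on {0..1} (\<lambda>t. vel \<beta> t l)" "continuous_on {0..1} (\<lambda>t. \<beta> t l)" if "l \<in> {i, j, k}" for l
        using pure_braid_vel(2,3)[OF \<beta>] that by blast+
      show ?thesis
        unfolding F'_def xx prod.case dcdet_def cross2_def by (intro continuous_intros c) auto
    qed
    show "x = y" if xy: "x \<in> triples3 n" "y \<in> triples3 n" "t \<in> {0..1}" "cdets \<beta> x t = 0" "cdets \<beta> y t = 0" for x y t
    proof -
      obtain i j k a b c where x: "x = (i, j, k)" and y: "y = (a, b, c)" by (cases x, cases y)
      have "{i, j, k} \<in> collinear_triples n (\<beta> t)" "{a, b, c} \<in> collinear_triples n (\<beta> t)"
        using xy collinear_triples_iff triples3_dist_idx by (auto simp: x y cdets_def)
      then have eq: "{i, j, k} = {a, b, c}" using amo[OF xy(3)] by (simp add: amo_def)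
      have s: "i < j" "j < k" "a < b" "b < c" using xy(1,2) by (auto simp: x y triples3_def)
      have "i = Min {i, j, k}" "a = Min {a, b, c}" "k = Max {i, j, k}" "c = Max {a, b, c}" using s by auto
      then have "i = a" "k = c" using eq by metis+
      moreover have "j \<in> {a, b, c}" using eq by blast
      ultimately show ?thesis using s by (auto simp: x y)
    qed
    show "F' \<beta> x t \<noteq> 0" if "x \<in> triples3 n" "t \<in> {0..1}" "cdets \<beta> x t = 0" for x t
    proof -
      obtain i j k where x: "x = (i, j, k)" by (cases x)
      then show ?thesis using tr[OF that(2) triples3_dist_idx] that by (simp add: F'_def cdets_def)
    qed
    show "cdets \<beta> x 0 \<noteq> 0 \<and> cdets \<beta> x 1 \<noteq> 0" if "x \<in> triples3 n" for x
    proof -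
      obtain i j k where x: "x = (i, j, k)" by (cases x)
      have "\<beta> 0 = base_config n" "\<beta> 1 = base_config n" using \<beta> by (auto simp: pure_braid_def)
      then show ?thesis
        using base_config_generic[of n] triples3_dist_idx that by (simp add: x cdets_def generic_def)
    qed
  qed
  then obtain \<epsilon> where \<epsilon>: "0 < \<epsilon>" and stab: "\<And>G G'.
    (\<forall>i\<in>triples3 n. \<forall>t\<in>{0..1}. (G i has_real_derivative G' i t) (at t within {0..1}) \<and>
       \<bar>G i t - cdets \<beta> i t\<bar> < \<epsilon> \<and> \<bar>G' i t - F' \<beta> i t\<bar> < \<epsilon>) \<Longrightarrow>
    finite (zero_times (triples3 n) G) \<and> card (zero_times (triples3 n) G) = card (zero_times (triples3 n) (cdets \<beta>))"
    by blast
  obtain e where e: "0 < e" "\<And>\<gamma> t i j k. C1_close n e \<beta> \<gamma> \<Longrightarrow> t \<in> {0..1} \<Longrightarrow> dist_idx n [i, j, k] \<Longrightarrow>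
    \<bar>cdet (\<gamma> t) i j k - cdet (\<beta> t) i j k\<bar> < \<epsilon> \<and> \<bar>dcdet (\<gamma> t) (vel \<gamma> t) i j k - dcdet (\<beta> t) (vel \<beta> t) i j k\<bar> < \<epsilon>"
    using C1_close_cdet[OF \<beta> \<epsilon>] by blast
  show ?thesis
    unfolding good_stable_def
  proof (intro conjI exI[of _ e] allI impI ballI)
    show "pure_braid n \<beta>" "0 < e" using \<beta> e by auto
    show "finite (critical_moments n \<beta>)" using Z by (simp add: critical_moments_eq)
    show "\<exists>!T. T \<in> collinear_triples n (\<beta> t)" if "t \<in> critical_moments n \<beta>" for t
      using that amo[of t] by (auto simp: critical_moments_def amo_def)
    fix \<gamma> assume g: "pure_braid n \<gamma> \<and> C1_close n e \<beta> \<gamma>"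
    have "finite (zero_times (triples3 n) (cdets \<gamma>)) \<and>
        card (zero_times (triples3 n) (cdets \<gamma>)) = card (zero_times (triples3 n) (cdets \<beta>))"
    proof (rule stab[where G' = "F' \<gamma>"], intro ballI)
      fix x t assume x: "x \<in> triples3 n" and t: "t \<in> {0..1::real}"
      obtain i j k where xx: "x = (i, j, k)" by (cases x)
      show "(cdets \<gamma> x has_real_derivative F' \<gamma> x t) (at t within {0..1}) \<and>
         \<bar>cdets \<gamma> x t - cdets \<beta> x t\<bar> < \<epsilon> \<and> \<bar>F' \<gamma> x t - F' \<beta> x t\<bar> < \<epsilon>"
        using der[OF _ x t, of \<gamma>] g e(2)[of \<gamma> t i j k] t triples3_dist_idx[of i j k n] x
        by (simp add: xx cdets_def F'_def)
    qed
    then show "finite (critical_moments n \<gamma>)" "card (critical_moments n \<gamma>) = card (critical_moments n \<beta>)"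
      by (simp_all add: critical_moments_eq)
  qed
qed

text \<open>Within a window a determinant interpolates between nonzero values \<open>A\<close> and
  \<open>B\<close> with weight \<open>\<sigma>\<close>. A zero forces \<open>A \<noteq> B\<close>
  and a weight strictly between zero and one, where the step function has positive derivative; so
  the zero is transverse.\<close>

lemma chain_braid_good_stable:
  assumes M: "0 < M" and c: "chain n M c" and pure: "pure_braid n (chain_braid n M c)"
  shows "good_stable n (chain_braid n M c)"
proof (rule transverse_good_stable[OF pure])
  let ?\<beta> = "chain_braid n M c"
  fix t :: real assume t: "t \<in> {0..1}"
  obtain w where w: "w < M" "real w \<le> real M * t" "real M * t \<le> real (Suc w)"
    using window_exists[OF M t] by blast
  have step: "gstep n (c w) (c (Suc w))" using c w(1) by (simp add: chain_def)
  obtain a where a: "\<And>j. j \<noteq> a \<Longrightarrow> c (Suc w) j = c w j" using step by (auto simp: gstep_def)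
  have "collinear_triples n (?\<beta> t) = collinear_triples n (seg (c w) (c (Suc w)) (step (real M * t - real w)))"
    using chain_braid_seg[OF w] by (intro collinear_triples_cong) auto
  moreover have "amo n (seg (c w) (c (Suc w)) (step (real M * t - real w)))"
    using step step_bounds unfolding gstep_def by simp
  ultimately show "amo n (?\<beta> t)" by (simp add: amo_def)
  fix i j k assume d: "dist_idx n [i, j, k]" and 0: "cdet (?\<beta> t) i j k = 0"
  have in_n: "i \<in> {1..n}" "j \<in> {1..n}" "k \<in> {1..n}" and dd: "distinct [i, j, k]"
    using d by (auto simp: dist_idx_def)
  define A B where "A = cdet (c w) i j k" and "B = cdet (c (Suc w)) i j k"
  have AB: "A \<noteq> 0" "B \<noteq> 0" using step d by (auto simp: A_def B_def gstep_def generic_def)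
  have form: "cdet (?\<beta> s) i j k = (1 - step (real M * s - real w)) * A + step (real M * s - real w) * B"
    if "real w \<le> real M * s" "real M * s \<le> real (Suc w)" for s
  proof -
    have "cdet (?\<beta> s) i j k = cdet (seg (c w) (c (Suc w)) (step (real M * s - real w))) i j k"
      unfolding cdet_def using chain_braid_seg[OF w(1) that] in_n by simp
    also have "\<dots> = (1 - step (real M * s - real w)) * A + step (real M * s - real w) * B"
      unfolding A_def B_def by (rule cdet_seg[OF a dd])
    finally show ?thesis .
  qed
  define \<sigma> where "\<sigma> = step (real M * t - real w)"
  have z: "(1 - \<sigma>) * A + \<sigma> * B = 0" using form[OF w(2,3)] 0 by (simp add: \<sigma>_def)
  have "\<sigma> \<noteq> 0" "\<sigma> \<noteq> 1" using z AB by auto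
  then have x: "0 < real M * t - real w" "real M * t - real w < 1"
    using step_le_0[of "real M * t - real w"] step_ge_1[of "real M * t - real w"] unfolding \<sigma>_def by linarith+
  have BA: "B - A \<noteq> 0" using z AB(1) by (auto simp: algebra_simps)
  have t': "0 < t" "t < 1"
  proof -
    show "0 < t" using x(1) M by (metis diff_gt_0_iff_gt le_less_trans less_irrefl mult_eq_0_iff of_nat_0_le_iff order.order_iff_strict atLeastAtMost_iff t)
    have "real w + 1 \<le> real M" using w(1) by linarith
    then have "real M * t < real M * 1" using x(2) by linarith
    then show "t < 1" using M by (metis mult_less_cancel_left_pos of_nat_0_less_iff)
  qed
  obtain D where D: "0 < D" "(step has_real_derivative D) (at (real M * t - real w))"
    using step_deriv[OF x] by blast
  have lin: "((\<lambda>s. real M * s - real w) has_real_derivative real M) (at t)"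
    by (auto intro!: derivative_eq_intros)
  have st: "((\<lambda>s. step (real M * s - real w)) has_real_derivative D * real M) (at t)"
    by (rule DERIV_chain2[OF D(2) lin])
  have "((\<lambda>s. (1 - step (real M * s - real w)) * A + step (real M * s - real w) * B) has_real_derivative
      D * real M * (B - A)) (at t)"
    by (rule DERIV_cong[OF DERIV_add[OF DERIV_cmult_right[OF DERIV_diff[OF DERIV_const st]] DERIV_cmult_right[OF st]]])
      (simp add: algebra_simps)
  moreover have "open {s. real w < real M * s \<and> real M * s < real (Suc w)}"
    by (intro open_Collect_conj open_Collect_less continuous_intros)
  ultimately have der: "((\<lambda>s. cdet (?\<beta> s) i j k) has_real_derivative D * real M * (B - A)) (at t)"
    using x form by (elim has_field_derivative_transform_within_open) auto
  have "((\<lambda>s. cdet (?\<beta> s) i j k) has_real_derivative dcdet (?\<beta> t) (vel ?\<beta> t) i j k) (at t within {0..1})"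
    using in_n by (intro cdet_has_derivative pure_braid_vel(1)[OF pure _ t]) auto
  then have "((\<lambda>s. cdet (?\<beta> s) i j k) has_real_derivative dcdet (?\<beta> t) (vel ?\<beta> t) i j k) (at t)"
    using t' at_within_Icc_at[of 0 t 1] by simp
  then have "dcdet (?\<beta> t) (vel ?\<beta> t) i j k = D * real M * (B - A)"
    using der DERIV_unique by blast
  then show "dcdet (?\<beta> t) (vel ?\<beta> t) i j k \<noteq> 0" using D(1) M BA by simp
qed

section \<open>Smooth isotopy and homotopy of loops\<close>

lemma bloop_radius:
  assumes "bloop n p"
  obtains e where "0 < e" "\<And>t z. t \<in> {0..1} \<Longrightarrow> z \<in> nbox n (p t) e \<Longrightarrow> inj_on z {1..n}"
  using uniform_potential[OF bloop_bpath[OF assms]] by blast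

lemma chain_braid_approx:
  assumes n: "0 < n" and p: "bloop n p" and e: "0 < e"
  obtains N0 where "\<And>N. N0 \<le> N \<Longrightarrow> 0 < n * N \<and> (\<exists>c. chain n (n * N) c \<and>
    pure_braid n (chain_braid n (n * N) c) \<and> (\<forall>t\<in>{0..1}. chain_braid n (n * N) c t \<in> nbox n (p t) e))"
proof -
  obtain e' where e': "0 < e'" "\<And>t z. t \<in> {0..1} \<Longrightarrow> z \<in> nbox n (p t) e' \<Longrightarrow> inj_on z {1..n}"
    using bloop_radius[OF p] by blast
  define d where "d = min e e'"
  have d: "0 < d" "nbox n (p t) d \<subseteq> nbox n (p t) e" "nbox n (p t) d \<subseteq> nbox n (p t) e'" for t
    using e e'(1) by (auto simp: d_def intro!: nbox_mono)
  obtain N0 where N0: "\<And>N. N0 \<le> N \<Longrightarrow> 0 < N \<and> (\<exists>c. chain n (n * N) c \<and> (\<forall>w<n * N. \<forall>t\<in>{0..1}.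
     real w \<le> real (n * N) * t \<longrightarrow> real (n * N) * t \<le> real (Suc w) \<longrightarrow> c w \<in> nbox n (p t) d \<and> c (Suc w) \<in> nbox n (p t) d))"
    using chain_approx[OF n p d(1)] by blast
  show ?thesis
  proof (rule that[of N0])
    fix N assume "N0 \<le> N"
    then obtain c where N: "0 < N" and c: "chain n (n * N) c" and near: "\<forall>w<n * N. \<forall>t\<in>{0..1}.
     real w \<le> real (n * N) * t \<longrightarrow> real (n * N) * t \<le> real (Suc w) \<longrightarrow> c w \<in> nbox n (p t) d \<and> c (Suc w) \<in> nbox n (p t) d"
      using N0 by blast
    have M: "0 < n * N" using n N by simp
    have "pure_braid n (chain_braid n (n * N) c)"
      by (rule chain_braid_pure[OF M c near]) (use e'(2) d(3) in blast)
    moreover have "chain_braid n (n * N) c t \<in> nbox n (p t) e" if "t \<in> {0..1}" for t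
      using chain_braid_near[OF M near that] d(2) by blast
    ultimately show "0 < n * N \<and> (\<exists>c. chain n (n * N) c \<and>
      pure_braid n (chain_braid n (n * N) c) \<and> (\<forall>t\<in>{0..1}. chain_braid n (n * N) c t \<in> nbox n (p t) e))"
      using M c by blast
  qed
qed

lemma pure_approx:
  assumes "0 < n" "bloop n p" "0 < e"
  shows "\<exists>\<beta>. pure_braid n \<beta> \<and> (\<forall>t\<in>{0..1}. \<beta> t \<in> nbox n (p t) e)"
  using chain_braid_approx[OF assms] by (metis order_refl)

definition line_homotopy :: "nat \<Rightarrow> (real \<Rightarrow> nat \<Rightarrow> complex) \<Rightarrow> (real \<Rightarrow> nat \<Rightarrow> complex) \<Rightarrow> real \<times> real \<Rightarrow> nat \<Rightarrow> complex" where
  "line_homotopy n p q x = (\<lambda>j\<in>{1..n}. p (snd x) j + of_real (fst x) * (q (snd x) j - p (snd x) j))"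

lemma line_homotopy_continuous:
  assumes "cpath n p" "cpath n q"
    and inj: "\<And>s t. s \<in> {0..1} \<Longrightarrow> t \<in> {0..1} \<Longrightarrow> inj_on (seg (p t) (q t) s) {1..n}"
  shows "continuous_map (prod_topology (top_of_set {0..1}) (top_of_set {0..1})) (config_space n) (line_homotopy n p q)"
proof -
  have "line_homotopy n p q x \<in> Conf n" if "x \<in> {0..1} \<times> {0..1}" for x
  proof -
    have x: "fst x \<in> {0..1}" "snd x \<in> {0..1}" using that by auto
    have "inj_on (line_homotopy n p q x) {1..n} \<longleftrightarrow> inj_on (seg (p (snd x)) (q (snd x)) (fst x)) {1..n}"
      by (rule inj_on_cong) (simp add: line_homotopy_def seg_def)
    then show ?thesis
      using inj[OF x] by (simp add: Conf_iff line_homotopy_def)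
  qed
  moreover have "continuous_on ({0..1} \<times> {0..1}) (\<lambda>x. line_homotopy n p q x j)" if j: "j \<in> {1..n}" for j
  proof -
    have c: "continuous_on {0..1} (\<lambda>t. p t j)" "continuous_on {0..1} (\<lambda>t. q t j)"
      using assms j by (auto simp: cpath_def)
    have c2: "continuous_on ({0..1} \<times> {0..1}) (\<lambda>x :: real \<times> real. p (snd x) j)"
      "continuous_on ({0..1} \<times> {0..1}) (\<lambda>x :: real \<times> real. q (snd x) j)"
    proof -
      have s: "continuous_on ({0..1} \<times> {0..1}) (snd :: real \<times> real \<Rightarrow> real)"
        by (rule continuous_on_snd[OF continuous_on_id])
      have im: "snd ` ({0..1} \<times> {0..1} :: (real \<times> real) set) \<subseteq> {0..1}" by auto
      show "continuous_on ({0..1} \<times> {0..1}) (\<lambda>x :: real \<times> real. p (snd x) j)"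
        "continuous_on ({0..1} \<times> {0..1}) (\<lambda>x :: real \<times> real. q (snd x) j)"
        by (rule continuous_on_compose2[OF c(1) s im], rule continuous_on_compose2[OF c(2) s im])
    qed
    have "continuous_on ({0..1} \<times> {0..1}) (\<lambda>x. p (snd x) j + of_real (fst x) * (q (snd x) j - p (snd x) j))"
      by (intro continuous_intros c2)
    then show ?thesis using j by (simp add: line_homotopy_def)
  qed
  ultimately show ?thesis
    by (simp add: continuous_map_config_space)
qed

lemma line_homotopy_ends:
  assumes "p t \<in> extensional {1..n}" "q t \<in> extensional {1..n}"
  shows "line_homotopy n p q (0, t) = p t" "line_homotopy n p q (1, t) = q t"
  using assms by (auto simp: line_homotopy_def extensional_def)

lemma bloop_ext: "bloop n p \<Longrightarrow> t \<in> {0..1} \<Longrightarrow> p t \<in> extensional {1..n}"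
  using path_Conf_iff[of p n] by (auto simp: bloop_def Conf_iff)

lemma bloop_cpath: "bloop n p \<Longrightarrow> cpath n p"
  using bloop_bpath by (simp add: bpath_def)

text \<open>The straight segments between \<open>p t\<close> and \<open>q t\<close> stay in convex
  boxes whose members are all injective.\<close>

lemma near_homotopic:
  assumes p: "bloop n p" and q: "bloop n q"
    and r: "\<And>t z. t \<in> {0..1} \<Longrightarrow> z \<in> nbox n (r t) e \<Longrightarrow> inj_on z {1..n}"
    and near: "\<And>t. t \<in> {0..1} \<Longrightarrow> p t \<in> nbox n (r t) e" "\<And>t. t \<in> {0..1} \<Longrightarrow> q t \<in> nbox n (r t) e"
  shows "homotopic_paths (Conf n) p q"
proof -
  have inj: "inj_on (seg (p t) (q t) s) {1..n}" if "s \<in> {0..1}" "t \<in> {0..1}" for s t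
    by (rule r[OF that(2)]) (rule nbox_seg[OF near(1)[OF that(2)] near(2)[OF that(2)] that(1)])
  have c: "continuous_map (prod_topology (top_of_set {0..1}) (top_of_set {0..1})) (top_of_set (Conf n)) (line_homotopy n p q)"
    using line_homotopy_continuous[OF bloop_cpath[OF p] bloop_cpath[OF q] inj]
    unfolding continuous_map_Conf .
  show ?thesis
    unfolding homotopic_paths
  proof (rule exI[of _ "line_homotopy n p q"], intro conjI ballI)
    show "continuous_on ({0..1} \<times> {0..1}) (line_homotopy n p q)"
      "line_homotopy n p q \<in> {0..1} \<times> {0..1} \<rightarrow> Conf n"
      using c by (auto simp: continuous_map_in_subtopology)
    fix t :: real assume t: "t \<in> {0..1}"
    show "line_homotopy n p q (0, t) = p t" "line_homotopy n p q (1, t) = q t"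
      using line_homotopy_ends[of p t n q] bloop_ext[OF p t] bloop_ext[OF q t] by auto
    have "line_homotopy n p q (t, 0) = p 0" "line_homotopy n p q (t, 1) = p 1"
      using bloop_ends[OF p] bloop_ends[OF q] base_config_Conf[of n]
      by (auto simp: line_homotopy_def Conf_iff extensional_def)
    then show "pathstart (line_homotopy n p q \<circ> Pair t) = pathstart p" "pathfinish (line_homotopy n p q \<circ> Pair t) = pathfinish p"
      by (auto simp: pathstart_def pathfinish_def)
  qed
qed

lemma pure_braid_cong:
  assumes "\<And>t. t \<in> {0..1} \<Longrightarrow> \<beta> t = \<gamma> t"
  shows "pure_braid n \<beta> \<longleftrightarrow> pure_braid n \<gamma>"
proof -
  have "smooth_on {0..1} (\<lambda>t. \<beta> t j) \<longleftrightarrow> smooth_on {0..1} (\<lambda>t. \<gamma> t j)" for j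
    by (rule smooth_on_cong) (use assms in simp)
  then show ?thesis using assms unfolding pure_braid_def by simp
qed

text \<open>The slices of the straight-line homotopy are linear combinations of smooth braids, hence
  smooth.\<close>

lemma near_isotopic:
  assumes p: "pure_braid n p" and q: "pure_braid n q"
    and r: "\<And>t z. t \<in> {0..1} \<Longrightarrow> z \<in> nbox n (r t) e \<Longrightarrow> inj_on z {1..n}"
    and near: "\<And>t. t \<in> {0..1} \<Longrightarrow> p t \<in> nbox n (r t) e" "\<And>t. t \<in> {0..1} \<Longrightarrow> q t \<in> nbox n (r t) e"
  shows "braid_isotopic n p q"
proof -
  have bl: "bloop n p" "bloop n q" using p q pure_braid_bloop by auto
  have inj: "inj_on (seg (p t) (q t) s) {1..n}" if "s \<in> {0..1}" "t \<in> {0..1}" for s t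
    by (rule r[OF that(2)]) (rule nbox_seg[OF near(1)[OF that(2)] near(2)[OF that(2)] that(1)])
  have c: "continuous_map (prod_topology (top_of_set {0..1}) (top_of_set {0..1})) (config_space n) (line_homotopy n p q)"
    by (rule line_homotopy_continuous[OF bloop_cpath[OF bl(1)] bloop_cpath[OF bl(2)] inj])
  have "homotopic_with (pure_braid n) (top_of_set {0..1}) (config_space n) p q"
  proof (subst homotopic_with)
    show "pure_braid n h \<longleftrightarrow> pure_braid n k" if "\<And>x. x \<in> topspace (top_of_set {0..1}) \<Longrightarrow> h x = k x" for h k
      using that by (intro pure_braid_cong) simp
    show "\<exists>h. continuous_map (prod_topology (top_of_set {0..1::real}) (top_of_set {0..1})) (config_space n) h \<and>
      (\<forall>x\<in>topspace (top_of_set {0..1}). h (0, x) = p x) \<and> (\<forall>x\<in>topspace (top_of_set {0..1}). h (1, x) = q x) \<and>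
      (\<forall>t\<in>{0..1}. pure_braid n (\<lambda>x. h (t, x)))"
    proof (rule exI[of _ "line_homotopy n p q"], intro conjI ballI)
      show "continuous_map (prod_topology (top_of_set {0..1}) (top_of_set {0..1})) (config_space n) (line_homotopy n p q)"
        by (rule c)
      fix s :: real assume s: "s \<in> {0..1}"
      have "line_homotopy n p q (s, t) \<in> Conf n" if "t \<in> {0..1}" for t
        using c that s unfolding continuous_map_config_space by auto
      moreover have "smooth_on {0..1} (\<lambda>t. line_homotopy n p q (s, t) j)" if j: "j \<in> {1..n}" for j
      proof -
        have sm: "smooth_on {0..1} (\<lambda>t. p t j)" "smooth_on {0..1} (\<lambda>t. q t j)"
          using p q j by (auto simp: pure_braid_def)
        have "smooth_on {0..1} (\<lambda>t. (1 - s) *\<^sub>R p t j + s *\<^sub>R q t j)"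
          by (intro smooth_on_add smooth_on_bounded_linear[OF bounded_linear_scaleR_right] sm)
        then show ?thesis
          using j by (simp add: line_homotopy_def scaleR_conv_of_real algebra_simps)
      qed
      moreover have "line_homotopy n p q (s, 0) = base_config n" "line_homotopy n p q (s, 1) = base_config n"
        using bloop_ends[OF bl(1)] bloop_ends[OF bl(2)] base_config_Conf[of n]
        by (auto simp: line_homotopy_def Conf_iff extensional_def)
      ultimately show "pure_braid n (\<lambda>x. line_homotopy n p q (s, x))"
        unfolding pure_braid_def by blast
    next
      fix x :: real assume "x \<in> topspace (top_of_set {0..1})"
      then have x: "x \<in> {0..1}" by simp
      show "line_homotopy n p q (0, x) = p x" "line_homotopy n p q (1, x) = q x"
        using line_homotopy_ends[of p x n q] bloop_ext[OF bl(1) x] bloop_ext[OF bl(2) x] by auto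
    qed
  qed
  then show ?thesis by (simp add: braid_isotopic_def)
qed

lemma braid_isotopic_sym: "braid_isotopic n p q \<Longrightarrow> braid_isotopic n q p"
  and braid_isotopic_trans: "braid_isotopic n p q \<Longrightarrow> braid_isotopic n q r \<Longrightarrow> braid_isotopic n p r"
  unfolding braid_isotopic_def by (fact homotopic_with_symD, fact homotopic_with_trans)

lemma braid_class_eqI: "braid_isotopic n p q \<Longrightarrow> braid_class n p = braid_class n q"
  unfolding braid_class_def using braid_isotopic_sym braid_isotopic_trans by blast

lemma isotopic_imp_pure: "braid_isotopic n p q \<Longrightarrow> pure_braid n p \<and> pure_braid n q"
  unfolding braid_isotopic_def
  using homotopic_with_imp_property[of "pure_braid n" "top_of_set {0..1}" "config_space n" p q] .

lemma isotopic_imp_homotopic: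
  assumes "braid_isotopic n p q"
  shows "homotopic_paths (Conf n) p q"
proof -
  have p: "p 0 = base_config n" "p 1 = base_config n"
    using isotopic_imp_pure[OF assms] by (auto simp: pure_braid_def)
  obtain h where h: "continuous_map (prod_topology (top_of_set {0..1::real}) (top_of_set {0..1})) (config_space n) h"
    "\<forall>x. h (0, x) = p x" "\<forall>x. h (1, x) = q x" "\<forall>t\<in>{0..1}. pure_braid n (\<lambda>x. h (t, x))"
    using assms unfolding braid_isotopic_def homotopic_with_def by blast
  show ?thesis
    unfolding homotopic_paths
  proof (rule exI[of _ h], intro conjI ballI)
    show "continuous_on ({0..1} \<times> {0..1}) h" "h \<in> {0..1} \<times> {0..1} \<rightarrow> Conf n"
      using h(1) unfolding continuous_map_Conf by (auto simp: continuous_map_in_subtopology)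
    fix t :: real assume t: "t \<in> {0..1}"
    show "h (0, t) = p t" "h (1, t) = q t" using h(2,3) by auto
    have "h (t, 0) = base_config n" "h (t, 1) = base_config n"
      using h(4) t unfolding pure_braid_def by blast+
    then show "pathstart (h \<circ> Pair t) = pathstart p" "pathfinish (h \<circ> Pair t) = pathfinish p"
      using p by (simp_all add: pathstart_def pathfinish_def)
  qed
qed

text \<open>The slices of a continuous homotopy need not be smooth; they are replaced by chain braids nearby,
  consecutive ones being joined by straight-line homotopies.\<close>

lemma homotopic_imp_isotopic:
  assumes n: "0 < n" and p: "pure_braid n p" and q: "pure_braid n q"
    and hom: "homotopic_paths (Conf n) p q"
  shows "braid_isotopic n p q"
proof -
  obtain h where hc: "continuous_on ({0..1::real} \<times> {0..1}) h" and him: "h \<in> {0..1} \<times> {0..1} \<rightarrow> Conf n"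
    and h0: "\<forall>x\<in>{0..1}. h (0, x) = p x" and h1: "\<forall>x\<in>{0..1}. h (1, x) = q x"
    and he: "\<forall>t\<in>{0..1}. pathstart (h \<circ> Pair t) = pathstart p \<and> pathfinish (h \<circ> Pair t) = pathfinish p"
    using hom unfolding homotopic_paths by blast
  define P where "P = (\<lambda>s t. h (s, t))"
  have P: "bloop n (P s)" if s: "s \<in> {0..1}" for s
  proof -
    have "continuous_on {0..1} (P s)"
      unfolding P_def by (rule continuous_on_compose2[OF hc]) (use s in \<open>auto intro!: continuous_intros\<close>)
    moreover have "P s t \<in> Conf n" if "t \<in> {0..1}" for t using him s that by (auto simp: P_def)
    moreover have "P s 0 = base_config n" "P s 1 = base_config n"
      using he s p by (auto simp: P_def pure_braid_def pathstart_def pathfinish_def)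
    ultimately show ?thesis
      by (auto simp: bloop_def path_def path_image_def pathstart_def pathfinish_def)
  qed
  have "\<forall>s\<in>{0..1}. \<exists>e>0. \<forall>t\<in>{0..1}. \<forall>z\<in>nbox n (P s t) e. inj_on z {1..n}"
    using bloop_radius[OF P] by metis
  then obtain e where e: "\<And>s. s \<in> {0..1} \<Longrightarrow> 0 < e s"
    "\<And>s t z. s \<in> {0..1} \<Longrightarrow> t \<in> {0..1} \<Longrightarrow> z \<in> nbox n (P s t) (e s) \<Longrightarrow> inj_on z {1..n}" by metis
  have "\<forall>s\<in>{0..1}. \<exists>\<gamma>. pure_braid n \<gamma> \<and> (\<forall>t\<in>{0..1}. \<gamma> t \<in> nbox n (P s t) (e s))"
    using pure_approx[OF n P] e(1) by blast
  then obtain \<gamma> where \<gamma>: "\<And>s. s \<in> {0..1} \<Longrightarrow> pure_braid n (\<gamma> s)"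
    "\<And>s t. s \<in> {0..1} \<Longrightarrow> t \<in> {0..1} \<Longrightarrow> \<gamma> s t \<in> nbox n (P s t) (e s)" by metis
  have cj: "continuous_on ({0..1} \<times> {0..1}) (\<lambda>x. h x j)" for j
    by (rule continuous_on_product_then_coordinatewise[OF hc])
  have "braid_class n (\<gamma> 0) = braid_class n (\<gamma> 1)"
  proof (rule connected_local_const[of "{0..1::real}" 0 1 "\<lambda>s. braid_class n (\<gamma> s)"])
    show "\<forall>s\<in>{0..1}. \<forall>\<^sub>F s' in at s within {0..1}. braid_class n (\<gamma> s) = braid_class n (\<gamma> s')"
    proof
      fix s :: real assume s: "s \<in> {0..1}"
      have pos: "0 < e s / 2" using e(1)[OF s] by simp
      obtain d where d: "0 < d" "\<forall>a\<in>{0..1}. \<forall>b\<in>{0..1}. dist b a < d \<longrightarrow> (\<forall>t\<in>{0..1}. h (b, t) \<in> nbox n (h (a, t)) (e s / 2))"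
        using square_near[of n h "e s / 2", OF cj pos] by blast
      have "braid_class n (\<gamma> s) = braid_class n (\<gamma> s')" if s': "s' \<in> {0..1}" "dist s' s < d" for s'
      proof -
        have near: "P s' t \<in> nbox n (P s t) (e s / 2)" if t: "t \<in> {0..1}" for t
          unfolding P_def by (rule d(2)[rule_format, OF s s' t])
        \<comment> \<open>An auxiliary braid close to slice \<open>s'\<close> within both radii: it
          is joined to \<open>\<gamma> s\<close> inside the boxes of slice \<open>s\<close> and to
          \<open>\<gamma> s'\<close> inside those of slice \<open>s'\<close>.\<close>
        have "0 < min (e s / 2) (e s')" using pos e(1)[OF s'(1)] by simp
        then obtain \<delta> where \<delta>: "pure_braid n \<delta>" "\<forall>t\<in>{0..1}. \<delta> t \<in> nbox n (P s' t) (min (e s / 2) (e s'))"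
          using pure_approx[OF n P[OF s'(1)]] by blast
        have \<delta>': "\<delta> t \<in> nbox n (P s' t) (e s')" "\<delta> t \<in> nbox n (P s t) (e s)" if t: "t \<in> {0..1}" for t
        proof -
          have sub: "nbox n (P s' t) (min (e s / 2) (e s')) \<subseteq> nbox n (P s' t) (e s')"
            "nbox n (P s' t) (min (e s / 2) (e s')) \<subseteq> nbox n (P s' t) (e s / 2)"
            by (auto intro!: nbox_mono)
          show "\<delta> t \<in> nbox n (P s' t) (e s')" using \<delta>(2) sub(1) t by blast
          have "nbox n (P s' t) (e s / 2) \<subseteq> nbox n (P s t) (e s)"
            using nbox_add[OF near[OF t], of "e s / 2"] by simp
          then show "\<delta> t \<in> nbox n (P s t) (e s)" using \<delta>(2) sub(2) t by blast
        qed
        have "braid_isotopic n (\<gamma> s) \<delta>"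
          by (rule near_isotopic[OF \<gamma>(1)[OF s] \<delta>(1) e(2)[OF s] \<gamma>(2)[OF s] \<delta>'(2)])
        moreover have "braid_isotopic n \<delta> (\<gamma> s')"
          by (rule near_isotopic[OF \<delta>(1) \<gamma>(1)[OF s'(1)] e(2)[OF s'(1)] \<delta>'(1) \<gamma>(2)[OF s'(1)]])
        ultimately show ?thesis using braid_class_eqI braid_isotopic_trans by blast
      qed
      then show "\<forall>\<^sub>F s' in at s within {0..1}. braid_class n (\<gamma> s) = braid_class n (\<gamma> s')"
        unfolding eventually_at using d(1) by auto
    qed
  qed auto
  then have cls: "braid_class n (\<gamma> 0) = braid_class n (\<gamma> 1)" .
  have p0: "braid_isotopic n p (\<gamma> 0)"
  proof (rule near_isotopic[OF p \<gamma>(1) e(2)[of 0]])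
    show "p t \<in> nbox n (P 0 t) (e 0)" if "t \<in> {0..1}" for t
      using h0 that e(1)[of 0] by (simp add: P_def)
  qed (use \<gamma>(2) in auto)
  have q1: "braid_isotopic n q (\<gamma> 1)"
  proof (rule near_isotopic[OF q \<gamma>(1) e(2)[of 1]])
    show "q t \<in> nbox n (P 1 t) (e 1)" if "t \<in> {0..1}" for t
      using h1 that e(1)[of 1] by (simp add: P_def)
  qed (use \<gamma>(2) in auto)
  have "\<gamma> 1 \<in> braid_class n (\<gamma> 1)"
    using braid_isotopic_trans[OF braid_isotopic_sym[OF q1] q1] by (simp add: braid_class_def)
  then have "braid_isotopic n (\<gamma> 0) (\<gamma> 1)" unfolding cls[symmetric] by (simp add: braid_class_def)
  then show ?thesis
    using braid_isotopic_trans[OF p0 braid_isotopic_trans[OF _ braid_isotopic_sym[OF q1]]] by blast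
qed

section \<open>Group structure on classes of loops\<close>

section \<open>The pure braid group\<close>

text \<open>The smooth braids homotopic to a loop that is merely continuous. Concatenations and
  reversals can then be formed freely on loops, whether or not they are smooth.\<close>

definition loop_class :: "nat \<Rightarrow> (real \<Rightarrow> nat \<Rightarrow> complex) \<Rightarrow> (real \<Rightarrow> nat \<Rightarrow> complex) set" where
  "loop_class n p = {\<beta>. pure_braid n \<beta> \<and> homotopic_paths (Conf n) p \<beta>}"

lemma braid_class_loop_class:
  assumes "0 < n" "pure_braid n \<beta>"
  shows "braid_class n \<beta> = loop_class n \<beta>"
proof (intro Set.set_eqI iffI)
  fix \<gamma>
  show "\<gamma> \<in> loop_class n \<beta>" if "\<gamma> \<in> braid_class n \<beta>"
  proof -
    have i: "braid_isotopic n \<beta> \<gamma>" using that by (simp add: braid_class_def)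
    then show ?thesis
      using isotopic_imp_pure[OF i] isotopic_imp_homotopic[OF i] by (simp add: loop_class_def)
  qed
  show "\<gamma> \<in> braid_class n \<beta>" if "\<gamma> \<in> loop_class n \<beta>"
    using that homotopic_imp_isotopic[OF assms, of \<gamma>] by (simp add: loop_class_def braid_class_def)
qed

lemma loop_class_eqI: "homotopic_paths (Conf n) p q \<Longrightarrow> loop_class n p = loop_class n q"
proof (intro Set.set_eqI iffI)
  assume pq: "homotopic_paths (Conf n) p q"
  fix \<gamma>
  show "\<gamma> \<in> loop_class n q" if "\<gamma> \<in> loop_class n p"
    using that homotopic_paths_trans[OF homotopic_paths_sym[OF pq], of \<gamma>] by (simp add: loop_class_def)
  show "\<gamma> \<in> loop_class n p" if "\<gamma> \<in> loop_class n q"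
    using that homotopic_paths_trans[OF pq, of \<gamma>] by (simp add: loop_class_def)
qed

lemma bloop_join: "bloop n p \<Longrightarrow> bloop n q \<Longrightarrow> bloop n (p +++ q)"
  by (simp add: bloop_def subset_path_image_join)

lemma approx_homotopic:
  assumes n: "0 < n" and p: "bloop n p"
  obtains N0 where "\<And>N. N0 \<le> N \<Longrightarrow> 0 < n * N \<and> (\<exists>c. chain n (n * N) c \<and>
    chain_braid n (n * N) c \<in> loop_class n p)"
proof -
  obtain e where e: "0 < e" "\<And>t z. t \<in> {0..1} \<Longrightarrow> z \<in> nbox n (p t) e \<Longrightarrow> inj_on z {1..n}"
    using bloop_radius[OF p] by blast
  obtain N0 where N0: "\<And>N. N0 \<le> N \<Longrightarrow> 0 < n * N \<and> (\<exists>c. chain n (n * N) c \<and>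
    pure_braid n (chain_braid n (n * N) c) \<and> (\<forall>t\<in>{0..1}. chain_braid n (n * N) c t \<in> nbox n (p t) e))"
    using chain_braid_approx[OF n p e(1)] by blast
  show ?thesis
  proof (rule that[of N0])
    fix N assume "N0 \<le> N"
    then obtain c where c: "0 < n * N" "chain n (n * N) c" "pure_braid n (chain_braid n (n * N) c)"
      "\<And>t. t \<in> {0..1} \<Longrightarrow> chain_braid n (n * N) c t \<in> nbox n (p t) e" using N0 by blast
    have "homotopic_paths (Conf n) p (chain_braid n (n * N) c)"
      by (rule near_homotopic[OF p pure_braid_bloop[OF c(3)] e(2)]) (use c(4) e(1) in auto)
    then show "0 < n * N \<and> (\<exists>c. chain n (n * N) c \<and> chain_braid n (n * N) c \<in> loop_class n p)"
      using c by (auto simp: loop_class_def)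
  qed
qed

text \<open>Supplies the good and stable representative that the definite description in
  \<open>PB_map\<close> presupposes.\<close>

lemma loop_class_pure:
  assumes "0 < n" "bloop n p"
  obtains \<beta> where "pure_braid n \<beta>" "good_stable n \<beta>" "\<beta> \<in> loop_class n p" "loop_class n p = braid_class n \<beta>"
proof -
  obtain N0 where N0: "\<And>N. N0 \<le> N \<Longrightarrow> 0 < n * N \<and> (\<exists>c. chain n (n * N) c \<and>
    chain_braid n (n * N) c \<in> loop_class n p)" using approx_homotopic[OF assms] by blast
  then obtain c where c: "0 < n * N0" "chain n (n * N0) c" "chain_braid n (n * N0) c \<in> loop_class n p" by blast
  then have pure: "pure_braid n (chain_braid n (n * N0) c)" and
    hom: "homotopic_paths (Conf n) p (chain_braid n (n * N0) c)" by (auto simp: loop_class_def)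
  show ?thesis
    using that[OF pure chain_braid_good_stable[OF c(1,2) pure] c(3)]
      loop_class_eqI[OF hom] braid_class_loop_class[OF assms(1) pure] by simp
qed

lemma PB_carrier:
  assumes "0 < n"
  shows "carrier (PB n) = {loop_class n p | p. bloop n p}"
proof -
  have "carrier (PB n) = {braid_class n \<beta> | \<beta>. pure_braid n \<beta>}" by (simp add: PB_def)
  also have "\<dots> = {loop_class n p | p. bloop n p}"
    using braid_class_loop_class[OF assms] pure_braid_bloop loop_class_pure[OF assms] by (smt (verit) Collect_cong)
  finally show ?thesis .
qed

text \<open>With the same number of moves both factors run at the same speed in the concatenation,
  which is again a chain braid and therefore smooth at the junction.\<close>

lemma chain_braid_join:
  assumes M: "0 < M" and c: "chain n M c" and d: "chain n M d" and t: "t \<in> {0..1}"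
  shows "(chain_braid n M c +++ chain_braid n M d) t
    = chain_braid n (2 * M) (\<lambda>w. if w \<le> M then c w else d (w - M)) t"
proof (rule ext)
  let ?e = "\<lambda>w. if w \<le> M then c w else d (w - M)"
  have cd: "c M = d 0" using c d by (simp add: chain_def)
  fix j
  show "(chain_braid n M c +++ chain_braid n M d) t j = chain_braid n (2 * M) ?e t j"
  proof (cases "j \<in> {1..n}")
    case j: True
    show ?thesis
    proof (cases "t \<le> 1 / 2")
      case True
      then have t2: "2 * t \<in> {0..1}" using t by simp
      obtain w where w: "w < M" "real w \<le> real M * (2 * t)" "real M * (2 * t) \<le> real (Suc w)"
        using window_exists[OF M t2] by blast
      have e: "real (2 * M) * t = real M * (2 * t)" by simp
      have "chain_braid n (2 * M) ?e t j = seg (?e w) (?e (Suc w)) (step (real (2 * M) * t - real w)) j"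
      proof (rule chain_braid_seg[OF _ _ _ j])
        show "w < 2 * M" using w by simp
        show "real w \<le> real (2 * M) * t" "real (2 * M) * t \<le> real (Suc w)" unfolding e using w by auto
      qed
      also have "\<dots> = chain_braid n M c (2 * t) j"
        unfolding chain_braid_seg[OF w j] e using w(1) by simp
      finally show ?thesis using True by (simp add: joinpaths_def)
    next
      case False
      then have t2: "2 * t - 1 \<in> {0..1}" using t by simp
      obtain w where w: "w < M" "real w \<le> real M * (2 * t - 1)" "real M * (2 * t - 1) \<le> real (Suc w)"
        using window_exists[OF M t2] by blast
      have e: "real (2 * M) * t = real M * (2 * t - 1) + real M" by (simp add: algebra_simps)
      have "chain_braid n (2 * M) ?e t j = seg (?e (M + w)) (?e (Suc (M + w))) (step (real (2 * M) * t - real (M + w))) j"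
      proof (rule chain_braid_seg[OF _ _ _ j])
        show "M + w < 2 * M" using w by simp
        show "real (M + w) \<le> real (2 * M) * t" "real (2 * M) * t \<le> real (Suc (M + w))" unfolding e using w by auto
      qed
      also have "\<dots> = chain_braid n M d (2 * t - 1) j"
      proof -
        \<comment> \<open>For \<open>w = 0\<close> the combined list still takes its value from
          \<open>c\<close>, and the junction condition \<open>c M = d 0\<close> is used.\<close>
        have "?e (M + w) = d w" "?e (Suc (M + w)) = d (Suc w)" using cd by (cases "w = 0"; simp)+
        moreover have "real (2 * M) * t - real (M + w) = real M * (2 * t - 1) - real w" unfolding e by simp
        ultimately show ?thesis unfolding chain_braid_seg[OF w j] by (simp only:)
      qed
      finally show ?thesis using False by (simp add: joinpaths_def)
    qed
  next
    case False
    then show ?thesis by (auto simp: joinpaths_def chain_braid_def)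
  qed
qed

text \<open>The product of two classes is a union over smooth concatenations; this shows that the
  union is not empty. The larger of the two thresholds gives both approximations equally many
  moves.\<close>

lemma pure_braid_join_exists:
  assumes n: "0 < n" and p: "bloop n p" and q: "bloop n q"
  obtains \<beta> \<gamma> where "\<beta> \<in> loop_class n p" "\<gamma> \<in> loop_class n q" "pure_braid n (\<beta> +++ \<gamma>)"
proof -
  obtain N1 where N1: "\<And>N. N1 \<le> N \<Longrightarrow> 0 < n * N \<and> (\<exists>c. chain n (n * N) c \<and> chain_braid n (n * N) c \<in> loop_class n p)"
    using approx_homotopic[OF n p] by blast
  obtain N2 where N2: "\<And>N. N2 \<le> N \<Longrightarrow> 0 < n * N \<and> (\<exists>c. chain n (n * N) c \<and> chain_braid n (n * N) c \<in> loop_class n q)"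
    using approx_homotopic[OF n q] by blast
  define M where "M = n * max N1 N2"
  obtain c d where M: "0 < M" and c: "chain n M c" "chain_braid n M c \<in> loop_class n p"
    and d: "chain n M d" "chain_braid n M d \<in> loop_class n q"
    using N1[of "max N1 N2"] N2[of "max N1 N2"] by (auto simp: M_def)
  let ?e = "\<lambda>w. if w \<le> M then c w else d (w - M)"
  have "bloop n (chain_braid n M c)" "bloop n (chain_braid n M d)"
    using c(2) d(2) pure_braid_bloop by (auto simp: loop_class_def)
  then have bl: "bloop n (chain_braid n M c +++ chain_braid n M d)" by (rule bloop_join)
  have eq: "(chain_braid n M c +++ chain_braid n M d) t = chain_braid n (2 * M) ?e t" if "t \<in> {0..1}" for t
    by (rule chain_braid_join[OF M c(1) d(1) that])
  have "pure_braid n (chain_braid n (2 * M) ?e)"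
    unfolding pure_braid_def
  proof (intro conjI ballI)
    show "chain_braid n (2 * M) ?e t \<in> Conf n" if "t \<in> {0..1}" for t
    proof -
      have "(chain_braid n M c +++ chain_braid n M d) t \<in> Conf n"
        using bl that unfolding bloop_def path_image_def by blast
      then show ?thesis by (simp only: eq[OF that])
    qed
    show "smooth_on {0..1} (\<lambda>t. chain_braid n (2 * M) ?e t j)" if "j \<in> {1..n}" for j
      by (rule chain_braid_smooth[OF that])
    show "chain_braid n (2 * M) ?e 0 = base_config n" "chain_braid n (2 * M) ?e 1 = base_config n"
      using bloop_ends[OF bl] eq[of 0] eq[of 1] by auto
  qed
  moreover have "pure_braid n (chain_braid n M c +++ chain_braid n M d) \<longleftrightarrow> pure_braid n (chain_braid n (2 * M) ?e)"
    by (rule pure_braid_cong) (rule eq)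
  ultimately have "pure_braid n (chain_braid n M c +++ chain_braid n M d)" by simp
  then show ?thesis using that c(2) d(2) by blast
qed

text \<open>All admissible pairs of representatives have homotopic concatenations, so the union
  defining the product consists of a single class.\<close>

lemma PB_mult:
  assumes n: "0 < n" and p: "bloop n p" and q: "bloop n q"
  shows "loop_class n p \<otimes>\<^bsub>PB n\<^esub> loop_class n q = loop_class n (p +++ q)"
proof -
  have eq: "braid_class n (\<beta> +++ \<gamma>) = loop_class n (p +++ q)"
    if bc: "\<beta> \<in> loop_class n p" "\<gamma> \<in> loop_class n q" "pure_braid n (\<beta> +++ \<gamma>)" for \<beta> \<gamma>
  proof -
    have "homotopic_paths (Conf n) (p +++ q) (\<beta> +++ \<gamma>)"
      using bc p q by (intro homotopic_paths_join) (auto simp: loop_class_def bloop_def)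
    then show ?thesis
      using braid_class_loop_class[OF n bc(3)] loop_class_eqI by metis
  qed
  obtain \<beta> \<gamma> where "\<beta> \<in> loop_class n p" "\<gamma> \<in> loop_class n q" "pure_braid n (\<beta> +++ \<gamma>)"
    using pure_braid_join_exists[OF assms] by blast
  then have "{braid_class n (\<beta> +++ \<gamma>) | \<beta> \<gamma>. \<beta> \<in> loop_class n p \<and> \<gamma> \<in> loop_class n q \<and> pure_braid n (\<beta> +++ \<gamma>)}
      = {loop_class n (p +++ q)}"
    using eq by blast
  then show ?thesis by (simp add: PB_def)
qed

lemma base_loop: "bloop n (\<lambda>_. base_config n)"
  using base_config_Conf by (auto simp: bloop_def path_def path_image_def pathstart_def pathfinish_def)

lemma PB_one:
  assumes "0 < n"
  shows "\<one>\<^bsub>PB n\<^esub> = loop_class n (\<lambda>_. base_config n)"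
proof -
  have "pure_braid n (\<lambda>_. base_config n)"
    using base_config_Conf smooth_on_const by (auto simp: pure_braid_def)
  then show ?thesis using braid_class_loop_class[OF assms] by (simp add: PB_def)
qed

lemma homotopic_const_join:
  assumes p: "bloop n p"
  shows "homotopic_paths (Conf n) ((\<lambda>_. base_config n) +++ p) p"
proof (rule homotopic_paths_sym, rule homotopic_paths_reparametrize[where f = "\<lambda>t. max 0 (2 * t - 1)"])
  show "continuous_on {0..1} (\<lambda>t. max 0 (2 * t - 1 :: real))" by (intro continuous_intros)
  show "((\<lambda>_. base_config n) +++ p) t = p (max 0 (2 * t - 1))" if "t \<in> {0..1}" for t
    using bloop_ends[OF p] by (cases "t \<le> 1 / 2") (auto simp: joinpaths_def)
qed (use p in \<open>auto simp: bloop_def\<close>)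

lemma homotopic_reverse_join:
  assumes p: "bloop n p"
  shows "homotopic_paths (Conf n) (reversepath p +++ p) (\<lambda>_. base_config n)"
proof -
  \<comment> \<open>The concatenation is \<open>p\<close> at the parameter
    \<open>\<bar>1 - 2 * t\<bar>\<close>, which runs from one to zero and back. The homotopy moves
    this parameter linearly to one, where \<open>p\<close> is at the base configuration.\<close>
  define g where "g = (\<lambda>x::real \<times> real. (1 - fst x) * \<bar>1 - 2 * snd x\<bar> + fst x)"
  have g01: "g x \<in> {0..1}" if "x \<in> {0..1} \<times> {0..1}" for x
  proof -
    have "\<bar>1 - 2 * snd x\<bar> \<le> 1" "0 \<le> 1 - fst x" using that by (auto simp: abs_le_iff)
    then have "(1 - fst x) * \<bar>1 - 2 * snd x\<bar> \<le> 1 - fst x" by (simp add: mult_left_le)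
    moreover have "0 \<le> (1 - fst x) * \<bar>1 - 2 * snd x\<bar>" using \<open>0 \<le> 1 - fst x\<close> by simp
    moreover have "0 \<le> fst x" using that by auto
    ultimately show ?thesis by (simp add: g_def)
  qed
  have cp: "continuous_on {0..1} p" using p by (simp add: bloop_def path_def)
  have cg: "continuous_on ({0..1} \<times> {0..1}) g" unfolding g_def by (intro continuous_intros)
  have Conf: "p s \<in> Conf n" if "s \<in> {0..1}" for s using p that by (auto simp: bloop_def path_image_def)
  show ?thesis
    unfolding homotopic_paths
  proof (rule exI[of _ "\<lambda>x. p (g x)"], intro conjI ballI)
    show "continuous_on ({0..1} \<times> {0..1}) (\<lambda>x. p (g x))"
      by (rule continuous_on_compose2[OF cp cg]) (use g01 in blast)
    show "(\<lambda>x. p (g x)) \<in> {0..1} \<times> {0..1} \<rightarrow> Conf n" using g01 Conf by blast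
    fix t :: real assume t: "t \<in> {0..1}"
    show "p (g (0, t)) = (reversepath p +++ p) t"
      by (auto simp: g_def joinpaths_def reversepath_def abs_if)
    show "p (g (1, t)) = base_config n" using bloop_ends[OF p] by (simp add: g_def)
    show "pathstart ((\<lambda>x. p (g x)) \<circ> Pair t) = pathstart (reversepath p +++ p)"
      "pathfinish ((\<lambda>x. p (g x)) \<circ> Pair t) = pathfinish (reversepath p +++ p)"
      using bloop_ends[OF p] by (auto simp: pathstart_def pathfinish_def g_def joinpaths_def reversepath_def)
  qed
qed

lemma group_PB:
  assumes n: "0 < n"
  shows "group (PB n)"
proof (rule groupI)
  show "\<one>\<^bsub>PB n\<^esub> \<in> carrier (PB n)" using base_loop PB_one[OF n] PB_carrier[OF n] by blast
  fix x assume "x \<in> carrier (PB n)"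
  then obtain p where p: "x = loop_class n p" "bloop n p" using PB_carrier[OF n] by blast
  show "\<one>\<^bsub>PB n\<^esub> \<otimes>\<^bsub>PB n\<^esub> x = x"
    unfolding p(1) PB_one[OF n] PB_mult[OF n base_loop p(2)]
    by (rule loop_class_eqI[OF homotopic_const_join[OF p(2)]])
  have r: "bloop n (reversepath p)" using p(2) by (simp add: bloop_def)
  have "loop_class n (reversepath p) \<otimes>\<^bsub>PB n\<^esub> x = \<one>\<^bsub>PB n\<^esub>"
    unfolding p(1) PB_one[OF n] PB_mult[OF n r p(2)]
    by (rule loop_class_eqI[OF homotopic_reverse_join[OF p(2)]])
  then show "\<exists>y\<in>carrier (PB n). y \<otimes>\<^bsub>PB n\<^esub> x = \<one>\<^bsub>PB n\<^esub>"
    using r PB_carrier[OF n] by blast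
  fix y assume "y \<in> carrier (PB n)"
  then obtain q where q: "y = loop_class n q" "bloop n q" using PB_carrier[OF n] by blast
  show "x \<otimes>\<^bsub>PB n\<^esub> y \<in> carrier (PB n)"
    unfolding p(1) q(1) PB_mult[OF n p(2) q(2)] PB_carrier[OF n] using bloop_join[OF p(2) q(2)] by blast
  fix z assume "z \<in> carrier (PB n)"
  then obtain s where s: "z = loop_class n s" "bloop n s" using PB_carrier[OF n] by blast
  have "homotopic_paths (Conf n) (p +++ (q +++ s)) ((p +++ q) +++ s)"
    using p q s by (intro homotopic_paths_assoc) (auto simp: bloop_def)
  then show "x \<otimes>\<^bsub>PB n\<^esub> y \<otimes>\<^bsub>PB n\<^esub> z = x \<otimes>\<^bsub>PB n\<^esub> (y \<otimes>\<^bsub>PB n\<^esub> z)"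
    unfolding p(1) q(1) s(1) PB_mult[OF n p(2) q(2)] PB_mult[OF n q(2) s(2)]
      PB_mult[OF n bloop_join[OF p(2) q(2)] s(2)] PB_mult[OF n p(2) bloop_join[OF q(2) s(2)]]
    using loop_class_eqI by blast
qed

section \<open>Removing a touching zero by a bump function\<close>

section \<open>Stability forces sign changes\<close>

lemma smooth_bump:
  obtains b where "smooth_on {0..1} b" "\<And>t. t \<in> {l<..<u} \<Longrightarrow> 0 < (b t :: real)" "\<And>t. t \<notin> {l<..<u} \<Longrightarrow> b t = 0"
proof (rule that[of "\<lambda>t. flat 0 (1 * t + - l) * flat 0 (- 1 * t + u)"])
  show "smooth_on {0..1} (\<lambda>t. flat 0 (1 * t + - l) * flat 0 (- 1 * t + u))"
    by (intro smooth_on_mult smooth_on_affine smooth_flat)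
qed (auto simp: flat_zero flat_pos)

lemma smooth_bound:
  fixes b :: "real \<Rightarrow> real"
  assumes b: "smooth_on {0..1} b"
  obtains b' K where "\<And>t. t \<in> {0..1} \<Longrightarrow> (b has_vector_derivative b' t) (at t within {0..1})"
    "0 < K" "\<And>t. t \<in> {0..1} \<Longrightarrow> \<bar>b t\<bar> \<le> K \<and> \<bar>b' t\<bar> \<le> K"
proof -
  obtain b' where b': "smooth_on {0..1} b'" "\<And>t. t \<in> {0..1} \<Longrightarrow> (b has_vector_derivative b' t) (at t within {0..1})"
    using smooth_on_derivE[OF b] by metis
  have "bounded (b ` {0..1})" "bounded (b' ` {0..1})"
    using smooth_on_continuous[OF b] smooth_on_continuous[OF b'(1)]
    by (auto intro!: compact_imp_bounded compact_continuous_image)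
  then obtain K1 K2 where K: "\<forall>x\<in>b ` {0..1}. norm x \<le> K1" "\<forall>x\<in>b' ` {0..1}. norm x \<le> K2"
    unfolding bounded_iff by blast
  show ?thesis
  proof (rule that[of b' "1 + \<bar>K1\<bar> + \<bar>K2\<bar>"])
    fix t :: real assume t: "t \<in> {0..1}"
    then show "(b has_vector_derivative b' t) (at t within {0..1})" by (rule b'(2))
    have "\<bar>b t\<bar> \<le> K1" "\<bar>b' t\<bar> \<le> K2" using K t by auto
    then show "\<bar>b t\<bar> \<le> 1 + \<bar>K1\<bar> + \<bar>K2\<bar> \<and> \<bar>b' t\<bar> \<le> 1 + \<bar>K1\<bar> + \<bar>K2\<bar>" by linarith
  qed simp
qed

text \<open>A zero without sign change could be removed by pushing the strand \<open>k\<close> slightly off the line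
  through \<open>i\<close> and \<open>j\<close> with a bump function.\<close>

lemma no_touching:
  assumes gs: "good_stable n \<beta>" and c: "c \<in> critical_moments n \<beta>"
  shows "\<exists>d>0. \<forall>s\<in>{c-d<..<c}. \<forall>u\<in>{c<..<c+d}. s \<in> {0..1} \<longrightarrow> u \<in> {0..1} \<longrightarrow>
    \<not> (\<forall>T. same_sign n (\<beta> s) (\<beta> u) T)"
proof (rule ccontr)
  assume neg: "\<not> ?thesis"
  have pure: "pure_braid n \<beta>" and fin: "finite (critical_moments n \<beta>)"
    and uniq: "\<And>t. t \<in> critical_moments n \<beta> \<Longrightarrow> \<exists>!T. T \<in> collinear_triples n (\<beta> t)"
    using gs by (auto simp: good_stable_def)
  obtain \<epsilon> where \<epsilon>: "0 < \<epsilon>" "\<And>\<gamma>. pure_braid n \<gamma> \<Longrightarrow> C1_close n \<epsilon> \<beta> \<gamma> \<Longrightarrow>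
      card (critical_moments n \<gamma>) = card (critical_moments n \<beta>)"
    using gs unfolding good_stable_def by blast
  have bl: "bloop n \<beta>" by (rule pure_braid_bloop[OF pure])
  have cp: "cpath n \<beta>" by (rule bloop_cpath[OF bl])
  define Z where "Z = critical_moments n \<beta>"
  have gen_iff: "generic n (\<beta> t) \<longleftrightarrow> t \<notin> Z" if "t \<in> {0..1}" for t
    using that by (simp add: Z_def critical_moments_def generic_iff)
  have c01: "c \<in> {0..1}" "c \<noteq> 0" "c \<noteq> 1"
    using c gen_iff[of 0] gen_iff[of 1] base_config_generic[of n] bloop_ends[OF bl]
    by (auto simp: Z_def critical_moments_def)
  obtain T where T: "T \<in> collinear_triples n (\<beta> c)" using uniq[OF c] by blast
  then obtain i j k where ijk: "dist_idx n [i, j, k]" "T = {i, j, k}" "cdet (\<beta> c) i j k = 0"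
    by (rule collinear_triplesE)
  have in_n: "i \<in> {1..n}" "j \<in> {1..n}" "k \<in> {1..n}" and dist: "i \<noteq> j" "j \<noteq> k" "i \<noteq> k"
    using ijk(1) by (auto simp: dist_idx_def)
  have other: "cdet (\<beta> c) x y z \<noteq> 0" if "dist_idx n [x, y, z]" "{x, y, z} \<noteq> T" for x y z
    using uniq[OF c] T that collinear_triples_iff[OF that(1)] by blast
  obtain e1 where e1: "0 < e1" "\<And>z x y w. z \<in> nbox n (\<beta> c) e1 \<Longrightarrow> dist_idx n [x, y, w] \<Longrightarrow> cdet (\<beta> c) x y w \<noteq> 0 \<Longrightarrow>
    cdet z x y w \<noteq> 0 \<and> (0 < cdet z x y w \<longleftrightarrow> 0 < cdet (\<beta> c) x y w)"
    using sgn_stable[of n "\<beta> c"] by blast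
  have half: "0 < e1 / 2" using e1(1) by simp
  obtain d1 where d1: "0 < d1" "\<forall>s\<in>{0..1}. \<forall>t\<in>{0..1}. \<bar>s - t\<bar> < d1 \<longrightarrow> \<beta> s \<in> nbox n (\<beta> t) (e1 / 2)"
    using cpath_uniform[OF cp half] by blast
  define w where "w = \<beta> c j - \<beta> c i"
  have "inj_on (\<beta> c) {1..n}" using bloop_bpath[OF bl] c01(1) by (simp add: bpath_def)
  then have w: "w \<noteq> 0"
    using in_n dist(1) unfolding w_def by (metis eq_iff_diff_eq_0 inj_onD)
  have cj: "continuous_on {0..1} (\<lambda>t. \<beta> t j)" "continuous_on {0..1} (\<lambda>t. \<beta> t i)" "continuous_on {0..1} (\<lambda>t. \<beta> t k)"
    using cp in_n by (auto simp: cpath_def)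
  have "continuous_on {0..1} (\<lambda>t. Re (cnj (\<beta> t j - \<beta> t i) * w))" by (intro continuous_intros cj)
  moreover have "0 < Re (cnj (\<beta> c j - \<beta> c i) * w)"
  proof -
    have "Re (cnj w * w) = (cmod w)\<^sup>2" unfolding cmod_power2 by (simp add: power2_eq_square)
    then show ?thesis using w unfolding w_def by simp
  qed
  ultimately obtain d2 where d2: "0 < d2"
    "\<forall>t\<in>{0..1}. dist t c < d2 \<longrightarrow> dist (Re (cnj (\<beta> t j - \<beta> t i) * w)) (Re (cnj (\<beta> c j - \<beta> c i) * w)) < Re (cnj (\<beta> c j - \<beta> c i) * w)"
    using c01(1) unfolding continuous_on_iff by blast
  have turn: "0 < Re (cnj (\<beta> t j - \<beta> t i) * w)" if "t \<in> {0..1}" "\<bar>t - c\<bar> < d2" for t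
    using d2(2)[rule_format, OF that(1)] that(2) unfolding dist_real_def by linarith
  obtain d3 where d3: "0 < d3" "\<And>y. y \<in> Z - {c} \<Longrightarrow> d3 \<le> \<bar>y - c\<bar>"
  proof (rule finite_uniform_radius[of "Z - {c}" "\<lambda>d y. d \<le> \<bar>y - c\<bar>"])
    show "finite (Z - {c})" using fin by (simp add: Z_def)
    show "\<exists>e>0. e \<le> \<bar>y - c\<bar>" if "y \<in> Z - {c}" for y using that by (intro exI[of _ "\<bar>y - c\<bar>"]) auto
  qed auto
  \<comment> \<open>Within \<open>r\<close> of \<open>c\<close> the other triples stay noncollinear,
    the direction from \<open>i\<close> to \<open>j\<close> stays within a right angle of
    \<open>w\<close>, and there is no further critical moment or end point.\<close>
  define r where "r = min (min d1 d2) (min d3 (min c (1 - c)))"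
  have r: "0 < r" "r \<le> d1" "r \<le> d2" "r \<le> d3" "r \<le> c" "r \<le> 1 - c"
    using d1(1) d2(1) d3(1) c01 by (auto simp: r_def)
  have in01: "t \<in> {0..1}" if "\<bar>t - c\<bar> < r" for t using that r by auto
  have noZ: "t \<notin> Z" if "\<bar>t - c\<bar> < r" "t \<noteq> c" for t using d3(2)[of t] that r by auto
  obtain s u where s: "s \<in> {c-r<..<c}" and u: "u \<in> {c<..<c+r}" and ss: "\<And>T. same_sign n (\<beta> s) (\<beta> u) T"
    using neg r(1) by blast
  define D where "D = (\<lambda>t. cdet (\<beta> t) i j k)"
  have cD: "continuous_on {0..1} D"
    unfolding D_def cdet_def by (intro continuous_intros cj)
  have D0: "D t \<noteq> 0" if "\<bar>t - c\<bar> < r" "t \<noteq> c" for t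
    using gen_iff[OF in01[OF that(1)]] noZ[OF that] ijk(1) by (auto simp: generic_def D_def)
  have const: "0 < D a \<longleftrightarrow> 0 < D b"
    if ab: "\<bar>a - c\<bar> < r" "\<bar>b - c\<bar> < r" "a \<le> b" "c \<notin> {a..b}" for a b
  proof (rule ccontr)
    assume ne: "\<not> ?thesis"
    have sub: "{a..b} \<subseteq> {0..1}" using in01[OF ab(1)] in01[OF ab(2)] by auto
    have cab: "continuous_on {a..b} D" by (rule continuous_on_subset[OF cD sub])
    have "\<exists>x. a \<le> x \<and> x \<le> b \<and> D x = 0"
    proof (cases "0 < D a")
      case True
      then show ?thesis using IVT2'[of D b 0 a] cab ab(3) ne by auto
    next
      case False
      then show ?thesis using IVT'[of D a 0 b] cab ab(3) ne by auto
    qed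
    then obtain x where x: "a \<le> x" "x \<le> b" "D x = 0" by blast
    then show False using D0[of x] ab by auto
  qed
  have su: "0 < D s \<longleftrightarrow> 0 < D u" using ss[of "{i, j, k}"] ijk(1) by (auto simp: same_sign_def D_def)
  \<comment> \<open>The common sign of \<open>D\<close> on both sides of \<open>c\<close>, where it
    has constant sign by the intermediate value theorem.\<close>
  define \<sigma> :: real where "\<sigma> = (if 0 < D s then 1 else - 1)"
  have \<sigma>D: "0 \<le> \<sigma> * D t" if t: "\<bar>t - c\<bar> < r" for t
  proof (cases "t = c")
    case True
    then show ?thesis using ijk(3) by (simp add: D_def)
  next
    case False
    have "0 < D t \<longleftrightarrow> 0 < D s"
    proof (cases "t < c")
      case True
      show ?thesis
      proof (cases "t \<le> s")
        case le: True
        show ?thesis by (rule const) (use le True t s in auto)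
      next
        case le: False
        have "0 < D s \<longleftrightarrow> 0 < D t" by (rule const) (use le True t s in auto)
        then show ?thesis by simp
      qed
    next
      case f: False
      have "0 < D t \<longleftrightarrow> 0 < D u"
      proof (cases "t \<le> u")
        case le: True
        show ?thesis by (rule const) (use le f False t u in auto)
      next
        case le: False
        have "0 < D u \<longleftrightarrow> 0 < D t" by (rule const) (use le f False t u in auto)
        then show ?thesis by simp
      qed
      then show ?thesis using su by simp
    qed
    then show ?thesis using D0[OF t False] by (auto simp: \<sigma>_def)
  qed
  obtain b where b: "smooth_on {0..1} b" "\<And>t. t \<in> {c - r<..<c + r} \<Longrightarrow> 0 < (b t :: real)"
    "\<And>t. t \<notin> {c - r<..<c + r} \<Longrightarrow> b t = 0"
    using smooth_bump by metis
  obtain b' K where b': "\<And>t. t \<in> {0..1} \<Longrightarrow> (b has_vector_derivative b' t) (at t within {0..1})"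
    and K: "0 < K" "\<And>t. t \<in> {0..1} \<Longrightarrow> \<bar>b t\<bar> \<le> K \<and> \<bar>b' t\<bar> \<le> K"
    using smooth_bound[OF b(1)] by metis
  obtain e2 where e2: "0 < e2" "\<And>t z. t \<in> {0..1} \<Longrightarrow> z \<in> nbox n (\<beta> t) e2 \<Longrightarrow> inj_on z {1..n}"
    using bloop_radius[OF bl] by blast
  \<comment> \<open>The three bounds are for closeness to \<open>\<beta>\<close>, injectivity of the
    new configurations, and orientation of the triples other than \<open>T\<close>.\<close>
  define m where "m = min \<epsilon> (min e2 (e1 / 2))"
  have m: "0 < m" "m \<le> \<epsilon>" "m \<le> e2" "m \<le> e1 / 2" using \<epsilon>(1) e2(1) e1(1) by (auto simp: m_def)
  \<comment> \<open>A push of \<open>k\<close> perpendicular to the line at time \<open>c\<close>,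
    to the side that changes the determinant by an amount of sign \<open>\<sigma>\<close>; it thus
    adds to \<open>D\<close> and never cancels it.\<close>
  define v where "v = of_real \<sigma> * \<i> * w"
  have v: "cmod v = cmod w" by (simp add: v_def norm_mult \<sigma>_def)
  \<comment> \<open>The constant \<open>K\<close> bounds the bump and its derivative, so the
    displacement and its velocity both stay below \<open>m\<close>, the factor two making the bound
    strict.\<close>
  define \<eta> where "\<eta> = m / (2 * K * cmod w)"
  have \<eta>: "0 < \<eta>" "\<eta> * K * cmod v < m"
    using m(1) K(1) w by (auto simp: \<eta>_def v field_simps)
  have small: "cmod ((\<eta> * x) *\<^sub>R v) < m" if "\<bar>x\<bar> \<le> K" for x
  proof -
    have "cmod ((\<eta> * x) *\<^sub>R v) = \<eta> * \<bar>x\<bar> * cmod v" using \<eta>(1) by (simp add: abs_mult)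
    also have "\<dots> \<le> \<eta> * K * cmod v" using that \<eta>(1) by (intro mult_right_mono mult_left_mono) auto
    finally show ?thesis using \<eta>(2) by linarith
  qed
  define \<gamma> where "\<gamma> = (\<lambda>t. (\<beta> t)(k := \<beta> t k + (\<eta> * b t) *\<^sub>R v))"
  have \<gamma>_out: "\<gamma> t = \<beta> t" if "\<not> \<bar>t - c\<bar> < r" for t
    using b(3)[of t] that by (auto simp: \<gamma>_def abs_less_iff)
  have near: "\<gamma> t \<in> nbox n (\<beta> t) m" if t: "t \<in> {0..1}" for t
    using small[of "b t"] K(2)[OF t] m(1) by (auto simp: \<gamma>_def nbox_def dist_norm)
  have sm: "smooth_on {0..1} (\<lambda>t. \<gamma> t l)" if l: "l \<in> {1..n}" for l
  proof (cases "l = k")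
    case True
    have "bounded_linear (\<lambda>x. (\<eta> * x) *\<^sub>R v)"
      using bounded_linear_compose[OF bounded_linear_scaleR_left bounded_linear_mult_right] .
    then have "smooth_on {0..1} (\<lambda>t. (\<eta> * b t) *\<^sub>R v)" by (rule smooth_on_bounded_linear[OF _ b(1)])
    then show ?thesis
      using smooth_on_add[of _ "\<lambda>t. \<beta> t k"] pure in_n True by (simp add: \<gamma>_def pure_braid_def)
  next
    case False
    then show ?thesis using pure l by (simp add: \<gamma>_def pure_braid_def)
  qed
  have \<gamma>_pure: "pure_braid n \<gamma>"
    unfolding pure_braid_def Conf_iff
  proof (intro conjI ballI sm)
    fix t :: real assume t: "t \<in> {0..1}"
    have "\<beta> t \<in> extensional {1..n}" using pure t by (simp add: pure_braid_def Conf_iff)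
    then show "\<gamma> t \<in> extensional {1..n}" using in_n by (auto simp: \<gamma>_def extensional_def)
    have "nbox n (\<beta> t) m \<subseteq> nbox n (\<beta> t) e2" by (rule nbox_mono[OF m(3)])
    then show "inj_on (\<gamma> t) {1..n}" using e2(2)[OF t] near[OF t] by blast
  next
    have "\<not> \<bar>0 - c\<bar> < r" "\<not> \<bar>1 - c\<bar> < r" using r by auto
    then show "\<gamma> 0 = base_config n" "\<gamma> 1 = base_config n" using bloop_ends[OF bl] \<gamma>_out by auto
  qed
  have "C1_close n \<epsilon> \<beta> \<gamma>"
    unfolding C1_close_def vel_def[symmetric]
  proof (intro ballI conjI)
    fix l t assume l: "l \<in> {1..n}" and t: "t \<in> {0..1::real}"
    show "dist (\<beta> t l) (\<gamma> t l) < \<epsilon>" using near[OF t] l m(2) unfolding nbox_def by fastforce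
    show "dist (vel \<beta> t l) (vel \<gamma> t l) < \<epsilon>"
    proof (cases "l = k")
      case True
      have "bounded_linear (\<lambda>x. (\<eta> * x) *\<^sub>R v)"
        using bounded_linear_compose[OF bounded_linear_scaleR_left bounded_linear_mult_right] .
      then have "((\<lambda>t. (\<eta> * b t) *\<^sub>R v) has_vector_derivative (\<eta> * b' t) *\<^sub>R v) (at t within {0..1})"
        by (rule bounded_linear.has_vector_derivative[OF _ b'[OF t]])
      then have "((\<lambda>t. \<beta> t k + (\<eta> * b t) *\<^sub>R v) has_vector_derivative vel \<beta> t k + (\<eta> * b' t) *\<^sub>R v) (at t within {0..1})"
        by (intro has_vector_derivative_add pure_braid_vel(1)[OF pure in_n(3) t])
      then have "vel \<gamma> t l = vel \<beta> t k + (\<eta> * b' t) *\<^sub>R v"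
        using True t by (intro vel_eqI) (simp_all add: \<gamma>_def)
      then show ?thesis using small[of "b' t"] K(2)[OF t] m(2) True by (simp add: dist_norm)
    next
      case False
      then have "vel \<gamma> t l = vel \<beta> t l" by (simp add: \<gamma>_def vel_def)
      then show ?thesis using \<epsilon>(1) by simp
    qed
  qed
  then have card: "card (critical_moments n \<gamma>) = card Z" using \<epsilon>(2)[OF \<gamma>_pure] by (simp add: Z_def)
  have "generic n (\<gamma> t)" if t: "\<bar>t - c\<bar> < r" for t
    unfolding generic_def
  proof (intro allI impI)
    fix x y z assume d: "dist_idx n [x, y, z]"
    have t01: "t \<in> {0..1}" by (rule in01[OF t])
    show "cdet (\<gamma> t) x y z \<noteq> 0"
    proof (cases "{x, y, z} = T")
      case False
      have "\<beta> t \<in> nbox n (\<beta> c) (e1 / 2)" using d1(2) t t01 c01(1) r(2) by auto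
      moreover have "\<gamma> t \<in> nbox n (\<beta> t) (e1 / 2)" using near[OF t01] nbox_mono[OF m(4)] by blast
      ultimately have "\<gamma> t \<in> nbox n (\<beta> c) e1" using nbox_add[of "\<beta> t" n "\<beta> c" "e1 / 2" "e1 / 2"] by auto
      then show ?thesis using e1(2) d other[OF d False] by blast
    next
      case True
      have val: "cdet (\<gamma> t) i j k = D t + \<eta> * b t * cross2 (\<beta> t j - \<beta> t i) v"
        using dist by (simp add: \<gamma>_def D_def cdet_cross2 cross2_def algebra_simps)
      have "cross2 (\<beta> t j - \<beta> t i) v = \<sigma> * Re (cnj (\<beta> t j - \<beta> t i) * w)"
        by (simp add: cross2_def v_def algebra_simps)
      moreover have "\<sigma> * (\<sigma> * x) = x" for x by (simp add: \<sigma>_def)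
      ultimately have "\<sigma> * cross2 (\<beta> t j - \<beta> t i) v = Re (cnj (\<beta> t j - \<beta> t i) * w)" by metis
      moreover have "\<sigma> * cdet (\<gamma> t) i j k = \<sigma> * D t + \<eta> * b t * (\<sigma> * cross2 (\<beta> t j - \<beta> t i) v)"
        unfolding val by (simp only: distrib_left mult.left_commute mult.assoc)
      ultimately have "\<sigma> * cdet (\<gamma> t) i j k = \<sigma> * D t + \<eta> * b t * Re (cnj (\<beta> t j - \<beta> t i) * w)"
        by metis
      moreover have "0 < \<eta> * b t * Re (cnj (\<beta> t j - \<beta> t i) * w)"
      proof (intro mult_pos_pos \<eta>(1) b(2) turn[OF t01])
        show "t \<in> {c - r<..<c + r}" using t by auto
        show "\<bar>t - c\<bar> < d2" using t r(3) by linarith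
      qed
      ultimately have "cdet (\<gamma> t) i j k \<noteq> 0" using \<sigma>D[OF t] by (metis add_nonneg_pos less_irrefl mult_zero_right)
      then have "T \<notin> collinear_triples n (\<gamma> t)" unfolding ijk(2) collinear_triples_iff[OF ijk(1)] .
      then show ?thesis using collinear_triples_iff[OF d] True by simp
    qed
  qed
  then have \<gamma>_gen: "collinear_triples n (\<gamma> t) = {}" if "\<bar>t - c\<bar> < r" for t
    using that by (simp add: generic_iff)
  \<comment> \<open>Exactly the moment \<open>c\<close> disappears, so the number of critical
    moments drops by one, against stability.\<close>
  have "t \<in> critical_moments n \<gamma> \<longleftrightarrow> t \<in> Z - {c}" for t
  proof (cases "\<bar>t - c\<bar> < r")
    case True
    then show ?thesis using \<gamma>_gen[OF True] noZ[OF True] by (auto simp: critical_moments_def)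
  next
    case False
    then have "t \<noteq> c" using r(1) by auto
    then show ?thesis using \<gamma>_out[OF False] by (simp add: critical_moments_def Z_def)
  qed
  then have "critical_moments n \<gamma> = Z - {c}" by blast
  then show False using card c fin card_Diff1_less[of Z c] by (simp add: Z_def)
qed

section \<open>Well-definedness and multiplicativity through the holonomy\<close>

section \<open>The homomorphism\<close>

lemma holonomy_good_stable:
  assumes gs: "good_stable n \<beta>"
  shows "holonomy n \<beta> = braid_word_value n \<beta>"
proof (rule holonomy_word)
  have pure: "pure_braid n \<beta>" using gs by (simp add: good_stable_def)
  show "bpath n \<beta>" by (rule bloop_bpath[OF pure_braid_bloop[OF pure]])
  show "finite (critical_moments n \<beta>)" using gs by (simp add: good_stable_def)
  show "generic n (\<beta> 0)" "generic n (\<beta> 1)" using pure base_config_generic by (auto simp: pure_braid_def)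
  show "amo n (\<beta> t)" if "t \<in> {0..1}" for t
  proof (cases "t \<in> critical_moments n \<beta>")
    case True
    then have "\<exists>!T. T \<in> collinear_triples n (\<beta> t)" using gs by (simp add: good_stable_def)
    then show ?thesis unfolding amo_def by blast
  next
    case False
    then show ?thesis using that by (auto simp: amo_def critical_moments_def)
  qed
qed (rule no_touching[OF gs])

lemma holonomy_homotopic:
  assumes p: "bloop n p" and hom: "homotopic_paths (Conf n) p q"
  shows "holonomy n p = holonomy n q"
proof -
  obtain h where h: "continuous_map (prod_topology (top_of_set {0..1::real}) (top_of_set {0..1})) (top_of_set (Conf n)) h"
    "\<forall>x. h (0, x) = p x" "\<forall>x. h (1, x) = q x"
    "\<forall>t\<in>{0..1}. pathstart (\<lambda>x. h (t, x)) = pathstart p \<and> pathfinish (\<lambda>x. h (t, x)) = pathfinish p"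
    using hom unfolding homotopic_paths_def homotopic_with_def by blast
  have c: "continuous_on ({0..1} \<times> {0..1}) h" and im: "h \<in> {0..1} \<times> {0..1} \<rightarrow> Conf n"
    using h(1) by (auto simp: continuous_map_in_subtopology)
  have cj: "continuous_on ({0..1} \<times> {0..1}) (\<lambda>x. h x j)" for j
    by (rule continuous_on_product_then_coordinatewise[OF c])
  have "holonomy n (\<lambda>t. h (0, t)) = holonomy n (\<lambda>t. h (1, t))"
  proof (rule holonomy_homotopy[OF cj])
    show "h (s, 0) = base_config n \<and> h (s, 1) = base_config n" if "s \<in> {0..1}" for s
      using h(4) that bloop_ends[OF p] by (simp add: pathstart_def pathfinish_def)
    show "bpath n (\<lambda>t. h (s, t))" if s: "s \<in> {0..1}" for s
      unfolding bpath_def cpath_def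
    proof (intro conjI ballI)
      fix j
      show "continuous_on {0..1} (\<lambda>t. h (s, t) j)"
        by (rule continuous_on_compose2[OF cj[of j]]) (use s in \<open>auto intro!: continuous_intros\<close>)
      show "inj_on (h (s, t)) {1..n}" if "t \<in> {0..1}" for t
        using im s that Conf_iff by blast
    qed
  qed (rule base_config_generic)+
  then show ?thesis using h(2,3) by simp
qed

text \<open>For every good and stable braid in the class the word equals the holonomy of
  \<open>p\<close>, and such a braid exists; so the description in \<open>PB_map\<close> has exactly
  one solution.\<close>

lemma PB_map_loop_class:
  assumes n: "0 < n" and p: "bloop n p"
  shows "\<exists>!g. \<exists>\<beta>\<in>loop_class n p. good_stable n \<beta> \<and> g = braid_word_value n \<beta>"
    and "PB_map n (loop_class n p) = holonomy n p"
proof -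
  have val: "braid_word_value n \<beta> = holonomy n p" if "\<beta> \<in> loop_class n p" "good_stable n \<beta>" for \<beta>
    using holonomy_homotopic[OF p, of \<beta>] holonomy_good_stable[OF that(2)] that(1)
    by (simp add: loop_class_def)
  obtain \<beta> where \<beta>: "good_stable n \<beta>" "\<beta> \<in> loop_class n p" using loop_class_pure[OF n p] by blast
  show "\<exists>!g. \<exists>\<beta>\<in>loop_class n p. good_stable n \<beta> \<and> g = braid_word_value n \<beta>"
    using val \<beta> by metis
  show "PB_map n (loop_class n p) = holonomy n p"
    unfolding PB_map_def by (rule the_equality) (use val \<beta> in metis)+
qed

theorem theorem1:
  fixes n :: nat
  assumes "3 \<le> n"
  shows "(\<forall>A\<in>carrier (PB n). \<exists>!g. \<exists>\<beta>\<in>A. good_stable n \<beta> \<and> g = braid_word_value n \<beta>)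
       \<and> group_hom (PB n) (G3 n) (PB_map n)"
proof
  have n: "0 < n" using assms by simp
  show "\<forall>A\<in>carrier (PB n). \<exists>!g. \<exists>\<beta>\<in>A. good_stable n \<beta> \<and> g = braid_word_value n \<beta>"
    unfolding PB_carrier[OF n] using PB_map_loop_class(1)[OF n] by blast
  have gen: "generic n (p 0)" "generic n (p 1)" if "bloop n p" for p
    using bloop_ends[OF that] base_config_generic by auto
  \<comment> \<open>On classes of loops the map is the holonomy, so multiplicativity can be read off
    from a continuous concatenation that need not itself be smooth.\<close>
  have "PB_map n \<in> hom (PB n) (G3 n)"
  proof (rule homI)
    fix x assume "x \<in> carrier (PB n)"
    then obtain p where p: "x = loop_class n p" "bloop n p" unfolding PB_carrier[OF n] by blast
    then show "PB_map n x \<in> carrier (G3 n)"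
      using PB_map_loop_class(2)[OF n p(2)] holonomy_closed[OF bloop_bpath[OF p(2)] gen[OF p(2)]] by simp
    fix y assume "y \<in> carrier (PB n)"
    then obtain q where q: "y = loop_class n q" "bloop n q" unfolding PB_carrier[OF n] by blast
    have pq: "p 1 = q 0" using bloop_ends p(2) q(2) by simp
    show "PB_map n (x \<otimes>\<^bsub>PB n\<^esub> y) = PB_map n x \<otimes>\<^bsub>G3 n\<^esub> PB_map n y"
      unfolding p(1) q(1) PB_mult[OF n p(2) q(2)] PB_map_loop_class(2)[OF n p(2)]
        PB_map_loop_class(2)[OF n q(2)] PB_map_loop_class(2)[OF n bloop_join[OF p(2) q(2)]]
      by (rule holonomy_join[OF bloop_bpath[OF p(2)] bloop_bpath[OF q(2)] bloop_bpath[OF bloop_join[OF p(2) q(2)]] pq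
            gen[OF p(2)] gen(2)[OF q(2)]])
  qed
  then show "group_hom (PB n) (G3 n) (PB_map n)"
    using group_PB[OF n] group_G3 by (simp add: group_hom_def group_hom_axioms_def)
qed

end
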